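(* Let $\widetilde{\mathcal H}_{\mathcal T}$ be the specified Feynman graphs bialgebra of a theory $\mathcal T$, let $\mathcal A=\mathcal B[z^{-1},z]]=\mathcal A_-\oplus\mathcal A_+$ with $\mathcal A_+=\mathcal B[[z]]$ and $\mathcal A_-=z^{-1}\mathcal B[z^{-1}]$, let $P$ be the projection onto $\mathcal A_-$ parallel to $\mathcal A_+$, and let $G$ be the group, under the convolution product $\circledast$, of characters of $\widetilde{\mathcal H}_{\mathcal T}$ with values in $\mathcal A$ (defined in the context). (1) Any character $\varphi\in G$ has a unique Birkhoff decomposition in $G$, $$\varphi=\varphi_-^{\circledast-1}\circledast\varphi_+ ,$$ such that $\varphi_+$ takes its values in $\mathcal A_+$ and $\varphi_-(\bar\Gamma)\in\mathcal A_-$ for any specified graph $\bar\Gamma=(\Gamma,\underline i)$ of degree $\ge1$. The components are given by the following recursion: for $\bar\Gamma$ of degree zero (i.e. without internal edges), $\varphi_-(\bar\Gamma)=\varphi_+(\bar\Gamma)=\varphi(\bar\Gamma)=\mathbf 1_{V_\Gamma}$; and if $\varphi_\pm$ are known in degrees $k\le n-1$, then for any specified graph $\bar\Gamma$ of degree $n$, $$\varphi_-(\bar\Gamma)=\varphi_-(\Gamma)=-P\Big(\varphi(\Gamma)+\sum_{\bar\gamma\subsetneq\bar\Gamma,\ \bar\Gamma/\bar\gamma\in\mathcal T}\pi_{\gamma,\Gamma}[\varphi_-(\gamma)]\; i_{\Gamma,\gamma}\big[\varphi(\Gamma/(\gamma,\underline j))\big]\Big),$$ $$\varphi_+(\bar\Gamma)=\varphi_+(\Gamma)=(I-P)\Big(\varphi(\Gamma)+\sum_{\bar\gamma\subsetneq\bar\Gamma,\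 \bar\Gamma/\bar\gamma\in\mathcal T}\pi_{\gamma,\Gamma}[\varphi_-(\gamma)]\; i_{\Gamma,\gamma}\big[\varphi(\Gamma/(\gamma,\underline j))\big]\Big),$$ where the sums run over the proper locally 1PI specified covering subgraphs $\bar\gamma=(\gamma,\underline j)$ of $\bar\Gamma$ with $\bar\Gamma/\bar\gamma\in\mathcal T$. (2) $\varphi_+$ and $\varphi_-$ are two characters.
   Context: Graphs. A (Feynman) graph $\Gamma$ consists of a finite set $\mathcal V(\Gamma)$ of vertices, a finite set $\mathcal E(\Gamma)$ of half-edges, an involution $\sigma_\Gamma:\mathcal E(\Gamma)\to\mathcal E(\Gamma)$ and a map $\partial:\mathcal E(\Gamma)\to\mathcal V(\Gamma)$. For a vertex $v$, $st(v)=\{e:\partial(e)=v\}$. Fixed points of $\sigma_\Gamma$ are the external edges; pairs $\{e,\sigma_\Gamma(e)\}$ with $e\ne\sigma_\Gamma(e)$ are the internal edges, forming the set $\mathcal I(\Gamma)$. Cutting an internal edge means modifying $\sigma_\Gamma$ so that its two half-edges become fixed points. $\pi_0(\Gamma)$ is the set of connected components. The degree of $\Gamma$ is the loop number $L(\Gamma)=|\mathcal I(\Gamma)|-|\mathcal V(\Gamma)|+|\pi_0(\Gamma)|$. A graph is 1PI if it is connected and remains connected when any one internal edge is cut; it is locally 1PI if each connected component is 1PI (the empty graph is locally 1PI). A covering subgraph $\gamma$ of $\Gamma$ is a graph obtained from $\Gamma$ by cutting some (possibly no, possibly all) internal edges; it has the same vertices and half-edges. The contracted graph $\Gamma/\gamma$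 has as vertices the connected components of $\gamma$, as half-edges the fixed points of $\sigma_\gamma$, as involution the restriction of $\sigma_\Gamma$, and a half-edge $e$ is attached to the component of $\gamma$ containing $\partial(e)$. The residue is $\mathrm{res}\,\Gamma=\Gamma/\Gamma$; the skeleton $\mathrm{sk}\,\Gamma$ is obtained by cutting all internal edges. $\Gamma\Gamma'$ denotes disjoint union. Theory. Every half-edge carries a type in a set $\mathcal E(\mathcal T)$, and $\sigma_\Gamma$ preserves types. A vertex type is a function $\mathcal E(\mathcal T)\to\mathbb N$ (the number of half-edges of each type at the vertex); $\mathcal V(\mathcal T)$ is a prescribed set of vertex types. $\widetilde{\mathcal V}(\mathcal T)$ is a set of pairs $(t,k)$ (refined types) with $t\in\mathcal V(\mathcal T)$ and $k\in\mathbb N$, every $t$ occurring with at least one and only finitely many $k$. In a graph of $\mathcal T$ each vertex $v$ carries a refined type $(t,k)\in\widetilde{\mathcal V}(\mathcal T)$, where $t$ is the type of $v$ determined by the half-edges in $st(v)$. A locally 1PI graph is superficially divergent if the residue of each of its components is a vertex whose type lies in $\mathcal V(\mathcal T)$. Specified graphs. A specified graph of $\mathcal T$ is a pair $\bar\Gamma=(\Gamma,\underline i)$ where $\Gamma$ is a locally 1PI superficially divergent graph of $\mathcal T$ and $\underline i:\pi_0(\Gamma)\to\mathbb N$ is such that for each component $\Gamma_0$, if $t$ is the type of the vertex $\mathrm{res}\,\Gamma_0$, then $(t,\underline i(\Gamma_0))\in\widetilde{\mathcal V}(\mathcal T)$; if $\Gamma_0$ is a single vertex of refined type $(t,k)$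 without internal edges, then $\underline i(\Gamma_0)=k$. A specified graph $(\gamma,\underline j)$ is a specified covering subgraph of $(\Gamma,\underline i)$, written $(\gamma,\underline j)\subset(\Gamma,\underline i)$, if $\gamma$ is a covering subgraph of $\Gamma$ (vertices keeping their refined types) and $\underline j(\gamma_0)=\underline i(\gamma_0)$ whenever the component $\gamma_0$ of $\gamma$ is also a full connected component of $\Gamma$; $\bar\gamma=\bar\Gamma$ is allowed. It is proper, written $\bar\gamma\subsetneq\bar\Gamma$, if $\gamma\ne\Gamma$ and $\gamma\neq\mathrm{sk}\,\Gamma$. The contracted specified graph is $\bar\Gamma/\bar\gamma=(\Gamma/\bar\gamma,\underline i)$, where $\Gamma/\bar\gamma=\Gamma/(\gamma,\underline j)$ is $\Gamma/\gamma$ with the vertex coming from a component $\gamma_0$ of $\gamma$ given the refined type $(t,\underline j(\gamma_0))$, $t$ being the type of $\mathrm{res}\,\gamma_0$. It is in $\mathcal T$ if all its vertices have refined type in $\widetilde{\mathcal V}(\mathcal T)$. $\widetilde{\mathcal H}_{\mathcal T}$ is the $\mathbb C$-vector space with basis the specified graphs, with product disjoint union and unit $\mathbf 1$ the empty graph. Function spaces. Fix an integer $D\ge1$. The momentum space of $\Gamma$ is $$W_\Gamma=\Big\{p:\mathcal E(\Gamma)\to\mathbb R^D\ :\ \sum_{e\in st(v)}p_e=0\ \forall v\in\mathcal V(\Gamma),\ \ p_e+p_{\sigma_\Gamma(e)}=0\ \forall e\in\mathcal E(\Gamma)\text{ with }e\ne\sigma_\Gamma(e)\Big\}.$$ For $\Gamma$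 connected, $V_\Gamma=\mathcal C^\infty(W_\Gamma,\mathbb C)$; in general $V_\Gamma=\bigotimes_jV_{\Gamma_j}$ is the (unordered, algebraic) tensor product over the connected components $\Gamma_j$, identified with a subalgebra of $\mathcal C^\infty(W_\Gamma,\mathbb C)$ via $(\bigotimes_jv_j)(p)=\prod_jv_j(p|_{\mathcal E(\Gamma_j)})$. $\mathcal B=\prod_\Gamma V_\Gamma$, product over all graphs, connected or not. The concatenation product $\bullet$ is $(v\bullet v')(p,p')=v(p)v'(p')$ for $v\in V_\Gamma$, $v'\in V_{\Gamma'}$, giving an element of $V_{\Gamma\Gamma'}$ (with $W_{\Gamma\Gamma'}=W_\Gamma\times W_{\Gamma'}$), extended bilinearly to $\mathcal B$; its unit is $1\in V_\emptyset=\mathbb C$. For $\gamma$ a covering subgraph of $\Gamma$: $i_{\Gamma,\gamma}:V_{\Gamma/\gamma}\to V_\Gamma$ is the pullback of functions along the map $W_\Gamma\to W_{\Gamma/\gamma}$ restricting $p$ to $\mathcal E(\Gamma/\gamma)\subset\mathcal E(\Gamma)$; $\pi_{\gamma,\Gamma}:V_\gamma\to V_\Gamma$ is the restriction of functions along the inclusion $W_\Gamma\hookrightarrow W_\gamma$. All of $\bullet$, the pointwise product on $V_\Gamma$, $i_{\Gamma,\gamma}$ and $\pi_{\gamma,\Gamma}$ are extended to Laurent series coefficientwise ($z$-(bi)linearly). The group $G$. $G$ is the set of $\mathbb C$-linear maps $\varphi:\widetilde{\mathcal H}_{\mathcal T}\to\mathcal A$ such that (1) $\varphi(\Gamma,\underline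 i)=\varphi(\Gamma)$ does not depend on $\underline i$; (2) $\varphi(\Gamma)\in V_\Gamma[z^{-1},z]]$ for every graph $\Gamma$; (3) $\varphi(\Gamma)=\mathbf 1_{V_\Gamma}$ (constant function $1$) if $\Gamma$ has no internal edges; (4) $\varphi(\Gamma\Gamma')=\varphi(\Gamma)\bullet\varphi(\Gamma')$ and $\varphi(\mathbf 1)=\mathbf 1_{\mathcal A}$. Its elements are called characters. It is a group for $$(\chi\circledast\eta)(\Gamma,\underline i)=\sum_{(\gamma,\underline j)\subset(\Gamma,\underline i),\ (\Gamma,\underline i)/(\gamma,\underline j)\in\mathcal T}\pi_{\gamma,\Gamma}[\chi(\gamma)]\; i_{\Gamma,\gamma}\big[\eta(\Gamma/(\gamma,\underline j))\big]$$ (pointwise product on the right; sum over locally 1PI specified covering subgraphs), with identity $e$ given by $e(\bar\Gamma)=\mathbf 1_{V_\Gamma}$ in degree $0$ and $e(\bar\Gamma)=0$ otherwise. Graphs are considered up to isomorphism preserving half-edge types and refined types; an isomorphism $\Gamma\cong\Gamma'$ induces identifications $W_\Gamma\cong W_{\Gamma'}$, $V_\Gamma\cong V_{\Gamma'}$, and all assignments $\Gamma\mapsto\varphi(\Gamma)$ are understood to be compatible with these. *)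

theory Defs
  imports
    "HOL-Analysis.Analysis"
    "HOL-Algebra.Group"
    "HOL-Library.Function_Algebras"
    "HOL-Library.Poly_Mapping"
    "HOL-Computational_Algebra.Formal_Laurent_Series"
begin

section \<open>Graphs\<close>

text \<open>
  Vertices and half-edges are labelled by natural numbers; every finite graph has such a copy.
  Passing to isomorphism classes is replaced by requiring everything that is assigned to graphs to
  be compatible with isomorphisms (see \<open>compatible\<close> below). Half-edges carry a type in \<open>'t\<close>. The
  type of a vertex is determined by its half-edges, so only the second component \<open>vk\<close> of its
  refined type is stored.
\<close>

record 't fgraph =
  verts :: "nat set"
  hedges :: "nat set"
  sig :: "nat \<Rightarrow> nat"
  bd :: "nat \<Rightarrow> nat"
  htype :: "nat \<Rightarrow> 't"
  vk :: "nat \<Rightarrow> nat"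

text \<open>
  All functions are fixed to be \<open>undefined\<close> outside their domain, so that equality of records is
  equality of labelled graphs.
\<close>

definition is_graph :: "'t fgraph \<Rightarrow> bool" where
  "is_graph G \<longleftrightarrow> finite (verts G) \<and> finite (hedges G)
     \<and> sig G \<in> hedges G \<rightarrow>\<^sub>E hedges G
     \<and> (\<forall>e\<in>hedges G. sig G (sig G e) = e \<and> htype G (sig G e) = htype G e)
     \<and> bd G \<in> hedges G \<rightarrow>\<^sub>E verts G
     \<and> htype G \<in> extensional (hedges G)
     \<and> vk G \<in> extensional (verts G)"

definition star :: "'t fgraph \<Rightarrow> nat \<Rightarrow> nat set" where
  "star G v = {e \<in> hedges G. bd G e = v}"

definition external :: "'t fgraph \<Rightarrow> nat set" where
  "external G = {e \<in> hedges G. sig G e = e}"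

definition internal :: "'t fgraph \<Rightarrow> nat set set" where
  "internal G = {{e, sig G e} | e. e \<in> hedges G \<and> sig G e \<noteq> e}"

definition cut :: "'t fgraph \<Rightarrow> nat set set \<Rightarrow> 't fgraph" where
  "cut G K = G\<lparr>sig := (\<lambda>e. if e \<in> \<Union>K then e else sig G e)\<rparr>"

definition joined :: "'t fgraph \<Rightarrow> (nat \<times> nat) set" where
  "joined G = {(v, w). v \<in> verts G \<and> w \<in> verts G
     \<and> (v, w) \<in> {(bd G e, bd G (sig G e)) | e. e \<in> hedges G}\<^sup>*}"

text \<open>Connected components are represented by their vertex sets.\<close>

definition pi0 :: "'t fgraph \<Rightarrow> nat set set" where
  "pi0 G = verts G // joined G"

definition comp_of :: "'t fgraph \<Rightarrow> nat \<Rightarrow> nat set" where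
  "comp_of G v = joined G `` {v}"

definition component :: "'t fgraph \<Rightarrow> nat set \<Rightarrow> 't fgraph" where
  "component G C = (let E = {e \<in> hedges G. bd G e \<in> C} in
     \<lparr>verts = C, hedges = E, sig = restrict (sig G) E, bd = restrict (bd G) E,
      htype = restrict (htype G) E, vk = restrict (vk G) C\<rparr>)"

definition loop_number :: "'t fgraph \<Rightarrow> int" where
  "loop_number G = int (card (internal G)) - int (card (verts G)) + int (card (pi0 G))"

definition connected_graph :: "'t fgraph \<Rightarrow> bool" where
  "connected_graph G \<longleftrightarrow> card (pi0 G) = 1"

definition one_PI :: "'t fgraph \<Rightarrow> bool" where
  "one_PI G \<longleftrightarrow> connected_graph G \<and> (\<forall>ed\<in>internal G. connected_graph (cut G {ed}))"

definition locally_one_PI :: "'t fgraph \<Rightarrow> bool" where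
  "locally_one_PI G \<longleftrightarrow> (\<forall>C\<in>pi0 G. one_PI (component G C))"

definition covering_subgraph :: "'t fgraph \<Rightarrow> 't fgraph \<Rightarrow> bool" where
  "covering_subgraph g G \<longleftrightarrow> (\<exists>K\<subseteq>internal G. g = cut G K)"

definition skeleton :: "'t fgraph \<Rightarrow> 't fgraph" where
  "skeleton G = cut G (internal G)"

text \<open>
  The vertex of the contracted graph coming from a component \<open>C\<close> of \<open>g\<close> is labelled by \<open>Min C\<close>,
  which keeps the labels in \<open>nat\<close>. The contraction by an unspecified subgraph leaves \<open>vk\<close> undefined.
\<close>

definition contract :: "'t fgraph \<Rightarrow> 't fgraph \<Rightarrow> 't fgraph" where
  "contract G g = (let E = external g in
     \<lparr>verts = Min ` pi0 g, hedges = E, sig = restrict (sig G) E,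
      bd = restrict (\<lambda>e. Min (comp_of g (bd g e))) E,
      htype = restrict (htype G) E, vk = (\<lambda>_. undefined)\<rparr>)"

definition residue :: "'t fgraph \<Rightarrow> 't fgraph" where
  "residue G = contract G G"

definition empty_graph :: "'t fgraph" where
  "empty_graph = \<lparr>verts = {}, hedges = {}, sig = (\<lambda>_. undefined), bd = (\<lambda>_. undefined),
     htype = (\<lambda>_. undefined), vk = (\<lambda>_. undefined)\<rparr>"

text \<open>Disjoint union is only used for graphs with disjoint sets of labels.\<close>

definition disjoint_graphs :: "'t fgraph \<Rightarrow> 't fgraph \<Rightarrow> bool" where
  "disjoint_graphs G G' \<longleftrightarrow> verts G \<inter> verts G' = {} \<and> hedges G \<inter> hedges G' = {}"

definition graph_union :: "'t fgraph \<Rightarrow> 't fgraph \<Rightarrow> 't fgraph" where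
  "graph_union G G' =
     \<lparr>verts = verts G \<union> verts G', hedges = hedges G \<union> hedges G',
      sig = (\<lambda>e. if e \<in> hedges G then sig G e else sig G' e),
      bd = (\<lambda>e. if e \<in> hedges G then bd G e else bd G' e),
      htype = (\<lambda>e. if e \<in> hedges G then htype G e else htype G' e),
      vk = (\<lambda>v. if v \<in> verts G then vk G v else vk G' v)\<rparr>"


section \<open>Theories and specified graphs\<close>

text \<open>Vertex types are functions on \<open>etypes\<close>, extended by \<open>0\<close> to the whole of \<open>'t\<close>.\<close>

record 't feynman_theory =
  etypes :: "'t set"
  vtypes :: "('t \<Rightarrow> nat) set"
  rvtypes :: "(('t \<Rightarrow> nat) \<times> nat) set"

definition is_theory :: "'t feynman_theory \<Rightarrow> bool" where
  "is_theory T \<longleftrightarrow> (\<forall>t\<in>vtypes T. \<forall>x. x \<notin> etypes T \<longrightarrow> t x = 0)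
     \<and> fst ` rvtypes T = vtypes T
     \<and> (\<forall>t\<in>vtypes T. finite {k. (t, k) \<in> rvtypes T})"

definition vtype :: "'t fgraph \<Rightarrow> nat \<Rightarrow> 't \<Rightarrow> nat" where
  "vtype G v = (\<lambda>x. card {e \<in> star G v. htype G e = x})"

definition graph_of :: "'t feynman_theory \<Rightarrow> 't fgraph \<Rightarrow> bool" where
  "graph_of T G \<longleftrightarrow> is_graph G \<and> (\<forall>e\<in>hedges G. htype G e \<in> etypes T)
     \<and> (\<forall>v\<in>verts G. (vtype G v, vk G v) \<in> rvtypes T)"

text \<open>For connected \<open>G\<close>: the type of the only vertex of the residue.\<close>

definition res_type :: "'t fgraph \<Rightarrow> 't \<Rightarrow> nat" where
  "res_type G = vtype (residue G) (the_elem (verts (residue G)))"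

definition superficially_divergent :: "'t feynman_theory \<Rightarrow> 't fgraph \<Rightarrow> bool" where
  "superficially_divergent T G \<longleftrightarrow> locally_one_PI G
     \<and> (\<forall>C\<in>pi0 G. res_type (component G C) \<in> vtypes T)"

type_synonym 't sgraph = "'t fgraph \<times> (nat set \<Rightarrow> nat)"

definition specified :: "'t feynman_theory \<Rightarrow> 't sgraph set" where
  "specified T = {(G, i). graph_of T G \<and> locally_one_PI G \<and> superficially_divergent T G
     \<and> i \<in> extensional (pi0 G)
     \<and> (\<forall>C\<in>pi0 G. (res_type (component G C), i C) \<in> rvtypes T)
     \<and> (\<forall>v. {v} \<in> pi0 G \<and> internal (component G {v}) = {} \<longrightarrow> i {v} = vk G v)}"

definition sdegree :: "'t sgraph \<Rightarrow> int" where
  "sdegree X = loop_number (fst X)"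

text \<open>A component of \<open>g\<close> is a full component of \<open>G\<close> if it is one as a graph, not only as a vertex set.\<close>

definition spec_subgraph :: "'t feynman_theory \<Rightarrow> 't sgraph \<Rightarrow> 't sgraph \<Rightarrow> bool" where
  "spec_subgraph T = (\<lambda>(g, j) (G, i).
     (g, j) \<in> specified T \<and> (G, i) \<in> specified T \<and> covering_subgraph g G
     \<and> (\<forall>C\<in>pi0 g \<inter> pi0 G. component g C = component G C \<longrightarrow> j C = i C))"

definition proper_spec_subgraph :: "'t feynman_theory \<Rightarrow> 't sgraph \<Rightarrow> 't sgraph \<Rightarrow> bool" where
  "proper_spec_subgraph T Y X \<longleftrightarrow>
     spec_subgraph T Y X \<and> fst Y \<noteq> fst X \<and> fst Y \<noteq> skeleton (fst X)"

definition scontract_graph :: "'t fgraph \<Rightarrow> 't sgraph \<Rightarrow> 't fgraph" where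
  "scontract_graph G = (\<lambda>(g, j).
     (contract G g)\<lparr>vk := restrict (\<lambda>v. j (comp_of g v)) (Min ` pi0 g)\<rparr>)"

text \<open>
  The components of the contracted graph correspond to those of \<open>G\<close>: the vertices (labels) of a
  component of the former all lie in the corresponding component of \<open>G\<close>.
\<close>

definition scontract :: "'t sgraph \<Rightarrow> 't sgraph \<Rightarrow> 't sgraph" where
  "scontract = (\<lambda>(G, i) Y. (scontract_graph G Y,
     restrict (\<lambda>C. i (comp_of G (Min C))) (pi0 (scontract_graph G Y))))"

definition sgraph_union :: "'t sgraph \<Rightarrow> 't sgraph \<Rightarrow> 't sgraph" where
  "sgraph_union = (\<lambda>(G, i) (G', i').
     (graph_union G G', \<lambda>C. if C \<in> pi0 G then i C else i' C))"

definition empty_sgraph :: "'t sgraph" where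
  "empty_sgraph = (empty_graph, \<lambda>_. undefined)"

definition sgraph_iso ::
    "(nat \<Rightarrow> nat) \<Rightarrow> (nat \<Rightarrow> nat) \<Rightarrow> 't sgraph \<Rightarrow> 't sgraph \<Rightarrow> bool" where
  "sgraph_iso f h = (\<lambda>(G, i) (G', i').
     bij_betw f (verts G) (verts G') \<and> bij_betw h (hedges G) (hedges G')
     \<and> (\<forall>e\<in>hedges G. h (sig G e) = sig G' (h e) \<and> f (bd G e) = bd G' (h e)
           \<and> htype G' (h e) = htype G e)
     \<and> (\<forall>v\<in>verts G. vk G' (f v) = vk G v)
     \<and> (\<forall>C\<in>pi0 G. i' (f ` C) = i C))"


section \<open>Function spaces\<close>

text \<open>
  Momenta live in \<open>real ^ 'd\<close>, so \<open>D = CARD('d)\<close>. A function on the half-edges of a graph is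
  extended by \<open>0\<close> to all labels, and a function on a momentum space is extended by \<open>0\<close>.
\<close>

type_synonym 'd mom = "nat \<Rightarrow> real ^ 'd"

definition momentum_space :: "'t fgraph \<Rightarrow> 'd::finite mom set" where
  "momentum_space G = {p. (\<forall>e. e \<notin> hedges G \<longrightarrow> p e = 0)
     \<and> (\<forall>v\<in>verts G. (\<Sum>e\<in>star G v. p e) = 0)
     \<and> (\<forall>e\<in>hedges G. sig G e \<noteq> e \<longrightarrow> p e + p (sig G e) = 0)}"

definition mom_restrict :: "nat set \<Rightarrow> 'd::finite mom \<Rightarrow> 'd mom" where
  "mom_restrict E p = (\<lambda>e. if e \<in> E then p e else 0)"

text \<open>
  Smoothness on a finite-dimensional linear subspace \<open>W\<close>: all iterated directional derivatives
  along \<open>W\<close> exist and are continuous. The topology is that of \<open>'d mom\<close> (pointwise convergence),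
  which induces the usual one on every \<open>W\<close> of momenta supported on a fixed finite set.
\<close>

primrec Ck_on :: "nat \<Rightarrow> 'd::finite mom set \<Rightarrow> ('d mom \<Rightarrow> complex) \<Rightarrow> bool" where
  "Ck_on 0 W f \<longleftrightarrow> continuous_on W f"
| "Ck_on (Suc n) W f \<longleftrightarrow> continuous_on W f \<and> (\<forall>w\<in>W. \<exists>f'.
     (\<forall>p\<in>W. ((\<lambda>s. f (\<lambda>e. p e + s *\<^sub>R w e)) has_vector_derivative f' p) (at 0)) \<and> Ck_on n W f')"

definition smooth_on :: "'d::finite mom set \<Rightarrow> ('d mom \<Rightarrow> complex) \<Rightarrow> bool" where
  "smooth_on W f \<longleftrightarrow> (\<forall>n. Ck_on n W f)"

text \<open>
  The algebraic tensor product over the components, as the complex span of the product functions.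
  For connected \<open>G\<close> these are all the smooth functions on \<open>momentum_space G\<close>.
\<close>

definition V_space :: "'t fgraph \<Rightarrow> ('d::finite mom \<Rightarrow> complex) set" where
  "V_space G = module.span (\<lambda>(c::complex) f p. c * f p)
     {\<lambda>p. if p \<in> momentum_space G
           then \<Prod>C\<in>pi0 G. v C (mom_restrict (hedges (component G C)) p) else 0
      | v. \<forall>C\<in>pi0 G. smooth_on (momentum_space (component G C)) (v C)}"

text \<open>
  \<open>B_space\<close> is the product of all the spaces \<open>V_space G\<close>, and \<open>A_space\<close> consists of the Laurent
  series over it. On the ambient types, \<open>*\<close> is the componentwise pointwise product, extended to
  Laurent series \<open>z\<close>-bilinearly.
\<close>

type_synonym ('t, 'd) bfam = "'t fgraph \<Rightarrow> 'd mom \<Rightarrow> complex"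

definition B_space :: "('t, 'd::finite) bfam set" where
  "B_space = {b. \<forall>G. if is_graph G then b G \<in> V_space G else b G = 0}"

definition A_space :: "('t, 'd::finite) bfam fls set" where
  "A_space = {F. \<forall>n. fls_nth F n \<in> B_space}"

definition A_plus :: "('t, 'd::finite) bfam fls set" where
  "A_plus = {F \<in> A_space. \<forall>n<0. fls_nth F n = 0}"

definition A_minus :: "('t, 'd::finite) bfam fls set" where
  "A_minus = {F \<in> A_space. \<forall>n\<ge>0. fls_nth F n = 0}"

definition P_minus :: "('t, 'd::finite) bfam fls \<Rightarrow> ('t, 'd) bfam fls" where
  "P_minus F = Abs_fls (\<lambda>n. if n < 0 then fls_nth F n else 0)"

text \<open>Coefficientwise extension of a linear map.\<close>

definition z_ext :: "(('t, 'd::finite) bfam \<Rightarrow> ('t, 'd) bfam) \<Rightarrow>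
    ('t, 'd) bfam fls \<Rightarrow> ('t, 'd) bfam fls" where
  "z_ext h F = Abs_fls (\<lambda>n. h (fls_nth F n))"

definition A_scale :: "complex \<Rightarrow> ('t, 'd::finite) bfam fls \<Rightarrow> ('t, 'd) bfam fls" where
  "A_scale c = z_ext (\<lambda>b G p. c * b G p)"

text \<open>The inclusion of the factor belonging to \<open>G\<close>.\<close>

definition in_B :: "'t fgraph \<Rightarrow> ('d::finite mom \<Rightarrow> complex) \<Rightarrow> ('t, 'd) bfam" where
  "in_B G v = (\<lambda>G'. if G' = G then v else 0)"

definition V_laurent :: "'t fgraph \<Rightarrow> ('t, 'd::finite) bfam fls set" where
  "V_laurent G = {F. \<forall>n. fls_nth F n \<in> in_B G ` V_space G}"

definition one_V :: "'t fgraph \<Rightarrow> ('t, 'd::finite) bfam fls" where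
  "one_V G = fls_const (in_B G (\<lambda>p. if p \<in> momentum_space G then 1 else 0))"

text \<open>
  The maps \<open>\<pi>\<^bsub>g,G\<^esub>\<close> and \<open>i\<^bsub>G,g\<^esub>\<close>, on families and Laurent series. Since the factors are indexed by
  graphs with refined types, \<open>i_map\<close> takes as second argument the contracted graph itself.
\<close>

definition pi_map :: "'t fgraph \<Rightarrow> 't fgraph \<Rightarrow> ('t, 'd::finite) bfam fls \<Rightarrow> ('t, 'd) bfam fls" where
  "pi_map g G = z_ext (\<lambda>b. in_B G (\<lambda>p. if p \<in> momentum_space G then b g p else 0))"

definition i_map :: "'t fgraph \<Rightarrow> 't fgraph \<Rightarrow> ('t, 'd::finite) bfam fls \<Rightarrow> ('t, 'd) bfam fls" where
  "i_map G Q = z_ext (\<lambda>b. in_B G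
     (\<lambda>p. if p \<in> momentum_space G then b Q (mom_restrict (hedges Q) p) else 0))"

text \<open>
  The concatenation product on the factors belonging to disjoint \<open>G\<close> and \<open>G'\<close>: the momentum space
  of the union is the product of the momentum spaces, with the restrictions as projections.
\<close>

definition conc :: "'t fgraph \<Rightarrow> 't fgraph \<Rightarrow>
    ('t, 'd::finite) bfam fls \<Rightarrow> ('t, 'd) bfam fls \<Rightarrow> ('t, 'd) bfam fls" where
  "conc G G' F F' = (let U = graph_union G G' in
     z_ext (\<lambda>b. in_B U (\<lambda>p. if p \<in> momentum_space U then b G (mom_restrict (hedges G) p) else 0)) F
   * z_ext (\<lambda>b. in_B U (\<lambda>p. if p \<in> momentum_space U then b G' (mom_restrict (hedges G') p) else 0)) F')"

text \<open>The identification of the factor of \<open>G'\<close> with that of \<open>G\<close> given by a bijection \<open>h\<close> of half-edges.\<close>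

definition iso_map :: "(nat \<Rightarrow> nat) \<Rightarrow> 't fgraph \<Rightarrow> 't fgraph \<Rightarrow>
    ('t, 'd::finite) bfam fls \<Rightarrow> ('t, 'd) bfam fls" where
  "iso_map h G G' = z_ext (\<lambda>b. in_B G
     (\<lambda>p. if p \<in> momentum_space G
           then b G' (\<lambda>e. if e \<in> hedges G' then p (inv_into (hedges G) h e) else 0) else 0))"


section \<open>The group of characters\<close>

definition H_space :: "'t feynman_theory \<Rightarrow> ('t sgraph \<Rightarrow>\<^sub>0 complex) set" where
  "H_space T = {x. Poly_Mapping.keys x \<subseteq> specified T}"

type_synonym ('t, 'd) hmap = "('t sgraph \<Rightarrow>\<^sub>0 complex) \<Rightarrow> ('t, 'd) bfam fls"

definition linear_maps :: "'t feynman_theory \<Rightarrow> ('t, 'd::finite) hmap set" where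
  "linear_maps T = {\<phi> \<in> H_space T \<rightarrow>\<^sub>E A_space.
     (\<forall>x\<in>H_space T. \<forall>y\<in>H_space T. \<phi> (x + y) = \<phi> x + \<phi> y)
     \<and> (\<forall>c. \<forall>x\<in>H_space T. \<phi> (Poly_Mapping.map ((*) c) x) = A_scale c (\<phi> x))}"

definition linear_ext :: "'t feynman_theory \<Rightarrow> ('t sgraph \<Rightarrow> ('t, 'd::finite) bfam fls) \<Rightarrow>
    ('t, 'd) hmap" where
  "linear_ext T F = restrict
     (\<lambda>x. \<Sum>X\<in>Poly_Mapping.keys x. A_scale (Poly_Mapping.lookup x X) (F X)) (H_space T)"

definition val :: "('t, 'd::finite) hmap \<Rightarrow> 't sgraph \<Rightarrow> ('t, 'd) bfam fls" where
  "val \<phi> X = \<phi> (Poly_Mapping.single X 1)"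

definition compatible :: "'t feynman_theory \<Rightarrow> ('t, 'd::finite) hmap \<Rightarrow> bool" where
  "compatible T \<phi> \<longleftrightarrow> (\<forall>X\<in>specified T. \<forall>X'\<in>specified T. \<forall>f h.
     sgraph_iso f h X X' \<longrightarrow> val \<phi> X = iso_map h (fst X) (fst X') (val \<phi> X'))"

definition characters :: "'t feynman_theory \<Rightarrow> ('t, 'd::finite) hmap set" where
  "characters T = {\<phi> \<in> linear_maps T. compatible T \<phi>
     \<and> (\<forall>G i i'. (G, i) \<in> specified T \<longrightarrow> (G, i') \<in> specified T \<longrightarrow> val \<phi> (G, i) = val \<phi> (G, i'))
     \<and> (\<forall>X\<in>specified T. val \<phi> X \<in> V_laurent (fst X))
     \<and> (\<forall>X\<in>specified T. internal (fst X) = {} \<longrightarrow> val \<phi> X = one_V (fst X))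
     \<and> (\<forall>X\<in>specified T. \<forall>X'\<in>specified T. disjoint_graphs (fst X) (fst X') \<longrightarrow>
          val \<phi> (sgraph_union X X') = conc (fst X) (fst X') (val \<phi> X) (val \<phi> X'))
     \<and> val \<phi> empty_sgraph = one_V empty_graph}"

definition conv_term :: "('t, 'd::finite) hmap \<Rightarrow> ('t, 'd) hmap \<Rightarrow> 't sgraph \<Rightarrow> 't sgraph \<Rightarrow>
    ('t, 'd) bfam fls" where
  "conv_term \<psi> \<eta> X Y =
     pi_map (fst Y) (fst X) (val \<psi> Y) * i_map (fst X) (fst (scontract X Y)) (val \<eta> (scontract X Y))"

definition conv :: "'t feynman_theory \<Rightarrow> ('t, 'd::finite) hmap \<Rightarrow> ('t, 'd) hmap \<Rightarrow> ('t, 'd) hmap" where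
  "conv T \<psi> \<eta> = linear_ext T (\<lambda>X.
     \<Sum>Y | spec_subgraph T Y X \<and> graph_of T (fst (scontract X Y)). conv_term \<psi> \<eta> X Y)"

definition counit :: "'t feynman_theory \<Rightarrow> ('t, 'd::finite) hmap" where
  "counit T = linear_ext T (\<lambda>X. if sdegree X = 0 then one_V (fst X) else 0)"

definition char_group :: "'t feynman_theory \<Rightarrow> ('t, 'd::finite) hmap monoid" where
  "char_group T = \<lparr>carrier = characters T, mult = conv T, one = counit T\<rparr>"


section \<open>Birkhoff decomposition\<close>

definition birkhoff :: "'t feynman_theory \<Rightarrow> ('t, 'd::finite) hmap \<Rightarrow>
    ('t, 'd) hmap \<Rightarrow> ('t, 'd) hmap \<Rightarrow> bool" where
  "birkhoff T \<phi> \<phi>m \<phi>p \<longleftrightarrow> \<phi>m \<in> carrier (char_group T) \<and> \<phi>p \<in> carrier (char_group T)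
     \<and> \<phi> = inv\<^bsub>char_group T\<^esub> \<phi>m \<otimes>\<^bsub>char_group T\<^esub> \<phi>p
     \<and> (\<forall>x\<in>H_space T. \<phi>p x \<in> A_plus)
     \<and> (\<forall>X\<in>specified T. sdegree X \<ge> 1 \<longrightarrow> val \<phi>m X \<in> A_minus)"

definition prepared :: "'t feynman_theory \<Rightarrow> ('t, 'd::finite) hmap \<Rightarrow> ('t, 'd) hmap \<Rightarrow>
    't sgraph \<Rightarrow> ('t, 'd) bfam fls" where
  "prepared T \<phi> \<phi>m X = val \<phi> X +
     (\<Sum>Y | proper_spec_subgraph T Y X \<and> graph_of T (fst (scontract X Y)). conv_term \<phi>m \<phi> X Y)"

definition birkhoff_recursion :: "'t feynman_theory \<Rightarrow> ('t, 'd::finite) hmap \<Rightarrow>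
    ('t, 'd) hmap \<Rightarrow> ('t, 'd) hmap \<Rightarrow> bool" where
  "birkhoff_recursion T \<phi> \<phi>m \<phi>p \<longleftrightarrow> (\<forall>X\<in>specified T.
     (sdegree X = 0 \<longrightarrow>
        val \<phi>m X = one_V (fst X) \<and> val \<phi>p X = one_V (fst X) \<and> val \<phi> X = one_V (fst X))
     \<and> (sdegree X \<ge> 1 \<longrightarrow>
        val \<phi>m X = - P_minus (prepared T \<phi> \<phi>m X)
        \<and> val \<phi>p X = prepared T \<phi> \<phi>m X - P_minus (prepared T \<phi> \<phi>m X)))"

end

theory Submission
  imports Defs
begin

text \<open>
  Evaluating at a fixed graph and momentum is a ring homomorphism from Laurent series over the
  ambient product to complex Laurent series, and an element of \<open>V_laurent G\<close> is determined by its
  evaluations. All identities thus become identities between finite sums of complex Laurent series,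
  indexed by specified covering subgraphs. Associativity of the convolution comes from the bijection
  \<open>Y \<mapsto> Y/Z\<close> between the intermediate subgraphs \<open>Z \<subseteq> Y \<subseteq> X\<close> and the subgraphs of \<open>X/Z\<close>, together with
  \<open>(X/Z)/(Y/Z) = X/Y\<close>.

  The recursion is run for the projection onto the exponents in a set \<open>S\<close> such that \<open>S\<close> and its
  complement are closed under addition: the negative integers give \<open>\<phi>\<^sub>-\<close>, and \<open>S = UNIV\<close> gives the
  left inverse of a character. The counterterm is multiplicative because, by induction on the number
  of internal edges, \<open>\<phi>\<^sub>+(XX') - \<phi>\<^sub>-(XX') = \<phi>\<^sub>+(X)\<phi>\<^sub>+(X') - \<phi>\<^sub>-(X)\<phi>\<^sub>-(X')\<close>, and the decomposition into a
  series supported in \<open>S\<close> and one supported outside \<open>S\<close> is unique. Uniqueness of the Birkhoff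
  decomposition follows in the same way from \<open>\<phi>\<^sub>+ = \<phi>\<^sub>- \<circledast> \<phi>\<close>.
\<close>

text \<open>Paths are avoided: connectivity is expressed by vertex sets closed under edges
  (\<open>saturated\<close>), a component being a minimal nonempty one, and 1PI is put in similar
  terms (\<open>bridgeless\<close>). Such sets move well through cutting, contraction, splitting and
  isomorphism, so the graph notions are all transported by one kind of argument. The delicate point
  is independence of the specification. The vertices of a contraction get their refined types from
  \<open>j\<close>, which is tied to \<open>i\<close> on the components left uncut; changing
  \<open>i\<close> therefore changes the graphs at which the second factor of a convolution is
  evaluated. The vertices affected are isolated, and multiplicativity of the second factor splits
  them off. In the recursion the second factor is the given character, so this can be used from the
  start. Multiplicativity is stated as the splitting of one graph along a closed set, which fits an
  induction over subgraphs. The counit is recognised as a character by being the product of a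
  character with its left inverse.\<close>

unbundle fps_syntax

section \<open>Laurent series\<close>

text \<open>\<open>z_ext\<close> with different coefficient types at source and target, so that
  evaluation into complex series is an instance.\<close>

definition fls_map :: "('a::zero \<Rightarrow> 'b::zero) \<Rightarrow> 'a fls \<Rightarrow> 'b fls" where
  "fls_map h F = Abs_fls (\<lambda>n. h (fls_nth F n))"

definition fls_filter :: "int set \<Rightarrow> 'a::zero fls \<Rightarrow> 'a fls" where
  "fls_filter S F = Abs_fls (\<lambda>n. if n \<in> S then fls_nth F n else 0)"

definition fls_supp_in :: "int set \<Rightarrow> 'a::zero fls \<Rightarrow> bool" where
  "fls_supp_in S F \<longleftrightarrow> (\<forall>n. n \<notin> S \<longrightarrow> fls_nth F n = 0)"

lemma fls_map_nth:
  assumes "h 0 = 0"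
  shows "fls_map h F $$ n = h (F $$ n)"
proof -
  obtain N where N: "\<forall>n<N. F $$ n = 0" by (rule fls_nth_vanishes_belowE)
  show ?thesis unfolding fls_map_def
    by (rule nth_Abs_fls_lower_bound[of N]) (use N assms in auto)
qed

lemma fls_filter_nth [simp]: "fls_filter S F $$ n = (if n \<in> S then F $$ n else 0)"
proof -
  obtain N where N: "\<forall>n<N. F $$ n = 0" by (rule fls_nth_vanishes_belowE)
  show ?thesis unfolding fls_filter_def
    by (rule nth_Abs_fls_lower_bound[of N]) (use N in auto)
qed

text \<open>Arbitrary lower bounds take the place of the subdegrees: a coefficientwise map may kill
  leading coefficients, so \<open>fls_map_mult\<close> needs bounds common to a series and its
  image.\<close>

lemma fls_times_nth_bounds:
  fixes F G :: "'a::{comm_monoid_add, mult_zero} fls"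
  assumes "\<And>n. n < a \<Longrightarrow> F $$ n = 0" "\<And>n. n < b \<Longrightarrow> G $$ n = 0"
  shows "(F * G) $$ n = (\<Sum>i=a..n-b. F $$ i * G $$ (n - i))"
proof (cases "F = 0 \<or> G = 0")
  case False
  then have "a \<le> fls_subdegree F" "b \<le> fls_subdegree G"
    using assms by (meson fls_subdegree_geI)+
  have "(\<Sum>i=fls_subdegree F..n - fls_subdegree G. F $$ i * G $$ (n - i))
      = (\<Sum>i=a..n-b. F $$ i * G $$ (n - i))"
    by (rule sum.mono_neutral_left) (use \<open>a \<le> _\<close> \<open>b \<le> _\<close> in auto)
  then show ?thesis by (simp add: fls_times_nth(2))
qed auto

lemma fls_map_mult:
  fixes h :: "'a::{comm_monoid_add, mult_zero} \<Rightarrow> 'b::{comm_monoid_add, mult_zero}"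
  assumes h0: "h 0 = 0" and "\<And>x y. h (x + y) = h x + h y" "\<And>x y. h (x * y) = h x * h y"
  shows "fls_map h (F * G) = fls_map h F * fls_map h G"
proof (rule fls_eqI)
  fix n
  obtain a where a: "\<forall>n<a. F $$ n = 0" by (rule fls_nth_vanishes_belowE)
  obtain b where b: "\<forall>n<b. G $$ n = 0" by (rule fls_nth_vanishes_belowE)
  have hs: "h (sum f A) = (\<Sum>x\<in>A. h (f x))" for f and A :: "int set"
    by (induction A rule: infinite_finite_induct) (auto simp: assms)
  have m: "fls_map h X $$ k = h (X $$ k)" for X k using h0 by (rule fls_map_nth)
  have "fls_map h (F * G) $$ n = h (\<Sum>i=a..n-b. F $$ i * G $$ (n - i))"
    using a b by (simp add: m fls_times_nth_bounds[where a = a and b = b])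
  also have "\<dots> = (\<Sum>i=a..n-b. fls_map h F $$ i * fls_map h G $$ (n - i))"
    by (simp add: hs assms m)
  also have "\<dots> = (fls_map h F * fls_map h G) $$ n"
    by (rule fls_times_nth_bounds[symmetric]) (use a b in \<open>auto simp: m h0\<close>)
  finally show "fls_map h (F * G) $$ n = (fls_map h F * fls_map h G) $$ n" .
qed

lemma fls_supp_in_mult:
  fixes F G :: "'a::{comm_monoid_add, mult_zero} fls"
  assumes "fls_supp_in S F" "fls_supp_in S G" and S: "\<And>m n. m \<in> S \<Longrightarrow> n \<in> S \<Longrightarrow> m + n \<in> S"
  shows "fls_supp_in S (F * G)"
  unfolding fls_supp_in_def
proof (intro allI impI)
  fix n assume n: "n \<notin> S"
  have "F $$ i * G $$ (n - i) = 0" for i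
    using assms(1,2) S[of i "n - i"] n unfolding fls_supp_in_def by force
  then show "(F * G) $$ n = 0" by (simp add: fls_times_nth(2))
qed

text \<open>At an exponent in \<open>S\<close> both \<open>B\<close> and \<open>B'\<close> vanish,
  at one outside \<open>S\<close> both \<open>A\<close> and \<open>A'\<close> do. In the
  applications \<open>A\<close> is a counterterm and \<open>B\<close> a renormalised value.\<close>

lemma fls_supp_in_decomposition_unique:
  fixes A B A' B' :: "'a::ab_group_add fls"
  assumes "fls_supp_in S A" "fls_supp_in S A'" "fls_supp_in (- S) B" "fls_supp_in (- S) B'"
    and "B - A = B' - A'"
  shows "A = A'"
proof (rule fls_eqI)
  fix n
  have "B $$ n - A $$ n = B' $$ n - A' $$ n" using assms(5) by (metis fls_minus_nth)
  then show "A $$ n = A' $$ n"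
    using assms(1-4) unfolding fls_supp_in_def by (cases "n \<in> S") auto
qed

section \<open>Evaluation at a graph and a momentum\<close>

definition ev :: "'t fgraph \<Rightarrow> 'd::finite mom \<Rightarrow> ('t, 'd) bfam fls \<Rightarrow> complex fls" where
  "ev G p = fls_map (\<lambda>b. b G p)"

lemma ev_nth [simp]: "ev G p F $$ n = (F $$ n) G p"
  by (simp add: ev_def fls_map_nth)

lemma ev_mult [simp]: "ev G p (F * F') = ev G p F * ev G p F'"
  unfolding ev_def by (rule fls_map_mult) auto

lemma ev_add [simp]: "ev G p (F + F') = ev G p F + ev G p F'"
  by (rule fls_eqI) simp

lemma ev_uminus [simp]: "ev G p (- F) = - ev G p F"
  by (rule fls_eqI) simp

lemma ev_0 [simp]: "ev G p 0 = 0"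
  by (rule fls_eqI) simp

lemma ev_sum [simp]: "ev G p (sum f A) = (\<Sum>x\<in>A. ev G p (f x))"
  by (induction A rule: infinite_finite_induct) auto

lemma ev_fls_filter [simp]: "ev G p (fls_filter S F) = fls_filter S (ev G p F)"
  by (rule fls_eqI) simp

lemma fls_supp_in_filter [simp]: "fls_supp_in S (fls_filter S F)"
  by (simp add: fls_supp_in_def)

lemma fls_supp_in_uminus [simp]:
  fixes F :: "'a::group_add fls"
  shows "fls_supp_in S (- F) \<longleftrightarrow> fls_supp_in S F"
  by (simp add: fls_supp_in_def)

lemma z_ext_eq_fls_map: "z_ext = fls_map"
  by (intro ext) (simp add: z_ext_def fls_map_def)

lemma P_minus_eq_fls_filter: "P_minus = fls_filter {..<0}"
  by (intro ext) (simp add: P_minus_def fls_filter_def)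

lemma in_B_apply: "in_B G v G' = (if G' = G then v else 0)"
  by (simp add: in_B_def)

lemma one_V_nth: "one_V G $$ n = (if n = 0 then in_B G (\<lambda>p. if p \<in> momentum_space G then 1 else 0) else 0)"
  by (simp add: one_V_def)

lemma pi_map_nth: "pi_map g G F $$ n
    = in_B G (\<lambda>p. if p \<in> momentum_space G then (F $$ n) g p else 0)"
  unfolding pi_map_def z_ext_eq_fls_map by (subst fls_map_nth) (auto simp: in_B_def fun_eq_iff)

lemma i_map_nth: "i_map G Q F $$ n
    = in_B G (\<lambda>p. if p \<in> momentum_space G then (F $$ n) Q (mom_restrict (hedges Q) p) else 0)"
  unfolding i_map_def z_ext_eq_fls_map by (subst fls_map_nth) (auto simp: in_B_def fun_eq_iff)

lemma iso_map_nth: "iso_map h G G' F $$ n = in_B G (\<lambda>p. if p \<in> momentum_space G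
    then (F $$ n) G' (\<lambda>e. if e \<in> hedges G' then p (inv_into (hedges G) h e) else 0) else 0)"
  unfolding iso_map_def z_ext_eq_fls_map by (subst fls_map_nth) (auto simp: in_B_def fun_eq_iff)

lemma A_scale_nth: "A_scale c F $$ n = (\<lambda>G p. c * (F $$ n) G p)"
  unfolding A_scale_def z_ext_eq_fls_map by (subst fls_map_nth) (auto simp: fun_eq_iff)

lemma ev_one_V: "p \<in> momentum_space G \<Longrightarrow> ev G p (one_V G) = 1"
  by (rule fls_eqI) (simp add: one_V_nth in_B_apply)

lemma ev_pi_map: "p \<in> momentum_space G \<Longrightarrow> ev G p (pi_map g G F) = ev g p F"
  by (rule fls_eqI) (simp add: pi_map_nth in_B_apply)

lemma ev_i_map: "p \<in> momentum_space G \<Longrightarrow> ev G p (i_map G Q F) = ev Q (mom_restrict (hedges Q) p) F"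
  by (rule fls_eqI) (simp add: i_map_nth in_B_apply)

lemma ev_iso_map: "p \<in> momentum_space G \<Longrightarrow> ev G p (iso_map h G G' F)
    = ev G' (\<lambda>e. if e \<in> hedges G' then p (inv_into (hedges G) h e) else 0) F"
  by (rule fls_eqI) (simp add: iso_map_nth in_B_apply)

lemma ev_conc:
  assumes "p \<in> momentum_space (graph_union G G')"
  shows "ev (graph_union G G') p (conc G G' F F')
    = ev G (mom_restrict (hedges G) p) F * ev G' (mom_restrict (hedges G') p) F'"
proof -
  have *: "ev U p (z_ext (\<lambda>b. in_B U (\<lambda>p. if p \<in> momentum_space U then b H (f p) else 0)) F) = ev H (f p) F"
    if "p \<in> momentum_space U" for U H :: "'t fgraph" and f F
    unfolding z_ext_eq_fls_map using that
    by (intro fls_eqI, simp, subst fls_map_nth) (auto simp: in_B_def fun_eq_iff)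
  show ?thesis unfolding conc_def Let_def using assms by (simp add: *)
qed

section \<open>Graphs\<close>

text \<open>These are the unions of connected components. Closure is asked from \<open>e\<close> to
  its partner only; since \<open>sig\<close> is an involution it holds in both directions
  (\<open>saturated_iff\<close>).\<close>

definition saturated :: "'t fgraph \<Rightarrow> nat set \<Rightarrow> bool" where
  "saturated G U \<longleftrightarrow> U \<subseteq> verts G \<and> (\<forall>e\<in>hedges G. bd G e \<in> U \<longrightarrow> bd G (sig G e) \<in> U)"

lemma is_graphD:
  assumes "is_graph G"
  shows "finite (verts G)" "finite (hedges G)"
    "e \<in> hedges G \<Longrightarrow> sig G e \<in> hedges G" "e \<in> hedges G \<Longrightarrow> sig G (sig G e) = e"
    "e \<in> hedges G \<Longrightarrow> bd G e \<in> verts G" "e \<in> hedges G \<Longrightarrow> htype G (sig G e) = htype G e"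
    "e \<notin> hedges G \<Longrightarrow> sig G e = undefined" "e \<notin> hedges G \<Longrightarrow> bd G e = undefined"
    "e \<notin> hedges G \<Longrightarrow> htype G e = undefined" "v \<notin> verts G \<Longrightarrow> vk G v = undefined"
  using assms unfolding is_graph_def extensional_def PiE_def Pi_def by auto

lemma fgraph_eqI:
  fixes G H :: "'t fgraph"
  assumes "verts G = verts H" "hedges G = hedges H" "\<And>e. sig G e = sig H e" "\<And>e. bd G e = bd H e"
    "\<And>e. htype G e = htype H e" "\<And>v. vk G v = vk H v"
  shows "G = H"
  using assms by (intro fgraph.equality) (auto simp: fun_eq_iff)

lemma is_graph_eqI:
  fixes G H :: "'t fgraph"
  assumes "is_graph G" "is_graph H" "verts G = verts H" "hedges G = hedges H"
    "\<And>e. e \<in> hedges G \<Longrightarrow> sig G e = sig H e" "\<And>e. e \<in> hedges G \<Longrightarrow> bd G e = bd H e"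
    "\<And>e. e \<in> hedges G \<Longrightarrow> htype G e = htype H e" "\<And>v. v \<in> verts G \<Longrightarrow> vk G v = vk H v"
  shows "G = H"
  by (rule fgraph_eqI) (use assms is_graphD in metis)+

lemma saturated_subset: "saturated G U \<Longrightarrow> U \<subseteq> verts G"
  by (simp add: saturated_def)

lemma saturatedD: "saturated G U \<Longrightarrow> e \<in> hedges G \<Longrightarrow> bd G e \<in> U \<Longrightarrow> bd G (sig G e) \<in> U"
  by (simp add: saturated_def)

lemma saturated_iff:
  assumes "is_graph G" "saturated G U" "e \<in> hedges G"
  shows "bd G (sig G e) \<in> U \<longleftrightarrow> bd G e \<in> U"
  using saturatedD[OF assms(2)] is_graphD(3,4)[OF assms(1)] assms(3) by metis

lemma saturated_verts: "is_graph G \<Longrightarrow> saturated G (verts G)"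
  by (simp add: saturated_def is_graphD)

lemma saturated_Int: "saturated G U \<Longrightarrow> saturated G W \<Longrightarrow> saturated G (U \<inter> W)"
  by (auto simp: saturated_def)

lemma saturated_Diff: "is_graph G \<Longrightarrow> saturated G U \<Longrightarrow> saturated G W \<Longrightarrow> saturated G (U - W)"
  using saturated_iff[of G U] saturated_iff[of G W]  by (auto simp: saturated_def)

text \<open>A path cannot leave a saturated set; conversely the set of vertices reachable from
  \<open>v\<close> is itself saturated.\<close>

lemma joined_iff:
  assumes G: "is_graph G"
  shows "(v, w) \<in> joined G \<longleftrightarrow> v \<in> verts G \<and> w \<in> verts G \<and> (\<forall>U. saturated G U \<longrightarrow> v \<in> U \<longrightarrow> w \<in> U)"
    (is "_ \<longleftrightarrow> ?R")
proof
  let ?E = "{(bd G e, bd G (sig G e)) | e. e \<in> hedges G}"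
  assume "(v, w) \<in> joined G"
  then have vw: "v \<in> verts G" "w \<in> verts G" and r: "(v, w) \<in> ?E\<^sup>*" by (auto simp: joined_def)
  have "w \<in> U" if "saturated G U" "v \<in> U" for U
    using r by (induction rule: rtrancl_induct) (use that in \<open>auto dest: saturatedD\<close>)
  with vw show ?R by blast
next
  let ?E = "{(bd G e, bd G (sig G e)) | e. e \<in> hedges G}"
  assume R: ?R
  let ?U = "{w \<in> verts G. (v, w) \<in> ?E\<^sup>*}"
  have "saturated G ?U"
    unfolding saturated_def
  proof (intro conjI ballI impI)
    fix e assume e: "e \<in> hedges G" "bd G e \<in> ?U"
    then have "(bd G e, bd G (sig G e)) \<in> ?E" by blast
    with e have "(v, bd G (sig G e)) \<in> ?E\<^sup>*" by (metis (mono_tags, lifting) mem_Collect_eq rtrancl.rtrancl_into_rtrancl)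
    with e G show "bd G (sig G e) \<in> ?U" by (simp add: is_graphD)
  qed auto
  with R have "w \<in> ?U" by blast
  with R show "(v, w) \<in> joined G" by (auto simp: joined_def)
qed

text \<open>Symmetry amounts to the closure of saturated sets under complement.\<close>

lemma equiv_joined:
  assumes G: "is_graph G"
  shows "equiv (verts G) (joined G)"
proof (rule equivI)
  show "joined G \<subseteq> verts G \<times> verts G" by (auto simp: joined_def)
  show "refl_on (verts G) (joined G)" by (auto simp: refl_on_def joined_def)
  show "sym (joined G)"
  proof (rule symI)
    fix v w assume vw: "(v, w) \<in> joined G"
    have "v \<in> U" if "saturated G U" "w \<in> U" for U
      using vw saturated_Diff[OF G saturated_verts[OF G] that(1)] that unfolding joined_iff[OF G] by blast
    with vw show "(w, v) \<in> joined G" unfolding joined_iff[OF G] by blast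
  qed
  show "trans (joined G)" by (rule transI) (auto simp: joined_iff[OF G])
qed

lemma saturated_Collect_joined:
  assumes G: "is_graph G"
  shows "saturated G (comp_of G v)"
  unfolding saturated_def comp_of_def
  by (auto simp: joined_iff[OF G] is_graphD[OF G] dest: saturatedD)

lemma comp_of_in_pi0: "v \<in> verts G \<Longrightarrow> comp_of G v \<in> pi0 G"
  by (simp add: pi0_def comp_of_def quotientI)

lemma self_in_comp_of: "v \<in> verts G \<Longrightarrow> v \<in> comp_of G v"
  by (auto simp: comp_of_def joined_def)

text \<open>The class of a vertex is the least saturated set around it, so the components are the
  atoms of the algebra of saturated sets. Components are then handled through minimality instead of
  paths.\<close>

lemma pi0_char:
  assumes G: "is_graph G"
  shows "C \<in> pi0 G \<longleftrightarrow> C \<noteq> {} \<and> saturated G C \<and> (\<forall>U. saturated G U \<longrightarrow> C \<inter> U \<noteq> {} \<longrightarrow> C \<subseteq> U)"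
proof
  assume "C \<in> pi0 G"
  then obtain v where v: "v \<in> verts G" "C = comp_of G v"
    by (auto simp: pi0_def comp_of_def elim: quotientE)
  have "C \<subseteq> U" if "saturated G U" "C \<inter> U \<noteq> {}" for U
  proof -
    from that obtain w where w: "w \<in> U" "(v, w) \<in> joined G" by (auto simp: v comp_of_def)
    then have "(w, v) \<in> joined G" using equiv_joined[OF G] by (meson equivE symD)
    with w that have "v \<in> U" by (auto simp: joined_iff[OF G])
    with that show ?thesis by (auto simp: v comp_of_def joined_iff[OF G])
  qed
  then show "C \<noteq> {} \<and> saturated G C \<and> (\<forall>U. saturated G U \<longrightarrow> C \<inter> U \<noteq> {} \<longrightarrow> C \<subseteq> U)"
    using self_in_comp_of[OF v(1)] v(2) saturated_Collect_joined[OF G] by blast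
next
  assume C: "C \<noteq> {} \<and> saturated G C \<and> (\<forall>U. saturated G U \<longrightarrow> C \<inter> U \<noteq> {} \<longrightarrow> C \<subseteq> U)"
  then obtain v where v: "v \<in> C" "v \<in> verts G" using saturated_subset by blast
  then have "C \<subseteq> comp_of G v"
    using C saturated_Collect_joined[OF G] self_in_comp_of[OF v(2)] by blast
  moreover have "comp_of G v \<subseteq> C"
    using C v by (auto simp: comp_of_def joined_iff[OF G])
  ultimately show "C \<in> pi0 G" using comp_of_in_pi0[OF v(2)] by simp
qed

lemma pi0_saturated: "is_graph G \<Longrightarrow> C \<in> pi0 G \<Longrightarrow> saturated G C"
  and pi0_nonempty: "is_graph G \<Longrightarrow> C \<in> pi0 G \<Longrightarrow> C \<noteq> {}"
  and pi0_minimal: "is_graph G \<Longrightarrow> C \<in> pi0 G \<Longrightarrow> saturated G U \<Longrightarrow> v \<in> C \<Longrightarrow> v \<in> U \<Longrightarrow> C \<subseteq> U"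
  using pi0_char by blast+

lemma pi0_subset: "is_graph G \<Longrightarrow> C \<in> pi0 G \<Longrightarrow> C \<subseteq> verts G"
  using pi0_saturated saturated_subset by blast

lemma pi0_finite: "is_graph G \<Longrightarrow> C \<in> pi0 G \<Longrightarrow> finite C"
  using pi0_subset is_graphD(1) finite_subset by metis

lemma finite_pi0: "is_graph G \<Longrightarrow> finite (pi0 G)"
  using pi0_subset is_graphD(1) by (metis PowI finite_Pow_iff finite_subset subsetI)

lemma pi0_eqI: "is_graph G \<Longrightarrow> C \<in> pi0 G \<Longrightarrow> D \<in> pi0 G \<Longrightarrow> v \<in> C \<Longrightarrow> v \<in> D \<Longrightarrow> C = D"
  using pi0_minimal pi0_saturated by (metis subset_antisym)

lemma comp_of_eq: "is_graph G \<Longrightarrow> C \<in> pi0 G \<Longrightarrow> v \<in> C \<Longrightarrow> comp_of G v = C"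
  using pi0_eqI comp_of_in_pi0 self_in_comp_of pi0_subset by (metis subsetD)

lemma Min_in_pi0: "is_graph G \<Longrightarrow> C \<in> pi0 G \<Longrightarrow> Min C \<in> C"
  using pi0_finite pi0_nonempty Min_in by metis

subsection \<open>Covering subgraphs\<close>

text \<open>Cutting described by the involution alone: a half-edge keeps its partner or becomes
  external. No set of cut edges is named, so transitivity and the passage to components or
  contractions are pointwise statements.\<close>

definition subgr :: "'t fgraph \<Rightarrow> 't fgraph \<Rightarrow> bool" where
  "subgr g G \<longleftrightarrow> is_graph g \<and> is_graph G \<and> verts g = verts G \<and> hedges g = hedges G \<and> bd g = bd G
     \<and> htype g = htype G \<and> vk g = vk G \<and> (\<forall>e\<in>hedges G. sig g e = e \<or> sig g e = sig G e)"

lemma subgrD: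
  assumes "subgr g G"
  shows "is_graph g" "is_graph G" "verts g = verts G" "hedges g = hedges G" "bd g = bd G"
    "htype g = htype G" "vk g = vk G" "e \<in> hedges G \<Longrightarrow> sig g e = e \<or> sig g e = sig G e"
  using assms unfolding subgr_def by auto

lemma internal_eq: "internal G = (\<lambda>e. {e, sig G e}) ` (hedges G - external G)"
  by (auto simp: internal_def external_def)

lemma is_graph_cut:
  assumes G: "is_graph G" and K: "K \<subseteq> internal G"
  shows "is_graph (cut G K)"
proof -
  have 1: "e \<in> hedges G" if "e \<in> \<Union>K" for e
    using that K by (auto simp: internal_def is_graphD[OF G])
  have 2: "sig G e \<in> \<Union>K" if "e \<in> \<Union>K" for e
  proof -
    from that obtain k where k: "e \<in> k" "k \<in> K" by blast
    then have "sig G e \<in> k" using K by (fastforce simp: internal_def is_graphD[OF G])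
    with k show ?thesis by blast
  qed
  have 3: "e \<in> \<Union>K" if "e \<in> hedges G" "sig G e \<in> \<Union>K" for e
    using 2[OF that(2)] that G by (simp add: is_graphD)
  have sel: "verts (cut G K) = verts G" "hedges (cut G K) = hedges G" "bd (cut G K) = bd G"
    "htype (cut G K) = htype G" "vk (cut G K) = vk G" "sig (cut G K) e = (if e \<in> \<Union>K then e else sig G e)" for e
    by (simp_all add: cut_def)
  have s: "sig (cut G K) (sig (cut G K) e) = e \<and> htype G (sig (cut G K) e) = htype G e"
    if "e \<in> hedges G" for e
    using 3[OF that] is_graphD(3,4,6)[OF G] that by (auto simp add: sel simp del: Union_iff)
  have p: "sig (cut G K) \<in> hedges G \<rightarrow>\<^sub>E hedges G"
  proof (rule PiE_I)
    show "sig (cut G K) e \<in> hedges G" if "e \<in> hedges G" for e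
      using that is_graphD(3)[OF G] by (simp add: sel)
    show "sig (cut G K) e = undefined" if "e \<notin> hedges G" for e
      using that 1[of e] is_graphD(7)[OF G] by (auto simp: sel)
  qed
  show ?thesis using G s p unfolding is_graph_def sel(1-5) by blast
qed

lemma covering_subgraph_iff:
  assumes G: "is_graph G"
  shows "covering_subgraph g G \<longleftrightarrow> subgr g G"
proof
  assume "covering_subgraph g G"
  then obtain K where K: "K \<subseteq> internal G" "g = cut G K" by (auto simp: covering_subgraph_def)
  then show "subgr g G"
    using is_graph_cut[OF G K(1)] G by (auto simp: subgr_def cut_def)
next
  assume s: "subgr g G"
  \<comment> \<open>The cut edges are those at whose half-edges the two involutions differ; by
    \<open>inv\<close> both ends of such an edge are external in \<open>g\<close>.\<close>
  let ?K = "(\<lambda>e. {e, sig G e}) ` {e \<in> hedges G. sig g e \<noteq> sig G e}"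
  have sym: "sig g e = sig G e" if "e \<in> hedges G" "sig g (sig G e) = e" for e
    using subgrD[OF s] that is_graphD by metis
  have inv: "sig g (sig G e) = sig G e" if "e \<in> hedges G" "sig g e \<noteq> sig G e" for e
    using subgrD(8)[OF s, of "sig G e"] sym that is_graphD[OF G] by metis
  have "g = cut G ?K"
  proof (rule fgraph_eqI)
    fix e
    show "sig g e = sig (cut G ?K) e"
    proof (cases "e \<in> hedges G")
      case True
      have "e \<in> \<Union>?K \<longleftrightarrow> sig g e \<noteq> sig G e"
      proof
        assume "e \<in> \<Union>?K"
        then obtain f where f: "f \<in> hedges G" "sig g f \<noteq> sig G f" "e = f \<or> e = sig G f" by auto
        then have "sig G f \<noteq> f" using subgrD(8)[OF s, of f] by metis
        then show "sig g e \<noteq> sig G e" using f inv is_graphD(4)[OF G] by metis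
      qed (use True in blast)
      then show ?thesis using subgrD(8)[OF s True] by (auto simp: cut_def)
    next
      case False
      then have "e \<notin> \<Union>?K" by (auto simp: is_graphD[OF G])
      moreover have "sig g e = undefined" "sig G e = undefined"
        using False subgrD(4)[OF s] is_graphD(7)[OF subgrD(1)[OF s]] is_graphD(7)[OF G] by auto
      ultimately show ?thesis by (auto simp: cut_def)
    qed
  qed (use subgrD[OF s] in \<open>auto simp: cut_def\<close>)
  moreover have "?K \<subseteq> internal G"
  proof
    fix k assume "k \<in> ?K"
    then obtain e where e: "e \<in> hedges G" "sig g e \<noteq> sig G e" "k = {e, sig G e}" by blast
    then have "sig G e \<noteq> e" using subgrD(8)[OF s, of e] by metis
    with e show "k \<in> internal G" by (auto simp: internal_def)
  qed
  ultimately show "covering_subgraph g G" unfolding covering_subgraph_def by blast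
qed

lemma subgr_refl: "is_graph G \<Longrightarrow> subgr G G"
  by (simp add: subgr_def)

lemma subgr_trans: "subgr f g \<Longrightarrow> subgr g G \<Longrightarrow> subgr f G"
  unfolding subgr_def by metis

lemma saturated_subgr: "subgr g G \<Longrightarrow> saturated G U \<Longrightarrow> saturated g U"
  unfolding saturated_def subgr_def by metis

lemma subgr_sig_fixed: "subgr g G \<Longrightarrow> e \<in> hedges G \<Longrightarrow> sig G e = e \<Longrightarrow> sig g e = e"
  unfolding subgr_def by auto

lemma subgr_fixed_sig:
  assumes "subgr g G" "e \<in> hedges G" "sig g e = e"
  shows "sig g (sig G e) = sig G e"
  using assms is_graphD unfolding subgr_def by metis

lemma subgr_skeleton:
  assumes G: "is_graph G"
  shows "subgr (skeleton G) G" "e \<in> hedges G \<Longrightarrow> sig (skeleton G) e = e"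
proof -
  show "subgr (skeleton G) G"
    using covering_subgraph_iff[OF G] by (auto simp: covering_subgraph_def skeleton_def)
  show "sig (skeleton G) e = e" if "e \<in> hedges G"
    using that by (cases "sig G e = e") (auto simp: skeleton_def cut_def internal_def)
qed

lemma subgr_eqI:
  assumes "subgr g G" "subgr g' G" "\<And>e. e \<in> hedges G \<Longrightarrow> sig g e = sig g' e"
  shows "g = g'"
  by (rule is_graph_eqI) (use assms in \<open>auto simp: subgr_def\<close>)

lemma finite_subgr: "is_graph G \<Longrightarrow> finite {g. subgr g G}"
proof -
  assume G: "is_graph G"
  have "finite (internal G)" using is_graphD[OF G] by (simp add: internal_eq)
  moreover have "{g. subgr g G} \<subseteq> cut G ` Pow (internal G)"
    using covering_subgraph_iff[OF G] by (auto simp: covering_subgraph_def)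
  ultimately show ?thesis by (meson finite_Pow_iff finite_imageI finite_subset)
qed

lemma finite_internal: "is_graph G \<Longrightarrow> finite (internal G)"
  using is_graphD(2) by (auto simp: internal_eq)

lemma internal_subgr:
  assumes "subgr g G"
  shows "internal g \<subseteq> internal G"
  using assms unfolding internal_def subgr_def by force

text \<open>A half-edge at which the involutions differ belongs to an edge that is lost. The number
  of internal edges is the measure of the later inductions over subgraphs.\<close>

lemma internal_subgr_less:
  assumes s: "subgr g G" and "g \<noteq> G"
  shows "card (internal g) < card (internal G)"
proof -
  obtain e where e: "e \<in> hedges G" "sig g e \<noteq> sig G e"
    using subgr_eqI[OF s subgr_refl] subgrD[OF s] assms(2) by blast
  then have ge: "sig g e = e" "sig G e \<noteq> e" using subgrD(8)[OF s] by metis+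
  have "{e, sig G e} \<notin> internal g"
  proof
    assume "{e, sig G e} \<in> internal g"
    then obtain f where f: "{e, sig G e} = {f, sig g f}" "f \<in> hedges g" "sig g f \<noteq> f"
      by (auto simp: internal_def)
    then have "sig g f = e \<and> f = sig G e \<or> f = e" using ge by (auto simp: doubleton_eq_iff)
    then show False using f ge e is_graphD(4)[OF subgrD(1)[OF s]] by metis
  qed
  moreover have "{e, sig G e} \<in> internal G" using e ge by (auto simp: internal_def)
  ultimately show ?thesis
    using internal_subgr[OF s] finite_internal[OF subgrD(2)[OF s]] by (metis psubsetI psubset_card_mono)
qed

lemma internal_empty_iff: "internal G = {} \<longleftrightarrow> (\<forall>e\<in>hedges G. sig G e = e)"
  by (auto simp: internal_def)

subsection \<open>Saturated parts\<close>

lemma component_sel [simp]: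
  "verts (component G U) = U" "hedges (component G U) = {e \<in> hedges G. bd G e \<in> U}"
  "e \<in> hedges G \<Longrightarrow> bd G e \<in> U \<Longrightarrow> sig (component G U) e = sig G e"
  "e \<in> hedges G \<Longrightarrow> bd G e \<in> U \<Longrightarrow> bd (component G U) e = bd G e"
  "e \<in> hedges G \<Longrightarrow> bd G e \<in> U \<Longrightarrow> htype (component G U) e = htype G e"
  "v \<in> U \<Longrightarrow> vk (component G U) v = vk G v"
  by (auto simp: component_def Let_def)

lemma is_graph_component:
  assumes G: "is_graph G" and U: "saturated G U"
  shows "is_graph (component G U)"
  unfolding is_graph_def
proof (intro conjI)
  show "finite (verts (component G U))" using U G by (auto simp: saturated_def is_graphD intro: finite_subset)
  show "sig (component G U) \<in> hedges (component G U) \<rightarrow>\<^sub>E hedges (component G U)"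
    using U G by (auto simp: saturated_def is_graphD component_def Let_def)
  show "\<forall>e\<in>hedges (component G U). sig (component G U) (sig (component G U) e) = e \<and>
       htype (component G U) (sig (component G U) e) = htype (component G U) e"
    using U G by (auto simp: saturated_def is_graphD)
qed (use G in \<open>auto simp: is_graphD component_def Let_def\<close>)

lemma saturated_component:
  assumes G: "is_graph G" and "saturated G U"
  shows "saturated (component G U) W \<longleftrightarrow> W \<subseteq> U \<and> saturated G W"
proof -
  have "bd (component G U) (sig (component G U) e) = bd G (sig G e)" if "e \<in> hedges G" "bd G e \<in> U" for e
    using that saturatedD[OF assms(2)] G by (simp add: is_graphD)
  then show ?thesis using assms by (auto simp: saturated_def)
qed

lemma pi0_component:
  assumes G: "is_graph G" and U: "saturated G U"
  shows "pi0 (component G U) = {C \<in> pi0 G. C \<subseteq> U}"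
proof -
  have "(\<forall>W. W \<subseteq> U \<and> saturated G W \<longrightarrow> C \<inter> W \<noteq> {} \<longrightarrow> C \<subseteq> W)
      \<longleftrightarrow> (\<forall>W. saturated G W \<longrightarrow> C \<inter> W \<noteq> {} \<longrightarrow> C \<subseteq> W)" if "C \<subseteq> U" for C
  proof (intro iffI allI impI)
    fix W assume "\<forall>W. W \<subseteq> U \<and> saturated G W \<longrightarrow> C \<inter> W \<noteq> {} \<longrightarrow> C \<subseteq> W" "saturated G W" "C \<inter> W \<noteq> {}"
    then show "C \<subseteq> W" using saturated_Int[OF U, of W] that by blast
  qed blast
  then show ?thesis
    unfolding pi0_char[OF G] pi0_char[OF is_graph_component[OF G U]] saturated_component[OF G U] set_eq_iff mem_Collect_eq
    by meson
qed

lemma pi0_component_self: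
  assumes G: "is_graph G" and C: "C \<in> pi0 G"
  shows "pi0 (component G C) = {C}"
proof -
  have "D = C" if "D \<in> pi0 G" "D \<subseteq> C" for D
    using pi0_eqI[OF G that(1) C] pi0_nonempty[OF G that(1)] that by blast
  then show ?thesis using C by (auto simp: pi0_component[OF G pi0_saturated[OF G C]])
qed

lemma internal_component:
  assumes G: "is_graph G" and U: "saturated G U"
  shows "internal (component G U) = {{e, sig G e} | e. e \<in> hedges G \<and> bd G e \<in> U \<and> sig G e \<noteq> e}"
  unfolding internal_def by force

lemma external_component: "external (component G U) = {e \<in> external G. bd G e \<in> U}"
  by (auto simp: external_def)

lemma subgr_component:
  assumes s: "subgr g G" and U: "saturated G U"
  shows "subgr (component g U) (component G U)"
proof -
  have "is_graph (component g U)" "is_graph (component G U)"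
    using is_graph_component saturated_subgr[OF s U] U subgrD(1,2)[OF s] by blast+
  moreover have "bd (component g U) = bd (component G U)" "htype (component g U) = htype (component G U)"
    "vk (component g U) = vk (component G U)"
    using subgrD[OF s] by (simp_all add: component_def Let_def)
  ultimately show ?thesis
    unfolding subgr_def using subgrD[OF s] by auto
qed

lemma component_eq_iff:
  assumes s: "subgr g G"
  shows "component g C = component G C \<longleftrightarrow> (\<forall>e\<in>hedges G. bd G e \<in> C \<longrightarrow> sig g e = sig G e)"
proof
  assume "component g C = component G C"
  then have "sig (component g C) e = sig (component G C) e" for e by simp
  then show "\<forall>e\<in>hedges G. bd G e \<in> C \<longrightarrow> sig g e = sig G e"
    using subgrD[OF s] component_sel(3) by metis
next
  assume "\<forall>e\<in>hedges G. bd G e \<in> C \<longrightarrow> sig g e = sig G e"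
  then show "component g C = component G C"
    using subgrD[OF s] by (auto simp: component_def Let_def restrict_def fun_eq_iff)
qed

text \<open>An uncut component is closed in \<open>G\<close> too, and sets closed in
  \<open>G\<close> are closed in \<open>g\<close>, so minimality passes from \<open>g\<close> to
  \<open>G\<close>.\<close>

lemma pi0_full_component:
  assumes s: "subgr g G" and C: "C \<in> pi0 g" and eq: "component g C = component G C"
  shows "C \<in> pi0 G"
proof -
  note g = subgrD(1)[OF s] and G = subgrD(2)[OF s]
  have "saturated G C"
    using pi0_saturated[OF g C] eq subgrD(3-5)[OF s] unfolding component_eq_iff[OF s] saturated_def by simp
  moreover have "C \<subseteq> U" if "saturated G U" "C \<inter> U \<noteq> {}" for U
    using C saturated_subgr[OF s that(1)] that(2) unfolding pi0_char[OF g] by blast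
  ultimately show ?thesis using pi0_nonempty[OF g C] unfolding pi0_char[OF G] by blast
qed

subsection \<open>Bridges and the loop number\<close>

text \<open>No internal edge is a bridge, in dual form: an edge cannot be the only one to leave a
  vertex set. Neither components nor cut graphs occur, so the condition moves to contractions and
  back (\<open>bridgeless_scontract_graph\<close>, \<open>bridgeless_lift\<close>).\<close>

definition bridgeless :: "'t fgraph \<Rightarrow> bool" where
  "bridgeless G \<longleftrightarrow> (\<forall>e\<in>hedges G. sig G e \<noteq> e \<longrightarrow> (\<forall>U\<subseteq>verts G.
     (\<forall>f\<in>hedges G. f \<noteq> e \<longrightarrow> f \<noteq> sig G e \<longrightarrow> bd G f \<in> U \<longrightarrow> bd G (sig G f) \<in> U) \<longrightarrow>
     bd G e \<in> U \<longrightarrow> bd G (sig G e) \<in> U))"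

lemma bridgelessD:
  assumes "bridgeless G" "e \<in> hedges G" "sig G e \<noteq> e" "U \<subseteq> verts G" "bd G e \<in> U"
    "\<And>f. f \<in> hedges G \<Longrightarrow> f \<noteq> e \<Longrightarrow> f \<noteq> sig G e \<Longrightarrow> bd G f \<in> U \<Longrightarrow> bd G (sig G f) \<in> U"
  shows "bd G (sig G e) \<in> U"
  using assms unfolding bridgeless_def by blast

lemma connected_graph_iff:
  assumes G: "is_graph G"
  shows "connected_graph G \<longleftrightarrow> verts G \<noteq> {} \<and> (\<forall>U. saturated G U \<longrightarrow> U \<noteq> {} \<longrightarrow> U = verts G)"
proof
  assume "connected_graph G"
  then obtain C where C: "pi0 G = {C}" unfolding connected_graph_def by (meson card_1_singletonE)
  have CV: "C = verts G"
    using comp_of_in_pi0[of _ G] self_in_comp_of[of _ G] pi0_subset[OF G, of C] C by blast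
  moreover have "C \<noteq> {}" using C pi0_nonempty[OF G] by blast
  moreover have "U = verts G" if U: "saturated G U" "U \<noteq> {}" for U
  proof -
    from U obtain v where v: "v \<in> U" by blast
    have "C \<subseteq> U" by (rule pi0_minimal[OF G _ U(1) _ v]) (use C CV v saturated_subset[OF U(1)] in auto)
    then show ?thesis using CV saturated_subset[OF U(1)] by blast
  qed
  ultimately show "verts G \<noteq> {} \<and> (\<forall>U. saturated G U \<longrightarrow> U \<noteq> {} \<longrightarrow> U = verts G)" by blast
next
  assume R: "verts G \<noteq> {} \<and> (\<forall>U. saturated G U \<longrightarrow> U \<noteq> {} \<longrightarrow> U = verts G)"
  then have "pi0 G = {verts G}"
    using saturated_verts[OF G] unfolding set_eq_iff pi0_char[OF G] by blast
  then show "connected_graph G" by (simp add: connected_graph_def)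
qed

lemma cut_sel [simp]:
  "verts (cut G K) = verts G" "hedges (cut G K) = hedges G" "bd (cut G K) = bd G"
  "sig (cut G K) e = (if e \<in> \<Union>K then e else sig G e)"
  by (simp_all add: cut_def)

lemma subgr_cut: "is_graph G \<Longrightarrow> K \<subseteq> internal G \<Longrightarrow> subgr (cut G K) G"
  using covering_subgraph_iff[of G] unfolding covering_subgraph_def by blast

text \<open>If no edge other than that of \<open>e\<close> leaves \<open>U\<close>, then
  \<open>U \<inter> C\<close> is closed once this edge is cut and must fill the component
  \<open>C\<close> of \<open>e\<close>. Conversely, a set closed after the cut is closed already
  before it, by \<open>bridgeless\<close> applied from both ends of the edge.\<close>

lemma locally_one_PI_iff:
  assumes G: "is_graph G"
  shows "locally_one_PI G \<longleftrightarrow> bridgeless G"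
proof
  assume L: "locally_one_PI G"
  show "bridgeless G" unfolding bridgeless_def
  proof (intro ballI impI allI)
    fix e U
    assume e: "e \<in> hedges G" "sig G e \<noteq> e" and U: "U \<subseteq> verts G"
      "\<forall>f\<in>hedges G. f \<noteq> e \<longrightarrow> f \<noteq> sig G e \<longrightarrow> bd G f \<in> U \<longrightarrow> bd G (sig G f) \<in> U"
      "bd G e \<in> U"
    define C where "C = comp_of G (bd G e)"
    have be: "bd G e \<in> verts G" using e G by (simp add: is_graphD)
    have C: "C \<in> pi0 G" "bd G e \<in> C"
      using comp_of_in_pi0[OF be] self_in_comp_of[OF be] by (auto simp: C_def)
    note sC = pi0_saturated[OF G C(1)]
    note gC = is_graph_component[OF G sC]
    have se: "bd G (sig G e) \<in> C" using saturatedD[OF sC e(1) C(2)] .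
    have i: "{e, sig G e} \<in> internal (component G C)"
      unfolding internal_component[OF G sC] using e C(2) by blast
    let ?H = "cut (component G C) {{e, sig G e}}"
    have gH: "is_graph ?H" by (rule is_graph_cut[OF gC]) (use i in simp)
    have con: "connected_graph ?H" using L C(1) i by (simp add: locally_one_PI_def one_PI_def)
    have "saturated ?H (U \<inter> C)"
      unfolding saturated_def
    proof (intro conjI ballI impI)
      fix f assume f: "f \<in> hedges ?H" "bd ?H f \<in> U \<inter> C"
      then have f': "f \<in> hedges G" "bd G f \<in> C" "bd G f \<in> U" by auto
      then have "sig G f \<in> hedges G" "bd G (sig G f) \<in> C" using saturatedD[OF sC] is_graphD(3)[OF G] by auto
      then show "bd ?H (sig ?H f) \<in> U \<inter> C" using U(2) f' by auto
    qed auto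
    then have "U \<inter> C = C"
      using con U(3) C(2) unfolding connected_graph_iff[OF gH] by auto
    with se show "bd G (sig G e) \<in> U" by blast
  qed
next
  assume B: "bridgeless G"
  show "locally_one_PI G" unfolding locally_one_PI_def one_PI_def
  proof (intro ballI conjI)
    fix C assume C: "C \<in> pi0 G"
    note sC = pi0_saturated[OF G C]
    note gC = is_graph_component[OF G sC]
    show "connected_graph (component G C)"
      using pi0_component_self[OF G C] by (simp add: connected_graph_def)
    fix ed assume ed: "ed \<in> internal (component G C)"
    then obtain e where e: "e \<in> hedges G" "bd G e \<in> C" "sig G e \<noteq> e" "ed = {e, sig G e}"
      unfolding internal_component[OF G sC] by blast
    have gH: "is_graph (cut (component G C) {ed})" by (rule is_graph_cut[OF gC]) (use ed in simp)
    have "U = C" if U: "saturated (cut (component G C) {ed}) U" "U \<noteq> {}" for U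
    proof -
      have UC: "U \<subseteq> C" using saturated_subset[OF U(1)] by simp
      have cl: "bd G (sig G f) \<in> U" if f: "f \<in> hedges G" "f \<noteq> e" "f \<noteq> sig G e" "bd G f \<in> U" for f
        using saturatedD[OF U(1), of f] f UC e saturatedD[OF sC, of f] is_graphD(3)[OF G] by auto
      have UV: "U \<subseteq> verts G" using UC saturated_subset[OF sC] by blast
      have 1: "bd G (sig G e) \<in> U" if "bd G e \<in> U"
        by (rule bridgelessD[OF B e(1,3) UV that]) (use cl in blast)
      have se: "sig G e \<in> hedges G" "sig G (sig G e) = e" using e G by (simp_all add: is_graphD)
      have 2: "bd G e \<in> U" if "bd G (sig G e) \<in> U"
        using bridgelessD[OF B se(1) _ UV that] cl e(3) se(2) by auto
      have "saturated G U"
        unfolding saturated_def using UV cl 1 2 se by metis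
      then have "C \<subseteq> U" using pi0_minimal[OF G C] U(2) UC by blast
      with UC show ?thesis by blast
    qed
    then show "connected_graph (cut (component G C) {ed})"
      unfolding connected_graph_iff[OF gH] using pi0_nonempty[OF G C] by simp
  qed
qed

text \<open>Sending a component of the cut graph to the component of \<open>G\<close> around it is
  injective away from the component \<open>D\<close> at one end of the edge: components without an
  end of the edge are components of \<open>G\<close>, and besides \<open>D\<close> at most one
  contains an end.\<close>

lemma card_pi0_cut_le:
  assumes G: "is_graph G" and e: "e \<in> hedges G" "sig G e \<noteq> e"
  shows "card (pi0 (cut G {{e, sig G e}})) \<le> Suc (card (pi0 G))"
proof -
  let ?H = "cut G {{e, sig G e}}"
  have K: "{{e, sig G e}} \<subseteq> internal G" using e by (auto simp: internal_def)
  note H = is_graph_cut[OF G K]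
  have s: "subgr ?H G" by (rule subgr_cut[OF G K])
  define D where "D = comp_of ?H (bd G e)"
  have D: "D \<in> pi0 ?H" "bd G e \<in> D"
    using comp_of_in_pi0[of "bd G e" ?H] self_in_comp_of[of "bd G e" ?H] e G by (auto simp: D_def is_graphD)
  define f where "f C = comp_of G (Min C)" for C
  have f: "f C \<in> pi0 G" "C \<subseteq> f C" if "C \<in> pi0 ?H" for C
  proof -
    have m: "Min C \<in> C" "Min C \<in> verts G" using Min_in_pi0[OF H that] pi0_subset[OF H that] by auto
    show "f C \<in> pi0 G" unfolding f_def by (rule comp_of_in_pi0[OF m(2)])
    then show "C \<subseteq> f C"
      using pi0_minimal[OF H that saturated_subgr[OF s pi0_saturated[OF G]] m(1)] self_in_comp_of[OF m(2)]
      by (simp add: f_def)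
  qed
  have eq: "f C = C" if "C \<in> pi0 ?H" "bd G e \<notin> C" "bd G (sig G e) \<notin> C" for C
  proof -
    have "saturated G C"
      unfolding saturated_def
    proof (intro conjI ballI impI)
      fix x assume x: "x \<in> hedges G" "bd G x \<in> C"
      then have "x \<noteq> e" "x \<noteq> sig G e" using that(2,3) by auto
      then show "bd G (sig G x) \<in> C" using saturatedD[OF pi0_saturated[OF H that(1)], of x] x by simp
    qed (use pi0_subset[OF H that(1)] in simp)
    then have "f C \<subseteq> C"
      using pi0_minimal[OF G f(1)[OF that(1)]] f(2)[OF that(1)] pi0_nonempty[OF H that(1)] by blast
    with f(2)[OF that(1)] show ?thesis by blast
  qed
  have "inj_on f (pi0 ?H - {D})"
  proof (rule inj_onI)
    fix C C' assume C: "C \<in> pi0 ?H - {D}" "C' \<in> pi0 ?H - {D}" "f C = f C'"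
    then have n: "bd G e \<notin> C" "bd G e \<notin> C'" using pi0_eqI[OF H _ D(1) _ D(2)] by auto
    show "C = C'"
    proof (cases "bd G (sig G e) \<in> C \<and> bd G (sig G e) \<in> C'")
      case True then show ?thesis using pi0_eqI[OF H, of C C' "bd G (sig G e)"] C by simp
    next
      case False
      then have "f C = C \<or> f C' = C'" using eq n C by blast
      then have "C' \<subseteq> C \<or> C \<subseteq> C'" using f(2)[of C] f(2)[of C'] C by auto
      then obtain x where "x \<in> C" "x \<in> C'"
        using pi0_nonempty[OF H, of C] pi0_nonempty[OF H, of C'] C by auto
      then show ?thesis using pi0_eqI[OF H, of C C' x] C by simp
    qed
  qed
  then have "card (pi0 ?H - {D}) \<le> card (pi0 G)"
    using f(1) finite_pi0[OF G] by (intro card_inj_on_le[of f]) auto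
  then show ?thesis using D(1) finite_pi0[OF H] by (simp add: card_Diff_singleton)
qed

lemma internal_cut_single:
  assumes G: "is_graph G" and e: "e \<in> hedges G" "sig G e \<noteq> e"
  shows "internal (cut G {{e, sig G e}}) = internal G - {{e, sig G e}}"
proof (intro subset_antisym subsetI)
  let ?H = "cut G {{e, sig G e}}"
  fix k assume "k \<in> internal ?H"
  then obtain f where "f \<in> hedges G" "sig ?H f \<noteq> f" "k = {f, sig ?H f}" by (auto simp: internal_def)
  then have "f \<in> hedges G" "sig G f \<noteq> f" "k = {f, sig G f}" "f \<noteq> e" "f \<noteq> sig G e" by (auto split: if_splits)
  then show "k \<in> internal G - {{e, sig G e}}" by (auto simp: internal_def doubleton_eq_iff)
next
  let ?H = "cut G {{e, sig G e}}"
  fix k assume k: "k \<in> internal G - {{e, sig G e}}"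
  then obtain f where f: "f \<in> hedges G" "sig G f \<noteq> f" "k = {f, sig G f}" by (auto simp: internal_def)
  then have "f \<noteq> e" "f \<noteq> sig G e" using k is_graphD(4)[OF G e(1)] by (auto simp: insert_commute)
  then have "sig ?H f = sig G f" by simp
  then show "k \<in> internal ?H" using f unfolding internal_def by force
qed

lemma pi0_no_internal:
  assumes G: "is_graph G" and i: "internal G = {}"
  shows "pi0 G = (\<lambda>v. {v}) ` verts G"
proof -
  have s: "saturated G U \<longleftrightarrow> U \<subseteq> verts G" for U
    using i by (auto simp: saturated_def internal_empty_iff)
  show ?thesis
  proof (intro subset_antisym subsetI)
    fix C assume C: "C \<in> pi0 G"
    then obtain v where v: "v \<in> C" "v \<in> verts G" using pi0_nonempty[OF G] pi0_subset[OF G] by blast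
    then have "C \<subseteq> {v}" using pi0_minimal[OF G C, of "{v}" v] s by auto
    with v show "C \<in> (\<lambda>v. {v}) ` verts G" by auto
  next
    fix C assume "C \<in> (\<lambda>v. {v}) ` verts G"
    then show "C \<in> pi0 G" unfolding pi0_char[OF G] s by auto
  qed
qed

lemma loop_number_no_internal:
  assumes "is_graph G" "internal G = {}"
  shows "loop_number G = 0"
  using pi0_no_internal[OF assms] assms(2) by (simp add: loop_number_def card_image)

text \<open>Cutting an edge lowers the edge count by one and adds at most one component, and without
  internal edges the loop number is 0.\<close>

lemma loop_number_nonneg:
  assumes "is_graph G"
  shows "loop_number G \<ge> 0"
  using assms
proof (induction "card (internal G)" arbitrary: G rule: less_induct)
  case less
  show ?case
  proof (cases "internal G = {}")
    case True then show ?thesis using loop_number_no_internal[OF less.prems] by simp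
  next
    case False
    then obtain e where e: "e \<in> hedges G" "sig G e \<noteq> e" by (auto simp: internal_def)
    let ?H = "cut G {{e, sig G e}}"
    have K: "{{e, sig G e}} \<subseteq> internal G" using e by (auto simp: internal_def)
    have c: "card (internal G) = Suc (card (internal ?H))"
      using internal_cut_single[OF less.prems e] K card.remove[OF finite_internal[OF less.prems], of "{e, sig G e}"]
      by simp
    then have "loop_number ?H \<ge> 0" using less.hyps[of ?H] is_graph_cut[OF less.prems K] by simp
    then show ?thesis using c card_pi0_cut_le[OF less.prems e] by (simp add: loop_number_def)
  qed
qed

text \<open>Cutting an edge that is not a bridge does not change the components.\<close>

lemma loop_number_pos:
  assumes G: "is_graph G" and B: "bridgeless G" and i: "internal G \<noteq> {}"
  shows "loop_number G \<ge> 1"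
proof -
  obtain e where e: "e \<in> hedges G" "sig G e \<noteq> e" using i by (auto simp: internal_def)
  let ?H = "cut G {{e, sig G e}}"
  have K: "{{e, sig G e}} \<subseteq> internal G" using e by (auto simp: internal_def)
  note H = is_graph_cut[OF G K]
  have s: "subgr ?H G" by (rule subgr_cut[OF G K])
  have se: "sig G e \<in> hedges G" "sig G (sig G e) = e" using e G by (simp_all add: is_graphD)
  have "saturated G U" if U: "saturated ?H U" for U
  proof -
    have UV: "U \<subseteq> verts G" using saturated_subset[OF U] by simp
    have cl: "bd G (sig G f) \<in> U" if "f \<in> hedges G" "f \<noteq> e" "f \<noteq> sig G e" "bd G f \<in> U" for f
      using saturatedD[OF U, of f] that by auto
    have 1: "bd G (sig G e) \<in> U" if "bd G e \<in> U"
      by (rule bridgelessD[OF B e UV that]) (use cl in blast)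
    have 2: "bd G e \<in> U" if "bd G (sig G e) \<in> U"
      using bridgelessD[OF B se(1) _ UV that] cl e(2) se(2) by auto
    show ?thesis unfolding saturated_def using UV cl 1 2 se by metis
  qed
  then have "saturated ?H = saturated G" using saturated_subgr[OF s] by blast
  then have "pi0 ?H = pi0 G" unfolding set_eq_iff pi0_char[OF G] pi0_char[OF H] by simp
  moreover have "card (internal G) = Suc (card (internal ?H))"
    using internal_cut_single[OF G e] K card.remove[OF finite_internal[OF G], of "{e, sig G e}"] by simp
  ultimately show ?thesis using loop_number_nonneg[OF H] by (simp add: loop_number_def)
qed

subsection \<open>Contraction\<close>

text \<open>
  As \<open>Min\<close> of a union of components is the least of their minima, iterated contractions agree on
  the nose; the components of a contraction are those of the graph, cut down to the new labels.
\<close>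

definition rep :: "'t fgraph \<Rightarrow> nat \<Rightarrow> nat" where
  "rep g v = Min (comp_of g v)"

lemma rep_in:
  assumes "is_graph g" "v \<in> verts g"
  shows "rep g v \<in> comp_of g v" "rep g v \<in> verts g" "comp_of g (rep g v) = comp_of g v" "rep g (rep g v) = rep g v"
proof -
  note c = comp_of_in_pi0[OF assms(2)]
  show 1: "rep g v \<in> comp_of g v" unfolding rep_def by (rule Min_in_pi0[OF assms(1) c])
  then show "rep g v \<in> verts g" using pi0_subset[OF assms(1) c] by blast
  show "comp_of g (rep g v) = comp_of g v" by (rule comp_of_eq[OF assms(1) c 1])
  then show "rep g (rep g v) = rep g v" by (simp add: rep_def)
qed

text \<open>A component of \<open>g\<close> lies inside \<open>U\<close> or misses it, so membership
  can be tested on the label.\<close>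

lemma rep_in_saturated_iff:
  assumes g: "is_graph g" and U: "saturated g U" and v: "v \<in> verts g"
  shows "rep g v \<in> U \<longleftrightarrow> v \<in> U"
  using pi0_minimal[OF g comp_of_in_pi0[OF v] U] rep_in(1)[OF g v] self_in_comp_of[OF v] by blast

lemma rep_eq_iff:
  assumes "is_graph g" "v \<in> verts g" "w \<in> verts g"
  shows "rep g v = rep g w \<longleftrightarrow> v \<in> comp_of g w"
  using rep_in(3)[OF assms(1,2)] rep_in(3)[OF assms(1,3)] self_in_comp_of[OF assms(2)]
    comp_of_eq[OF assms(1) comp_of_in_pi0[OF assms(3)]] by (metis rep_def)

lemma Min_pi0_eq_rep: "C \<in> pi0 g \<Longrightarrow> is_graph g \<Longrightarrow> v \<in> C \<Longrightarrow> Min C = rep g v"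
  by (simp add: rep_def comp_of_eq)

lemma Min_pi0_image:
  assumes g: "is_graph g"
  shows "Min ` pi0 g = rep g ` verts g"
proof
  show "Min ` pi0 g \<subseteq> rep g ` verts g"
  proof
    fix x assume "x \<in> Min ` pi0 g"
    then obtain C where C: "C \<in> pi0 g" "x = Min C" by blast
    then obtain v where "v \<in> C" "v \<in> verts g" using pi0_nonempty[OF g] pi0_subset[OF g] by blast
    with C show "x \<in> rep g ` verts g" using Min_pi0_eq_rep[OF _ g] by blast
  qed
qed (auto simp: rep_def intro: comp_of_in_pi0)

lemma scontract_graph_sel:
  assumes g: "is_graph g"
  shows "verts (scontract_graph G (g, j)) = rep g ` verts g"
    "hedges (scontract_graph G (g, j)) = external g"
    "e \<in> external g \<Longrightarrow> sig (scontract_graph G (g, j)) e = sig G e"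
    "e \<in> external g \<Longrightarrow> bd (scontract_graph G (g, j)) e = rep g (bd g e)"
    "e \<in> external g \<Longrightarrow> htype (scontract_graph G (g, j)) e = htype G e"
    "v \<in> rep g ` verts g \<Longrightarrow> vk (scontract_graph G (g, j)) v = j (comp_of g v)"
  unfolding scontract_graph_def contract_def Let_def
  using Min_pi0_image[OF g] by (simp_all add: rep_def[symmetric])

lemma external_subgr:
  assumes s: "subgr g G"
  shows "e \<in> external g \<Longrightarrow> e \<in> hedges G" "e \<in> external g \<Longrightarrow> sig G e \<in> external g"
    "e \<in> hedges G \<Longrightarrow> e \<notin> external g \<Longrightarrow> sig g e = sig G e"
  using subgrD(4)[OF s] subgr_fixed_sig[OF s] is_graphD(3)[OF subgrD(2)[OF s]] subgrD(8)[OF s]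
  by (auto simp: external_def)

lemma is_graph_scontract_graph:
  assumes s: "subgr g G"
  shows "is_graph (scontract_graph G (g, j))"
proof -
  note g = subgrD(1)[OF s] and G = subgrD(2)[OF s]
  let ?Q = "scontract_graph G (g, j)"
  note sel = scontract_graph_sel[OF g, where G = G and j = j]
  have ext: "e \<notin> external g \<Longrightarrow> sig ?Q e = undefined \<and> bd ?Q e = undefined \<and> htype ?Q e = undefined"
    "v \<notin> rep g ` verts g \<Longrightarrow> vk ?Q v = undefined" for e v
    unfolding scontract_graph_def contract_def Let_def using Min_pi0_image[OF g] by simp_all
  show ?thesis
    unfolding is_graph_def sel(1,2)
  proof (intro conjI ballI)
    show "finite (rep g ` verts g)" "finite (external g)" using is_graphD(1,2)[OF g] by (auto simp: external_def)
    show "sig ?Q \<in> external g \<rightarrow>\<^sub>E external g"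
      by (rule PiE_I) (use sel(3) external_subgr(2)[OF s] ext in auto)
    show "bd ?Q \<in> external g \<rightarrow>\<^sub>E rep g ` verts g"
      by (rule PiE_I) (use sel(4) is_graphD(5)[OF g] external_subgr(1)[OF s] subgrD(4)[OF s] ext in auto)
    fix e assume e: "e \<in> external g"
    then show "sig ?Q (sig ?Q e) = e" "htype ?Q (sig ?Q e) = htype ?Q e"
      using sel(3,5) external_subgr(1,2)[OF s e] is_graphD(4,6)[OF G] by auto
  qed (use ext in \<open>auto simp: extensional_def\<close>)
qed

lemma bd_sig_internal:
  assumes s: "subgr g G" and e: "e \<in> hedges G" "e \<notin> external g"
  shows "rep g (bd g (sig G e)) = rep g (bd g e)"
proof -
  note g = subgrD(1)[OF s]
  have v: "bd g e \<in> verts g" "bd g (sig G e) \<in> verts g"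
    using e is_graphD(5)[OF g] is_graphD(3)[OF subgrD(2)[OF s]] subgrD(4)[OF s] by auto
  have "bd g (sig G e) \<in> comp_of g (bd g e)"
    using saturatedD[OF pi0_saturated[OF g comp_of_in_pi0[OF v(1)]], of e] self_in_comp_of[OF v(1)]
      external_subgr(3)[OF s e] e(1) subgrD(4)[OF s] by simp
  then show ?thesis using rep_eq_iff[OF g v(2,1)] by blast
qed

text \<open>The half-edges lost in the contraction join vertices with the same label
  (\<open>bd_sig_internal\<close>) and so never leave a preimage under \<open>rep g\<close>; all
  others are kept with their partners.\<close>

lemma saturated_scontract_graph:
  assumes s: "subgr g G"
  shows "saturated (scontract_graph G (g, j)) W \<longleftrightarrow>
    W \<subseteq> rep g ` verts g \<and> saturated G {v \<in> verts G. rep g v \<in> W}"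
proof -
  note g = subgrD(1)[OF s] and G = subgrD(2)[OF s]
  note sel = scontract_graph_sel[OF g, where G = G and j = j]
  have a: "(\<forall>e\<in>external g. rep g (bd g e) \<in> W \<longrightarrow> rep g (bd g (sig G e)) \<in> W)
    \<longleftrightarrow> (\<forall>e\<in>hedges G. rep g (bd g e) \<in> W \<longrightarrow> rep g (bd g (sig G e)) \<in> W)"
    using bd_sig_internal[OF s] external_subgr(1)[OF s] by metis
  show ?thesis
    unfolding saturated_def sel(1,2)
    using a sel(3,4) external_subgr(1,2)[OF s] is_graphD(3,5)[OF G] subgrD(5)[OF s] by auto
qed

lemma saturated_scontract_graph_Int:
  assumes s: "subgr g G" and U: "saturated G U"
  shows "saturated (scontract_graph G (g, j)) (U \<inter> rep g ` verts g)"
proof -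
  have "{v \<in> verts G. rep g v \<in> U \<inter> rep g ` verts g} = U"
    using rep_in_saturated_iff[OF subgrD(1)[OF s] saturated_subgr[OF s U]] subgrD(3)[OF s] saturated_subset[OF U]
    by auto
  then show ?thesis using U unfolding saturated_scontract_graph[OF s] by simp
qed

lemma pi0_scontract_graph:
  assumes s: "subgr g G"
  shows "pi0 (scontract_graph G (g, j)) = (\<lambda>C. C \<inter> rep g ` verts g) ` pi0 G"
proof -
  note g = subgrD(1)[OF s] and G = subgrD(2)[OF s] and Q = is_graph_scontract_graph[OF s, of j]
  have sv: "verts g = verts G" by (rule subgrD(3)[OF s])
  have mem: "rep g v \<in> U \<longleftrightarrow> v \<in> U" if "saturated G U" "v \<in> verts G" for U v
    using rep_in_saturated_iff[OF g saturated_subgr[OF s that(1)]] that(2) sv by auto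
  have im: "C \<inter> rep g ` verts g \<in> pi0 (scontract_graph G (g, j))" if C: "C \<in> pi0 G" for C
    unfolding pi0_char[OF Q]
  proof (intro conjI allI impI)
    note sC = pi0_saturated[OF G C]
    show "C \<inter> rep g ` verts g \<noteq> {}"
      using pi0_nonempty[OF G C] mem[OF sC] saturated_subset[OF sC] sv by blast
    show "saturated (scontract_graph G (g, j)) (C \<inter> rep g ` verts g)"
      by (rule saturated_scontract_graph_Int[OF s sC])
    fix W assume W: "saturated (scontract_graph G (g, j)) W" "C \<inter> rep g ` verts g \<inter> W \<noteq> {}"
    then have W': "saturated G {v \<in> verts G. rep g v \<in> W}" unfolding saturated_scontract_graph[OF s] by blast
    from W(2) obtain v where v: "v \<in> verts G" "rep g v \<in> C" "rep g v \<in> W" using sv by blast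
    then have "v \<in> C" using mem[OF sC] by blast
    then have "C \<subseteq> {v \<in> verts G. rep g v \<in> W}" using pi0_minimal[OF G C W'] v by blast
    moreover have "rep g (rep g w) = rep g w" if "w \<in> verts g" for w using rep_in(4)[OF g that] .
    ultimately show "C \<inter> rep g ` verts g \<subseteq> W" by force
  qed
  show ?thesis
  proof (intro subset_antisym subsetI)
    fix D assume D: "D \<in> pi0 (scontract_graph G (g, j))"
    then obtain w where w: "w \<in> D" "w \<in> rep g ` verts g"
      using pi0_nonempty[OF Q D] pi0_subset[OF Q D] scontract_graph_sel(1)[OF g] by blast
    then obtain v where v: "v \<in> verts G" "w = rep g v" using sv by blast
    let ?C = "comp_of G v"
    have C: "?C \<in> pi0 G" by (rule comp_of_in_pi0[OF v(1)])
    have "w \<in> ?C \<inter> rep g ` verts g"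
      using mem[OF pi0_saturated[OF G C] v(1)] self_in_comp_of[OF v(1)] v w by blast
    then have "D = ?C \<inter> rep g ` verts g" using pi0_eqI[OF Q D im[OF C] w(1)] by blast
    with C show "D \<in> (\<lambda>C. C \<inter> rep g ` verts g) ` pi0 G" by blast
  qed (use im in blast)
qed

text \<open>The least vertex of \<open>C\<close> is also least in its component of \<open>g\<close>,
  which lies in \<open>C\<close>. Hence it survives the contraction as a label and names the same
  component before and after.\<close>

lemma Min_pi0_in_rep_image:
  assumes s: "subgr g G" and C: "C \<in> pi0 G"
  shows "Min C \<in> rep g ` verts g" "Min (C \<inter> rep g ` verts g) = Min C" "comp_of G (Min (C \<inter> rep g ` verts g)) = C"
proof -
  note g = subgrD(1)[OF s] and G = subgrD(2)[OF s]
  have fin: "finite C" by (rule pi0_finite[OF G C])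
  have m: "Min C \<in> C" by (rule Min_in_pi0[OF G C])
  then have v: "Min C \<in> verts g" using pi0_subset[OF G C] subgrD(3)[OF s] by auto
  have "comp_of g (Min C) \<subseteq> C"
    by (rule pi0_minimal[OF g comp_of_in_pi0[OF v] saturated_subgr[OF s pi0_saturated[OF G C]] self_in_comp_of[OF v] m])
  then have "Min C \<le> rep g (Min C)" using rep_in(1)[OF g v] fin by (simp add: subset_iff)
  moreover have "rep g (Min C) \<le> Min C"
    unfolding rep_def using self_in_comp_of[OF v] pi0_finite[OF g comp_of_in_pi0[OF v]] by simp
  ultimately have r: "Min C = rep g (Min C)" by simp
  then show 1: "Min C \<in> rep g ` verts g" using v by blast
  then show 2: "Min (C \<inter> rep g ` verts g) = Min C"
    using fin m by (intro Min_eqI) auto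
  show "comp_of G (Min (C \<inter> rep g ` verts g)) = C"
    unfolding 2 by (rule comp_of_eq[OF G C m])
qed

lemma external_scontract_graph:
  assumes s: "subgr g G"
  shows "external (scontract_graph G (g, j)) = external G"
  using scontract_graph_sel[OF subgrD(1)[OF s], where G = G and j = j] subgr_sig_fixed[OF s] subgrD(4)[OF s]
  by (auto simp: external_def)

text \<open>The set \<open>W\<close> is pulled back along \<open>rep g\<close>. Edges inside
  \<open>g\<close> stay in the preimage, so the edge of \<open>e\<close> is again the only one that
  might leave it.\<close>

lemma bridgeless_scontract_graph:
  assumes s: "subgr g G" and B: "bridgeless G"
  shows "bridgeless (scontract_graph G (g, j))"
  unfolding bridgeless_def
proof (intro ballI allI impI)
  note g = subgrD(1)[OF s] and G = subgrD(2)[OF s]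
  let ?Q = "scontract_graph G (g, j)"
  note sel = scontract_graph_sel[OF g, where G = G and j = j]
  fix e W
  assume e: "e \<in> hedges ?Q" "sig ?Q e \<noteq> e" and W: "W \<subseteq> verts ?Q"
    "\<forall>f\<in>hedges ?Q. f \<noteq> e \<longrightarrow> f \<noteq> sig ?Q e \<longrightarrow> bd ?Q f \<in> W \<longrightarrow> bd ?Q (sig ?Q f) \<in> W" "bd ?Q e \<in> W"
  have e': "e \<in> external g" "sig G e \<noteq> e" "e \<in> hedges G" using e sel external_subgr(1)[OF s] by auto
  have q: "sig ?Q f = sig G f" "bd ?Q f = rep g (bd G f)" "bd ?Q (sig ?Q f) = rep g (bd G (sig G f))"
    if "f \<in> external g" for f
    using that sel external_subgr(2)[OF s that] subgrD(5)[OF s] by auto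
  have bv: "bd G f \<in> verts G \<and> bd G (sig G f) \<in> verts G" if "f \<in> hedges G" for f
    using is_graphD(3,5)[OF G] that by blast
  have "bd G (sig G e) \<in> {v \<in> verts G. rep g v \<in> W}"
  proof (rule bridgelessD[OF B e'(3,2)])
    show "bd G e \<in> {v \<in> verts G. rep g v \<in> W}" using W(3) q[OF e'(1)] bv[OF e'(3)] by simp
    fix f assume f: "f \<in> hedges G" "f \<noteq> e" "f \<noteq> sig G e" "bd G f \<in> {v \<in> verts G. rep g v \<in> W}"
    show "bd G (sig G f) \<in> {v \<in> verts G. rep g v \<in> W}"
    proof (cases "f \<in> external g")
      case True
      then show ?thesis using W(2) f q[OF True] q[OF e'(1)] bv[OF f(1)] sel(2) by auto
    next
      case False
      then show ?thesis using bd_sig_internal[OF s f(1) False] f(4) bv[OF f(1)] subgrD(5)[OF s] by simp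
    qed
  qed auto
  then show "bd ?Q (sig ?Q e) \<in> W" using q[OF e'(1)] by simp
qed

text \<open>An edge of \<open>g\<close> is no bridge in \<open>g\<close>, hence none in
  \<open>G\<close>. For any other edge, \<open>U\<close> is closed in \<open>g\<close>, and
  bridgelessness of the contraction applies to the labels in \<open>U\<close>. This makes the
  intermediate graph of \<open>scontract_surj\<close> locally 1PI.\<close>

lemma bridgeless_lift:
  assumes s: "subgr g G" and B: "bridgeless g" and BQ: "bridgeless (scontract_graph G (g, j))"
  shows "bridgeless G"
  unfolding bridgeless_def
proof (intro ballI allI impI)
  note g = subgrD(1)[OF s] and G = subgrD(2)[OF s]
  let ?Q = "scontract_graph G (g, j)"
  note sel = scontract_graph_sel[OF g, where G = G and j = j]
  fix e U
  assume e: "e \<in> hedges G" "sig G e \<noteq> e" and U: "U \<subseteq> verts G"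
    "\<forall>f\<in>hedges G. f \<noteq> e \<longrightarrow> f \<noteq> sig G e \<longrightarrow> bd G f \<in> U \<longrightarrow> bd G (sig G f) \<in> U" "bd G e \<in> U"
  show "bd G (sig G e) \<in> U"
  proof (cases "e \<in> external g")
    case False
    then have sg: "sig g e = sig G e" using external_subgr(3)[OF s e(1)] by blast
    have "bd g (sig g e) \<in> U"
    proof (rule bridgelessD[OF B])
      fix f assume f: "f \<in> hedges g" "f \<noteq> e" "f \<noteq> sig g e" "bd g f \<in> U"
      then show "bd g (sig g f) \<in> U"
        using U(2) subgrD[OF s] sg by (metis)
    qed (use e sg U subgrD[OF s] in auto)
    then show ?thesis using sg subgrD(5)[OF s] by simp
  next
    case True
    have q: "sig ?Q f = sig G f" "bd ?Q f = rep g (bd G f)" "bd ?Q (sig ?Q f) = rep g (bd G (sig G f))"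
      if "f \<in> external g" for f
      using that sel external_subgr(2)[OF s that] subgrD(5)[OF s] by auto
    have sU: "saturated g U"
      unfolding saturated_def
    proof (intro conjI ballI impI)
      fix f assume f: "f \<in> hedges g" "bd g f \<in> U"
      show "bd g (sig g f) \<in> U"
      proof (cases "f \<in> external g")
        case True then show ?thesis using f by (simp add: external_def)
      next
        case False
        then have "f \<noteq> e" "f \<noteq> sig G e" using \<open>e \<in> external g\<close> external_subgr(2)[OF s] by auto
        then show ?thesis using U(2) f external_subgr(3)[OF s _ False] subgrD(4,5)[OF s] by auto
      qed
    qed (use U subgrD(3)[OF s] in simp)
    have mem: "rep g (bd G f) \<in> U \<longleftrightarrow> bd G f \<in> U" if "f \<in> hedges G" for f
      using rep_in_saturated_iff[OF g sU] is_graphD(5)[OF G that] subgrD(3)[OF s] by simp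
    have sh: "sig G f \<in> hedges G" if "f \<in> hedges G" for f using is_graphD(3)[OF G that] .
    have inr: "rep g (bd G f) \<in> rep g ` verts g" if "f \<in> hedges G" for f
      using is_graphD(5)[OF G that] subgrD(3)[OF s] by simp
    have "bd ?Q (sig ?Q e) \<in> U \<inter> rep g ` verts g"
    proof (rule bridgelessD[OF BQ])
      show "bd ?Q e \<in> U \<inter> rep g ` verts g" using q[OF True] mem[OF e(1)] inr[OF e(1)] U(3) by simp
      fix f assume f: "f \<in> hedges ?Q" "f \<noteq> e" "f \<noteq> sig ?Q e" "bd ?Q f \<in> U \<inter> rep g ` verts g"
      then have f': "f \<in> external g" "f \<in> hedges G" using sel(2) external_subgr(1)[OF s] by auto
      then have "bd G (sig G f) \<in> U" using U(2) f q[OF f'(1)] q[OF True] mem[OF f'(2)] by auto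
      then show "bd ?Q (sig ?Q f) \<in> U \<inter> rep g ` verts g"
        using q[OF f'(1)] mem[OF sh[OF f'(2)]] inr[OF sh[OF f'(2)]] by simp
    qed (use True e q sel in auto)
    then show ?thesis using q[OF True] mem[OF sh[OF e(1)]] by simp
  qed
qed

lemma bridgeless_component:
  assumes G: "is_graph G" and U: "saturated G U" and B: "bridgeless G"
  shows "bridgeless (component G U)"
  unfolding bridgeless_def
proof (intro ballI allI impI)
  let ?H = "component G U"
  fix e W
  assume e: "e \<in> hedges ?H" "sig ?H e \<noteq> e" and W: "W \<subseteq> verts ?H"
    "\<forall>f\<in>hedges ?H. f \<noteq> e \<longrightarrow> f \<noteq> sig ?H e \<longrightarrow> bd ?H f \<in> W \<longrightarrow> bd ?H (sig ?H f) \<in> W" "bd ?H e \<in> W"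
  have q: "bd ?H (sig ?H f) = bd G (sig G f)" if "f \<in> hedges G" "bd G f \<in> U" for f
    using that saturatedD[OF U that] is_graphD(3)[OF G] by simp
  have "bd G (sig G e) \<in> W"
  proof (rule bridgelessD[OF B])
    fix f assume f: "f \<in> hedges G" "f \<noteq> e" "f \<noteq> sig G e" "bd G f \<in> W"
    then have "bd G f \<in> U" using W(1) by auto
    with f show "bd G (sig G f) \<in> W" using W(2) e q[of f] by auto
  qed (use e W saturated_subset[OF U] in auto)
  then show "bd ?H (sig ?H e) \<in> W" using q e by simp
qed

lemma bridgeless_from_components:
  assumes G: "is_graph G" and U: "saturated G U" and B: "bridgeless (component G U)"
    and B': "bridgeless (component G (verts G - U))"
  shows "bridgeless G"
  unfolding bridgeless_def
proof (intro ballI allI impI)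
  fix e W
  assume e: "e \<in> hedges G" "sig G e \<noteq> e" and W: "W \<subseteq> verts G"
    "\<forall>f\<in>hedges G. f \<noteq> e \<longrightarrow> f \<noteq> sig G e \<longrightarrow> bd G f \<in> W \<longrightarrow> bd G (sig G f) \<in> W" "bd G e \<in> W"
  obtain V where V: "saturated G V" "bridgeless (component G V)" "bd G e \<in> V"
    using U B B' saturated_Diff[OF G saturated_verts[OF G] U] is_graphD(5)[OF G e(1)] by blast
  let ?H = "component G V"
  have q: "bd ?H (sig ?H f) = bd G (sig G f)" "bd G (sig G f) \<in> V" if "f \<in> hedges G" "bd G f \<in> V" for f
    using that saturatedD[OF V(1) that] is_graphD(3)[OF G] by auto
  have "bd ?H (sig ?H e) \<in> W \<inter> V"
    by (rule bridgelessD[OF V(2)]) (use e W V(3) q in auto)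
  then show "bd G (sig G e) \<in> W" using q[OF e(1) V(3)] by simp
qed

text \<open>For a component \<open>C\<close> this is the type of its residue
  (\<open>res_type_component\<close>), counted in \<open>G\<close> itself so that no residue graph
  has to be formed.\<close>

definition ext_type :: "'t fgraph \<Rightarrow> nat set \<Rightarrow> 't \<Rightarrow> nat" where
  "ext_type G C = (\<lambda>x. card {e \<in> external G. bd G e \<in> C \<and> htype G e = x})"

lemma res_type_component:
  assumes G: "is_graph G" and C: "C \<in> pi0 G"
  shows "res_type (component G C) = ext_type G C"
proof -
  note sC = pi0_saturated[OF G C]
  let ?H = "component G C"
  have H: "is_graph ?H" by (rule is_graph_component[OF G sC])
  have p: "pi0 ?H = {C}" by (rule pi0_component_self[OF G C])
  have c: "comp_of ?H v = C" if "v \<in> C" for v by (rule comp_of_eq[OF H _ that]) (simp add: p)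
  have "the_elem (verts (residue ?H)) = Min C" by (simp add: residue_def contract_def Let_def p)
  then show ?thesis
    unfolding res_type_def vtype_def ext_type_def star_def
    by (intro ext arg_cong[where f = card])
      (auto simp: residue_def contract_def Let_def c external_def)
qed

lemma vtype_scontract_graph:
  assumes s: "subgr g G" and v: "v \<in> rep g ` verts g"
  shows "vtype (scontract_graph G (g, j)) v = ext_type g (comp_of g v)"
proof -
  note g = subgrD(1)[OF s]
  note sel = scontract_graph_sel[OF g, where G = G and j = j]
  obtain w where w: "w \<in> verts g" "v = rep g w" using v by blast
  have v': "v \<in> verts g" "rep g v = v" using rep_in[OF g w(1)] w by auto
  have "bd (scontract_graph G (g, j)) e = v \<longleftrightarrow> bd g e \<in> comp_of g v" if "e \<in> external g" for e
    using rep_eq_iff[OF g, of "bd g e" v] v' is_graphD(5)[OF g, of e] that sel(4) by (auto simp: external_def)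
  moreover have "htype G = htype g" using subgrD(6)[OF s] by simp
  ultimately show ?thesis
    unfolding vtype_def ext_type_def star_def
    by (intro ext arg_cong[where f = card]) (auto simp: sel(2,5))
qed

lemma ext_type_scontract_graph:
  assumes s: "subgr g G" and C: "C \<in> pi0 G"
  shows "ext_type (scontract_graph G (g, j)) (C \<inter> rep g ` verts g) = ext_type G C"
proof -
  note g = subgrD(1)[OF s] and G = subgrD(2)[OF s]
  note sel = scontract_graph_sel[OF g, where G = G and j = j]
  have "e \<in> external g" if "e \<in> external G" for e
    using that subgr_sig_fixed[OF s] subgrD(4)[OF s] by (auto simp: external_def)
  moreover have "bd (scontract_graph G (g, j)) e \<in> C \<inter> rep g ` verts g \<longleftrightarrow> bd G e \<in> C"
    if "e \<in> external g" for e
  proof -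
    have "bd g e \<in> verts g" using that is_graphD(5)[OF g] by (simp add: external_def)
    then show ?thesis
      using rep_in_saturated_iff[OF g saturated_subgr[OF s pi0_saturated[OF G C]]] subgrD(5)[OF s] sel(4)[OF that]
      by auto
  qed
  ultimately show ?thesis
    unfolding ext_type_def external_scontract_graph[OF s]
    by (intro ext arg_cong[where f = card]) (auto simp: sel(5) simp del: Int_iff)
qed

section \<open>Function spaces\<close>

lemma Ck_on_imp_continuous_on: "Ck_on n W f \<Longrightarrow> continuous_on W f"
  by (cases n) auto

lemma Ck_on_SucD: "Ck_on (Suc n) W f \<Longrightarrow> Ck_on n W f"
proof (induction n arbitrary: f)
  case (Suc n)
  then show ?case unfolding Ck_on.simps(2)[of "Suc n"] Ck_on.simps(2)[of n] by blast
qed simp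

lemma Ck_on_SucE:
  assumes "Ck_on (Suc n) W f" "w \<in> W"
  obtains f' where "\<And>p. p \<in> W \<Longrightarrow> ((\<lambda>s. f (\<lambda>e. p e + s *\<^sub>R w e)) has_vector_derivative f' p) (at 0)"
    "Ck_on n W f'"
  using assms unfolding Ck_on.simps by blast

lemma Ck_on_const: "Ck_on n W (\<lambda>p. c)"
  by (induction n arbitrary: c) (auto intro!: exI[of _ "\<lambda>_. 0"])

lemma Ck_on_add:
  assumes "Ck_on n W f" "Ck_on n W g"
  shows "Ck_on n W (\<lambda>p. f p + g p)"
  using assms
proof (induction n arbitrary: f g)
  case (Suc n)
  show ?case
    unfolding Ck_on.simps
  proof (intro conjI ballI)
    show "continuous_on W (\<lambda>p. f p + g p)" using Suc.prems by (auto intro: continuous_intros)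
    fix w assume w: "w \<in> W"
    obtain f' where f': "\<And>p. p \<in> W \<Longrightarrow> ((\<lambda>s. f (\<lambda>e. p e + s *\<^sub>R w e)) has_vector_derivative f' p) (at 0)" "Ck_on n W f'"
      by (rule Ck_on_SucE[OF Suc.prems(1) w]) blast
    obtain g' where g': "\<And>p. p \<in> W \<Longrightarrow> ((\<lambda>s. g (\<lambda>e. p e + s *\<^sub>R w e)) has_vector_derivative g' p) (at 0)" "Ck_on n W g'"
      by (rule Ck_on_SucE[OF Suc.prems(2) w]) blast
    show "\<exists>h. (\<forall>p\<in>W. ((\<lambda>s. f (\<lambda>e. p e + s *\<^sub>R w e) + g (\<lambda>e. p e + s *\<^sub>R w e)) has_vector_derivative h p) (at 0)) \<and> Ck_on n W h"
      by (intro exI[of _ "\<lambda>p. f' p + g' p"] conjI ballI has_vector_derivative_add f' g' Suc.IH)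
  qed
qed (auto intro: continuous_intros)

lemma Ck_on_mult:
  assumes "Ck_on n W f" "Ck_on n W g"
  shows "Ck_on n W (\<lambda>p. f p * g p)"
  using assms
proof (induction n arbitrary: f g)
  case (Suc n)
  show ?case
    unfolding Ck_on.simps
  proof (intro conjI ballI)
    show "continuous_on W (\<lambda>p. f p * g p)" using Suc.prems by (auto intro: continuous_intros)
    fix w assume w: "w \<in> W"
    obtain f' where f': "\<And>p. p \<in> W \<Longrightarrow> ((\<lambda>s. f (\<lambda>e. p e + s *\<^sub>R w e)) has_vector_derivative f' p) (at 0)" "Ck_on n W f'"
      by (rule Ck_on_SucE[OF Suc.prems(1) w]) blast
    obtain g' where g': "\<And>p. p \<in> W \<Longrightarrow> ((\<lambda>s. g (\<lambda>e. p e + s *\<^sub>R w e)) has_vector_derivative g' p) (at 0)" "Ck_on n W g'"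
      by (rule Ck_on_SucE[OF Suc.prems(2) w]) blast
    have d: "((\<lambda>s. f (\<lambda>e. p e + s *\<^sub>R w e) * g (\<lambda>e. p e + s *\<^sub>R w e)) has_vector_derivative f p * g' p + f' p * g p) (at 0)"
      if "p \<in> W" for p
      using has_vector_derivative_mult[OF f'(1)[OF that] g'(1)[OF that]] by simp
    \<comment> \<open>By the product rule each summand has one factor differentiated; the other
      factor is weakened from order \<open>Suc n\<close> to order \<open>n\<close>.\<close>
    have c: "Ck_on n W (\<lambda>p. f p * g' p + f' p * g p)"
      by (intro Ck_on_add Suc.IH f' g' Ck_on_SucD[OF Suc.prems(1)] Ck_on_SucD[OF Suc.prems(2)])
    show "\<exists>h. (\<forall>p\<in>W. ((\<lambda>s. f (\<lambda>e. p e + s *\<^sub>R w e) * g (\<lambda>e. p e + s *\<^sub>R w e)) has_vector_derivative h p) (at 0)) \<and> Ck_on n W h"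
      by (intro exI[of _ "\<lambda>p. f p * g' p + f' p * g p"] conjI ballI d c)
  qed
qed (auto intro: continuous_intros)

text \<open>Restriction of momenta to some half-edges (\<open>h = id\<close>), the inclusion of
  momentum spaces (\<open>E = UNIV\<close>, \<open>h = id\<close>) and transport along isomorphisms
  all have this form, so \<open>V_space_reindex\<close> serves for each of them.\<close>

definition reindex :: "nat set \<Rightarrow> (nat \<Rightarrow> nat) \<Rightarrow> 'd::finite mom \<Rightarrow> 'd mom" where
  "reindex E h p = (\<lambda>e. if e \<in> E then p (h e) else 0)"

lemma mom_restrict_eq_reindex: "mom_restrict E = reindex E id"
  by (simp add: mom_restrict_def reindex_def fun_eq_iff)

lemma continuous_on_reindex: "continuous_on (W :: 'd::finite mom set) (reindex E h)"
  unfolding reindex_def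
proof (rule continuous_on_coordinatewise_then_product)
  show "continuous_on W (\<lambda>p. if e \<in> E then p (h e) else (0::real^'d))" for e
    by (cases "e \<in> E")
      (auto intro!: continuous_on_product_coordinates[THEN continuous_on_subset])
qed

lemma reindex_line: "reindex E h (\<lambda>e. p e + s *\<^sub>R w e) = (\<lambda>e. reindex E h p e + s *\<^sub>R reindex E h w e)"
  by (auto simp: reindex_def)

text \<open>\<open>reindex E h\<close> is linear, so the derivative of the composite along
  \<open>w\<close> is the derivative along the image of \<open>w\<close>, composed with
  \<open>reindex E h\<close>.\<close>

lemma Ck_on_reindex:
  assumes "Ck_on n W' f" "reindex E h ` W \<subseteq> W'"
  shows "Ck_on n W (\<lambda>p. f (reindex E h p))"
  using assms(1)
proof (induction n arbitrary: f)
  have cont: "continuous_on W (\<lambda>p. f (reindex E h p))" if "continuous_on W' f" for f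
    by (rule continuous_on_compose2[OF that continuous_on_reindex assms(2)])
  {
    case 0 then show ?case using cont by simp
  next
    case (Suc n)
    show ?case
      unfolding Ck_on.simps
    proof (intro conjI ballI)
      show "continuous_on W (\<lambda>p. f (reindex E h p))" using cont Ck_on_imp_continuous_on[OF Suc.prems] by blast
      fix w assume "w \<in> W"
      then have "reindex E h w \<in> W'" using assms(2) by blast
      then obtain f' where f': "\<And>p. p \<in> W' \<Longrightarrow>
          ((\<lambda>s. f (\<lambda>e. p e + s *\<^sub>R reindex E h w e)) has_vector_derivative f' p) (at 0)" "Ck_on n W' f'"
        by (rule Ck_on_SucE[OF Suc.prems]) blast
      show "\<exists>f'. (\<forall>p\<in>W. ((\<lambda>s. f (reindex E h (\<lambda>e. p e + s *\<^sub>R w e))) has_vector_derivative f' p) (at 0)) \<and> Ck_on n W f'"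
        unfolding reindex_line using f' assms(2) Suc.IH[OF f'(2)]
        by (intro exI[of _ "\<lambda>p. f' (reindex E h p)"]) auto
    qed
  }
qed

lemma smooth_on_const: "smooth_on W (\<lambda>p. c)"
  by (simp add: smooth_on_def Ck_on_const)

lemma smooth_on_mult: "smooth_on W f \<Longrightarrow> smooth_on W g \<Longrightarrow> smooth_on W (\<lambda>p. f p * g p)"
  by (simp add: smooth_on_def Ck_on_mult)

lemma smooth_on_prod: "(\<And>i. i \<in> I \<Longrightarrow> smooth_on W (f i)) \<Longrightarrow> smooth_on W (\<lambda>p. \<Prod>i\<in>I. f i p)"
  by (induction I rule: infinite_finite_induct) (auto simp: smooth_on_const smooth_on_mult)

lemma smooth_on_reindex: "smooth_on W' f \<Longrightarrow> reindex E h ` W \<subseteq> W' \<Longrightarrow> smooth_on W (\<lambda>p. f (reindex E h p))"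
  unfolding smooth_on_def using Ck_on_reindex by blast

subsection \<open>Momentum spaces\<close>

lemma momentum_spaceD:
  assumes "p \<in> momentum_space G"
  shows "e \<notin> hedges G \<Longrightarrow> p e = 0" "v \<in> verts G \<Longrightarrow> (\<Sum>e\<in>star G v. p e) = 0"
    "e \<in> hedges G \<Longrightarrow> sig G e \<noteq> e \<Longrightarrow> p e + p (sig G e) = 0"
  using assms by (auto simp: momentum_space_def)

lemma momentum_space_subgr:
  assumes "subgr g G"
  shows "momentum_space G \<subseteq> (momentum_space g :: 'd::finite mom set)"
proof
  fix p :: "'d mom" assume p: "p \<in> momentum_space G"
  have "star g v = star G v" for v using subgrD[OF assms] by (simp add: star_def)
  moreover have "p e + p (sig g e) = 0" if "e \<in> hedges g" "sig g e \<noteq> e" for e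
    using that subgrD(4)[OF assms] subgrD(8)[OF assms, of e] momentum_spaceD(3)[OF p, of e] by metis
  ultimately show "p \<in> momentum_space g"
    using p subgrD[OF assms] by (simp add: momentum_space_def)
qed

lemma mom_restrict_mom_restrict: "mom_restrict E (mom_restrict F p) = mom_restrict (E \<inter> F) p"
  by (auto simp: mom_restrict_def)

lemma mom_restrict_hedges: "p \<in> momentum_space G \<Longrightarrow> hedges G \<subseteq> E \<Longrightarrow> mom_restrict E p = p"
  by (auto simp: mom_restrict_def fun_eq_iff momentum_space_def)

lemma momentum_space_component:
  assumes G: "is_graph G" and U: "saturated G U" and p: "p \<in> momentum_space G"
  shows "mom_restrict (hedges (component G U)) p \<in> momentum_space (component G U)"
  unfolding momentum_space_def
proof (intro CollectI conjI allI ballI impI)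
  let ?H = "component G U"
  fix v assume v: "v \<in> verts ?H"
  have "star ?H v = star G v" using v by (auto simp: star_def)
  moreover have "(\<Sum>e\<in>star G v. mom_restrict (hedges ?H) p e) = (\<Sum>e\<in>star G v. p e)"
    by (rule sum.cong) (use v in \<open>auto simp: star_def mom_restrict_def\<close>)
  ultimately show "(\<Sum>e\<in>star ?H v. mom_restrict (hedges ?H) p e) = 0"
    using momentum_spaceD(2)[OF p, of v] v saturated_subset[OF U] by auto
next
  let ?H = "component G U"
  fix e assume e: "e \<in> hedges ?H" "sig ?H e \<noteq> e"
  then have "sig G e \<in> hedges ?H" using saturatedD[OF U, of e] is_graphD(3)[OF G, of e] by auto
  then show "mom_restrict (hedges ?H) p e + mom_restrict (hedges ?H) p (sig ?H e) = 0"
    using e momentum_spaceD(3)[OF p, of e] by (auto simp: mom_restrict_def)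
qed (auto simp: mom_restrict_def)

lemma momentum_space_component_subset:
  assumes G: "is_graph G" and U: "saturated G U"
  shows "momentum_space (component G U) \<subseteq> (momentum_space G :: 'd::finite mom set)"
proof
  let ?H = "component G U"
  fix p :: "'d mom" assume p: "p \<in> momentum_space ?H"
  show "p \<in> momentum_space G"
    unfolding momentum_space_def
  proof (intro CollectI conjI allI ballI impI)
    fix e assume "e \<notin> hedges G" then show "p e = 0" using momentum_spaceD(1)[OF p] by simp
  next
    fix v assume v: "v \<in> verts G"
    show "(\<Sum>e\<in>star G v. p e) = 0"
    proof (cases "v \<in> U")
      case True
      then have "star ?H v = star G v" by (auto simp: star_def)
      then show ?thesis using momentum_spaceD(2)[OF p, of v] True by simp
    next
      case False
      then show ?thesis using momentum_spaceD(1)[OF p] by (intro sum.neutral) (auto simp: star_def)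
    qed
  next
    fix e assume e: "e \<in> hedges G" "sig G e \<noteq> e"
    show "p e + p (sig G e) = 0"
    proof (cases "bd G e \<in> U")
      case True
      then show ?thesis using e momentum_spaceD(3)[OF p, of e] by simp
    next
      case False
      then have "bd G (sig G e) \<notin> U" using saturated_iff[OF G U e(1)] by simp
      with False show ?thesis using momentum_spaceD(1)[OF p] by simp
    qed
  qed
qed

lemma sum_momentum_vertices:
  assumes G: "is_graph G" and p: "p \<in> momentum_space G" and C: "C \<subseteq> verts G"
  shows "(\<Sum>e\<in>{e\<in>hedges G. bd G e \<in> C}. p e) = 0"
proof -
  have fC: "finite C" using C is_graphD(1)[OF G] by (rule finite_subset)
  have "{e\<in>hedges G. bd G e \<in> C} = (\<Union>v\<in>C. star G v)" by (auto simp: star_def)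
  also have "sum p \<dots> = (\<Sum>v\<in>C. sum p (star G v))"
    by (rule sum.UNION_disjoint) (use fC is_graphD(2)[OF G] in \<open>auto simp: star_def\<close>)
  also have "\<dots> = 0" using momentum_spaceD(2)[OF p] C by (intro sum.neutral) blast
  finally show ?thesis .
qed

text \<open>Conservation at a contracted vertex is the sum of the conservation laws over its
  component in \<open>g\<close>: the two halves of each internal edge cancel, and the external
  half-edges remain.\<close>

lemma momentum_space_scontract_graph:
  assumes s: "subgr g G" and p: "p \<in> momentum_space G"
  shows "mom_restrict (external g) p \<in> momentum_space (scontract_graph G (g, j))"
  unfolding momentum_space_def
proof (intro CollectI conjI allI ballI impI)
  note g = subgrD(1)[OF s] and G = subgrD(2)[OF s]
  let ?Q = "scontract_graph G (g, j)"
  note sel = scontract_graph_sel[OF g, where G = G and j = j]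
  note pg = subsetD[OF momentum_space_subgr[OF s] p]
  fix v assume "v \<in> verts ?Q"
  then have v: "v \<in> verts g" "rep g v = v" using rep_in[OF g] sel(1) by auto
  define C where "C = comp_of g v"
  have C: "C \<in> pi0 g" "C \<subseteq> verts g"
    using comp_of_in_pi0[OF v(1)] pi0_subset[OF g] by (auto simp: C_def)
  have "bd ?Q e = v \<longleftrightarrow> bd g e \<in> C" if "e \<in> external g" for e
    using rep_eq_iff[OF g, of "bd g e" v] v is_graphD(5)[OF g, of e] that sel(4) by (auto simp: external_def C_def)
  then have st: "star ?Q v = {e \<in> external g. bd g e \<in> C}"
    by (auto simp: star_def sel(2))
  let ?I = "{e \<in> hedges g. sig g e \<noteq> e \<and> bd g e \<in> C}"
  have "sum p ?I = (\<Sum>e\<in>?I. p (sig g e))"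
    using saturated_iff[OF g pi0_saturated[OF g C(1)]] is_graphD(3,4)[OF g]
    by (intro sum.reindex_bij_witness[of _ "sig g" "sig g"]) auto
  also have "\<dots> = (\<Sum>e\<in>?I. - p e)"
    using momentum_spaceD(3)[OF pg] add.inverse_unique by (intro sum.cong) force+
  finally have "sum p ?I = - sum p ?I" by (simp add: sum_negf)
  then have i0: "sum p ?I = 0"
  proof -
    assume S: "sum p ?I = - sum p ?I"
    have "2 *\<^sub>R sum p ?I = sum p ?I + sum p ?I" by (rule scaleR_2)
    also have "\<dots> = - sum p ?I + sum p ?I" by (rule arg_cong2[where f = "(+)", OF S refl])
    finally show "sum p ?I = 0" by simp
  qed
  have "sum p {e \<in> hedges g. bd g e \<in> C} = sum p {e \<in> external g. bd g e \<in> C} + sum p ?I"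
  proof -
    have eq: "{e \<in> hedges g. bd g e \<in> C} = {e \<in> external g. bd g e \<in> C} \<union> ?I" by (auto simp: external_def)
    have dis: "{e \<in> external g. bd g e \<in> C} \<inter> ?I = {}" by (auto simp: external_def)
    have fin: "finite {e \<in> external g. bd g e \<in> C}" "finite ?I"
      using is_graphD(2)[OF g] by (auto simp: external_def)
    show ?thesis unfolding eq by (rule sum.union_disjoint[OF fin dis])
  qed
  then have "sum p {e \<in> external g. bd g e \<in> C} = 0"
    using sum_momentum_vertices[OF g pg C(2)] i0 by simp
  then show "(\<Sum>e\<in>star ?Q v. mom_restrict (external g) p e) = 0"
    unfolding st by (simp add: mom_restrict_def)
next
  note g = subgrD(1)[OF s] and G = subgrD(2)[OF s]
  let ?Q = "scontract_graph G (g, j)"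
  note sel = scontract_graph_sel[OF g, where G = G and j = j]
  fix e
  assume e: "e \<in> hedges ?Q" "sig ?Q e \<noteq> e"
  then show "mom_restrict (external g) p e + mom_restrict (external g) p (sig ?Q e) = 0"
    using sel external_subgr(1,2)[OF s, of e] momentum_spaceD(3)[OF p, of e] by (simp add: mom_restrict_def)
qed (use scontract_graph_sel(2)[OF subgrD(1)[OF s]] in \<open>auto simp: mom_restrict_def\<close>)

subsection \<open>The spaces V\<close>

interpretation cfun: module "\<lambda>(c::complex) (f :: 'd::finite mom \<Rightarrow> complex) p. c * f p"
  by unfold_locales (auto simp: fun_eq_iff algebra_simps)

definition comp_prod :: "'t fgraph \<Rightarrow> (nat set \<Rightarrow> 'd::finite mom \<Rightarrow> complex) \<Rightarrow> 'd mom \<Rightarrow> complex" where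
  "comp_prod G v = (\<lambda>p. if p \<in> momentum_space G
     then \<Prod>C\<in>pi0 G. v C (mom_restrict (hedges (component G C)) p) else 0)"

text \<open>The elementary tensors of the tensor product over the components.\<close>

definition V_gen :: "'t fgraph \<Rightarrow> ('d::finite mom \<Rightarrow> complex) set" where
  "V_gen G = {comp_prod G v | v. \<forall>C\<in>pi0 G. smooth_on (momentum_space (component G C)) (v C)}"

lemma V_space_eq_span: "V_space G = cfun.span (V_gen G)"
  by (simp add: V_space_def V_gen_def comp_prod_def)

lemma V_gen_mult: "f \<in> V_gen G \<Longrightarrow> f' \<in> V_gen G \<Longrightarrow> f * f' \<in> V_gen G"
proof -
  assume "f \<in> V_gen G" "f' \<in> V_gen G"
  then obtain v v' where v: "f = comp_prod G v" "f' = comp_prod G v'"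
    "\<forall>C\<in>pi0 G. smooth_on (momentum_space (component G C)) (v C)"
    "\<forall>C\<in>pi0 G. smooth_on (momentum_space (component G C)) (v' C)" by (auto simp: V_gen_def)
  have "f * f' = comp_prod G (\<lambda>C p. v C p * v' C p)"
    by (simp add: v fun_eq_iff comp_prod_def prod.distrib)
  then show ?thesis using v(3,4) smooth_on_mult unfolding V_gen_def by blast
qed

lemma V_space_0: "0 \<in> V_space G"
  and V_space_add: "f \<in> V_space G \<Longrightarrow> f' \<in> V_space G \<Longrightarrow> f + f' \<in> V_space G"
  and V_space_uminus: "f \<in> V_space G \<Longrightarrow> - f \<in> V_space G"
  and V_space_scale: "f \<in> V_space G \<Longrightarrow> (\<lambda>p. c * f p) \<in> V_space G"
  unfolding V_space_eq_span
  by (rule cfun.span_zero, erule (1) cfun.span_add, erule cfun.span_neg, erule cfun.span_scale)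

text \<open>Bilinearity reduces the claim to elementary tensors, one argument at a time.\<close>

lemma V_space_mult:
  assumes "f \<in> V_space G" "f' \<in> V_space G"
  shows "f * f' \<in> V_space G"
proof -
  have 1: "f * f' \<in> V_space G" if "f \<in> V_gen G" "f' \<in> V_space G" for f f'
    using that(2) unfolding V_space_eq_span
  proof (induction f' rule: cfun.span_induct_alt)
    case base show ?case unfolding mult_zero_right mult_zero_left by (rule cfun.span_zero)
  next
    case (step c x y)
    have "f * ((\<lambda>p. c * x p) + y) = (\<lambda>p. c * (f * x) p) + f * y" by (simp add: fun_eq_iff algebra_simps)
    show ?case unfolding \<open>f * _ = _\<close>
      by (rule cfun.span_add[OF cfun.span_scale[OF cfun.span_base[OF V_gen_mult[OF that(1) step(1)]]] step(2)])
  qed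
  show ?thesis using assms(1) unfolding V_space_eq_span
  proof (induction f rule: cfun.span_induct_alt)
    case base show ?case unfolding mult_zero_right mult_zero_left by (rule cfun.span_zero)
  next
    case (step c x y)
    have "((\<lambda>p. c * x p) + y) * f' = (\<lambda>p. c * (x * f') p) + y * f'" by (simp add: fun_eq_iff algebra_simps)
    show ?case unfolding \<open>_ * f' = _\<close>
      by (rule cfun.span_add[OF cfun.span_scale[OF 1[OF step(1) assms(2), unfolded V_space_eq_span]] step(2)])
  qed
qed

lemma V_space_outside: "f \<in> V_space G \<Longrightarrow> p \<notin> momentum_space G \<Longrightarrow> f p = 0"
  unfolding V_space_eq_span
  by (induction f rule: cfun.span_induct_alt) (auto simp: V_gen_def comp_prod_def)

lemma V_space_one: "(\<lambda>p. if p \<in> momentum_space G then 1 else 0) \<in> V_space G" (is "?one \<in> _")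
proof -
  have "?one = comp_prod G (\<lambda>_ _. 1)"
    by (simp add: comp_prod_def fun_eq_iff)
  moreover have "comp_prod G (\<lambda>_ _. 1) \<in> V_gen G" unfolding V_gen_def using smooth_on_const by blast
  ultimately show ?thesis unfolding V_space_eq_span using cfun.span_base by metis
qed

text \<open>A component \<open>D\<close> of \<open>Q\<close> reads momenta only from the component
  \<open>c D\<close> of \<open>G\<close>. Collecting the factors of an elementary tensor according
  to \<open>c\<close> therefore gives an elementary tensor over the components of \<open>G\<close>;
  several \<open>D\<close>, or none, may go to the same component.\<close>

lemma V_space_reindex:
  assumes G: "is_graph G" and Q: "is_graph Q"
    and L: "\<And>p::'d::finite mom. p \<in> momentum_space G \<Longrightarrow> reindex E h p \<in> momentum_space Q"
    and c: "\<And>D. D \<in> pi0 Q \<Longrightarrow> c D \<in> pi0 G"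
    and ch: "\<And>D e. D \<in> pi0 Q \<Longrightarrow> e \<in> hedges Q \<Longrightarrow> bd Q e \<in> D \<Longrightarrow> e \<in> E \<Longrightarrow> h e \<in> hedges G \<and> bd G (h e) \<in> c D"
    and b: "b \<in> V_space Q"
  shows "(\<lambda>p::'d mom. if p \<in> momentum_space G then b (reindex E h p) else 0) \<in> V_space G"
    (is "?P b \<in> _")
  using b unfolding V_space_eq_span[of Q]
proof (induction b rule: cfun.span_induct_alt)
  case base
  have "?P 0 = 0" by (simp add: fun_eq_iff)
  then show ?case using V_space_0 by simp
next
  case (step k x y)
  obtain v where v: "x = comp_prod Q v" "\<And>D. D \<in> pi0 Q \<Longrightarrow> smooth_on (momentum_space (component Q D)) (v D)"
    using step(1) by (auto simp: V_gen_def)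
  define r :: "nat set \<Rightarrow> 'd mom \<Rightarrow> 'd mom" where "r D = mom_restrict (hedges (component Q D))" for D
  have r: "r D (reindex E h p) = reindex (hedges (component Q D) \<inter> E) h p" for D and p :: "'d mom"
    by (auto simp: r_def mom_restrict_def reindex_def)
  define u where "u C q = (\<Prod>D\<in>{D \<in> pi0 Q. c D = C}. v D (r D (reindex E h q)))" for C q
  have su: "smooth_on (momentum_space (component G C)) (u C)" if C: "C \<in> pi0 G" for C
    unfolding u_def
  proof (rule smooth_on_prod)
    fix D assume D: "D \<in> {D \<in> pi0 Q. c D = C}"
    have "r D (reindex E h p) \<in> momentum_space (component Q D)" if "p \<in> momentum_space (component G C)" for p :: "'d mom"
      unfolding r_def
      using D that momentum_space_component[OF Q pi0_saturated[OF Q] L]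
        momentum_space_component_subset[OF G pi0_saturated[OF G C]] by blast
    then show "smooth_on (momentum_space (component G C)) (\<lambda>p. v D (r D (reindex E h p)))"
      using D v(2)[of D] unfolding r by (intro smooth_on_reindex) auto
  qed
  have loc: "r D (reindex E h (mom_restrict (hedges (component G (c D))) p)) = r D (reindex E h p)"
    if "D \<in> pi0 Q" for D and p :: "'d mom"
    using ch[OF that] unfolding r by (auto simp: fun_eq_iff reindex_def mom_restrict_def)
  have "?P x = comp_prod G u"
  proof
    fix p
    show "?P x p = comp_prod G u p"
    proof (cases "p \<in> momentum_space G")
      case True
      have "x (reindex E h p) = (\<Prod>D\<in>pi0 Q. v D (r D (reindex E h p)))"
        using L[OF True] by (simp add: v(1) comp_prod_def r_def)
      also have "\<dots> = (\<Prod>C\<in>pi0 G. \<Prod>D\<in>{D \<in> pi0 Q. c D = C}. v D (r D (reindex E h p)))"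
        using c finite_pi0[OF G] finite_pi0[OF Q] by (intro prod.group[symmetric]) auto
      also have "\<dots> = comp_prod G u p"
        using True unfolding comp_prod_def u_def by (auto intro!: prod.cong simp: loc simp del: component_sel)
      finally show ?thesis using True by simp
    qed (simp add: comp_prod_def)
  qed
  then have Px: "?P x \<in> V_space G"
    using su unfolding V_space_eq_span by (auto intro!: cfun.span_base simp: V_gen_def)
  have eq: "?P ((\<lambda>p. k * x p) + y) = (\<lambda>p. k * ?P x p) + ?P y" by (simp add: fun_eq_iff)
  show ?case unfolding eq by (rule V_space_add[OF V_space_scale[OF Px] step(2)])
qed

lemma V_space_subgr:
  fixes b :: "'d::finite mom \<Rightarrow> complex"
  assumes s: "subgr g G" and b: "b \<in> V_space g"
  shows "(\<lambda>p. if p \<in> momentum_space G then b p else 0) \<in> V_space G"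
proof -
  note g = subgrD(1)[OF s] and G = subgrD(2)[OF s]
  have m: "momentum_space G \<subseteq> (momentum_space g :: 'd mom set)" by (rule momentum_space_subgr[OF s])
  have r: "reindex UNIV id = (\<lambda>p :: 'd mom. p)" by (simp add: reindex_def fun_eq_iff)
  define c where "c D = comp_of G (Min D)" for D
  have D: "D \<subseteq> c D \<and> c D \<in> pi0 G" if "D \<in> pi0 g" for D
  proof -
    have m: "Min D \<in> D" "Min D \<in> verts G"
      using Min_in_pi0[OF g that] pi0_subset[OF g that] subgrD(3)[OF s] by auto
    then have "c D \<in> pi0 G" "Min D \<in> c D"
      unfolding c_def using comp_of_in_pi0[OF m(2)] self_in_comp_of[OF m(2)] by auto
    then show ?thesis using pi0_minimal[OF g that saturated_subgr[OF s pi0_saturated[OF G]] m(1)] by blast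
  qed
  show ?thesis
    by (rule V_space_reindex[OF G g _ _ _ b, where E = UNIV and h = id and c = c, unfolded r])
      (use D m subgrD(4,5)[OF s] in auto)
qed

lemma V_space_scontract_graph:
  fixes b :: "'d::finite mom \<Rightarrow> complex"
  assumes s: "subgr g G" and b: "b \<in> V_space (scontract_graph G (g, j))"
  shows "(\<lambda>p. if p \<in> momentum_space G then b (mom_restrict (external g) p) else 0) \<in> V_space G"
proof -
  note g = subgrD(1)[OF s] and G = subgrD(2)[OF s]
  let ?Q = "scontract_graph G (g, j)"
  note sel = scontract_graph_sel[OF g, where G = G and j = j]
  define c where "c D = comp_of G (Min D)" for D
  have D: "c D \<in> pi0 G \<and> D = c D \<inter> rep g ` verts g" if "D \<in> pi0 ?Q" for D
    using that Min_pi0_in_rep_image(3)[OF s] unfolding pi0_scontract_graph[OF s] c_def by auto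
  have ch: "bd G e \<in> c D" if "D \<in> pi0 ?Q" "e \<in> hedges ?Q" "bd ?Q e \<in> D" for D e
  proof -
    have e: "e \<in> external g" "e \<in> hedges G" using that(2) sel(2) external_subgr(1)[OF s] by auto
    then have "rep g (bd g e) \<in> c D" using that(3) sel(4) D[OF that(1)] by auto
    then show ?thesis
      using rep_in_saturated_iff[OF g saturated_subgr[OF s pi0_saturated[OF G]]] D[OF that(1)]
        is_graphD(5)[OF G e(2)] subgrD(3,5)[OF s] by auto
  qed
  show ?thesis
    unfolding mom_restrict_eq_reindex
  proof (rule V_space_reindex[OF G is_graph_scontract_graph[OF s] _ _ _ b, where c = c])
    fix p :: "'d mom" assume "p \<in> momentum_space G"
    then show "reindex (external g) id p \<in> momentum_space ?Q"
      using momentum_space_scontract_graph[OF s] unfolding mom_restrict_eq_reindex by blast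
  next
    fix D e assume "D \<in> pi0 ?Q" "e \<in> hedges ?Q" "bd ?Q e \<in> D" "e \<in> external g"
    then show "id e \<in> hedges G \<and> bd G (id e) \<in> c D"
      using ch external_subgr(1)[OF s] by simp
  qed (rule D[THEN conjunct1])
qed

lemma V_space_component:
  fixes b :: "'d::finite mom \<Rightarrow> complex"
  assumes G: "is_graph G" and U: "saturated G U" and b: "b \<in> V_space (component G U)"
  shows "(\<lambda>p. if p \<in> momentum_space G then b (mom_restrict (hedges (component G U)) p) else 0) \<in> V_space G"
  unfolding mom_restrict_eq_reindex
proof (rule V_space_reindex[OF G is_graph_component[OF G U] _ _ _ b, where c = "\<lambda>D. D"])
  fix p :: "'d mom" assume "p \<in> momentum_space G"
  then show "reindex (hedges (component G U)) id p \<in> momentum_space (component G U)"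
    by (rule momentum_space_component[OF G U, unfolded mom_restrict_eq_reindex])
next
  fix D e assume "e \<in> hedges (component G U)" "bd (component G U) e \<in> D"
  then show "id e \<in> hedges G \<and> bd G (id e) \<in> D" by simp
qed (simp add: pi0_component[OF G U])

subsection \<open>Laurent series over the spaces V\<close>

lemma V_laurent_iff:
  fixes F :: "('t, 'd::finite) bfam fls"
  shows "F \<in> V_laurent G \<longleftrightarrow> (\<forall>n. (F $$ n) G \<in> V_space G \<and> (\<forall>G'. G' \<noteq> G \<longrightarrow> (F $$ n) G' = 0))"
proof -
  have "b \<in> in_B G ` V_space G \<longleftrightarrow> b G \<in> V_space G \<and> (\<forall>G'. G' \<noteq> G \<longrightarrow> b G' = 0)"
    for b :: "('t, 'd) bfam"
  proof
    assume r: "b G \<in> V_space G \<and> (\<forall>G'. G' \<noteq> G \<longrightarrow> b G' = 0)"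
    have "b = in_B G (b G)"
    proof
      fix G' show "b G' = in_B G (b G) G'" using r by (cases "G' = G") (simp_all add: in_B_apply)
    qed
    with r show "b \<in> in_B G ` V_space G" by blast
  qed (auto simp: in_B_apply)
  then show ?thesis by (simp add: V_laurent_def)
qed

lemma V_laurent_outside:
  assumes F: "F \<in> V_laurent G" and "\<not> (G' = G \<and> p \<in> momentum_space G)"
  shows "(F $$ n) G' p = 0"
proof (cases "G' = G")
  case True
  then show ?thesis using V_space_outside[of "(F $$ n) G" G p] assms by (simp add: V_laurent_iff)
next
  case False
  then have "(F $$ n) G' = 0" using F by (simp add: V_laurent_iff)
  then show ?thesis by simp
qed

lemma V_laurent_eqI:
  assumes F: "F \<in> V_laurent G" and F': "F' \<in> V_laurent G"
    and "\<And>p. p \<in> momentum_space G \<Longrightarrow> ev G p F = ev G p F'"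
  shows "F = F'"
proof (intro fls_eqI ext)
  fix n G' p
  show "(F $$ n) G' p = (F' $$ n) G' p"
  proof (cases "G' = G \<and> p \<in> momentum_space G")
    case True
    then have "ev G p F $$ n = ev G p F' $$ n" using assms(3) by simp
    with True show ?thesis by simp
  next
    case False
    then show ?thesis using V_laurent_outside[OF F False] V_laurent_outside[OF F' False] by simp
  qed
qed

lemma V_laurent_0: "0 \<in> V_laurent G"
  by (simp add: V_laurent_iff V_space_0)

lemma V_laurent_one: "one_V G \<in> V_laurent G"
  by (simp add: V_laurent_iff one_V_nth in_B_apply V_space_one V_space_0)

lemma V_laurent_add: "F \<in> V_laurent G \<Longrightarrow> F' \<in> V_laurent G \<Longrightarrow> F + F' \<in> V_laurent G"
  by (simp add: V_laurent_iff V_space_add)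

lemma V_laurent_uminus: "F \<in> V_laurent G \<Longrightarrow> - F \<in> V_laurent G"
  by (simp add: V_laurent_iff V_space_uminus)

lemma V_laurent_sum: "(\<And>x. x \<in> A \<Longrightarrow> f x \<in> V_laurent G) \<Longrightarrow> sum f A \<in> V_laurent G"
  by (induction A rule: infinite_finite_induct) (auto simp: V_laurent_0 V_laurent_add)

lemma V_laurent_fls_filter: "F \<in> V_laurent G \<Longrightarrow> fls_filter S F \<in> V_laurent G"
  by (simp add: V_laurent_iff V_space_0)

lemma V_laurent_mult:
  assumes "F \<in> V_laurent G" "F' \<in> V_laurent G"
  shows "F * F' \<in> V_laurent G"
proof -
  let ?B = "{b. b G \<in> V_space G \<and> (\<forall>G'. G' \<noteq> G \<longrightarrow> b G' = 0)}"
  have s: "sum f A \<in> ?B" if "\<And>x. x \<in> A \<Longrightarrow> f x \<in> ?B" for f and A :: "int set"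
    using that
  proof (induction A rule: infinite_finite_induct)
    case (insert x A)
    have "f x \<in> ?B" by (rule insert.prems) simp
    moreover have "sum f A \<in> ?B" by (rule insert.IH, rule insert.prems) simp
    ultimately
    show ?case using insert.hyps V_space_add[of "f x G" G "sum f A G"] by (simp add: plus_fun_def)
  qed (auto simp: V_space_0)
  have "(F * F') $$ n \<in> ?B" for n
    unfolding fls_times_nth(2) using assms by (intro s) (auto simp: V_laurent_iff V_space_mult)
  then show ?thesis by (simp add: V_laurent_iff)
qed

lemma V_laurent_pi_map: "subgr g G \<Longrightarrow> F \<in> V_laurent g \<Longrightarrow> pi_map g G F \<in> V_laurent G"
  by (simp add: V_laurent_iff pi_map_nth in_B_apply V_space_subgr)

lemma V_laurent_i_map:
  assumes "subgr g G" "F \<in> V_laurent (scontract_graph G (g, j))"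
  shows "i_map G (scontract_graph G (g, j)) F \<in> V_laurent G"
proof -
  have "(\<lambda>p. if p \<in> momentum_space G then (F $$ n) (scontract_graph G (g, j)) (mom_restrict (external g) p) else 0)
      \<in> V_space G" for n
    by (rule V_space_scontract_graph[OF assms(1), of _ j]) (use assms(2) in \<open>simp add: V_laurent_iff\<close>)
  then show ?thesis
    unfolding V_laurent_iff i_map_nth in_B_apply scontract_graph_sel(2)[OF subgrD(1)[OF assms(1)]] by simp
qed

lemma V_laurent_subset_A_space: "is_graph G \<Longrightarrow> F \<in> V_laurent G \<Longrightarrow> F \<in> A_space"
proof -
  assume G: "is_graph G" and F: "F \<in> V_laurent G"
  have "if is_graph H then (F $$ n) H \<in> V_space H else (F $$ n) H = 0" for n H
    using F G unfolding V_laurent_iff by (cases "H = G") (simp_all add: V_space_0)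
  then show "F \<in> A_space" unfolding A_space_def B_space_def by blast
qed

section \<open>Specified graphs\<close>

text \<open>Such a vertex is a component by itself, and there a specification is forced to equal
  \<open>vk\<close>.\<close>

definition isolated :: "'t fgraph \<Rightarrow> nat \<Rightarrow> bool" where
  "isolated G v \<longleftrightarrow> v \<in> verts G \<and> (\<forall>e\<in>hedges G. bd G e = v \<longrightarrow> sig G e = e)"

text \<open>For a component \<open>C\<close> of \<open>g\<close> this says that the cutting leaves
  \<open>C\<close> untouched, so that \<open>C\<close> is a full component of \<open>G\<close>
  (\<open>pi0_full_in\<close>).\<close>

definition full_in :: "'t fgraph \<Rightarrow> 't fgraph \<Rightarrow> nat set \<Rightarrow> bool" where
  "full_in g G C \<longleftrightarrow> (\<forall>e\<in>hedges G. bd G e \<in> C \<longrightarrow> sig g e = sig G e)"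

lemma saturated_singleton_pi0: "is_graph G \<Longrightarrow> saturated G {v} \<Longrightarrow> {v} \<in> pi0 G"
  unfolding pi0_char by auto

lemma isolated_pi0:
  assumes G: "is_graph G" and v: "isolated G v"
  shows "{v} \<in> pi0 G"
  by (rule saturated_singleton_pi0[OF G]) (use v in \<open>auto simp: isolated_def saturated_def\<close>)

lemma pi0_full_in:
  assumes "subgr g G" "C \<in> pi0 g" "full_in g G C"
  shows "C \<in> pi0 G"
  using pi0_full_component[OF assms(1,2)] assms(3) component_eq_iff[OF assms(1)] by (simp add: full_in_def)

text \<open>Divergence of the residues is read off from the refined types, whose first components
  form \<open>vtypes\<close>, and a component consisting of one vertex without internal edges is an
  isolated vertex.\<close>

lemma specified_iff:
  assumes T: "is_theory T"
  shows "(G, i) \<in> specified T \<longleftrightarrow> graph_of T G \<and> bridgeless G \<and> i \<in> extensional (pi0 G)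
    \<and> (\<forall>C\<in>pi0 G. (ext_type G C, i C) \<in> rvtypes T) \<and> (\<forall>v. isolated G v \<longrightarrow> i {v} = vk G v)"
proof (cases "is_graph G")
  case G: True
  have 1: "res_type (component G C) \<in> vtypes T" if "(ext_type G C, i C) \<in> rvtypes T" "C \<in> pi0 G" for C
    using T that res_type_component[OF G that(2)] unfolding is_theory_def by (metis fst_conv imageI)
  have 2: "{v} \<in> pi0 G \<and> internal (component G {v}) = {} \<longleftrightarrow> isolated G v" for v
    using isolated_pi0[OF G, of v] pi0_subset[OF G, of "{v}"] internal_component[OF G pi0_saturated[OF G, of "{v}"]]
    by (auto simp: isolated_def)
  show ?thesis
    unfolding specified_def superficially_divergent_def
    using 1 2 res_type_component[OF G] locally_one_PI_iff[OF G] by auto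
qed (auto simp: specified_def graph_of_def)

lemma specifiedD:
  assumes T: "is_theory T" and X: "(G, i) \<in> specified T"
  shows "graph_of T G" "is_graph G" "bridgeless G" "i \<in> extensional (pi0 G)"
    "C \<in> pi0 G \<Longrightarrow> (ext_type G C, i C) \<in> rvtypes T" "isolated G v \<Longrightarrow> i {v} = vk G v"
  using X unfolding specified_iff[OF T] by (auto simp: graph_of_def)

lemma spec_subgraph_iff:
  assumes T: "is_theory T"
  shows "spec_subgraph T (g, j) (G, i) \<longleftrightarrow> (g, j) \<in> specified T \<and> (G, i) \<in> specified T \<and> subgr g G
    \<and> (\<forall>C\<in>pi0 g. full_in g G C \<longrightarrow> j C = i C)"
proof (cases "(G, i) \<in> specified T")
  case True
  have *: "C \<in> pi0 g \<inter> pi0 G \<and> component g C = component G C \<longleftrightarrow> C \<in> pi0 g \<and> full_in g G C"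
    if "subgr g G" for C
    using component_eq_iff[OF that, of C] pi0_full_in[OF that, of C] by (auto simp: full_in_def)
  show ?thesis
    unfolding spec_subgraph_def using True * covering_subgraph_iff[OF specifiedD(2)[OF T True]] by auto
qed (simp add: spec_subgraph_def)

lemma spec_subgraphD:
  assumes T: "is_theory T" and "spec_subgraph T (g, j) (G, i)"
  shows "(g, j) \<in> specified T" "(G, i) \<in> specified T" "subgr g G"
    "C \<in> pi0 g \<Longrightarrow> full_in g G C \<Longrightarrow> j C = i C"
  using assms(2) unfolding spec_subgraph_iff[OF T] by auto

lemma spec_subgraph_subgr: "is_theory T \<Longrightarrow> spec_subgraph T Y X \<Longrightarrow> subgr (fst Y) (fst X)"
  by (cases X; cases Y) (simp add: spec_subgraph_iff)

lemma spec_subgraph_specified: "is_theory T \<Longrightarrow> spec_subgraph T Y X \<Longrightarrow> Y \<in> specified T \<and> X \<in> specified T"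
  by (cases X; cases Y) (simp add: spec_subgraph_iff)

lemma specified_is_graph: "is_theory T \<Longrightarrow> X \<in> specified T \<Longrightarrow> is_graph (fst X)"
  by (cases X) (simp add: specifiedD)

lemma vtype_subgr: "subgr g G \<Longrightarrow> vtype g = vtype G"
  by (intro ext) (simp add: vtype_def star_def subgr_def)

lemma graph_of_subgr: "subgr g G \<Longrightarrow> graph_of T g \<longleftrightarrow> graph_of T G"
  unfolding graph_of_def using vtype_subgr[of g G] by (simp add: subgr_def)

text \<open>There are finitely many cuttings, and on each of the finitely many components a
  specification takes one of the finitely many values that the theory admits for the type of the
  residue.\<close>

lemma finite_spec_subgraph:
  assumes T: "is_theory T"
  shows "finite {Y. spec_subgraph T Y X}"
proof (cases "X \<in> specified T")
  case True
  obtain G i where X: "X = (G, i)" by (cases X)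
  have G: "is_graph G" using True specifiedD(2)[OF T] X by blast
  let ?J = "\<lambda>g. PiE (pi0 g) (\<lambda>C. {k. (ext_type g C, k) \<in> rvtypes T})"
  have sub: "{Y. spec_subgraph T Y X} \<subseteq> Sigma {g. subgr g G} ?J"
  proof
    fix Y assume "Y \<in> {Y. spec_subgraph T Y X}"
    then have Y: "spec_subgraph T Y (G, i)" using X by simp
    obtain g j where gj: "Y = (g, j)" by (cases Y)
    note Y = spec_subgraphD[OF T Y[unfolded gj]]
    show "Y \<in> Sigma {g. subgr g G} ?J"
      using Y(3) specifiedD(4,5)[OF T Y(1)] unfolding gj by (auto simp: PiE_def)
  qed
  have "finite {k. (t, k) \<in> rvtypes T}" for t
  proof (cases "t \<in> vtypes T")
    case False
    have "(t, k) \<notin> rvtypes T" for k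
      using T False unfolding is_theory_def by (metis fst_conv imageI)
    then show ?thesis by simp
  qed (use T in \<open>simp add: is_theory_def\<close>)
  then have "finite (?J g)" if "subgr g G" for g
    using finite_pi0[OF subgrD(1)[OF that]] by (intro finite_PiE) auto
  then have "finite (Sigma {g. subgr g G} ?J)" using finite_subgr[OF G] by blast
  then show ?thesis using sub finite_subset by blast
next
  case False
  then have "{Y. spec_subgraph T Y X} = {}" using spec_subgraph_specified[OF T] by blast
  then show ?thesis by (metis finite.emptyI)
qed

lemma scontract_eq: "scontract (G, i) Y = (scontract_graph G Y,
    restrict (\<lambda>C. i (comp_of G (Min C))) (pi0 (scontract_graph G Y)))"
  by (simp add: scontract_def)

lemma fst_scontract: "fst (scontract X Y) = scontract_graph (fst X) Y"
  by (cases X) (simp add: scontract_eq)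

lemma snd_scontract:
  assumes s: "subgr g G" and C: "C \<in> pi0 G"
  shows "snd (scontract (G, i) (g, j)) (C \<inter> rep g ` verts g) = i C"
  using Min_pi0_in_rep_image(3)[OF s C] pi0_scontract_graph[OF s] C by (simp add: scontract_eq)

text \<open>
  An isolated vertex of the contraction comes from a full component, on which the two
  specifications agree; this is why contractions are again specified.
\<close>

lemma isolated_scontract_graph:
  assumes s: "subgr g G" and v: "isolated (scontract_graph G (g, j)) v"
  shows "comp_of g v \<in> pi0 g" "full_in g G (comp_of g v)" "comp_of g v \<inter> rep g ` verts g = {v}"
proof -
  note g = subgrD(1)[OF s] and G = subgrD(2)[OF s]
  note sel = scontract_graph_sel[OF g, where G = G and j = j]
  obtain u where u: "u \<in> verts g" "v = rep g u" using v sel(1) by (auto simp: isolated_def)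
  have vv: "v \<in> verts g" "rep g v = v" using rep_in[OF g u(1)] u by auto
  show 1: "comp_of g v \<in> pi0 g" by (rule comp_of_in_pi0[OF vv(1)])
  have in_comp: "w \<in> comp_of g v \<longleftrightarrow> rep g w = v" if "w \<in> verts g" for w
    using rep_eq_iff[OF g that vv(1)] vv(2) by simp
  show "full_in g G (comp_of g v)"
    unfolding full_in_def
  proof (intro ballI impI)
    fix e assume e: "e \<in> hedges G" "bd G e \<in> comp_of g v"
    show "sig g e = sig G e"
    proof (cases "e \<in> external g")
      case True
      have "rep g (bd g e) = v" using in_comp is_graphD(5)[OF g, of e] e subgrD(4,5)[OF s] by simp
      then have "sig G e = e" using v True sel(2,3,4) by (auto simp: isolated_def)
      then show ?thesis using True by (simp add: external_def)
    qed (use external_subgr(3)[OF s e(1)] in blast)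
  qed
  show "comp_of g v \<inter> rep g ` verts g = {v}"
  proof (intro subset_antisym subsetI)
    fix x assume x: "x \<in> comp_of g v \<inter> rep g ` verts g"
    then obtain w where w: "w \<in> verts g" "x = rep g w" by blast
    then have "rep g x = x" "x \<in> verts g" using rep_in[OF g w(1)] by auto
    then show "x \<in> {v}" using in_comp[of x] x by simp
  qed (use self_in_comp_of[OF vv(1)] u in auto)
qed

text \<open>The converse of \<open>isolated_scontract_graph\<close>. It lets the specification of an
  uncut component be read off the contraction, where it has become the \<open>vk\<close> of an
  isolated vertex.\<close>

lemma isolated_scontract_graphI:
  assumes s: "subgr g G" and C: "C \<in> pi0 g" and full: "full_in g G C"
  shows "isolated (scontract_graph G (g, j)) (Min C)" "comp_of g (Min C) = C" "C \<inter> rep g ` verts g = {Min C}"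
proof -
  note g = subgrD(1)[OF s] and G = subgrD(2)[OF s]
  note sel = scontract_graph_sel[OF g, where G = G and j = j]
  have m: "Min C \<in> C" by (rule Min_in_pi0[OF g C])
  then have mv: "Min C \<in> verts g" using pi0_subset[OF g C] by blast
  show c: "comp_of g (Min C) = C" by (rule comp_of_eq[OF g C m])
  have r: "rep g (Min C) = Min C" by (simp add: rep_def c)
  have "sig (scontract_graph G (g, j)) e = e"
    if e: "e \<in> external g" "rep g (bd g e) = Min C" for e
  proof -
    have "bd g e \<in> verts g" using e is_graphD(5)[OF g] by (simp add: external_def)
    then have "bd g e \<in> C" using rep_eq_iff[OF g _ mv] e(2) r c by simp
    then have "sig g e = sig G e"
      using full external_subgr(1)[OF s e(1)] subgrD(5)[OF s] by (simp add: full_in_def)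
    then show ?thesis using e(1) sel(3) by (simp add: external_def)
  qed
  then show iso: "isolated (scontract_graph G (g, j)) (Min C)"
    using sel(1,2,4) mv r by (force simp: isolated_def)
  show "C \<inter> rep g ` verts g = {Min C}"
    using isolated_scontract_graph(3)[OF s iso] c by simp
qed

text \<open>A contracted vertex has the type of the residue of its component in \<open>Y\<close>, so
  its refined type is admissible because \<open>Y\<close> is specified; the components of the
  contraction have the residue types of those of \<open>X\<close>.\<close>

lemma scontract_specified:
  assumes T: "is_theory T" and sub: "spec_subgraph T Y X"
  shows "scontract X Y \<in> specified T"
proof -
  obtain g j G i where XY: "Y = (g, j)" "X = (G, i)" by (cases X; cases Y)
  note D = spec_subgraphD[OF T sub[unfolded XY]]
  note s = D(3) and Y = specifiedD[OF T D(1)] and X = specifiedD[OF T D(2)]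
  note g = subgrD(1)[OF s] and G = subgrD(2)[OF s]
  let ?Q = "scontract_graph G (g, j)"
  let ?k = "snd (scontract (G, i) (g, j))"
  note sel = scontract_graph_sel[OF g, where G = G and j = j]
  have ex: "e \<in> hedges G" if "e \<in> external g" for e by (rule external_subgr(1)[OF s that])
  have "scontract X Y = (?Q, ?k)" by (simp add: XY scontract_eq)
  moreover have "graph_of T ?Q"
    unfolding graph_of_def
  proof (intro conjI ballI)
    show "is_graph ?Q" by (rule is_graph_scontract_graph[OF s])
    show "htype ?Q e \<in> etypes T" if "e \<in> hedges ?Q" for e
      using that sel(2,5) ex X(1) by (auto simp: graph_of_def)
    fix v assume "v \<in> verts ?Q"
    then have v: "v \<in> rep g ` verts g" using sel(1) by simp
    then have "comp_of g v \<in> pi0 g" using rep_in(2)[OF g] comp_of_in_pi0 by blast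
    then show "(vtype ?Q v, vk ?Q v) \<in> rvtypes T"
      using vtype_scontract_graph[OF s v] sel(6)[OF v] Y(5) by simp
  qed
  moreover have "bridgeless ?Q" by (rule bridgeless_scontract_graph[OF s X(3)])
  moreover have "?k \<in> extensional (pi0 ?Q)" by (simp add: scontract_eq)
  moreover have "(ext_type ?Q D, ?k D) \<in> rvtypes T" if D': "D \<in> pi0 ?Q" for D
  proof -
    obtain C where C: "C \<in> pi0 G" "D = C \<inter> rep g ` verts g" using D' unfolding pi0_scontract_graph[OF s] by auto
    then show ?thesis using ext_type_scontract_graph[OF s C(1)] snd_scontract[OF s C(1)] X(5) by simp
  qed
  moreover have "?k {v} = vk ?Q v" if "isolated ?Q v" for v
  proof -
    note I = isolated_scontract_graph[OF s that]
    have "?k {v} = i (comp_of g v)"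
      using snd_scontract[OF s pi0_full_in[OF s I(1,2)], of i j] I(3) by simp
    also have "\<dots> = j (comp_of g v)" using D(4)[OF I(1,2)] by simp
    also have "\<dots> = vk ?Q v" using sel(1,6) that by (simp add: isolated_def)
    finally show ?thesis .
  qed
  ultimately show ?thesis by (simp add: specified_iff[OF T])
qed

subsection \<open>Extreme subgraphs\<close>

lemma spec_subgraph_refl: "is_theory T \<Longrightarrow> X \<in> specified T \<Longrightarrow> spec_subgraph T X X"
  by (cases X) (simp add: spec_subgraph_iff subgr_refl specifiedD)

text \<open>When nothing is cut every component is full, so the two specifications agree.\<close>

lemma spec_subgraph_eq:
  assumes T: "is_theory T" and sub: "spec_subgraph T Y X" and "fst Y = fst X"
  shows "Y = X"
proof -
  obtain g j i where XY: "Y = (g, j)" "X = (g, i)" using assms(3) by (cases X; cases Y) simp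
  note D = spec_subgraphD[OF T sub[unfolded XY]]
  have "j = i"
    by (rule extensionalityI[OF specifiedD(4)[OF T D(1)] specifiedD(4)[OF T D(2)]]) (simp add: D(4) full_in_def)
  then show ?thesis using XY by simp
qed

lemma scontract_self_no_internal:
  assumes "is_graph G"
  shows "internal (scontract_graph G (G, i)) = {}"
  using scontract_graph_sel[OF assms, where G = G and j = i] by (auto simp: internal_empty_iff external_def)

text \<open>The components of the skeleton are single vertices, so \<open>Min C\<close> is the
  vertex itself. Its specification is forced, which gives uniqueness in
  \<open>spec_subgraph_skel_unique\<close>.\<close>

definition skel :: "'t sgraph \<Rightarrow> 't sgraph" where
  "skel X = (skeleton (fst X), restrict (\<lambda>C. vk (fst X) (Min C)) (pi0 (skeleton (fst X))))"

lemma skeleton_internal: "is_graph G \<Longrightarrow> internal (skeleton G) = {}"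
  using subgr_skeleton[of G] by (auto simp: internal_empty_iff subgr_def)

lemma pi0_skeleton:
  assumes "is_graph G"
  shows "pi0 (skeleton G) = (\<lambda>v. {v}) ` verts G"
  using pi0_no_internal[OF subgrD(1)[OF subgr_skeleton(1)[OF assms]] skeleton_internal[OF assms]]
    subgrD(3)[OF subgr_skeleton(1)[OF assms]] by simp

lemma bridgeless_no_internal: "internal G = {} \<Longrightarrow> bridgeless G"
  by (auto simp: bridgeless_def internal_empty_iff)

lemma skel_specified:
  assumes T: "is_theory T" and X: "X \<in> specified T"
  shows "skel X \<in> specified T"
proof -
  obtain G i where XG: "X = (G, i)" by (cases X)
  note D = specifiedD[OF T X[unfolded XG]]
  note s = subgr_skeleton[OF D(2)]
  let ?S = "skeleton G"
  have "ext_type ?S {v} = vtype G v" if "v \<in> verts G" for v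
    using s subgrD(4,5,6)[OF s(1)]
    by (intro ext) (auto simp: ext_type_def vtype_def star_def external_def intro!: arg_cong[where f = card])
  then show ?thesis
    using graph_of_subgr[OF s(1)] D(1) bridgeless_no_internal[OF skeleton_internal[OF D(2)]]
      pi0_skeleton[OF D(2)] subgrD(3,7)[OF s(1)]
    unfolding XG skel_def specified_iff[OF T] by (auto simp: graph_of_def isolated_def)
qed

lemma skel_spec_subgraph:
  assumes T: "is_theory T" and X: "X \<in> specified T"
  shows "spec_subgraph T (skel X) X"
proof -
  obtain G i where XG: "X = (G, i)" by (cases X)
  note D = specifiedD[OF T X[unfolded XG]]
  note s = subgr_skeleton[OF D(2)]
  have "vk G v = i {v}" if "v \<in> verts G" "full_in (skeleton G) G {v}" for v
    using that s(2) D(6)[of v] by (auto simp: full_in_def isolated_def)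
  then show ?thesis
    using skel_specified[OF T X] X s(1) unfolding XG skel_def spec_subgraph_iff[OF T]
    by (auto simp: pi0_skeleton[OF D(2)])
qed

lemma spec_subgraph_skel_unique:
  assumes T: "is_theory T" and sub: "spec_subgraph T Y X" and sk: "fst Y = skeleton (fst X)"
  shows "Y = skel X"
proof -
  obtain g j G i where XY: "Y = (g, j)" "X = (G, i)" by (cases X; cases Y)
  note D = spec_subgraphD[OF T sub[unfolded XY]]
  note Y = specifiedD[OF T D(1)] and X = specifiedD[OF T D(2)]
  have g: "g = skeleton G" using sk XY by simp
  note s = subgr_skeleton[OF X(2)]
  have iso: "isolated g v" if "v \<in> verts G" for v
    using that s(2) subgrD(3,4,5)[OF s(1)] by (auto simp: isolated_def g)
  have "j = restrict (\<lambda>C. vk G (Min C)) (pi0 g)"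
    by (rule extensionalityI[OF Y(4)])
      (use Y(6)[OF iso] subgrD(7)[OF s(1)] in \<open>auto simp: g pi0_skeleton[OF X(2)]\<close>)
  then show ?thesis by (simp add: XY skel_def g)
qed

text \<open>The components of the skeleton are singletons and \<open>Min {v} = v\<close>, so no
  label changes and an equality, not just an isomorphism, results.\<close>

lemma scontract_skel:
  assumes T: "is_theory T" and X: "X \<in> specified T"
  shows "scontract X (skel X) = X"
proof -
  obtain G i where XG: "X = (G, i)" by (cases X)
  note D = specifiedD[OF T X[unfolded XG]]
  note s = subgr_skeleton[OF D(2)]
  note S = subgrD(1)[OF s(1)]
  define j where "j = restrict (\<lambda>C. vk G (Min C)) (pi0 (skeleton G))"
  have sk: "skel X = (skeleton G, j)" by (simp add: XG skel_def j_def)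
  have c: "comp_of (skeleton G) v = {v}" if "v \<in> verts G" for v
    by (rule comp_of_eq[OF S]) (use that in \<open>auto simp: pi0_skeleton[OF D(2)]\<close>)
  have r: "rep (skeleton G) v = v" if "v \<in> verts G" for v by (simp add: rep_def c[OF that])
  have sv: "verts (skeleton G) = verts G" "hedges (skeleton G) = hedges G" "bd (skeleton G) = bd G"
    using subgrD[OF s(1)] by auto
  have rv: "rep (skeleton G) ` verts (skeleton G) = verts G" using r sv by force
  have ex: "external (skeleton G) = hedges G" using s(2) sv by (auto simp: external_def)
  note sel = scontract_graph_sel[OF S, where G = G and j = j, unfolded rv ex]
  have eq: "scontract_graph G (skel X) = G"
    unfolding sk
  proof (rule is_graph_eqI[OF is_graph_scontract_graph[OF s(1)] D(2)])
    show "bd (scontract_graph G (skeleton G, j)) e = bd G e" if "e \<in> hedges (scontract_graph G (skeleton G, j))" for e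
      using that r[of "bd G e"] is_graphD(5)[OF D(2), of e] by (simp add: sel(2,4) sv)
    show "vk (scontract_graph G (skeleton G, j)) v = vk G v" if "v \<in> verts (scontract_graph G (skeleton G, j))" for v
      using that by (simp add: sel(1,6) c) (simp add: j_def pi0_skeleton[OF D(2)])
  qed (simp_all add: sel(1,2,3,5))
  have "restrict (\<lambda>C. i (comp_of G (Min C))) (pi0 G) = i"
    by (rule extensionalityI[OF _ D(4)]) (auto simp: comp_of_eq[OF D(2) _ Min_in_pi0[OF D(2)]])
  then show ?thesis using eq by (simp add: XG scontract_eq)
qed

subsection \<open>Iterated subgraphs and contractions\<close>

lemma subgr_between:
  assumes "subgr z y" "subgr y x"
  shows "full_in z x C \<Longrightarrow> full_in z y C" "full_in z x C \<Longrightarrow> full_in y x C"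
  using assms unfolding full_in_def subgr_def by metis+

lemma spec_subgraph_trans:
  assumes T: "is_theory T" and "spec_subgraph T Z Y" "spec_subgraph T Y X"
  shows "spec_subgraph T Z X"
proof -
  obtain z l y j x i where XYZ: "Z = (z, l)" "Y = (y, j)" "X = (x, i)" by (cases X; cases Y; cases Z)
  note ZY = spec_subgraphD[OF T assms(2)[unfolded XYZ]] and YX = spec_subgraphD[OF T assms(3)[unfolded XYZ]]
  have "l C = i C" if C: "C \<in> pi0 z" "full_in z x C" for C
    using ZY(4)[OF C(1)] YX(4) subgr_between[OF ZY(3) YX(3) C(2)] pi0_full_in[OF ZY(3) C(1)] by simp
  then show ?thesis
    using ZY YX subgr_trans unfolding XYZ spec_subgraph_iff[OF T] by blast
qed

lemma external_mono: "subgr g G \<Longrightarrow> external G \<subseteq> external g"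
  using subgr_sig_fixed subgrD(4) by (fastforce simp: external_def)

lemma subgr_scontract_graph:
  assumes zy: "subgr z y" and yx: "subgr y x"
  shows "subgr (scontract_graph y (z, l)) (scontract_graph x (z, l))"
proof -
  note zx = subgr_trans[OF zy yx]
  note z = subgrD(1)[OF zy]
  note W = scontract_graph_sel[OF z, where G = y and j = l] and Q = scontract_graph_sel[OF z, where G = x and j = l]
  have "bd (scontract_graph y (z, l)) = bd (scontract_graph x (z, l))"
    "htype (scontract_graph y (z, l)) = htype (scontract_graph x (z, l))"
    "vk (scontract_graph y (z, l)) = vk (scontract_graph x (z, l))"
    using subgrD(6)[OF yx] by (simp_all add: scontract_graph_def contract_def Let_def)
  then show ?thesis
    unfolding subgr_def
    using is_graph_scontract_graph[OF zy, of l] is_graph_scontract_graph[OF zx, of l] W(1-3) Q(1-3)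
      subgrD(8)[OF yx] external_subgr(1)[OF zx] by auto
qed

lemma comp_of_scontract_graph:
  assumes s: "subgr g G" and v: "v \<in> verts G"
  shows "comp_of (scontract_graph G (g, j)) (rep g v) = comp_of G v \<inter> rep g ` verts g"
    "rep (scontract_graph G (g, j)) (rep g v) = rep G v"
proof -
  note g = subgrD(1)[OF s] and G = subgrD(2)[OF s]
  note C = comp_of_in_pi0[OF v]
  have vg: "v \<in> verts g" using v subgrD(3)[OF s] by simp
  have "rep g v \<in> comp_of G v"
    using rep_in_saturated_iff[OF g saturated_subgr[OF s pi0_saturated[OF G C]] vg] self_in_comp_of[OF v] by blast
  then have m: "rep g v \<in> comp_of G v \<inter> rep g ` verts g" using vg by blast
  show 1: "comp_of (scontract_graph G (g, j)) (rep g v) = comp_of G v \<inter> rep g ` verts g"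
    by (rule comp_of_eq[OF is_graph_scontract_graph[OF s] _ m]) (use C pi0_scontract_graph[OF s] in blast)
  show "rep (scontract_graph G (g, j)) (rep g v) = rep G v"
    unfolding rep_def[of "scontract_graph G (g, j)"] 1 Min_pi0_in_rep_image(2)[OF s C] by (simp add: rep_def)
qed

text \<open>The least label in a component of the contraction by \<open>z\<close> is the least
  vertex of the corresponding component of \<open>y\<close>
  (\<open>comp_of_scontract_graph\<close>), so both sides have the same vertices. Their refined
  types agree because a component of the contraction of \<open>y\<close> carries the value of
  \<open>j\<close> on the component of \<open>y\<close> it comes from.\<close>

lemma scontract_scontract:
  assumes zy: "subgr z y" and yx: "subgr y x"
  shows "scontract (scontract (x, i) (z, l)) (scontract (y, j) (z, l)) = scontract (x, i) (y, j)"
proof -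
  note zx = subgr_trans[OF zy yx]
  note z = subgrD(1)[OF zy] and y = subgrD(1)[OF yx] and x = subgrD(2)[OF yx]
  let ?W = "scontract_graph y (z, l)" and ?Q = "scontract_graph x (z, l)"
  let ?j = "snd (scontract (y, j) (z, l))" and ?i = "snd (scontract (x, i) (z, l))"
  note WQ = subgr_scontract_graph[OF zy yx, of l]
  note W = scontract_graph_sel[OF z, where G = y and j = l] and Q = scontract_graph_sel[OF z, where G = x and j = l]
  note wg = subgrD(1)[OF WQ]
  note L = scontract_graph_sel[OF wg, where G = ?Q and j = ?j] and R = scontract_graph_sel[OF y, where G = x and j = j]
  have vy: "verts y = verts z" and vx: "verts x = verts z" using subgrD(3)[OF zy] subgrD(3)[OF zx] by auto
  have exW: "external ?W = external y" by (rule external_scontract_graph[OF zy])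
  have exz: "e \<in> external z" if "e \<in> external y" for e using external_mono[OF zy] that by blast
  have rv: "rep ?W ` verts ?W = rep y ` verts y"
    unfolding W(1) image_image using comp_of_scontract_graph(2)[OF zy, of _ l] vy by (intro image_cong) auto
  have eq: "scontract_graph ?Q (?W, ?j) = scontract_graph x (y, j)"
  proof (rule is_graph_eqI[OF is_graph_scontract_graph[OF WQ] is_graph_scontract_graph[OF yx]])
    show "verts (scontract_graph ?Q (?W, ?j)) = verts (scontract_graph x (y, j))" by (simp add: L R rv)
    show "hedges (scontract_graph ?Q (?W, ?j)) = hedges (scontract_graph x (y, j))" by (simp add: L R exW)
    fix e assume "e \<in> hedges (scontract_graph ?Q (?W, ?j))"
    then have e: "e \<in> external y" "e \<in> external ?W" "e \<in> external z" using exW exz L(2) by auto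
    show "sig (scontract_graph ?Q (?W, ?j)) e = sig (scontract_graph x (y, j)) e"
      using L(3)[OF e(2)] R(3)[OF e(1)] Q(3)[OF e(3)] by simp
    show "htype (scontract_graph ?Q (?W, ?j)) e = htype (scontract_graph x (y, j)) e"
      using L(5)[OF e(2)] R(5)[OF e(1)] Q(5)[OF e(3)] by simp
    have "bd z e \<in> verts y" using e(3) is_graphD(5)[OF z] vy by (simp add: external_def)
    then show "bd (scontract_graph ?Q (?W, ?j)) e = bd (scontract_graph x (y, j)) e"
      using L(4)[OF e(2)] R(4)[OF e(1)] W(4)[OF e(3)] comp_of_scontract_graph(2)[OF zy] subgrD(5)[OF zy] by simp
  next
    fix v assume "v \<in> verts (scontract_graph ?Q (?W, ?j))"
    then have v: "v \<in> rep y ` verts y" "v \<in> rep ?W ` verts ?W" using L(1) rv by auto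
    then obtain u where u: "u \<in> verts y" "v = rep y u" by blast
    have vC: "v = Min (comp_of y u)" using u by (simp add: rep_def)
    have "v \<in> rep z ` verts z" using Min_pi0_in_rep_image(1)[OF zy comp_of_in_pi0[OF u(1)]] vC by simp
    then have vz: "rep z v = v" using rep_in(4)[OF z] by auto
    have vv: "v \<in> verts y" using rep_in(2)[OF y u(1)] u(2) by simp
    have "comp_of ?W v = comp_of y v \<inter> rep z ` verts z" using comp_of_scontract_graph(1)[OF zy vv, of l] vz by simp
    then have "?j (comp_of ?W v) = j (comp_of y v)" using snd_scontract[OF zy comp_of_in_pi0[OF vv], of j l] by simp
    then show "vk (scontract_graph ?Q (?W, ?j)) v = vk (scontract_graph x (y, j)) v"
      using L(6)[OF v(2)] R(6)[OF v(1)] by simp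
  qed
  have "?i (comp_of ?Q (Min D)) = i (comp_of x (Min D))" if D: "D \<in> pi0 (scontract_graph x (y, j))" for D
  proof -
    obtain C where C: "C \<in> pi0 x" "D = C \<inter> rep y ` verts y" using D unfolding pi0_scontract_graph[OF yx] by auto
    have m: "Min D = Min C" using Min_pi0_in_rep_image(2)[OF yx C(1)] C(2) by simp
    have mc: "Min C \<in> C" by (rule Min_in_pi0[OF x C(1)])
    have mv: "Min C \<in> verts x" using mc pi0_subset[OF x C(1)] by blast
    have "Min C \<in> rep z ` verts z" by (rule Min_pi0_in_rep_image(1)[OF zx C(1)])
    then have "rep z (Min C) = Min C" using rep_in(4)[OF z] by auto
    then have "comp_of ?Q (Min C) = comp_of x (Min C) \<inter> rep z ` verts z"
      using comp_of_scontract_graph(1)[OF zx mv, of l] by simp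
    then show ?thesis using snd_scontract[OF zx comp_of_in_pi0[OF mv], of i l] m by simp
  qed
  then show ?thesis
    using eq by (simp add: scontract_eq cong: restrict_cong)
qed

text \<open>\<open>y\<close> and \<open>x\<close> can differ only at half-edges external in
  \<open>z\<close>, and these are the half-edges of the two contractions.\<close>

lemma full_in_scontract_graph:
  assumes zy: "subgr z y" and yx: "subgr y x" and C: "saturated y C"
  shows "full_in (scontract_graph y (z, l)) (scontract_graph x (z, l)) (C \<inter> rep z ` verts z) \<longleftrightarrow> full_in y x C"
proof -
  note zx = subgr_trans[OF zy yx]
  note z = subgrD(1)[OF zy]
  note W = scontract_graph_sel[OF z, where G = y and j = l] and Q = scontract_graph_sel[OF z, where G = x and j = l]
  have mem: "rep z (bd z e) \<in> C \<inter> rep z ` verts z \<longleftrightarrow> bd x e \<in> C" if "e \<in> external z" for e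
  proof -
    have "bd z e \<in> verts z" using that is_graphD(5)[OF z] by (simp add: external_def)
    then show ?thesis using rep_in_saturated_iff[OF z saturated_subgr[OF zy C]] subgrD(5)[OF zx] by auto
  qed
  have int: "sig y e = sig x e" if "e \<in> hedges x" "e \<notin> external z" for e
    using external_subgr(3)[OF zy, of e] external_subgr(3)[OF zx, of e] that subgrD(4)[OF yx] by simp
  show ?thesis
    unfolding full_in_def Q(2) using W(3) Q(3,4) mem int external_subgr(1)[OF zx] by (metis (no_types))
qed

lemma scontract_spec_subgraph:
  assumes T: "is_theory T" and ZY: "spec_subgraph T Z Y" and YX: "spec_subgraph T Y X"
  shows "spec_subgraph T (scontract Y Z) (scontract X Z)"
proof -
  obtain z l y j x i where XYZ: "Z = (z, l)" "Y = (y, j)" "X = (x, i)" by (cases X; cases Y; cases Z)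
  note DY = spec_subgraphD[OF T ZY[unfolded XYZ]] and DX = spec_subgraphD[OF T YX[unfolded XYZ]]
  note zx = subgr_trans[OF DY(3) DX(3)]
  have 1: "scontract Y Z \<in> specified T" "scontract X Z \<in> specified T"
    using scontract_specified[OF T] ZY spec_subgraph_trans[OF T ZY YX] by blast+
  let ?k = "snd (scontract (y, j) (z, l))" and ?m = "snd (scontract (x, i) (z, l))"
  have "?k D = ?m D"
    if D: "D \<in> pi0 (scontract_graph y (z, l))" "full_in (scontract_graph y (z, l)) (scontract_graph x (z, l)) D" for D
  proof -
    obtain C where C: "C \<in> pi0 y" "D = C \<inter> rep z ` verts z" using D(1) unfolding pi0_scontract_graph[OF DY(3)] by auto
    have f: "full_in y x C"
      using full_in_scontract_graph[OF DY(3) DX(3) pi0_saturated[OF subgrD(1)[OF DX(3)] C(1)]] D(2) C(2) by blast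
    show ?thesis
      using snd_scontract[OF DY(3) C(1), of j l] snd_scontract[OF zx pi0_full_in[OF DX(3) C(1) f], of i l]
        DX(4)[OF C(1) f] C(2) by simp
  qed
  then show ?thesis
    using 1 subgr_scontract_graph[OF DY(3) DX(3), of l]
      spec_subgraph_iff[OF T, of "scontract_graph y (z, l)" ?k "scontract_graph x (z, l)" ?m]
    by (simp add: XYZ scontract_eq)
qed

text \<open>On half-edges external in \<open>z\<close> the involution of \<open>Y\<close> is visible
  in the contraction; on all others it agrees with that of \<open>z\<close>. The specification is
  visible because components correspond.\<close>

lemma scontract_inj:
  assumes T: "is_theory T" and Y: "spec_subgraph T Z Y" "spec_subgraph T Y X"
    and Y': "spec_subgraph T Z Y'" "spec_subgraph T Y' X" and eq: "scontract Y Z = scontract Y' Z"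
  shows "Y = Y'"
proof -
  obtain z l y j x i y' j' where XYZ: "Z = (z, l)" "Y = (y, j)" "X = (x, i)" "Y' = (y', j')"
    by (cases X; cases Y; cases Z; cases Y')
  note DY = spec_subgraphD[OF T Y(1)[unfolded XYZ]] and DX = spec_subgraphD[OF T Y(2)[unfolded XYZ]]
  note DY' = spec_subgraphD[OF T Y'(1)[unfolded XYZ]] and DX' = spec_subgraphD[OF T Y'(2)[unfolded XYZ]]
  note z = subgrD(1)[OF DY(3)]
  have g: "scontract_graph y (z, l) = scontract_graph y' (z, l)" using eq by (simp add: XYZ scontract_eq)
  have yy: "y = y'"
  proof (rule subgr_eqI[OF DX(3) DX'(3)])
    fix e assume e: "e \<in> hedges x"
    show "sig y e = sig y' e"
    proof (cases "e \<in> external z")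
      case True
      have "sig (scontract_graph y (z, l)) e = sig (scontract_graph y' (z, l)) e" using g by simp
      then show ?thesis using scontract_graph_sel(3)[OF z True] by simp
    next
      case False
      then show ?thesis
        using external_subgr(3)[OF DY(3) _ False] external_subgr(3)[OF DY'(3) _ False] e
          subgrD(4)[OF DX(3)] subgrD(4)[OF DX'(3)] by simp
    qed
  qed
  have "j = j'"
  proof (rule extensionalityI[OF specifiedD(4)[OF T DY(2)] specifiedD(4)[OF T DY'(2), folded yy]])
    fix C assume C: "C \<in> pi0 y"
    then show "j C = j' C"
      using snd_scontract[OF DY(3) C, of j l] snd_scontract[OF DY'(3), of C j' l] eq by (simp add: XYZ yy)
  qed
  with yy show ?thesis by (simp add: XYZ)
qed

lemma scontract_surj:
  assumes T: "is_theory T" and ZX: "spec_subgraph T Z X" and WQ: "spec_subgraph T W (scontract X Z)"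
  obtains Y where "spec_subgraph T Z Y" "spec_subgraph T Y X" "scontract Y Z = W"
proof -
  obtain z l x i w k where XYZ: "Z = (z, l)" "X = (x, i)" "W = (w, k)" by (cases X; cases W; cases Z)
  let ?Q = "scontract_graph x (z, l)"
  define m where "m = snd (scontract (x, i) (z, l))"
  have sc: "scontract (x, i) (z, l) = (?Q, m)" by (simp add: m_def scontract_eq)
  note DX = spec_subgraphD[OF T ZX[unfolded XYZ]]
  note DW = spec_subgraphD[OF T WQ[unfolded XYZ sc]]
  note zx = DX(3)
  note z = subgrD(1)[OF zx] and x = subgrD(2)[OF zx] and w = subgrD(1)[OF DW(3)]
  note Q = scontract_graph_sel[OF z, where G = x and j = l]
  \<comment> \<open>A half-edge external in \<open>z\<close> gets its partner from \<open>W\<close>;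
    the remaining ones, already joined in \<open>z\<close>, stay joined as in
    \<open>x\<close>.\<close>
  define y where "y = x\<lparr>sig := (\<lambda>e. if e \<in> external z then sig w e else sig x e)\<rparr>"
  have ysel: "verts y = verts x" "hedges y = hedges x" "bd y = bd x" "htype y = htype x" "vk y = vk x"
    "sig y e = (if e \<in> external z then sig w e else sig x e)" for e by (simp_all add: y_def)
  have hw: "hedges w = external z" using subgrD(4)[OF DW(3)] Q(2) by simp
  have sw: "sig w e = e \<or> sig w e = sig x e" if "e \<in> external z" for e
    using subgrD(8)[OF DW(3), of e] that Q(2,3) by simp
  have ss: "sig y e = e \<or> sig y e = sig x e" for e using sw by (simp add: ysel)
  have nz: "sig x e \<notin> external z" if "e \<in> hedges x" "e \<notin> external z" for e
    using external_subgr(2)[OF zx, of "sig x e"] is_graphD(4)[OF x that(1)] that(2) by auto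
  have yg: "is_graph y"
    unfolding is_graph_def
  proof (intro conjI ballI)
    show "sig y \<in> hedges y \<rightarrow>\<^sub>E hedges y"
    proof (rule PiE_I)
      fix e assume "e \<in> hedges y"
      then show "sig y e \<in> hedges y" using ss[of e] is_graphD(3)[OF x] ysel(2) by metis
    next
      fix e assume "e \<notin> hedges y"
      then show "sig y e = undefined"
        using is_graphD(7)[OF x, of e] external_subgr(1)[OF zx, of e] by (auto simp: ysel)
    qed
    fix e assume e: "e \<in> hedges y"
    show "sig y (sig y e) = e"
    proof (cases "e \<in> external z")
      case True
      then have "sig w e \<in> external z" "sig w (sig w e) = e" using is_graphD(3,4)[OF w] hw by auto
      then show ?thesis using True by (simp add: ysel)
    next
      case False
      then show ?thesis using e nz is_graphD(4)[OF x] by (simp add: ysel)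
    qed
    show "htype y (sig y e) = htype y e" using ss[of e] is_graphD(6)[OF x] e ysel(2,4) by metis
  qed (use x in \<open>auto simp: is_graph_def ysel\<close>)
  have yx: "subgr y x" unfolding subgr_def using yg x ysel ss by metis
  have zy: "subgr z y"
  proof -
    have "sig z e = e \<or> sig z e = sig y e" if "e \<in> hedges y" for e
    proof (cases "e \<in> external z")
      case True
      then show ?thesis by (simp add: external_def)
    next
      case False
      then show ?thesis using external_subgr(3)[OF zx, of e] that by (simp add: ysel)
    qed
    then show ?thesis unfolding subgr_def using z yg subgrD(3-7)[OF zx] ysel(1-5) by simp
  qed
  note y = yg
  have wy: "scontract_graph y (z, l) = w"
    by (rule subgr_eqI[OF subgr_scontract_graph[OF zy yx] DW(3)])
      (use scontract_graph_sel(3)[OF z, where G = y and j = l] ysel(6) Q(2) in simp)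
  note Ws = scontract_graph_sel[OF z, where G = y and j = l, unfolded wy]
  have p: "pi0 w = (\<lambda>C. C \<inter> rep z ` verts z) ` pi0 y" using pi0_scontract_graph[OF zy, of l] wy by simp
  \<comment> \<open>Components of \<open>y\<close> correspond to those of \<open>w\<close>, and the
    specification is pulled back along this correspondence.\<close>
  define j where "j = restrict (\<lambda>C. k (C \<inter> rep z ` verts z)) (pi0 y)"
  have k: "k (C \<inter> rep z ` verts z) = j C" if "C \<in> pi0 y" for C using that by (simp add: j_def)
  note SW = specifiedD[OF T DW(1)] and SZ = specifiedD[OF T DX(1)] and SX = specifiedD[OF T DX(2)]
  \<comment> \<open>A component of \<open>z\<close> left uncut in \<open>y\<close> becomes an
    isolated vertex of \<open>w\<close>; there \<open>k\<close> equals \<open>vk w\<close>, which is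
    the value of \<open>l\<close>.\<close>
  have jz: "j C = l C" if C: "C \<in> pi0 z" "full_in z y C" for C
  proof -
    note I = isolated_scontract_graphI(1)[OF zy C, of l, unfolded wy] isolated_scontract_graphI(2,3)[OF zy C]
    have "j C = k {Min C}" using k[OF pi0_full_in[OF zy C]] I(3) by simp
    also have "\<dots> = vk w (Min C)" by (rule SW(6)[OF I(1)])
    also have "\<dots> = l C" using Ws(1,6) I(1,2) by (simp add: isolated_def)
    finally show ?thesis .
  qed
  have spec: "(y, j) \<in> specified T"
    unfolding specified_iff[OF T]
  proof (intro conjI ballI allI impI)
    show "graph_of T y" using graph_of_subgr[OF yx] SX(1) by simp
    show "bridgeless y" by (rule bridgeless_lift[OF zy SZ(3), of l]) (use SW(3) wy in simp)
    show "(ext_type y C, j C) \<in> rvtypes T" if C: "C \<in> pi0 y" for C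
    proof -
      have "C \<inter> rep z ` verts z \<in> pi0 w" using p C by blast
      from SW(5)[OF this] show ?thesis using ext_type_scontract_graph[OF zy C, of l] k[OF C] wy by simp
    qed
    fix v assume v: "isolated y v"
    have iz: "isolated z v" using v subgr_sig_fixed[OF zy] subgrD(3,4,5)[OF zy] by (simp add: isolated_def)
    have "full_in z y {v}" using v iz subgrD(4,5)[OF zy] by (simp add: isolated_def full_in_def)
    then have "j {v} = l {v}" by (rule jz[OF isolated_pi0[OF z iz]])
    also have "\<dots> = vk y v" using SZ(6)[OF iz] subgrD(7)[OF zy] by simp
    finally show "j {v} = vk y v" .
  qed (simp add: j_def)
  have 1: "spec_subgraph T Z (y, j)"
    unfolding XYZ spec_subgraph_iff[OF T] using DX(1) spec zy jz by simp
  have "j C = i C" if C: "C \<in> pi0 y" "full_in y x C" for C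
  proof -
    have "full_in w ?Q (C \<inter> rep z ` verts z)"
      using full_in_scontract_graph[OF zy yx pi0_saturated[OF y C(1)], of l] C(2) wy by simp
    then show ?thesis
      using DW(4)[of "C \<inter> rep z ` verts z"] k[OF C(1)] p C(1) snd_scontract[OF zx pi0_full_in[OF yx C], of i l, folded m_def] by auto
  qed
  then have 2: "spec_subgraph T (y, j) X"
    unfolding XYZ spec_subgraph_iff[OF T] using DX(2) spec yx by simp
  have "snd (scontract (y, j) (z, l)) = k"
  proof (rule extensionalityI[OF _ SW(4)])
    show "snd (scontract (y, j) (z, l)) \<in> extensional (pi0 w)" by (simp add: scontract_eq wy)
    fix D assume "D \<in> pi0 w"
    then obtain C where C: "C \<in> pi0 y" "D = C \<inter> rep z ` verts z" using p by blast
    then show "snd (scontract (y, j) (z, l)) D = k D" using snd_scontract[OF zy C(1), of j l] k[OF C(1)] by simp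
  qed
  then have "scontract (y, j) Z = W" using wy by (simp add: XYZ scontract_eq)
  with 1 2 show thesis using that by blast
qed

subsection \<open>Disjoint unions and saturated parts\<close>

text \<open>Disjoint unions are handled backwards, as splittings of one graph along a saturated set:
  the other part is \<open>srestr X (verts (fst X) - U)\<close>.\<close>

definition srestr :: "'t sgraph \<Rightarrow> nat set \<Rightarrow> 't sgraph" where
  "srestr X U = (component (fst X) U, restrict (snd X) (pi0 (component (fst X) U)))"

lemma vtype_component: "v \<in> U \<Longrightarrow> vtype (component G U) v = vtype G v"
  by (intro ext) (auto simp: vtype_def star_def intro!: arg_cong[where f = card])

lemma ext_type_component: "C \<subseteq> U \<Longrightarrow> ext_type (component G U) C = ext_type G C"
  by (intro ext) (auto simp: ext_type_def external_component external_def intro!: arg_cong[where f = card])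

lemma isolated_component:
  assumes "saturated G U"
  shows "isolated (component G U) v \<longleftrightarrow> v \<in> U \<and> isolated G v"
  using saturated_subset[OF assms] by (auto simp: isolated_def)

lemma full_in_component: "C \<subseteq> U \<Longrightarrow> subgr g G \<Longrightarrow> full_in (component g U) (component G U) C \<longleftrightarrow> full_in g G C"
  by (auto simp: full_in_def subgr_def subset_iff)

lemma pi0_split:
  assumes "is_graph G" "saturated G U" "C \<in> pi0 G"
  shows "C \<subseteq> U \<or> C \<subseteq> verts G - U"
  using pi0_minimal[OF assms(1,3,2)] pi0_subset[OF assms(1,3)] by blast

lemma srestr_specified:
  assumes T: "is_theory T" and X: "X \<in> specified T" and U: "saturated (fst X) U"
  shows "srestr X U \<in> specified T"
proof -
  obtain G i where XG: "X = (G, i)" by (cases X)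
  note D = specifiedD[OF T X[unfolded XG]]
  have sU: "saturated G U" using U XG by simp
  note p = pi0_component[OF D(2) sU]
  have "graph_of T (component G U)"
    using D(1) is_graph_component[OF D(2) sU] saturated_subset[OF sU]
    unfolding graph_of_def by (auto simp: subset_iff vtype_component)
  then show ?thesis
    using D bridgeless_component[OF D(2) sU]
    unfolding XG srestr_def specified_iff[OF T]
    by (simp add: p ext_type_component isolated_component[OF sU] isolated_pi0)
qed

text \<open>Every condition concerns a single vertex, half-edge, edge or component, and each of
  these lies in one of the two parts.\<close>

lemma specified_from_parts:
  assumes T: "is_theory T" and G: "is_graph G" and U: "saturated G U" and i: "i \<in> extensional (pi0 G)"
    and 1: "srestr (G, i) U \<in> specified T" and 2: "srestr (G, i) (verts G - U) \<in> specified T"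
  shows "(G, i) \<in> specified T"
proof -
  have U': "saturated G (verts G - U)" by (rule saturated_Diff[OF G saturated_verts[OF G] U])
  have part: "\<exists>V. saturated G V \<and> v \<in> V \<and> srestr (G, i) V \<in> specified T" if "v \<in> verts G" for v
    using U U' 1 2 that by blast
  note D = specifiedD[OF T, of "component G V" "restrict i (pi0 (component G V))" for V]
  have s: "srestr (G, i) V = (component G V, restrict i (pi0 (component G V)))" for V
    by (simp add: srestr_def)
  have "(vtype G v, vk G v) \<in> rvtypes T" if v: "v \<in> verts G" for v
  proof -
    obtain V where V: "saturated G V" "v \<in> V" "srestr (G, i) V \<in> specified T" using part[OF v] by blast
    then have "graph_of T (component G V)" using D(1) s by metis
    then show ?thesis using vtype_component[OF V(2), of G] V(2) by (force simp: graph_of_def)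
  qed
  moreover have "htype G e \<in> etypes T" if e: "e \<in> hedges G" for e
  proof -
    obtain V where V: "saturated G V" "bd G e \<in> V" "srestr (G, i) V \<in> specified T"
      using part[OF is_graphD(5)[OF G e]] by blast
    then have "graph_of T (component G V)" using D(1) s by metis
    then show ?thesis using V(2) e by (auto simp: graph_of_def)
  qed
  moreover have "bridgeless G"
    by (rule bridgeless_from_components[OF G U]) (use D(3) 1 2 s in metis)+
  moreover have "(ext_type G C, i C) \<in> rvtypes T" if C: "C \<in> pi0 G" for C
  proof -
    obtain v where v: "v \<in> C" "v \<in> verts G" using pi0_nonempty[OF G C] pi0_subset[OF G C] by blast
    obtain V where V: "saturated G V" "v \<in> V" "srestr (G, i) V \<in> specified T" using part[OF v(2)] by blast
    have CV: "C \<subseteq> V" by (rule pi0_minimal[OF G C V(1) v(1) V(2)])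
    then have "C \<in> pi0 (component G V)" using C by (simp add: pi0_component[OF G V(1)])
    then show ?thesis using D(5)[of V C] V(3) s[of V] ext_type_component[OF CV, of G] by simp
  qed
  moreover have "i {v} = vk G v" if v: "isolated G v" for v
  proof -
    obtain V where V: "saturated G V" "v \<in> V" "srestr (G, i) V \<in> specified T"
      using part v by (auto simp: isolated_def)
    have iso: "isolated (component G V) v" using isolated_component[OF V(1)] v V(2) by blast
    have "{v} \<in> pi0 (component G V)"
      by (rule isolated_pi0[OF is_graph_component[OF G V(1)] iso])
    then show ?thesis using D(6)[of V v] V(2,3) s[of V] iso by simp
  qed
  ultimately show ?thesis using G i unfolding specified_iff[OF T] graph_of_def by blast
qed

lemma graph_union_sel [simp]:
  "verts (graph_union G G') = verts G \<union> verts G'" "hedges (graph_union G G') = hedges G \<union> hedges G'"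
  "sig (graph_union G G') e = (if e \<in> hedges G then sig G e else sig G' e)"
  "bd (graph_union G G') e = (if e \<in> hedges G then bd G e else bd G' e)"
  "htype (graph_union G G') e = (if e \<in> hedges G then htype G e else htype G' e)"
  "vk (graph_union G G') v = (if v \<in> verts G then vk G v else vk G' v)"
  by (simp_all add: graph_union_def)

lemma graph_union_parts:
  assumes G: "is_graph G" and G': "is_graph G'" and d: "disjoint_graphs G G'"
  shows "is_graph (graph_union G G')" "saturated (graph_union G G') (verts G)"
    "component (graph_union G G') (verts G) = G" "component (graph_union G G') (verts G') = G'"
    "verts (graph_union G G') - verts G = verts G'"
proof -
  let ?H = "graph_union G G'"
  have dv: "v \<in> verts G \<Longrightarrow> v \<notin> verts G'" and dh: "e \<in> hedges G \<Longrightarrow> e \<notin> hedges G'" for v e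
    using d by (auto simp: disjoint_graphs_def)
  have dh': "e \<in> hedges G' \<Longrightarrow> e \<notin> hedges G" for e using dh by blast
  note D = is_graphD[OF G] and D' = is_graphD[OF G']
  show H: "is_graph ?H"
    unfolding is_graph_def
  proof (intro conjI ballI)
    show "sig ?H \<in> hedges ?H \<rightarrow>\<^sub>E hedges ?H" by (rule PiE_I) (auto simp: D D')
    show "bd ?H \<in> hedges ?H \<rightarrow>\<^sub>E verts ?H" by (rule PiE_I) (auto simp: D D')
    show "sig ?H (sig ?H e) = e" "htype ?H (sig ?H e) = htype ?H e" if "e \<in> hedges ?H" for e
      using that dh' D'(3)[of e] by (auto simp: D D')
  qed (auto simp: D D' extensional_def)
  show sV: "saturated ?H (verts G)"
    unfolding saturated_def
  proof (intro conjI ballI impI)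
    fix e assume e: "e \<in> hedges ?H" "bd ?H e \<in> verts G"
    then have "e \<in> hedges G" using D'(5)[of e] dv by (auto split: if_splits)
    then show "bd ?H (sig ?H e) \<in> verts G" by (simp add: D)
  qed simp
  show vd: "verts ?H - verts G = verts G'" using dv by auto
  then have sV': "saturated ?H (verts G')" using saturated_Diff[OF H saturated_verts[OF H] sV] by simp
  have hG: "{e \<in> hedges ?H. bd ?H e \<in> verts G} = hedges G" using D(5) D'(5) dv by (auto split: if_splits)
  have hG': "{e \<in> hedges ?H. bd ?H e \<in> verts G'} = hedges G'" using D(5) D'(5) dv dh by (auto split: if_splits)
  show "component ?H (verts G) = G"
  proof (rule is_graph_eqI[OF is_graph_component[OF H sV] G])
    show h: "hedges (component ?H (verts G)) = hedges G" using hG by simp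
    fix e assume "e \<in> hedges (component ?H (verts G))"
    then have e: "e \<in> hedges G" "e \<in> hedges ?H" "bd ?H e \<in> verts G" using h D(5) by auto
    show "sig (component ?H (verts G)) e = sig G e" "bd (component ?H (verts G)) e = bd G e"
      "htype (component ?H (verts G)) e = htype G e"
      using component_sel(3-5)[OF e(2,3)] e(1) by simp_all
  qed simp_all
  show "component ?H (verts G') = G'"
  proof (rule is_graph_eqI[OF is_graph_component[OF H sV'] G'])
    show h: "hedges (component ?H (verts G')) = hedges G'" using hG' by simp
    fix e assume "e \<in> hedges (component ?H (verts G'))"
    then have e: "e \<in> hedges G'" "e \<in> hedges ?H" "bd ?H e \<in> verts G'" "e \<notin> hedges G" using h D'(5) dh' by auto
    show "sig (component ?H (verts G')) e = sig G' e" "bd (component ?H (verts G')) e = bd G' e"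
      "htype (component ?H (verts G')) e = htype G' e"
      using component_sel(3-5)[OF e(2,3)] e(4) by simp_all
  next
    fix v assume "v \<in> verts (component ?H (verts G'))"
    then show "vk (component ?H (verts G')) v = vk G' v" using dv by auto
  qed simp
qed

lemma pi0_graph_union:
  assumes G: "is_graph G" and G': "is_graph G'" and d: "disjoint_graphs G G'"
  shows "pi0 (graph_union G G') = pi0 G \<union> pi0 G'" "pi0 G \<inter> pi0 G' = {}"
proof -
  note P = graph_union_parts[OF assms]
  let ?H = "graph_union G G'"
  have s': "saturated ?H (verts G')" using saturated_Diff[OF P(1) saturated_verts[OF P(1)] P(2)] P(5) by simp
  have "pi0 G = {C \<in> pi0 ?H. C \<subseteq> verts G}" "pi0 G' = {C \<in> pi0 ?H. C \<subseteq> verts G'}"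
    using pi0_component[OF P(1,2)] pi0_component[OF P(1) s'] P(3,4) by simp_all
  then show "pi0 ?H = pi0 G \<union> pi0 G'" using pi0_split[OF P(1,2)] P(5) by blast
  have "C \<noteq> {} \<and> C \<subseteq> verts G \<and> C \<subseteq> verts G'" if "C \<in> pi0 G" "C \<in> pi0 G'" for C
    using that pi0_nonempty[OF G] pi0_subset[OF G] pi0_subset[OF G'] by blast
  then show "pi0 G \<inter> pi0 G' = {}" using d unfolding disjoint_graphs_def by blast
qed

lemma sgraph_union_parts:
  assumes T: "is_theory T" and X: "X \<in> specified T" "X' \<in> specified T" and d: "disjoint_graphs (fst X) (fst X')"
  shows "sgraph_union X X' \<in> specified T" "saturated (fst (sgraph_union X X')) (verts (fst X))"
    "srestr (sgraph_union X X') (verts (fst X)) = X"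
    "srestr (sgraph_union X X') (verts (fst (sgraph_union X X')) - verts (fst X)) = X'"
proof -
  obtain G i G' i' where XX: "X = (G, i)" "X' = (G', i')" by (cases X; cases X')
  note D = specifiedD[OF T X(1)[unfolded XX]] and D' = specifiedD[OF T X(2)[unfolded XX]]
  have d': "disjoint_graphs G G'" using d XX by simp
  note P = graph_union_parts[OF D(2) D'(2) d'] and p = pi0_graph_union[OF D(2) D'(2) d']
  define k where "k = (\<lambda>C. if C \<in> pi0 G then i C else i' C)"
  have u: "sgraph_union X X' = (graph_union G G', k)" by (simp add: XX sgraph_union_def k_def)
  have "restrict k (pi0 G) = i"
    by (rule extensionalityI[OF _ D(4)]) (auto simp: k_def)
  then show 1: "srestr (sgraph_union X X') (verts (fst X)) = X"
    unfolding u srestr_def by (simp add: XX P)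
  have "restrict k (pi0 G') = i'"
    by (rule extensionalityI[OF _ D'(4)]) (use p(2) in \<open>auto simp: k_def\<close>)
  then show 2: "srestr (sgraph_union X X') (verts (fst (sgraph_union X X')) - verts (fst X)) = X'"
    unfolding u srestr_def fst_conv snd_conv unfolding XX fst_conv P(5) by (simp add: P(4))
  show "saturated (fst (sgraph_union X X')) (verts (fst X))" using P(2) u[unfolded XX] by (simp add: XX)
  have "k \<in> extensional (pi0 (graph_union G G'))"
    using D(4) D'(4) by (auto simp: p(1) k_def extensional_def)
  then show "sgraph_union X X' \<in> specified T"
    unfolding u by (rule specified_from_parts[OF T P(1,2)]) (use 1 2 X P(5) in \<open>simp_all add: u[unfolded XX] XX\<close>)
qed

lemma disjoint_parts: "disjoint_graphs (component G U) (component G (verts G - U))"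
  by (auto simp: disjoint_graphs_def)

lemma graph_union_component:
  assumes G: "is_graph G" and U: "saturated G U"
  shows "graph_union (component G U) (component G (verts G - U)) = G"
proof -
  have U': "saturated G (verts G - U)" by (rule saturated_Diff[OF G saturated_verts[OF G] U])
  let ?H = "graph_union (component G U) (component G (verts G - U))"
  have H: "is_graph ?H"
    by (rule graph_union_parts(1)[OF is_graph_component[OF G U] is_graph_component[OF G U'] disjoint_parts])
  show ?thesis
  proof (rule is_graph_eqI[OF H G])
    show "verts ?H = verts G" using saturated_subset[OF U] by auto
    show h: "hedges ?H = hedges G" using is_graphD(5)[OF G] by auto
    fix e assume "e \<in> hedges ?H"
    then have e: "e \<in> hedges G" "bd G e \<in> verts G" using h is_graphD(5)[OF G] by auto
    show "sig ?H e = sig G e" "bd ?H e = bd G e" "htype ?H e = htype G e"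
      using e by (cases "bd G e \<in> U"; simp)+
  qed auto
qed

lemma sgraph_union_srestr:
  assumes T: "is_theory T" and X: "X \<in> specified T" and U: "saturated (fst X) U"
  shows "sgraph_union (srestr X U) (srestr X (verts (fst X) - U)) = X"
proof -
  obtain G i where XG: "X = (G, i)" by (cases X)
  note D = specifiedD[OF T X[unfolded XG]]
  have sU: "saturated G U" using U XG by simp
  have U': "saturated G (verts G - U)" by (rule saturated_Diff[OF D(2) saturated_verts[OF D(2)] sU])
  note p = pi0_component[OF D(2) sU] pi0_component[OF D(2) U']
  have "(\<lambda>C. if C \<in> pi0 (component G U) then restrict i (pi0 (component G U)) C
      else restrict i (pi0 (component G (verts G - U))) C) = i"
  proof
    fix C
    show "(if C \<in> pi0 (component G U) then restrict i (pi0 (component G U)) C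
      else restrict i (pi0 (component G (verts G - U))) C) = i C"
    proof (cases "C \<in> pi0 G")
      case True
      then show ?thesis using pi0_split[OF D(2) sU True] by (elim disjE) (simp_all add: p)
    next
      case False
      then show ?thesis using extensional_arb[OF D(4) False] by (simp add: p)
    qed
  qed
  then show ?thesis
    using graph_union_component[OF D(2) sU] by (simp add: XG srestr_def sgraph_union_def)
qed

lemma spec_subgraph_srestr:
  assumes T: "is_theory T" and sub: "spec_subgraph T Y X" and U: "saturated (fst X) U"
  shows "spec_subgraph T (srestr Y U) (srestr X U)"
proof -
  obtain g j G i where XY: "Y = (g, j)" "X = (G, i)" by (cases X; cases Y)
  note D = spec_subgraphD[OF T sub[unfolded XY]]
  have sU: "saturated G U" using U XY by simp
  have sg: "saturated g U" by (rule saturated_subgr[OF D(3) sU])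
  note g = subgrD(1)[OF D(3)] and G = subgrD(2)[OF D(3)]
  have "srestr (g, j) U \<in> specified T" "srestr (G, i) U \<in> specified T"
    using srestr_specified[OF T] D(1,2) sU sg by simp_all
  moreover have "j C = restrict i (pi0 (component G U)) C"
    if C: "C \<in> pi0 g" "C \<subseteq> U" "full_in (component g U) (component G U) C" for C
  proof -
    have f: "full_in g G C" using full_in_component[OF C(2) D(3)] C(3) by simp
    show ?thesis using D(4)[OF C(1) f] pi0_full_in[OF D(3) C(1) f] C(2) by (simp add: pi0_component[OF G sU])
  qed
  ultimately show ?thesis
    using subgr_component[OF D(3) sU] unfolding XY srestr_def fst_conv snd_conv spec_subgraph_iff[OF T]
    by (simp add: pi0_component[OF g sg])
qed

text \<open>A component of the glued subgraph lies on one side, so whether it is uncut, and whether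
  the specifications then agree, can be decided there.\<close>

lemma spec_subgraph_glue:
  assumes T: "is_theory T" and X: "X \<in> specified T" and U: "saturated (fst X) U"
    and Z: "spec_subgraph T Z (srestr X U)" and Z': "spec_subgraph T Z' (srestr X (verts (fst X) - U))"
  shows "spec_subgraph T (sgraph_union Z Z') X" "srestr (sgraph_union Z Z') U = Z"
    "srestr (sgraph_union Z Z') (verts (fst X) - U) = Z'"
proof -
  obtain z l z' l' G i where XZ: "Z = (z, l)" "Z' = (z', l')" "X = (G, i)" by (cases X; cases Z; cases Z')
  note D = specifiedD[OF T X[unfolded XZ]]
  have sU: "saturated G U" using U XZ by simp
  have U': "saturated G (verts G - U)" by (rule saturated_Diff[OF D(2) saturated_verts[OF D(2)] sU])
  have s: "srestr X V = (component G V, restrict i (pi0 (component G V)))" for V by (simp add: srestr_def XZ)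
  note E = spec_subgraphD[OF T Z[unfolded XZ(1) s]]
  note E' = spec_subgraphD[OF T Z'[unfolded XZ(2) s], unfolded XZ fst_conv]
  have d: "disjoint_graphs z z'"
    using disjoint_parts[of G U] subgrD(3,4)[OF E(3)] subgrD(3,4)[OF E'(3)] by (simp add: disjoint_graphs_def)
  have ZZ: "Z \<in> specified T" "Z' \<in> specified T" using E(1) E'(1) XZ by simp_all
  note P = sgraph_union_parts[OF T ZZ, unfolded XZ fst_conv, OF d]
  have vz: "verts z = U" "verts z' = verts G - U" using subgrD(3)[OF E(3)] subgrD(3)[OF E'(3)] by simp_all
  note gu = graph_union_parts[OF subgrD(1)[OF E(3)] subgrD(1)[OF E'(3)] d]
  let ?g = "graph_union z z'"
  have fu: "fst (sgraph_union (z, l) (z', l')) = ?g" by (simp add: sgraph_union_def)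
  define j where "j = snd (sgraph_union (z, l) (z', l'))"
  have u: "sgraph_union (z, l) (z', l') = (?g, j)" by (simp add: j_def sgraph_union_def)
  have vd: "verts (fst (sgraph_union (z, l) (z', l'))) - verts z = verts G - U"
    using gu(5) vz by (simp only: fu)
  show 2: "srestr (sgraph_union Z Z') U = Z" using P(3) by (simp add: XZ vz)
  show 3: "srestr (sgraph_union Z Z') (verts (fst X) - U) = Z'"
    using P(4) unfolding vd by (simp add: XZ)
  have sub: "subgr ?g G"
  proof -
    have eq: "graph_union (component G U) (component G (verts G - U)) = G" by (rule graph_union_component[OF D(2) sU])
    have "verts ?g = verts (graph_union (component G U) (component G (verts G - U)))"
      "hedges ?g = hedges (graph_union (component G U) (component G (verts G - U)))"
      "bd ?g = bd (graph_union (component G U) (component G (verts G - U)))"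
      "htype ?g = htype (graph_union (component G U) (component G (verts G - U)))"
      "vk ?g = vk (graph_union (component G U) (component G (verts G - U)))"
      using subgrD(3-7)[OF E(3)] subgrD(3-7)[OF E'(3)] by (simp_all add: graph_union_def cong: if_cong)
    moreover have "sig ?g e = e \<or> sig ?g e = sig (graph_union (component G U) (component G (verts G - U))) e"
      if "e \<in> hedges G" for e
      using subgrD(8)[OF E(3), of e] subgrD(8)[OF E'(3), of e] subgrD(4)[OF E(3)] subgrD(4)[OF E'(3)]
        that is_graphD(5)[OF D(2) that] by auto
    ultimately show ?thesis unfolding eq subgr_def using gu(1) D(2) by simp
  qed
  have r: "component ?g U = z" "component ?g (verts G - U) = z'" using gu(3,4) vz by simp_all
  have 4: "restrict j (pi0 z) = l" "restrict j (pi0 z') = l'"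
    using 2 3 unfolding XZ u srestr_def by (simp_all add: r)
  have "j C = i C" if C: "C \<in> pi0 ?g" "full_in ?g G C" for C
  proof -
    consider "C \<in> pi0 z" | "C \<in> pi0 z'"
      using C(1) pi0_graph_union(1)[OF subgrD(1)[OF E(3)] subgrD(1)[OF E'(3)] d] by blast
    then show ?thesis
    proof cases
      case 1
      then have CU: "C \<subseteq> U" using pi0_subset[OF subgrD(1)[OF E(3)]] vz by blast
      have "full_in z (component G U) C" using full_in_component[OF CU sub] C(2) r by simp
      from E(4)[OF 1 this] have "l C = i C"
        using pi0_full_in[OF sub C] CU by (simp add: pi0_component[OF D(2) sU])
      then show ?thesis using 1 4(1) by (metis restrict_apply')
    next
      case 2
      then have CU: "C \<subseteq> verts G - U" using pi0_subset[OF subgrD(1)[OF E'(3)]] vz by blast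
      have "full_in z' (component G (verts G - U)) C" using full_in_component[OF CU sub] C(2) r by simp
      from E'(4)[OF 2 this] have "l' C = i C"
        using pi0_full_in[OF sub C] CU by (simp add: pi0_component[OF D(2) U'])
      then show ?thesis using 2 4(2) by (metis restrict_apply')
    qed
  qed
  then show "spec_subgraph T (sgraph_union Z Z') X"
    using P(1) X sub unfolding XZ u spec_subgraph_iff[OF T] by simp
qed

text \<open>The two parts can be cut and specified independently. This product of index sets turns
  the convolution sum into a product of two sums in \<open>bsum_mult\<close>.\<close>

lemma bij_betw_srestr:
  assumes T: "is_theory T" and X: "X \<in> specified T" and U: "saturated (fst X) U"
  shows "bij_betw (\<lambda>Y. (srestr Y U, srestr Y (verts (fst X) - U))) {Y. spec_subgraph T Y X}
    ({Z. spec_subgraph T Z (srestr X U)} \<times> {Z. spec_subgraph T Z (srestr X (verts (fst X) - U))})"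
proof (rule bij_betwI[where g = "\<lambda>(Z, Z'). sgraph_union Z Z'"])
  have U': "saturated (fst X) (verts (fst X) - U)"
    using specified_is_graph[OF T X] U saturated_Diff saturated_verts by blast
  show "(\<lambda>Y. (srestr Y U, srestr Y (verts (fst X) - U))) \<in> {Y. spec_subgraph T Y X} \<rightarrow>
      {Z. spec_subgraph T Z (srestr X U)} \<times> {Z. spec_subgraph T Z (srestr X (verts (fst X) - U))}"
    using spec_subgraph_srestr[OF T _ U] spec_subgraph_srestr[OF T _ U'] by auto
  show "(\<lambda>(Z, Z'). sgraph_union Z Z') \<in> {Z. spec_subgraph T Z (srestr X U)}
      \<times> {Z. spec_subgraph T Z (srestr X (verts (fst X) - U))} \<rightarrow> {Y. spec_subgraph T Y X}"
    using spec_subgraph_glue(1)[OF T X U] by auto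
  show "(case (srestr Y U, srestr Y (verts (fst X) - U)) of (Z, Z') \<Rightarrow> sgraph_union Z Z') = Y"
    if "Y \<in> {Y. spec_subgraph T Y X}" for Y
  proof -
    have s: "subgr (fst Y) (fst X)" "Y \<in> specified T" using that spec_subgraph_subgr[OF T] spec_subgraph_specified[OF T] by auto
    then show ?thesis
      using sgraph_union_srestr[OF T s(2) saturated_subgr[OF s(1) U]] subgrD(3)[OF s(1)] by simp
  qed
  show "(\<lambda>Y. (srestr Y U, srestr Y (verts (fst X) - U))) (case ZZ of (Z, Z') \<Rightarrow> sgraph_union Z Z') = ZZ"
    if "ZZ \<in> {Z. spec_subgraph T Z (srestr X U)} \<times> {Z. spec_subgraph T Z (srestr X (verts (fst X) - U))}" for ZZ
    using that spec_subgraph_glue(2,3)[OF T X U] by (cases ZZ) auto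
qed

text \<open>Contraction commutes with splitting because \<open>U\<close> is a union of components of
  \<open>g\<close>: the labels of components inside \<open>U\<close> lie in \<open>U\<close>, and
  they are the vertices of the part of the contraction that belongs to \<open>U\<close>.\<close>

lemma scontract_srestr:
  assumes s: "subgr g G" and U: "saturated G U"
  shows "scontract (srestr (G, i) U) (srestr (g, j) U) = srestr (scontract (G, i) (g, j)) (U \<inter> rep g ` verts g)"
    "hedges (component (scontract_graph G (g, j)) (U \<inter> rep g ` verts g)) = external (component g U)"
proof -
  note g = subgrD(1)[OF s] and G = subgrD(2)[OF s]
  have sg: "saturated g U" by (rule saturated_subgr[OF s U])
  note sU = subgr_component[OF s U]
  let ?g = "component g U" and ?G = "component G U" and ?Q = "scontract_graph G (g, j)"
  let ?R = "U \<inter> rep g ` verts g"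
  define j' where "j' = restrict j (pi0 ?g)"
  have gg: "is_graph ?g" by (rule is_graph_component[OF g sg])
  have pg: "pi0 ?g = {C \<in> pi0 g. C \<subseteq> U}" by (rule pi0_component[OF g sg])
  have Uv: "U \<subseteq> verts g" by (rule saturated_subset[OF sg])
  have CU: "comp_of g v \<subseteq> U" if "v \<in> U" for v
    using pi0_minimal[OF g comp_of_in_pi0 sg self_in_comp_of that] that Uv by blast
  have co: "comp_of ?g v = comp_of g v" if "v \<in> U" for v
    by (rule comp_of_eq[OF gg]) (use that Uv CU in \<open>auto simp: pg comp_of_in_pi0 self_in_comp_of\<close>)
  then have r: "rep ?g v = rep g v" if "v \<in> U" for v using that by (simp add: rep_def)
  have rv: "rep ?g ` verts ?g = ?R"
  proof (intro subset_antisym subsetI)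
    fix x assume "x \<in> rep ?g ` verts ?g"
    then obtain v where v: "v \<in> U" "x = rep g v" using r by auto
    then show "x \<in> ?R" using rep_in_saturated_iff[OF g sg, of v] Uv by auto
  next
    fix x assume x: "x \<in> ?R"
    then obtain v where v: "v \<in> verts g" "x = rep g v" by blast
    then have "v \<in> U" using rep_in_saturated_iff[OF g sg, of v] x by blast
    then show "x \<in> rep ?g ` verts ?g" using r v by force
  qed
  have R: "saturated ?Q ?R" by (rule saturated_scontract_graph_Int[OF s U])
  note Qg = is_graph_scontract_graph[OF s, of j]
  note Q = scontract_graph_sel[OF g, where G = G and j = j] and L = scontract_graph_sel[OF gg, where G = ?G and j = j']
  have exU: "external ?g = {e \<in> external g. bd g e \<in> U}" by (rule external_component)
  have be: "bd ?Q e \<in> ?R \<longleftrightarrow> bd g e \<in> U" if "e \<in> external g" for e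
  proof -
    have "bd g e \<in> verts g" using that is_graphD(5)[OF g] by (simp add: external_def)
    then show ?thesis using Q(4)[OF that] rep_in_saturated_iff[OF g sg] by auto
  qed
  show h: "hedges (component ?Q ?R) = external ?g" using be by (auto simp: Q(2) exU)
  have eq: "scontract_graph ?G (?g, j') = component ?Q ?R"
  proof (rule is_graph_eqI[OF is_graph_scontract_graph[OF sU] is_graph_component[OF Qg R]])
    show "verts (scontract_graph ?G (?g, j')) = verts (component ?Q ?R)" using L(1) rv by simp
    show "hedges (scontract_graph ?G (?g, j')) = hedges (component ?Q ?R)" using L(2) h by simp
    fix e assume "e \<in> hedges (scontract_graph ?G (?g, j'))"
    then have e: "e \<in> external ?g" "e \<in> external g" "bd g e \<in> U" "e \<in> hedges ?Q" "bd ?Q e \<in> ?R" "e \<in> hedges g"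
      using L(2) exU be Q(2) by (auto simp: external_def)
    have eG: "e \<in> hedges G" "bd G e \<in> U" using e external_subgr(1)[OF s] subgrD(5)[OF s] by auto
    show "sig (scontract_graph ?G (?g, j')) e = sig (component ?Q ?R) e"
      using L(3)[OF e(1)] component_sel(3)[OF e(4,5)] Q(3)[OF e(2)] component_sel(3)[OF eG] by simp
    show "bd (scontract_graph ?G (?g, j')) e = bd (component ?Q ?R) e"
      using L(4)[OF e(1)] component_sel(4)[OF e(4,5)] Q(4)[OF e(2)] component_sel(4)[OF e(6,3)] r[OF e(3)] by simp
    show "htype (scontract_graph ?G (?g, j')) e = htype (component ?Q ?R) e"
      using L(5)[OF e(1)] component_sel(5)[OF e(4,5)] Q(5)[OF e(2)] component_sel(5)[OF eG] by simp
  next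
    fix v assume "v \<in> verts (scontract_graph ?G (?g, j'))"
    then have v: "v \<in> rep ?g ` verts ?g" "v \<in> ?R" using L(1) rv by auto
    then have vU: "v \<in> U" "v \<in> verts g" "v \<in> rep g ` verts g" using Uv by auto
    have "comp_of g v \<in> pi0 ?g" using CU[OF vU(1)] comp_of_in_pi0[OF vU(2)] by (simp add: pg)
    then show "vk (scontract_graph ?G (?g, j')) v = vk (component ?Q ?R) v"
      using L(6)[OF v(1)] component_sel(6)[OF v(2), of ?Q] Q(6)[OF vU(3)] co[OF vU(1)] by (simp add: j'_def)
  qed
  define i' where "i' = restrict i (pi0 ?G)"
  have "i' (comp_of ?G (Min D)) = restrict (\<lambda>C. i (comp_of G (Min C))) (pi0 ?Q) D" if D: "D \<in> pi0 (component ?Q ?R)" for D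
  proof -
    have D': "D \<in> pi0 ?Q" "D \<subseteq> U" using D by (auto simp: pi0_component[OF Qg R])
    obtain C where C: "C \<in> pi0 G" "D = C \<inter> rep g ` verts g" using D'(1) unfolding pi0_scontract_graph[OF s] by blast
    have m: "Min D = Min C" "Min C \<in> C" "Min C \<in> D"
      using Min_pi0_in_rep_image[OF s C(1)] C(2) Min_in_pi0[OF G C(1)] by auto
    have CU: "C \<subseteq> U" by (rule pi0_minimal[OF G C(1) U m(2)]) (use m D'(2) in blast)
    have CC: "C \<in> pi0 ?G" using C(1) CU by (simp add: pi0_component[OF G U])
    have "comp_of ?G (Min D) = C" "comp_of G (Min D) = C"
      using comp_of_eq[OF subgrD(2)[OF sU] CC m(2)] comp_of_eq[OF G C(1) m(2)] m(1) by simp_all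
    then show ?thesis using CC D'(1) by (simp add: i'_def)
  qed
  then have "restrict (\<lambda>D. i' (comp_of ?G (Min D))) (pi0 (component ?Q ?R))
      = restrict (restrict (\<lambda>C. i (comp_of G (Min C))) (pi0 ?Q)) (pi0 (component ?Q ?R))"
    by (rule restrict_ext)
  then show "scontract (srestr (G, i) U) (srestr (g, j) U) = srestr (scontract (G, i) (g, j)) ?R"
    by (simp add: srestr_def scontract_eq eq i'_def[symmetric] j'_def[symmetric])
qed

subsection \<open>Isomorphisms\<close>

definition graph_iso :: "(nat \<Rightarrow> nat) \<Rightarrow> (nat \<Rightarrow> nat) \<Rightarrow> 't fgraph \<Rightarrow> 't fgraph \<Rightarrow> bool" where
  "graph_iso f h G G' \<longleftrightarrow> is_graph G \<and> is_graph G'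
     \<and> bij_betw f (verts G) (verts G') \<and> bij_betw h (hedges G) (hedges G')
     \<and> (\<forall>e\<in>hedges G. h (sig G e) = sig G' (h e) \<and> f (bd G e) = bd G' (h e) \<and> htype G' (h e) = htype G e)
     \<and> (\<forall>v\<in>verts G. vk G' (f v) = vk G v)"

lemma sgraph_iso_iff:
  "is_graph G \<Longrightarrow> is_graph G' \<Longrightarrow>
    sgraph_iso f h (G, i) (G', i') \<longleftrightarrow> graph_iso f h G G' \<and> (\<forall>C\<in>pi0 G. i' (f ` C) = i C)"
  by (auto simp: sgraph_iso_def graph_iso_def)

lemma graph_isoD:
  assumes "graph_iso f h G G'"
  shows "is_graph G" "is_graph G'" "inj_on f (verts G)" "f ` verts G = verts G'"
    "inj_on h (hedges G)" "h ` hedges G = hedges G'"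
    "e \<in> hedges G \<Longrightarrow> sig G' (h e) = h (sig G e)" "e \<in> hedges G \<Longrightarrow> bd G' (h e) = f (bd G e)"
    "e \<in> hedges G \<Longrightarrow> htype G' (h e) = htype G e" "v \<in> verts G \<Longrightarrow> vk G' (f v) = vk G v"
    "e \<in> hedges G \<Longrightarrow> h e \<in> hedges G'" "v \<in> verts G \<Longrightarrow> f v \<in> verts G'"
  using assms by (auto simp: graph_iso_def bij_betw_def)

lemma graph_iso_mem_image:
  assumes I: "graph_iso f h G G'" and "U \<subseteq> verts G" "v \<in> verts G"
  shows "f v \<in> f ` U \<longleftrightarrow> v \<in> U"
  using graph_isoD(3)[OF I] assms(2,3) by (auto simp: inj_on_def)

lemma graph_iso_sym:
  assumes I: "graph_iso f h G G'"
  shows "graph_iso (inv_into (verts G) f) (inv_into (hedges G) h) G' G"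
proof -
  note D = graph_isoD[OF I] and G = is_graphD[OF graph_isoD(1)[OF I]]
  let ?f = "inv_into (verts G) f" and ?h = "inv_into (hedges G) h"
  have f: "?f (f v) = v" if "v \<in> verts G" for v using that D(3) by simp
  have h: "?h (h e) = e" if "e \<in> hedges G" for e using that D(5) by simp
  have "?h (sig G' e') = sig G (?h e') \<and> ?f (bd G' e') = bd G (?h e') \<and> htype G (?h e') = htype G' e'"
    if e': "e' \<in> hedges G'" for e'
  proof -
    obtain e where "e \<in> hedges G" "e' = h e" using e' D(6) by blast
    then show ?thesis using D(7,8,9) f h G(3,5) by simp
  qed
  moreover have "vk G (?f v') = vk G' v'" if v: "v' \<in> verts G'" for v'
  proof -
    obtain v where "v \<in> verts G" "v' = f v" using v D(4) by blast
    then show ?thesis using D(10) f by simp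
  qed
  moreover have "bij_betw ?f (verts G') (verts G)" "bij_betw ?h (hedges G') (hedges G)"
    using I unfolding graph_iso_def by (blast intro: bij_betw_inv_into)+
  ultimately show ?thesis
    unfolding graph_iso_def using D(1,2) by blast
qed

lemma graph_iso_cong:
  assumes I: "graph_iso f h G G'" and "\<And>v. v \<in> verts G \<Longrightarrow> f v = f' v" "\<And>e. e \<in> hedges G \<Longrightarrow> h e = h' e"
  shows "graph_iso f' h' G G'"
proof -
  note G = is_graphD[OF graph_isoD(1)[OF I]]
  have "bij_betw f' (verts G) (verts G')" "bij_betw h' (hedges G) (hedges G')"
    using I assms(2,3) bij_betw_cong[of "verts G" f f'] bij_betw_cong[of "hedges G" h h']
    by (auto simp: graph_iso_def)
  then show ?thesis using I assms(2,3) G(3,5) unfolding graph_iso_def by metis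
qed

lemma saturated_graph_iso:
  assumes I: "graph_iso f h G G'" and U: "U \<subseteq> verts G"
  shows "saturated G' (f ` U) \<longleftrightarrow> saturated G U"
proof -
  note D = graph_isoD[OF I] and G = is_graphD[OF graph_isoD(1)[OF I]]
  have "(\<forall>e'\<in>hedges G'. bd G' e' \<in> f ` U \<longrightarrow> bd G' (sig G' e') \<in> f ` U)
    \<longleftrightarrow> (\<forall>e\<in>hedges G. bd G' (h e) \<in> f ` U \<longrightarrow> bd G' (sig G' (h e)) \<in> f ` U)"
    unfolding D(6)[symmetric] by blast
  also have "\<dots> \<longleftrightarrow> (\<forall>e\<in>hedges G. bd G e \<in> U \<longrightarrow> bd G (sig G e) \<in> U)"
    using graph_iso_mem_image[OF I U] D(7,8) G(3,5) by simp
  finally show ?thesis using U D(4) unfolding saturated_def by blast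
qed

lemma pi0_graph_iso:
  assumes I: "graph_iso f h G G'" and C: "C \<in> pi0 G"
  shows "f ` C \<in> pi0 G'"
  unfolding pi0_char[OF graph_isoD(2)[OF I]]
proof (intro conjI allI impI)
  note D = graph_isoD[OF I]
  have CG: "C \<subseteq> verts G" by (rule pi0_subset[OF D(1) C])
  show "f ` C \<noteq> {}" using pi0_nonempty[OF D(1) C] by simp
  show "saturated G' (f ` C)" using saturated_graph_iso[OF I CG] pi0_saturated[OF D(1) C] by simp
  fix W assume W: "saturated G' W" "f ` C \<inter> W \<noteq> {}"
  define U where "U = {v \<in> verts G. f v \<in> W}"
  have "f ` U = W" using saturated_subset[OF W(1)] D(4) by (auto simp: U_def)
  then have "saturated G U" using saturated_graph_iso[OF I, of U] W(1) by (auto simp: U_def)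
  moreover obtain v where "v \<in> C" "v \<in> U" using W(2) CG by (auto simp: U_def)
  ultimately have "C \<subseteq> U" using pi0_minimal[OF D(1) C] by blast
  then show "f ` C \<subseteq> W" by (auto simp: U_def)
qed

lemma pi0_graph_isoE:
  assumes I: "graph_iso f h G G'" and "C' \<in> pi0 G'"
  obtains C where "C \<in> pi0 G" "C' = f ` C"
proof -
  let ?g = "inv_into (verts G) f"
  note D = graph_isoD[OF I]
  have "?g ` C' \<in> pi0 G" by (rule pi0_graph_iso[OF graph_iso_sym[OF I] assms(2)])
  moreover have "f ` ?g ` C' = C'"
    using pi0_subset[OF D(2) assms(2)] D(4) by (force simp: image_image f_inv_into_f)
  ultimately show thesis using that by metis
qed

lemma comp_of_graph_iso:
  assumes I: "graph_iso f h G G'" and v: "v \<in> verts G"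
  shows "comp_of G' (f v) = f ` comp_of G v"
  by (rule comp_of_eq[OF graph_isoD(2)[OF I] pi0_graph_iso[OF I comp_of_in_pi0[OF v]]])
    (use self_in_comp_of[OF v] in blast)

lemma external_graph_iso:
  assumes I: "graph_iso f h G G'" and e: "e \<in> hedges G"
  shows "h e \<in> external G' \<longleftrightarrow> e \<in> external G"
proof -
  note D = graph_isoD[OF I]
  have "h (sig G e) = h e \<longleftrightarrow> sig G e = e"
    using D(5) e is_graphD(3)[OF D(1) e] by (auto simp: inj_on_def)
  then show ?thesis using D(7,11) e by (simp add: external_def)
qed

lemma external_graph_iso_image:
  assumes I: "graph_iso f h G G'"
  shows "external G' = h ` external G"
proof (intro subset_antisym subsetI)
  fix e' assume e': "e' \<in> external G'"
  then obtain e where e: "e \<in> hedges G" "e' = h e" using graph_isoD(6)[OF I] by (auto simp: external_def)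
  then show "e' \<in> h ` external G" using external_graph_iso[OF I e(1)] e' by blast
next
  fix e' assume "e' \<in> h ` external G"
  then obtain e where e: "e \<in> external G" "e' = h e" by blast
  then have "e \<in> hedges G" by (simp add: external_def)
  then show "e' \<in> external G'" using external_graph_iso[OF I] e by simp
qed

lemma vtype_graph_iso:
  assumes I: "graph_iso f h G G'" and v: "v \<in> verts G"
  shows "vtype G' (f v) = vtype G v"
proof
  fix x
  note D = graph_isoD[OF I] and G = is_graphD[OF graph_isoD(1)[OF I]]
  have "f (bd G e) = f v \<longleftrightarrow> bd G e = v" if "e \<in> hedges G" for e
    using D(3) G(5)[OF that] v by (auto simp: inj_on_def)
  then have "{e \<in> star G' (f v). htype G' e = x} = h ` {e \<in> star G v. htype G e = x}"
    unfolding star_def D(6)[symmetric] using D(8,9) by auto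
  moreover have "inj_on h {e \<in> star G v. htype G e = x}"
    by (rule inj_on_subset[OF D(5)]) (auto simp: star_def)
  ultimately show "vtype G' (f v) x = vtype G v x" by (simp add: vtype_def card_image)
qed

lemma ext_type_graph_iso:
  assumes I: "graph_iso f h G G'" and C: "C \<subseteq> verts G"
  shows "ext_type G' (f ` C) = ext_type G C"
proof
  fix x
  note D = graph_isoD[OF I] and G = is_graphD[OF graph_isoD(1)[OF I]]
  have "bd G' (h e) \<in> f ` C \<longleftrightarrow> bd G e \<in> C" if "e \<in> external G" for e
    using graph_iso_mem_image[OF I C] G(5) D(8) that by (simp add: external_def)
  moreover have "htype G' (h e) = htype G e" if "e \<in> external G" for e using that D(9) by (simp add: external_def)
  ultimately have "{e \<in> external G. bd G' (h e) \<in> f ` C \<and> htype G' (h e) = x}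
      = {e \<in> external G. bd G e \<in> C \<and> htype G e = x}"
    by (simp cong: conj_cong)
  moreover have "{e \<in> external G'. bd G' e \<in> f ` C \<and> htype G' e = x}
      = h ` {e \<in> external G. bd G' (h e) \<in> f ` C \<and> htype G' (h e) = x}"
    unfolding external_graph_iso_image[OF I] by blast
  ultimately have "{e \<in> external G'. bd G' e \<in> f ` C \<and> htype G' e = x}
      = h ` {e \<in> external G. bd G e \<in> C \<and> htype G e = x}"
    by simp
  moreover have "inj_on h {e \<in> external G. bd G e \<in> C \<and> htype G e = x}"
    by (rule inj_on_subset[OF D(5)]) (auto simp: external_def)
  ultimately show "ext_type G' (f ` C) x = ext_type G C x" by (simp add: ext_type_def card_image)
qed

lemma bridgeless_graph_iso:
  assumes I: "graph_iso f h G G'" and B: "bridgeless G"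
  shows "bridgeless G'"
  unfolding bridgeless_def
proof (intro ballI allI impI)
  note D = graph_isoD[OF I] and G = is_graphD[OF graph_isoD(1)[OF I]]
  fix e' W
  assume e': "e' \<in> hedges G'" "sig G' e' \<noteq> e'" and W: "W \<subseteq> verts G'"
    "\<forall>f\<in>hedges G'. f \<noteq> e' \<longrightarrow> f \<noteq> sig G' e' \<longrightarrow> bd G' f \<in> W \<longrightarrow> bd G' (sig G' f) \<in> W" "bd G' e' \<in> W"
  obtain e where e: "e \<in> hedges G" "e' = h e" using e'(1) D(6) by blast
  have "bd G (sig G e) \<in> {v \<in> verts G. f v \<in> W}"
  proof (rule bridgelessD[OF B e(1)])
    show "sig G e \<noteq> e" using e' e D(7) by auto
    show "bd G e \<in> {v \<in> verts G. f v \<in> W}" using W(3) e D(8) G(5) by simp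
    fix k assume k: "k \<in> hedges G" "k \<noteq> e" "k \<noteq> sig G e" "bd G k \<in> {v \<in> verts G. f v \<in> W}"
    have n: "h k \<noteq> h e" "h k \<noteq> h (sig G e)" using k(1-3) D(5) e(1) G(3) by (auto simp: inj_on_def)
    have "bd G' (h k) \<in> W" using k D(8) by simp
    then have "bd G' (sig G' (h k)) \<in> W"
      using W(2)[rule_format, OF D(11)[OF k(1)]] n D(7)[OF e(1)] e(2) by simp
    then show "bd G (sig G k) \<in> {v \<in> verts G. f v \<in> W}" using D(7,8) k(1) G(3,5) by simp
  qed auto
  then show "bd G' (sig G' e') \<in> W" using D(7,8) e G(3) by simp
qed

lemma isolated_graph_iso:
  assumes I: "graph_iso f h G G'" and v: "v \<in> verts G" and iso: "isolated G' (f v)"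
  shows "isolated G v"
proof -
  note D = graph_isoD[OF I]
  have "sig G e = e" if "e \<in> hedges G" "bd G e = v" for e
  proof -
    have "bd G' (h e) = f v" using D(8) that by simp
    then have "sig G' (h e) = h e" using iso D(11)[OF that(1)] by (simp add: isolated_def)
    then have "h (sig G e) = h e" using D(7)[OF that(1)] by simp
    then show ?thesis using D(5) that is_graphD(3)[OF D(1)] by (auto simp: inj_on_def)
  qed
  then show ?thesis using v by (simp add: isolated_def)
qed

lemma specified_graph_iso:
  assumes T: "is_theory T" and X: "(G, i) \<in> specified T" and I: "graph_iso f h G G'"
    and i': "i' \<in> extensional (pi0 G')" "\<And>C. C \<in> pi0 G \<Longrightarrow> i' (f ` C) = i C"
  shows "(G', i') \<in> specified T"
  unfolding specified_iff[OF T] graph_of_def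
proof (intro conjI ballI allI impI)
  note D = graph_isoD[OF I] and S = specifiedD[OF T X]
  show "is_graph G'" by (rule D(2))
  show "htype G' e' \<in> etypes T" if e': "e' \<in> hedges G'" for e'
  proof -
    obtain e where "e \<in> hedges G" "e' = h e" using e' D(6) by blast
    then show ?thesis using D(9) S(1) by (simp add: graph_of_def)
  qed
  show "(vtype G' v', vk G' v') \<in> rvtypes T" if v': "v' \<in> verts G'" for v'
  proof -
    obtain v where "v \<in> verts G" "v' = f v" using v' D(4) by blast
    then show ?thesis using vtype_graph_iso[OF I] D(10) S(1) by (simp add: graph_of_def)
  qed
  show "bridgeless G'" by (rule bridgeless_graph_iso[OF I S(3)])
  show "(ext_type G' C', i' C') \<in> rvtypes T" if C': "C' \<in> pi0 G'" for C'
  proof -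
    obtain C where C: "C \<in> pi0 G" "C' = f ` C" using pi0_graph_isoE[OF I C'] .
    then show ?thesis using ext_type_graph_iso[OF I pi0_subset[OF D(1) C(1)]] i'(2) S(5) by simp
  qed
  show "i' {v'} = vk G' v'" if v': "isolated G' v'" for v'
  proof -
    obtain v where v: "v \<in> verts G" "v' = f v" using v' D(4) by (auto simp: isolated_def)
    then have iso: "isolated G v" using isolated_graph_iso[OF I v(1)] v' by simp
    then show ?thesis using i'(2)[OF isolated_pi0[OF D(1) iso]] S(6)[OF iso] D(10) v by simp
  qed
qed (rule i'(1))

lemma full_in_graph_iso:
  assumes I: "graph_iso f h g g'" and IG: "graph_iso f h G G'" and s: "subgr g G" and s': "subgr g' G'"
    and C: "C \<subseteq> verts G" and full: "full_in g' G' (f ` C)"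
  shows "full_in g G C"
  unfolding full_in_def
proof (intro ballI impI)
  note D = graph_isoD[OF I] and DG = graph_isoD[OF IG]
  fix e assume e: "e \<in> hedges G" "bd G e \<in> C"
  then have "bd G' (h e) \<in> f ` C" using DG(8) by simp
  then have "sig g' (h e) = sig G' (h e)" using full e(1) DG(11) by (simp add: full_in_def)
  then have "h (sig g e) = h (sig G e)" using D(7) DG(7) e(1) subgrD(4)[OF s] by simp
  then show "sig g e = sig G e"
    using DG(5) e(1) is_graphD(3)[OF DG(1)] is_graphD(3)[OF subgrD(1)[OF s]] subgrD(4)[OF s]
    by (auto simp: inj_on_def)
qed

text \<open>The involution of the subgraph is conjugated by \<open>h\<close>, and its specification
  is carried along \<open>f\<close>.\<close>

lemma spec_subgraph_transport:
  assumes T: "is_theory T" and X': "X' \<in> specified T" and I: "sgraph_iso f h X X'" and Y: "spec_subgraph T Y X"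
  obtains Y' where "spec_subgraph T Y' X'" "sgraph_iso f h Y Y'"
proof -
  obtain g j G i G' i' where XY: "Y = (g, j)" "X = (G, i)" "X' = (G', i')" by (cases X; cases Y; cases X')
  note D = spec_subgraphD[OF T Y[unfolded XY]]
  note s = D(3)
  note g = subgrD(1)[OF s] and G = subgrD(2)[OF s] and G' = specifiedD(2)[OF T X'[unfolded XY]]
  have IG: "graph_iso f h G G'" and ii: "\<And>C. C \<in> pi0 G \<Longrightarrow> i' (f ` C) = i C"
    using I sgraph_iso_iff[OF G G'] XY by auto
  note DG = graph_isoD[OF IG]
  let ?h = "inv_into (hedges G) h" and ?f = "inv_into (verts G) f"
  define g' where "g' = G'\<lparr>sig := (\<lambda>e'. if e' \<in> hedges G' then h (sig g (?h e')) else undefined)\<rparr>"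
  have sel: "verts g' = verts G'" "hedges g' = hedges G'" "bd g' = bd G'" "htype g' = htype G'" "vk g' = vk G'"
    by (simp_all add: g'_def)
  have sh: "sig g e \<in> hedges G" if "e \<in> hedges G" for e using that is_graphD(3)[OF g] subgrD(4)[OF s] by simp
  have sg: "sig g' (h e) = h (sig g e)" if "e \<in> hedges G" for e
    using that DG(5,11) by (simp add: g'_def)
  have ssub: "sig g' e' = e' \<or> sig g' e' = sig G' e'" if e': "e' \<in> hedges G'" for e'
  proof -
    obtain e where e: "e \<in> hedges G" "e' = h e" using e' DG(6) by blast
    then show ?thesis using sg subgrD(8)[OF s, of e] DG(7) by auto
  qed
  have gg: "is_graph g'"
    unfolding is_graph_def
  proof (intro conjI ballI)
    show "sig g' \<in> hedges g' \<rightarrow>\<^sub>E hedges g'"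
    proof (rule PiE_I)
      show "sig g' e' \<in> hedges g'" if "e' \<in> hedges g'" for e'
        unfolding sel(2)
      proof -
        have e': "e' \<in> hedges G'" using that sel(2) by simp
        show "sig g' e' \<in> hedges G'" using ssub[OF e'] is_graphD(3)[OF G' e'] e' by (elim disjE) simp_all
      qed
      show "sig g' e' = undefined" if "e' \<notin> hedges g'" for e' using that by (simp add: g'_def)
    qed
    fix e' assume "e' \<in> hedges g'"
    then obtain e where e: "e \<in> hedges G" "e' = h e" using sel(2) DG(6) by blast
    have eg: "e \<in> hedges g" using e(1) subgrD(4)[OF s] by simp
    show "sig g' (sig g' e') = e'"
      unfolding e(2) sg[OF e(1)] sg[OF sh[OF e(1)]] is_graphD(4)[OF g eg] ..
    show "htype g' (sig g' e') = htype g' e'"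
      unfolding e(2) sg[OF e(1)] sel(4) DG(9)[OF e(1)] DG(9)[OF sh[OF e(1)]]
      using is_graphD(6)[OF g eg] subgrD(6)[OF s] by simp
  qed (use G' in \<open>simp_all add: is_graph_def sel\<close>)
  have s': "subgr g' G'" unfolding subgr_def using gg G' sel ssub by simp
  have Ig: "graph_iso f h g g'"
    using IG subgrD[OF s] sg gg sel unfolding graph_iso_def by simp
  define j' where "j' = restrict (\<lambda>C'. j (?f ` C')) (pi0 g')"
  have jj: "j' (f ` C) = j C" if C: "C \<in> pi0 g" for C
  proof -
    have "?f ` f ` C = C"
      using pi0_subset[OF g C] DG(3) subgrD(3)[OF s] by (force simp: image_image)
    then show ?thesis using pi0_graph_iso[OF Ig C] by (simp add: j'_def)
  qed
  have Y': "(g', j') \<in> specified T"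
    by (rule specified_graph_iso[OF T D(1) Ig]) (simp_all add: jj, simp add: j'_def)
  have "j' C' = i' C'" if C': "C' \<in> pi0 g'" "full_in g' G' C'" for C'
  proof -
    obtain C where C: "C \<in> pi0 g" "C' = f ` C" using pi0_graph_isoE[OF Ig C'(1)] .
    have "full_in g G C"
      by (rule full_in_graph_iso[OF Ig IG s s']) (use C C' pi0_subset[OF g C(1)] subgrD(3)[OF s] in simp_all)
    then show ?thesis using D(4)[OF C(1)] pi0_full_in[OF s C(1)] ii jj[OF C(1)] C(2) by simp
  qed
  then have "spec_subgraph T (g', j') X'"
    using Y' X' s' unfolding XY spec_subgraph_iff[OF T] by simp
  moreover have "sgraph_iso f h Y (g', j')" using Ig jj sgraph_iso_iff[OF g gg] XY by simp
  ultimately show thesis using that by blast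
qed

lemma sgraph_iso_sym:
  assumes "is_graph (fst X)" "is_graph (fst X')" and I: "sgraph_iso f h X X'"
  shows "sgraph_iso (inv_into (verts (fst X)) f) (inv_into (hedges (fst X)) h) X' X"
proof -
  obtain G i G' i' where XX: "X = (G, i)" "X' = (G', i')" by (cases X; cases X')
  have G: "is_graph G" "is_graph G'" using assms XX by auto
  have IG: "graph_iso f h G G'" and ii: "\<And>C. C \<in> pi0 G \<Longrightarrow> i' (f ` C) = i C"
    using I sgraph_iso_iff[OF G] XX by auto
  have "i (inv_into (verts G) f ` C') = i' C'" if C': "C' \<in> pi0 G'" for C'
  proof -
    obtain C where C: "C \<in> pi0 G" "C' = f ` C" using pi0_graph_isoE[OF IG C'] .
    have "inv_into (verts G) f ` f ` C = C"
      using pi0_subset[OF G(1) C(1)] graph_isoD(3)[OF IG] by (force simp: image_image)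
    then show ?thesis using ii C by simp
  qed
  then show ?thesis using graph_iso_sym[OF IG] sgraph_iso_iff[OF G(2,1)] XX by simp
qed

text \<open>The involution and the specification of the image are determined by those of
  \<open>Y\<close>. This makes the choice in \<open>bij_betw_sgraph_iso\<close> a bijection.\<close>

lemma sgraph_iso_subgraph_unique:
  assumes T: "is_theory T" and Y: "Y \<in> specified T" and Y1: "spec_subgraph T Y1 X'" and Y2: "spec_subgraph T Y2 X'"
    and I1: "sgraph_iso f h Y Y1" and I2: "sgraph_iso f h Y Y2"
  shows "Y1 = Y2"
proof -
  obtain g j g1 j1 g2 j2 G' i' where XY: "Y = (g, j)" "Y1 = (g1, j1)" "Y2 = (g2, j2)" "X' = (G', i')"
    by (cases Y; cases Y1; cases Y2; cases X')
  note D1 = spec_subgraphD[OF T Y1[unfolded XY]] and D2 = spec_subgraphD[OF T Y2[unfolded XY]]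
  note g = specifiedD(2)[OF T Y[unfolded XY]] and S1 = specifiedD[OF T D1(1)] and S2 = specifiedD[OF T D2(1)]
  have I: "graph_iso f h g g1" "\<And>C. C \<in> pi0 g \<Longrightarrow> j1 (f ` C) = j C"
    "graph_iso f h g g2" "\<And>C. C \<in> pi0 g \<Longrightarrow> j2 (f ` C) = j C"
    using I1 I2 sgraph_iso_iff[OF g S1(2)] sgraph_iso_iff[OF g S2(2)] XY by auto
  have gg: "g1 = g2"
  proof (rule subgr_eqI[OF D1(3) D2(3)])
    fix e' assume "e' \<in> hedges G'"
    then obtain e where "e \<in> hedges g" "e' = h e" using graph_isoD(6)[OF I(1)] subgrD(4)[OF D1(3)] by blast
    then show "sig g1 e' = sig g2 e'" using graph_isoD(7)[OF I(1)] graph_isoD(7)[OF I(3)] by simp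
  qed
  have "j1 = j2"
  proof (rule extensionalityI[OF S1(4) S2(4)[folded gg]])
    fix C' assume "C' \<in> pi0 g1"
    then obtain C where "C \<in> pi0 g" "C' = f ` C" using pi0_graph_isoE[OF I(1)] by blast
    then show "j1 C' = j2 C'" using I(2,4) by simp
  qed
  with gg show ?thesis by (simp add: XY)
qed

text \<open>The double inverses agree with \<open>f\<close> and \<open>h\<close> on the vertices and
  half-edges of \<open>Y\<close>, and being an isomorphism depends on these values only.\<close>

lemma sgraph_iso_inv_inv:
  assumes Y: "is_graph (fst Y)" "is_graph (fst Y')" and V: "bij_betw f V V'" "bij_betw h E E'"
    and v: "verts (fst Y') = V'" "hedges (fst Y') = E'" "verts (fst Y) = V" "hedges (fst Y) = E"
    and I: "sgraph_iso (inv_into V f) (inv_into E h) Y' Y"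
  shows "sgraph_iso f h Y Y'"
proof -
  have I': "sgraph_iso (inv_into V' (inv_into V f)) (inv_into E' (inv_into E h)) Y Y'"
    using sgraph_iso_sym[OF Y(2,1) I] v by simp
  obtain g j g' j' where YY: "Y = (g, j)" "Y' = (g', j')" by (cases Y; cases Y')
  have G: "is_graph g" "is_graph g'" using Y YY by simp_all
  have e: "inv_into V' (inv_into V f) v = f v" if "v \<in> V" for v by (rule inv_into_inv_into_eq[OF V(1) that])
  have e': "inv_into E' (inv_into E h) v = h v" if "v \<in> E" for v by (rule inv_into_inv_into_eq[OF V(2) that])
  have "graph_iso f h g g'"
    by (rule graph_iso_cong[of "inv_into V' (inv_into V f)" "inv_into E' (inv_into E h)"])
      (use I' sgraph_iso_iff[OF G] YY e e' v in auto)
  moreover have "j' (f ` C) = j C" if C: "C \<in> pi0 g" for C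
  proof -
    have "inv_into V' (inv_into V f) ` C = f ` C"
      by (rule image_cong) (use pi0_subset[OF G(1) C] v YY e in auto)
    then show ?thesis using I' sgraph_iso_iff[OF G] YY C by auto
  qed
  ultimately show ?thesis using sgraph_iso_iff[OF G] YY by simp
qed

text \<open>\<open>f\<close> need not respect the order of labels, so it may fail to send the label
  of a component to the label of its image. The induced vertex map therefore replaces
  \<open>f v\<close> by the least vertex of its component.\<close>

lemma scontract_graph_iso:
  assumes T: "is_theory T" and I: "sgraph_iso f h X X'" and IY: "sgraph_iso f h Y Y'"
    and Y: "spec_subgraph T Y X" and Y': "spec_subgraph T Y' X'"
  shows "sgraph_iso (\<lambda>v. rep (fst Y') (f v)) h (scontract X Y) (scontract X' Y')"
proof -
  obtain g j G i g' j' G' i' where XY: "Y = (g, j)" "X = (G, i)" "Y' = (g', j')" "X' = (G', i')"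
    by (cases X; cases Y; cases X'; cases Y')
  note D = spec_subgraphD[OF T Y[unfolded XY]] and D' = spec_subgraphD[OF T Y'[unfolded XY]]
  note s = D(3) and s' = D'(3)
  note g = subgrD(1)[OF s] and G = subgrD(2)[OF s] and g' = subgrD(1)[OF s'] and G' = subgrD(2)[OF s']
  have IG: "graph_iso f h G G'" and ii: "\<And>C. C \<in> pi0 G \<Longrightarrow> i' (f ` C) = i C"
    using I sgraph_iso_iff[OF G G'] XY by auto
  have Ig: "graph_iso f h g g'" and jj: "\<And>C. C \<in> pi0 g \<Longrightarrow> j' (f ` C) = j C"
    using IY sgraph_iso_iff[OF g g'] XY by auto
  note DG = graph_isoD[OF IG] and Dg = graph_isoD[OF Ig]
  let ?Q = "scontract_graph G (g, j)" and ?Q' = "scontract_graph G' (g', j')"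
  note Q = scontract_graph_sel[OF g, where G = G and j = j] and Q' = scontract_graph_sel[OF g', where G = G' and j = j']
  note QG = is_graph_scontract_graph[OF s, of j] is_graph_scontract_graph[OF s', of j']
  let ?f = "\<lambda>v. rep g' (f v)"
  have frep: "?f (rep g v) = rep g' (f v)" if v: "v \<in> verts g" for v
  proof -
    have r: "rep g v \<in> comp_of g v" "rep g v \<in> verts g" using rep_in[OF g v] by auto
    then have "f (rep g v) \<in> comp_of g' (f v)" using comp_of_graph_iso[OF Ig v] by blast
    then show ?thesis using rep_eq_iff[OF g' Dg(12)[OF r(2)] Dg(12)[OF v]] by simp
  qed
  have inj: "rep g' (f v) = rep g' (f w) \<longleftrightarrow> rep g v = rep g w" if v: "v \<in> verts g" "w \<in> verts g" for v w
  proof -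
    have "comp_of g w \<subseteq> verts g" by (rule pi0_subset[OF g comp_of_in_pi0[OF v(2)]])
    then have "f v \<in> f ` comp_of g w \<longleftrightarrow> v \<in> comp_of g w" by (rule graph_iso_mem_image[OF Ig _ v(1)])
    then show ?thesis
      using rep_eq_iff[OF g' Dg(12)[OF v(1)] Dg(12)[OF v(2)]] rep_eq_iff[OF g v] comp_of_graph_iso[OF Ig v(2)] by simp
  qed
  have im: "?f ` rep g ` verts g = rep g' ` verts g'"
    unfolding image_image Dg(4)[symmetric] using frep by (rule image_cong[OF refl])
  have "graph_iso ?f h ?Q ?Q'"
    unfolding graph_iso_def
  proof (intro conjI ballI)
    show "bij_betw ?f (verts ?Q) (verts ?Q')"
      unfolding bij_betw_def Q(1) Q'(1)
    proof
      show "inj_on ?f (rep g ` verts g)"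
      proof (rule inj_onI)
        fix x y assume "x \<in> rep g ` verts g" "y \<in> rep g ` verts g" and eq: "?f x = ?f y"
        then obtain v w where "v \<in> verts g" "x = rep g v" "w \<in> verts g" "y = rep g w" by blast
        then show "x = y" using eq frep inj by simp
      qed
    qed (rule im)
    show "bij_betw h (hedges ?Q) (hedges ?Q')"
      unfolding bij_betw_def Q(2) Q'(2) external_graph_iso_image[OF Ig]
      using Dg(5) by (auto simp: external_def intro: inj_on_subset)
    fix e assume "e \<in> hedges ?Q"
    then have e: "e \<in> external g" "e \<in> hedges G" "e \<in> hedges g" "h e \<in> external g'"
      using Q(2) external_subgr(1)[OF s] external_graph_iso[OF Ig] by (auto simp: external_def)
    show "h (sig ?Q e) = sig ?Q' (h e)" using Q(3)[OF e(1)] Q'(3)[OF e(4)] DG(7)[OF e(2)] by simp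
    show "htype ?Q' (h e) = htype ?Q e" using Q(5)[OF e(1)] Q'(5)[OF e(4)] DG(9)[OF e(2)] by simp
    show "?f (bd ?Q e) = bd ?Q' (h e)"
      using Q(4)[OF e(1)] Q'(4)[OF e(4)] Dg(8)[OF e(3)] frep is_graphD(5)[OF g e(3)] by simp
  next
    fix v assume "v \<in> verts ?Q"
    then obtain u where u: "u \<in> verts g" "v = rep g u" using Q(1) by auto
    have v: "v \<in> rep g ` verts g" "v \<in> verts g" using u rep_in(2)[OF g] by auto
    have f1: "?f v \<in> rep g' ` verts g'" using im v(1) by blast
    have "comp_of g' (?f v) = f ` comp_of g v"
      using rep_in(3)[OF g' Dg(12)[OF v(2)]] comp_of_graph_iso[OF Ig v(2)] by simp
    then show "vk ?Q' (?f v) = vk ?Q v"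
      using Q(6)[OF v(1)] Q'(6)[OF f1] jj comp_of_in_pi0[OF v(2)] by simp
  qed (rule QG)+
  moreover have "snd (scontract (G', i') (g', j')) (?f ` D) = snd (scontract (G, i) (g, j)) D" if D: "D \<in> pi0 ?Q" for D
  proof -
    obtain C where C: "C \<in> pi0 G" "D = C \<inter> rep g ` verts g" using D unfolding pi0_scontract_graph[OF s] by blast
    have C': "f ` C \<in> pi0 G'" by (rule pi0_graph_iso[OF IG C(1)])
    have CG: "C \<subseteq> verts g" using pi0_subset[OF G C(1)] subgrD(3)[OF s] by simp
    have sC: "saturated g C" by (rule saturated_subgr[OF s pi0_saturated[OF G C(1)]])
    have sC': "saturated g' (f ` C)" by (rule saturated_subgr[OF s' pi0_saturated[OF G' C']])
    have "?f ` D = f ` C \<inter> rep g' ` verts g'"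
    proof (intro subset_antisym subsetI)
      fix x assume "x \<in> ?f ` D"
      then obtain d where d: "d \<in> C" "x = ?f d" using C(2) by blast
      then have dv: "d \<in> verts g" using CG by blast
      show "x \<in> f ` C \<inter> rep g' ` verts g'"
        using rep_in_saturated_iff[OF g' sC' Dg(12)[OF dv]] d Dg(12)[OF dv] by blast
    next
      fix x assume x: "x \<in> f ` C \<inter> rep g' ` verts g'"
      then obtain c where c: "c \<in> C" "x = f c" by blast
      have cv: "c \<in> verts g" using c CG by blast
      have "rep g' x = x" using x rep_in(4)[OF g'] by auto
      then have "x = ?f (rep g c)" using c frep[OF cv] by simp
      moreover have "rep g c \<in> D" using rep_in_saturated_iff[OF g sC cv] c cv C(2) by blast
      ultimately show "x \<in> ?f ` D" by blast
    qed
    then show ?thesis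
      using snd_scontract[OF s' C', of i' j'] snd_scontract[OF s C(1), of i j] ii[OF C(1)] C(2) by simp
  qed
  ultimately show ?thesis
    using sgraph_iso_iff[OF QG, of ?f h "snd (scontract (G, i) (g, j))" "snd (scontract (G', i') (g', j'))"]
    by (simp add: XY scontract_eq)
qed

lemma bij_betw_sgraph_iso:
  assumes T: "is_theory T" and X: "X \<in> specified T" "X' \<in> specified T" and I: "sgraph_iso f h X X'"
  obtains \<beta> where "bij_betw \<beta> {Y. spec_subgraph T Y X} {Y'. spec_subgraph T Y' X'}"
    "\<And>Y. spec_subgraph T Y X \<Longrightarrow> sgraph_iso f h Y (\<beta> Y)" "\<beta> X = X'"
proof -
  have gr: "is_graph (fst X)" "is_graph (fst X')" using specified_is_graph[OF T] X by auto
  define \<beta> where "\<beta> Y = (SOME Y'. spec_subgraph T Y' X' \<and> sgraph_iso f h Y Y')" for Y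
  have b: "spec_subgraph T (\<beta> Y) X' \<and> sgraph_iso f h Y (\<beta> Y)" if Y: "spec_subgraph T Y X" for Y
  proof -
    obtain Y' where "spec_subgraph T Y' X' \<and> sgraph_iso f h Y Y'"
      using spec_subgraph_transport[OF T X(2) I Y] by blast
    then show ?thesis unfolding \<beta>_def by (rule someI)
  qed
  have sp: "Y \<in> specified T" if "spec_subgraph T Y X" for Y X using spec_subgraph_specified[OF T that] by blast
  have uniq: "\<beta> Y = Y'" if "spec_subgraph T Y X" "spec_subgraph T Y' X'" "sgraph_iso f h Y Y'" for Y Y'
    using sgraph_iso_subgraph_unique[OF T sp[OF that(1)] _ that(2) _ that(3)] b[OF that(1)] by blast
  let ?f = "inv_into (verts (fst X)) f" and ?h = "inv_into (hedges (fst X)) h"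
  note I' = sgraph_iso_sym[OF gr I]
  have bij: "bij_betw f (verts (fst X)) (verts (fst X'))" "bij_betw h (hedges (fst X)) (hedges (fst X'))"
    using I by (auto simp: sgraph_iso_def split_beta)
  have vh: "verts (fst Y) = verts (fst X)" "hedges (fst Y) = hedges (fst X)" "is_graph (fst Y)"
    if "spec_subgraph T Y X" for Y X
    using spec_subgraph_subgr[OF T that] by (auto simp: subgr_def)
  have "\<exists>Y. spec_subgraph T Y X \<and> \<beta> Y = Y'" if Y': "spec_subgraph T Y' X'" for Y'
  proof -
    obtain Y where Y: "spec_subgraph T Y X" "sgraph_iso ?f ?h Y' Y"
      using spec_subgraph_transport[OF T X(1) I' Y'] by blast
    have "sgraph_iso f h Y Y'"
      by (rule sgraph_iso_inv_inv[OF _ _ bij _ _ _ _ Y(2)]) (use vh[OF Y(1)] vh[OF Y'] in auto)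
    then show ?thesis using uniq[OF Y(1) Y'] Y(1) by blast
  qed
  moreover have "Y1 = Y2" if Y1: "spec_subgraph T Y1 X" and Y2: "spec_subgraph T Y2 X" and eq: "\<beta> Y1 = \<beta> Y2" for Y1 Y2
  proof -
    have B: "spec_subgraph T (\<beta> Y1) X'" using b[OF Y1] by blast
    have "sgraph_iso ?f ?h (\<beta> Y1) Y" if "spec_subgraph T Y X" "sgraph_iso f h Y (\<beta> Y1)" for Y
      using sgraph_iso_sym[OF _ _ that(2)] vh[OF that(1)] vh[OF B] by simp
    then have "sgraph_iso ?f ?h (\<beta> Y1) Y1" "sgraph_iso ?f ?h (\<beta> Y1) Y2" using Y1 Y2 b eq by metis+
    then show ?thesis by (rule sgraph_iso_subgraph_unique[OF T sp[OF B] Y1 Y2])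
  qed
  ultimately have "bij_betw \<beta> {Y. spec_subgraph T Y X} {Y'. spec_subgraph T Y' X'}"
    using b unfolding bij_betw_def inj_on_def by blast
  moreover have "\<beta> X = X'" by (rule uniq[OF spec_subgraph_refl[OF T X(1)] spec_subgraph_refl[OF T X(2)] I])
  ultimately show thesis using that b by blast
qed

section \<open>Transport of momenta along isomorphisms\<close>

definition push :: "(nat \<Rightarrow> nat) \<Rightarrow> 't fgraph \<Rightarrow> 't fgraph \<Rightarrow> 'd::finite mom \<Rightarrow> 'd mom" where
  "push h G G' p = (\<lambda>e. if e \<in> hedges G' then p (inv_into (hedges G) h e) else 0)"

lemma push_apply: "graph_iso f h G G' \<Longrightarrow> e \<in> hedges G \<Longrightarrow> push h G G' p (h e) = p e"
  using graph_isoD(5,11)[of f h G G'] by (simp add: push_def)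

lemma push_momentum_space:
  assumes I: "graph_iso f h G G'" and p: "p \<in> momentum_space G"
  shows "push h G G' p \<in> momentum_space G'"
  unfolding momentum_space_def
proof (intro CollectI conjI allI ballI impI)
  note D = graph_isoD[OF I] and G = is_graphD[OF graph_isoD(1)[OF I]]
  show "push h G G' p e = 0" if "e \<notin> hedges G'" for e using that by (simp add: push_def)
  fix v' assume "v' \<in> verts G'"
  then obtain v where v: "v \<in> verts G" "v' = f v" using D(4) by blast
  have "f (bd G e) = f v \<longleftrightarrow> bd G e = v" if "e \<in> hedges G" for e
    using D(3) G(5)[OF that] v(1) by (auto simp: inj_on_def)
  then have st: "star G' v' = h ` star G v"
    unfolding star_def D(6)[symmetric] v(2) using D(8) by auto
  have "(\<Sum>e\<in>star G' v'. push h G G' p e) = (\<Sum>e\<in>star G v. push h G G' p (h e))"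
    unfolding st by (rule sum.reindex_cong[OF inj_on_subset[OF D(5)]]) (auto simp: star_def)
  also have "\<dots> = (\<Sum>e\<in>star G v. p e)" by (rule sum.cong) (auto simp: star_def push_apply[OF I])
  finally show "(\<Sum>e\<in>star G' v'. push h G G' p e) = 0" using momentum_spaceD(2)[OF p v(1)] by simp
next
  note D = graph_isoD[OF I] and G = is_graphD[OF graph_isoD(1)[OF I]]
  fix e' assume e': "e' \<in> hedges G'" "sig G' e' \<noteq> e'"
  then obtain e where e: "e \<in> hedges G" "e' = h e" using D(6) by blast
  then have "sig G e \<noteq> e" using e' D(7) by auto
  then show "push h G G' p e' + push h G G' p (sig G' e') = 0"
    using e D(7) G(3) momentum_spaceD(3)[OF p e(1)] by (simp add: push_apply[OF I])
qed

lemma V_laurent_iso_map: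
  fixes F :: "('t, 'd::finite) bfam fls"
  assumes I: "graph_iso f h G G'" and F: "F \<in> V_laurent G'"
  shows "iso_map h G G' F \<in> V_laurent G"
proof -
  note D = graph_isoD[OF I] and S = graph_isoD[OF graph_iso_sym[OF I]]
  let ?h = "inv_into (hedges G) h" and ?f = "inv_into (verts G) f"
  have r: "reindex (hedges G') ?h p = push h G G' p" for p :: "'d mom" by (simp add: reindex_def push_def)
  have "(\<lambda>p. if p \<in> momentum_space G then (F $$ n) G' (reindex (hedges G') ?h p) else 0) \<in> V_space G" for n
  proof (rule V_space_reindex[OF D(1,2), where c = "\<lambda>C. ?f ` C"])
    show "reindex (hedges G') ?h p \<in> momentum_space G'" if "p \<in> momentum_space G" for p :: "'d mom"
      unfolding r by (rule push_momentum_space[OF I that])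
    show "?f ` C \<in> pi0 G" if "C \<in> pi0 G'" for C by (rule pi0_graph_iso[OF graph_iso_sym[OF I] that])
    show "?h e \<in> hedges G \<and> bd G (?h e) \<in> ?f ` C" if "e \<in> hedges G'" "bd G' e \<in> C" for C e
      using S(8)[OF that(1)] S(11)[OF that(1)] that(2) by auto
    show "(F $$ n) G' \<in> V_space G'" using F by (simp add: V_laurent_iff)
  qed
  then show ?thesis
    unfolding V_laurent_iff iso_map_nth in_B_apply reindex_def by (simp add: V_space_0)
qed

section \<open>Characters by their values\<close>

text \<open>\<open>conv_term\<close> for assignments on specified graphs that need not come from
  linear maps; the recursion produces such assignments.\<close>

definition cterm :: "('t sgraph \<Rightarrow> ('t, 'd::finite) bfam fls) \<Rightarrow> ('t sgraph \<Rightarrow> ('t, 'd) bfam fls) \<Rightarrow>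
    't sgraph \<Rightarrow> 't sgraph \<Rightarrow> ('t, 'd) bfam fls" where
  "cterm F H X Y = pi_map (fst Y) (fst X) (F Y) * i_map (fst X) (fst (scontract X Y)) (H (scontract X Y))"

definition csum :: "'t feynman_theory \<Rightarrow> ('t sgraph \<Rightarrow> ('t, 'd::finite) bfam fls) \<Rightarrow>
    ('t sgraph \<Rightarrow> ('t, 'd) bfam fls) \<Rightarrow> 't sgraph \<Rightarrow> ('t, 'd) bfam fls" where
  "csum T F H X = (\<Sum>Y | spec_subgraph T Y X. cterm F H X Y)"

text \<open>The convolution without its term \<open>Y = X\<close>, so that it can be formed when
  \<open>F\<close> is known at proper subgraphs only. In the situation of
  \<open>bsum_eq_proper\<close> it is Bogoliubov's preparation of \<open>X\<close>, the skeleton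
  contributing \<open>H X\<close>.\<close>

definition bsum :: "'t feynman_theory \<Rightarrow> ('t sgraph \<Rightarrow> ('t, 'd::finite) bfam fls) \<Rightarrow>
    ('t sgraph \<Rightarrow> ('t, 'd) bfam fls) \<Rightarrow> 't sgraph \<Rightarrow> ('t, 'd) bfam fls" where
  "bsum T F H X = (\<Sum>Y | spec_subgraph T Y X \<and> fst Y \<noteq> fst X. cterm F H X Y)"

definition laurent_valued :: "'t feynman_theory \<Rightarrow> ('t sgraph \<Rightarrow> ('t, 'd::finite) bfam fls) \<Rightarrow> bool" where
  "laurent_valued T F \<longleftrightarrow> (\<forall>X\<in>specified T. F X \<in> V_laurent (fst X))"

definition unital :: "'t feynman_theory \<Rightarrow> ('t sgraph \<Rightarrow> ('t, 'd::finite) bfam fls) \<Rightarrow> bool" where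
  "unital T F \<longleftrightarrow> (\<forall>X\<in>specified T. internal (fst X) = {} \<longrightarrow> F X = one_V (fst X))"

definition indep_at :: "'t feynman_theory \<Rightarrow> ('t sgraph \<Rightarrow> ('t, 'd::finite) bfam fls) \<Rightarrow> 't fgraph \<Rightarrow> bool" where
  "indep_at T F G \<longleftrightarrow> (\<forall>i i'. (G, i) \<in> specified T \<longrightarrow> (G, i') \<in> specified T \<longrightarrow> F (G, i) = F (G, i'))"

definition part_ev :: "('t sgraph \<Rightarrow> ('t, 'd::finite) bfam fls) \<Rightarrow> 't sgraph \<Rightarrow> 'd mom \<Rightarrow> nat set \<Rightarrow> complex fls" where
  "part_ev F X p U = ev (component (fst X) U) (mom_restrict (hedges (component (fst X) U)) p) (F (srestr X U))"

text \<open>Multiplicativity at a single graph, so that it can serve as an induction hypothesis;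
  \<open>U\<close> ranges over the unions of components.\<close>

definition mult_at :: "('t sgraph \<Rightarrow> ('t, 'd::finite) bfam fls) \<Rightarrow> 't sgraph \<Rightarrow> bool" where
  "mult_at F X \<longleftrightarrow> (\<forall>U. saturated (fst X) U \<longrightarrow> (\<forall>p\<in>momentum_space (fst X).
     ev (fst X) p (F X) = part_ev F X p U * part_ev F X p (verts (fst X) - U)))"

definition iso_at :: "'t feynman_theory \<Rightarrow> ('t sgraph \<Rightarrow> ('t, 'd::finite) bfam fls) \<Rightarrow> 't sgraph \<Rightarrow> bool" where
  "iso_at T F X \<longleftrightarrow> (\<forall>X'\<in>specified T. \<forall>f h. sgraph_iso f h X X' \<longrightarrow> (\<forall>p\<in>momentum_space (fst X).
     ev (fst X) p (F X) = ev (fst X') (push h (fst X) (fst X') p) (F X')))"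

definition char_valued :: "'t feynman_theory \<Rightarrow> ('t sgraph \<Rightarrow> ('t, 'd::finite) bfam fls) \<Rightarrow> bool" where
  "char_valued T F \<longleftrightarrow> laurent_valued T F \<and> unital T F
     \<and> (\<forall>X\<in>specified T. indep_at T F (fst X) \<and> mult_at F X \<and> iso_at T F X)"

lemma char_valuedD:
  assumes "char_valued T F"
  shows "laurent_valued T F" "unital T F" "X \<in> specified T \<Longrightarrow> indep_at T F (fst X)"
    "X \<in> specified T \<Longrightarrow> mult_at F X" "X \<in> specified T \<Longrightarrow> iso_at T F X"
  using assms by (auto simp: char_valued_def)

lemma laurent_valuedD: "laurent_valued T F \<Longrightarrow> X \<in> specified T \<Longrightarrow> F X \<in> V_laurent (fst X)"
  by (simp add: laurent_valued_def)

lemma unitalD: "unital T F \<Longrightarrow> X \<in> specified T \<Longrightarrow> internal (fst X) = {} \<Longrightarrow> F X = one_V (fst X)"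
  by (simp add: unital_def)

subsection \<open>Convolution sums\<close>

lemma hedges_scontract:
  assumes "is_theory T" "spec_subgraph T Y X"
  shows "hedges (fst (scontract X Y)) = external (fst Y)"
  using scontract_graph_sel(2)[OF subgrD(1)[OF spec_subgraph_subgr[OF assms]]] by (cases Y) (simp add: fst_scontract)

lemma momentum_space_sub: "is_theory T \<Longrightarrow> spec_subgraph T Y X \<Longrightarrow> p \<in> momentum_space (fst X) \<Longrightarrow> p \<in> momentum_space (fst Y)"
  using momentum_space_subgr spec_subgraph_subgr by blast

lemma momentum_space_scontract:
  assumes "is_theory T" "spec_subgraph T Y X" "p \<in> momentum_space (fst X)"
  shows "mom_restrict (external (fst Y)) p \<in> momentum_space (fst (scontract X Y))"
  using momentum_space_scontract_graph[OF spec_subgraph_subgr[OF assms(1,2)] assms(3), of "snd Y"]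
  by (simp add: fst_scontract)

lemma ev_cterm:
  assumes "is_theory T" "spec_subgraph T Y X" "p \<in> momentum_space (fst X)"
  shows "ev (fst X) p (cterm F H X Y)
    = ev (fst Y) p (F Y) * ev (fst (scontract X Y)) (mom_restrict (external (fst Y)) p) (H (scontract X Y))"
  using assms by (simp add: cterm_def ev_pi_map ev_i_map hedges_scontract)

lemma cterm_laurent:
  fixes F H :: "'t sgraph \<Rightarrow> ('t, 'd::finite) bfam fls"
  assumes T: "is_theory T" and Y: "spec_subgraph T Y X" and F: "F Y \<in> V_laurent (fst Y)" and H: "laurent_valued T H"
  shows "cterm F H X Y \<in> V_laurent (fst X)"
proof -
  note s = spec_subgraph_subgr[OF T Y]
  have Q: "fst (scontract X Y) = scontract_graph (fst X) (fst Y, snd Y)" by (simp add: fst_scontract)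
  have "H (scontract X Y) \<in> V_laurent (fst (scontract X Y))"
    by (rule laurent_valuedD[OF H scontract_specified[OF T Y]])
  then show ?thesis
    unfolding cterm_def Q by (intro V_laurent_mult V_laurent_pi_map[OF s F] V_laurent_i_map[OF s])
qed

lemma csum_laurent:
  fixes F H :: "'t sgraph \<Rightarrow> ('t, 'd::finite) bfam fls"
  assumes T: "is_theory T" and F: "laurent_valued T F" and H: "laurent_valued T H"
  shows "laurent_valued T (csum T F H)"
  unfolding laurent_valued_def csum_def
proof (intro ballI V_laurent_sum)
  fix X Y assume "Y \<in> {Y. spec_subgraph T Y X}"
  then have Y: "spec_subgraph T Y X" by simp
  show "cterm F H X Y \<in> V_laurent (fst X)"
    by (rule cterm_laurent[where F = F, OF T Y laurent_valuedD[OF F] H]) (use spec_subgraph_specified[OF T Y] in blast)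
qed

text \<open>Contracting \<open>X\<close> by itself leaves no internal edges, and there
  \<open>H\<close> is 1.\<close>

lemma cterm_self:
  fixes F H :: "'t sgraph \<Rightarrow> ('t, 'd::finite) bfam fls"
  assumes T: "is_theory T" and X: "X \<in> specified T" and F: "F X \<in> V_laurent (fst X)"
    and H: "laurent_valued T H" "unital T H"
  shows "cterm F H X X = F X"
proof (rule V_laurent_eqI[OF cterm_laurent[where F = F, OF T spec_subgraph_refl[OF T X] F H(1)] F])
  fix p :: "'d mom" assume p: "p \<in> momentum_space (fst X)"
  note r = spec_subgraph_refl[OF T X]
  have "internal (fst (scontract X X)) = {}"
    using scontract_self_no_internal[OF specified_is_graph[OF T X], of "snd X"] by (simp add: fst_scontract)
  then have "H (scontract X X) = one_V (fst (scontract X X))" by (rule unitalD[OF H(2) scontract_specified[OF T r]])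
  then show "ev (fst X) p (cterm F H X X) = ev (fst X) p (F X)"
    using ev_one_V[OF momentum_space_scontract[OF T r p]] ev_cterm[OF T r p, of F H] by simp
qed

lemma proper_subs_eq:
  assumes T: "is_theory T" and X: "X \<in> specified T"
  shows "{Y. spec_subgraph T Y X \<and> fst Y \<noteq> fst X} = {Y. spec_subgraph T Y X} - {X}"
  using spec_subgraph_eq[OF T] by blast

lemma csum_eq:
  fixes F H :: "'t sgraph \<Rightarrow> ('t, 'd::finite) bfam fls"
  assumes T: "is_theory T" and X: "X \<in> specified T" and F: "F X \<in> V_laurent (fst X)"
    and H: "laurent_valued T H" "unital T H"
  shows "csum T F H X = F X + bsum T F H X"
  unfolding csum_def bsum_def proper_subs_eq[OF T X]
  using sum.remove[OF finite_spec_subgraph[OF T, of X], of X "cterm F H X"] cterm_self[where F = F, OF assms]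
    spec_subgraph_refl[OF T X] by simp

text \<open>\<open>csum_eq\<close> after evaluation. It supplies the two factors in
  \<open>bsum_mult\<close>, where only multiplicativity of \<open>F\<close> at proper subgraphs is
  given.\<close>

lemma ev_csum_eq:
  assumes T: "is_theory T" and X: "X \<in> specified T"
    and H: "laurent_valued T H" "unital T H" and p: "p \<in> momentum_space (fst X)"
  shows "(\<Sum>Y | spec_subgraph T Y X. ev (fst X) p (cterm F H X Y)) = ev (fst X) p (F X) + ev (fst X) p (bsum T F H X)"
proof -
  note r = spec_subgraph_refl[OF T X]
  have "internal (fst (scontract X X)) = {}"
    using scontract_self_no_internal[OF specified_is_graph[OF T X], of "snd X"] by (simp add: fst_scontract)
  then have "H (scontract X X) = one_V (fst (scontract X X))" by (rule unitalD[OF H(2) scontract_specified[OF T r]])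
  then have "ev (fst X) p (cterm F H X X) = ev (fst X) p (F X)"
    using ev_one_V[OF momentum_space_scontract[OF T r p]] ev_cterm[OF T r p, of F H] by simp
  then show ?thesis
    unfolding bsum_def proper_subs_eq[OF T X]
    using sum.remove[OF finite_spec_subgraph[OF T, of X], of X "\<lambda>Y. ev (fst X) p (cterm F H X Y)"] r by simp
qed

lemma card_internal_less:
  assumes "is_theory T" "spec_subgraph T Y X" "fst Y \<noteq> fst X"
  shows "card (internal (fst Y)) < card (internal (fst X))"
  by (rule internal_subgr_less[OF spec_subgraph_subgr[OF assms(1,2)] assms(3)])

lemma bsum_no_internal:
  assumes "is_theory T" "internal (fst X) = {}"
  shows "bsum T F H X = 0"
proof -
  have "\<not> (spec_subgraph T Y X \<and> fst Y \<noteq> fst X)" for Y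
    using card_internal_less[OF assms(1), of Y X] assms(2) by fastforce
  then have "{Y. spec_subgraph T Y X \<and> fst Y \<noteq> fst X} = {}" by blast
  then show ?thesis unfolding bsum_def by (metis sum.empty)
qed

lemma bsum_laurent:
  fixes F H :: "'t sgraph \<Rightarrow> ('t, 'd::finite) bfam fls"
  assumes T: "is_theory T" and H: "laurent_valued T H"
    and F: "\<And>Y. spec_subgraph T Y X \<Longrightarrow> fst Y \<noteq> fst X \<Longrightarrow> F Y \<in> V_laurent (fst Y)"
  shows "bsum T F H X \<in> V_laurent (fst X)"
  unfolding bsum_def
proof (rule V_laurent_sum)
  fix Y assume "Y \<in> {Y. spec_subgraph T Y X \<and> fst Y \<noteq> fst X}"
  then have Y: "spec_subgraph T Y X" "fst Y \<noteq> fst X" by simp_all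
  show "cterm F H X Y \<in> V_laurent (fst X)" by (rule cterm_laurent[where F = F, OF T Y(1) F[OF Y] H])
qed

lemma bsum_cong:
  assumes "\<And>Y. spec_subgraph T Y X \<Longrightarrow> fst Y \<noteq> fst X \<Longrightarrow> F Y = F' Y"
  shows "bsum T F H X = bsum T F' H X"
  unfolding bsum_def cterm_def using assms by (intro sum.cong) auto

lemma csum_cong:
  assumes T: "is_theory T" and "\<And>Y. Y \<in> specified T \<Longrightarrow> F Y = F' Y" "\<And>Y. Y \<in> specified T \<Longrightarrow> H Y = H' Y"
  shows "csum T F H X = csum T F' H' X"
  unfolding csum_def cterm_def
  using assms(2,3) spec_subgraph_specified[OF T] scontract_specified[OF T] by (intro sum.cong) auto

lemma external_skeleton: "is_graph G \<Longrightarrow> external (skeleton G) = hedges G"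
  using subgr_skeleton[of G] subgrD(4)[of "skeleton G" G] by (auto simp: external_def)

text \<open>\<open>F\<close> is 1 on the skeleton, and contracting the skeleton changes
  nothing.\<close>

lemma cterm_skel:
  fixes F H :: "'t sgraph \<Rightarrow> ('t, 'd::finite) bfam fls"
  assumes T: "is_theory T" and X: "X \<in> specified T" and F: "laurent_valued T F" "unital T F" and H: "laurent_valued T H"
  shows "cterm F H X (skel X) = H X"
proof -
  note s = skel_spec_subgraph[OF T X] and S = skel_specified[OF T X] and G = specified_is_graph[OF T X]
  have f: "fst (skel X) = skeleton (fst X)" by (simp add: skel_def)
  have "F (skel X) = one_V (fst (skel X))"
    by (rule unitalD[OF F(2) S]) (simp add: f skeleton_internal[OF G])
  then have "ev (fst X) p (cterm F H X (skel X)) = ev (fst X) p (H X)" if p: "p \<in> momentum_space (fst X)" for p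
    using ev_cterm[OF T s p, of F H] ev_one_V[OF momentum_space_sub[OF T s p]]
    by (simp add: scontract_skel[OF T X] f external_skeleton[OF G] mom_restrict_hedges[OF p])
  then show ?thesis
    by (rule V_laurent_eqI[OF cterm_laurent[where F = F, OF T s laurent_valuedD[OF F(1) S] H] laurent_valuedD[OF H X]])
qed

text \<open>The summand \<open>H X\<close> is the skeleton term, which is not the excluded term
  \<open>Y = X\<close> because there is an internal edge.\<close>

lemma bsum_eq_proper:
  assumes T: "is_theory T" and X: "X \<in> specified T" and F: "laurent_valued T F" "unital T F"
    and H: "laurent_valued T H" and i: "internal (fst X) \<noteq> {}"
  shows "bsum T F H X = H X + (\<Sum>Y | proper_spec_subgraph T Y X. cterm F H X Y)"
proof -
  let ?A = "{Y. spec_subgraph T Y X \<and> fst Y \<noteq> fst X}"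
  have f: "fst (skel X) = skeleton (fst X)" by (simp add: skel_def)
  have "skeleton (fst X) \<noteq> fst X" using i skeleton_internal[OF specified_is_graph[OF T X]] by metis
  then have s: "skel X \<in> ?A" using skel_spec_subgraph[OF T X] f by simp
  have fin: "finite ?A" by (rule finite_subset[OF _ finite_spec_subgraph[OF T, of X]]) blast
  have "?A - {skel X} = {Y. proper_spec_subgraph T Y X}"
    using spec_subgraph_skel_unique[OF T, of _ X] f by (auto simp: proper_spec_subgraph_def)
  then show ?thesis
    unfolding bsum_def using sum.remove[OF fin s, of "cterm F H X"] cterm_skel[OF T X F H] by simp
qed

subsection \<open>Independence of the specification\<close>

text \<open>
  The refined type of an isolated vertex does not matter: by multiplicativity the isolated vertices
  split off, and a character is 1 on them.
\<close>

lemma char_valued_vk_irrelevant: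
  assumes T: "is_theory T" and F: "char_valued T F"
    and X: "(Q, i) \<in> specified T" and X2: "(Q2, i2) \<in> specified T"
    and eq: "verts Q2 = verts Q" "hedges Q2 = hedges Q" "sig Q2 = sig Q" "bd Q2 = bd Q" "htype Q2 = htype Q"
    and vk: "\<And>v. v \<in> verts Q \<Longrightarrow> \<not> isolated Q v \<Longrightarrow> vk Q2 v = vk Q v"
    and p: "p \<in> momentum_space Q"
  shows "ev Q p (F (Q, i)) = ev Q2 p (F (Q2, i2))"
proof -
  note G = specifiedD(2)[OF T X] and G2 = specifiedD(2)[OF T X2]
  \<comment> \<open>Away from the isolated vertices the two graphs have the same refined types and
    are equal, so independence of the specification applies there; on \<open>V\<close> both values
    are 1.\<close>
  define V where "V = {v \<in> verts Q. isolated Q v}"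
  let ?U = "verts Q - V"
  have sV: "saturated Q V" unfolding saturated_def V_def isolated_def by auto
  have sU: "saturated Q ?U" by (rule saturated_Diff[OF G saturated_verts[OF G] sV])
  have sat: "saturated Q2 W \<longleftrightarrow> saturated Q W" for W unfolding saturated_def eq ..
  have UV: "verts Q - ?U = V" by (auto simp: V_def)
  have p2: "p \<in> momentum_space Q2" using p unfolding momentum_space_def star_def eq .
  have one: "part_ev F (Q', i') p V = 1"
    if S: "(Q', i') \<in> specified T" and sV': "saturated Q' V" and p': "p \<in> momentum_space Q'"
      and iso: "\<And>e. e \<in> hedges Q' \<Longrightarrow> bd Q' e \<in> V \<Longrightarrow> sig Q' e = e" for Q' i'
  proof -
    have "F (srestr (Q', i') V) = one_V (fst (srestr (Q', i') V))"
      by (rule unitalD[OF char_valuedD(2)[OF F] srestr_specified[OF T S]])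
        (use sV' iso in \<open>simp_all add: srestr_def internal_empty_iff\<close>)
    then show ?thesis
      using ev_one_V[OF momentum_space_component[OF specifiedD(2)[OF T S] sV' p']]
      by (simp add: part_ev_def srestr_def)
  qed
  have isoV: "sig Q e = e" if "e \<in> hedges Q" "bd Q e \<in> V" for e using that by (auto simp: V_def isolated_def)
  have 1: "part_ev F (Q, i) p V = 1" by (rule one[OF X sV p isoV])
  have 2: "part_ev F (Q2, i2) p V = 1" by (rule one[OF X2]) (use sV sat p2 isoV eq in auto)
  have c: "component Q2 ?U = component Q ?U"
    unfolding component_def Let_def eq using vk by (auto simp: V_def restrict_def)
  have "F (srestr (Q, i) ?U) = F (srestr (Q2, i2) ?U)"
  proof -
    have "srestr (Q, i) ?U \<in> specified T" "srestr (Q2, i2) ?U \<in> specified T"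
      using srestr_specified[OF T X] srestr_specified[OF T X2] sU sat by auto
    then show ?thesis
      using char_valuedD(3)[OF F, of "srestr (Q, i) ?U"] unfolding indep_at_def srestr_def fst_conv snd_conv c by blast
  qed
  then have 3: "part_ev F (Q, i) p ?U = part_ev F (Q2, i2) p ?U" by (simp add: part_ev_def c)
  have "ev Q p (F (Q, i)) = part_ev F (Q, i) p ?U * part_ev F (Q, i) p V"
    using char_valuedD(4)[OF F X] sU p UV unfolding mult_at_def by force
  moreover have "ev Q2 p (F (Q2, i2)) = part_ev F (Q2, i2) p ?U * part_ev F (Q2, i2) p V"
    using char_valuedD(4)[OF F X2] sU sat p2 UV eq(1) unfolding mult_at_def by force
  ultimately show ?thesis using 1 2 3 by simp
qed

text \<open>The specification of a subgraph is tied to that of \<open>G\<close> on uncut components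
  only. Replacing it there by \<open>i'\<close> gives a bijection from the specified subgraphs of
  \<open>(G, i)\<close> to those of \<open>(G, i')\<close>.\<close>

definition respec :: "'t fgraph \<Rightarrow> (nat set \<Rightarrow> nat) \<Rightarrow> 't sgraph \<Rightarrow> 't sgraph" where
  "respec G i' Y = (fst Y, restrict (\<lambda>C. if full_in (fst Y) G C then i' C else snd Y C) (pi0 (fst Y)))"

lemma ext_type_full_in:
  assumes s: "subgr g G" and "full_in g G C"
  shows "ext_type g C = ext_type G C"
  unfolding ext_type_def external_def
  using assms(2) subgrD(4-6)[OF s] by (intro ext arg_cong[where f = card]) (auto simp: full_in_def)

lemma respec_spec_subgraph:
  assumes T: "is_theory T" and X': "(G, i') \<in> specified T" and Y: "spec_subgraph T Y (G, i)"
  shows "spec_subgraph T (respec G i' Y) (G, i')"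
proof -
  obtain g j where gj: "Y = (g, j)" by (cases Y)
  note D = spec_subgraphD[OF T Y[unfolded gj]] and S' = specifiedD[OF T X']
  note s = D(3) and SY = specifiedD[OF T D(1)]
  define k where "k = restrict (\<lambda>C. if full_in g G C then i' C else j C) (pi0 g)"
  have r: "respec G i' Y = (g, k)" by (simp add: respec_def gj k_def cong: if_cong)
  have "(g, k) \<in> specified T"
    unfolding specified_iff[OF T]
  proof (intro conjI ballI allI impI SY)
    show "k \<in> extensional (pi0 g)" by (simp add: k_def)
    show "(ext_type g C, k C) \<in> rvtypes T" if C: "C \<in> pi0 g" for C
      using SY(5)[OF C] S'(5)[of C] pi0_full_in[OF s C] ext_type_full_in[OF s, of C] C by (simp add: k_def)
    fix v assume v: "isolated g v"
    have vC: "{v} \<in> pi0 g" by (rule isolated_pi0[OF SY(2) v])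
    show "k {v} = vk g v"
    proof (cases "full_in g G {v}")
      case True
      then have "isolated G v" using v subgrD(3-5)[OF s] by (auto simp: isolated_def full_in_def)
      then show ?thesis using S'(6) True vC subgrD(7)[OF s] by (simp add: k_def)
    next
      case False
      then show ?thesis using SY(6)[OF v] vC by (simp add: k_def)
    qed
  qed
  then show ?thesis
    unfolding r spec_subgraph_iff[OF T] using X' s by (simp add: k_def)
qed

lemma respec_respec:
  assumes T: "is_theory T" and Y: "spec_subgraph T Y (G, i)"
  shows "respec G i (respec G i' Y) = Y"
proof -
  obtain g j where gj: "Y = (g, j)" by (cases Y)
  note D = spec_subgraphD[OF T Y[unfolded gj]]
  have "snd (respec G i (respec G i' Y)) = j"
    by (rule extensionalityI[OF _ specifiedD(4)[OF T D(1)]]) (auto simp: respec_def gj D(4))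
  then show ?thesis by (simp add: respec_def gj)
qed

text \<open>The two contractions differ at most in the refined types of the vertices that come from
  uncut components, and these are isolated.\<close>

lemma ev_scontract_respec:
  assumes T: "is_theory T" and H: "char_valued T H" and X': "(G, i') \<in> specified T"
    and Y: "spec_subgraph T Y (G, i)" and p: "p \<in> momentum_space (fst (scontract (G, i) Y))"
  shows "ev (fst (scontract (G, i) Y)) p (H (scontract (G, i) Y))
    = ev (fst (scontract (G, i') (respec G i' Y))) p (H (scontract (G, i') (respec G i' Y)))"
proof -
  obtain g j where gj: "Y = (g, j)" by (cases Y)
  note D = spec_subgraphD[OF T Y[unfolded gj]]
  note s = D(3) and g = subgrD(1)[OF D(3)]
  define k where "k = restrict (\<lambda>C. if full_in g G C then i' C else j C) (pi0 g)"
  have r: "respec G i' Y = (g, k)" by (simp add: respec_def gj k_def cong: if_cong)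
  let ?Q = "scontract_graph G (g, j)" and ?Q' = "scontract_graph G (g, k)"
  note Q = scontract_graph_sel[OF g, where G = G and j = j] and Q' = scontract_graph_sel[OF g, where G = G and j = k]
  have eq: "verts ?Q' = verts ?Q" "hedges ?Q' = hedges ?Q" "sig ?Q' = sig ?Q" "bd ?Q' = bd ?Q" "htype ?Q' = htype ?Q"
    by (simp_all add: scontract_graph_def contract_def Let_def)
  have vk: "vk ?Q' v = vk ?Q v" if v: "v \<in> verts ?Q" "\<not> isolated ?Q v" for v
  proof -
    have vr: "v \<in> rep g ` verts g" using v(1) Q(1) by simp
    then obtain u where u: "u \<in> verts g" "v = rep g u" by blast
    have C: "comp_of g v \<in> pi0 g" using comp_of_in_pi0[of v g] rep_in(2)[OF g u(1)] u(2) by simp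
    have "Min (comp_of g v) = v" using rep_in(3)[OF g u(1)] u(2) by (simp add: rep_def)
    then have "\<not> full_in g G (comp_of g v)" using isolated_scontract_graphI(1)[OF s C, of j] v(2) by auto
    then show ?thesis using Q(6)[OF vr] Q'(6)[OF vr] C by (simp add: k_def)
  qed
  have sp: "scontract (G, i) (g, j) \<in> specified T" "scontract (G, i') (g, k) \<in> specified T"
    using scontract_specified[OF T Y] scontract_specified[OF T respec_spec_subgraph[OF T X' Y]] r gj by simp_all
  show ?thesis
    unfolding r unfolding gj scontract_eq fst_conv
    by (rule char_valued_vk_irrelevant[OF T H _ _ eq vk])
      (use sp p in \<open>simp_all add: scontract_eq gj\<close>)
qed

text \<open>Reindexing by \<open>respec\<close> matches the terms: \<open>F\<close> meets the same
  graph with two specifications, and \<open>H\<close> meets two contractions that differ only at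
  isolated vertices.\<close>

lemma bsum_indep:
  fixes F H :: "'t sgraph \<Rightarrow> ('t, 'd::finite) bfam fls"
  assumes T: "is_theory T" and H: "char_valued T H"
    and F: "\<And>Y. Y \<in> specified T \<Longrightarrow> subgr (fst Y) G \<Longrightarrow> fst Y \<noteq> G \<Longrightarrow> F Y \<in> V_laurent (fst Y) \<and> indep_at T F (fst Y)"
  shows "indep_at T (bsum T F H) G"
  unfolding indep_at_def
proof (intro allI impI)
  fix i i' assume X: "(G, i) \<in> specified T" and X': "(G, i') \<in> specified T"
  have Y: "Y \<in> specified T \<and> subgr (fst Y) G" if "spec_subgraph T Y (G, k)" for Y k
    using that spec_subgraph_specified[OF T] spec_subgraph_subgr[OF T that] by auto
  have L: "bsum T F H (G, k) \<in> V_laurent G" for k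
    using bsum_laurent[OF T char_valuedD(1)[OF H], of "(G, k)" F] F Y by fastforce
  show "bsum T F H (G, i) = bsum T F H (G, i')"
  proof (rule V_laurent_eqI[OF L L])
    fix p :: "'d mom" assume p: "p \<in> momentum_space G"
    let ?A = "\<lambda>i. {Y. spec_subgraph T Y (G, i) \<and> fst Y \<noteq> G}"
    have "(\<Sum>Y\<in>?A i. ev G p (cterm F H (G, i) Y)) = (\<Sum>Y\<in>?A i'. ev G p (cterm F H (G, i') Y))"
    proof (rule sum.reindex_bij_witness[of _ "respec G i" "respec G i'"])
      fix Y assume "Y \<in> ?A i"
      then have YA: "spec_subgraph T Y (G, i)" "fst Y \<noteq> G" by auto
      show "respec G i (respec G i' Y) = Y" by (rule respec_respec[OF T YA(1)])
      have r: "spec_subgraph T (respec G i' Y) (G, i')" by (rule respec_spec_subgraph[OF T X' YA(1)])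
      have f: "fst (respec G i' Y) = fst Y" by (simp add: respec_def)
      show "respec G i' Y \<in> ?A i'" using r f YA(2) by simp
      have "indep_at T F (fst Y)" using F Y[OF YA(1)] YA(2) by blast
      moreover have "(fst Y, snd Y) \<in> specified T" "(fst Y, snd (respec G i' Y)) \<in> specified T"
        using Y[OF YA(1)] Y[OF r] f by (metis prod.collapse)+
      ultimately have "F (fst Y, snd Y) = F (fst Y, snd (respec G i' Y))" unfolding indep_at_def by blast
      then have "F Y = F (respec G i' Y)" using f by (metis prod.collapse)
      then show "ev G p (cterm F H (G, i') (respec G i' Y)) = ev G p (cterm F H (G, i) Y)"
        using ev_cterm[OF T YA(1), of p F H] ev_cterm[OF T r, of p F H] p f
          ev_scontract_respec[OF T H X' YA(1)] momentum_space_scontract[OF T YA(1), of p] by simp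
    next
      fix Y assume "Y \<in> ?A i'"
      then have YA: "spec_subgraph T Y (G, i')" "fst Y \<noteq> G" by auto
      show "respec G i' (respec G i Y) = Y" by (rule respec_respec[OF T YA(1)])
      show "respec G i Y \<in> ?A i" using respec_spec_subgraph[OF T X YA(1)] YA(2) by (simp add: respec_def)
    qed
    then show "ev G p (bsum T F H (G, i)) = ev G p (bsum T F H (G, i'))" by (simp add: bsum_def)
  qed
qed

subsection \<open>Compatibility with isomorphisms\<close>

lemma push_mom_restrict:
  assumes I: "graph_iso f h G G'" and E: "E \<subseteq> hedges G" "hedges Q = E" "hedges Q' = h ` E"
  shows "push h Q Q' (mom_restrict E p) = mom_restrict (h ` E) (push h G G' p)"
proof
  fix e'
  note D = graph_isoD[OF I]
  show "push h Q Q' (mom_restrict E p) e' = mom_restrict (h ` E) (push h G G' p) e'"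
  proof (cases "e' \<in> h ` E")
    case True
    then obtain e where e: "e \<in> E" "e' = h e" by blast
    have "inj_on h E" by (rule inj_on_subset[OF D(5) E(1)])
    then have "inv_into E h (h e) = e" using e by simp
    moreover have "push h G G' p (h e) = p e" using push_apply[OF I] e E(1) by blast
    ultimately show ?thesis using e by (simp add: push_def[of h Q] mom_restrict_def E)
  qed (simp add: push_def[of h Q] mom_restrict_def E)
qed

text \<open>The sum is reindexed along the bijection of subgraphs, which sends \<open>X\<close> to
  \<open>X'\<close>, so that the omitted terms correspond.\<close>

lemma bsum_iso:
  fixes F H :: "'t sgraph \<Rightarrow> ('t, 'd::finite) bfam fls"
  assumes T: "is_theory T" and H: "char_valued T H" and X: "X \<in> specified T"
    and F: "\<And>Y. spec_subgraph T Y X \<Longrightarrow> fst Y \<noteq> fst X \<Longrightarrow> iso_at T F Y"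
  shows "iso_at T (bsum T F H) X"
  unfolding iso_at_def
proof (intro ballI allI impI)
  fix X' f h and p :: "'d mom"
  assume X': "X' \<in> specified T" and I: "sgraph_iso f h X X'" and p: "p \<in> momentum_space (fst X)"
  note G = specified_is_graph[OF T X] and G' = specified_is_graph[OF T X']
  have IG: "graph_iso f h (fst X) (fst X')"
    using I sgraph_iso_iff[OF G G', of f h "snd X" "snd X'"] by simp
  let ?p = "push h (fst X) (fst X') p"
  have p': "?p \<in> momentum_space (fst X')" by (rule push_momentum_space[OF IG p])
  obtain \<beta> where b: "bij_betw \<beta> {Y. spec_subgraph T Y X} {Y'. spec_subgraph T Y' X'}"
    "\<And>Y. spec_subgraph T Y X \<Longrightarrow> sgraph_iso f h Y (\<beta> Y)" "\<beta> X = X'"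
    by (rule bij_betw_sgraph_iso[OF T X X' I]) blast
  have bs: "bij_betw \<beta> ({Y. spec_subgraph T Y X} - {X}) ({Y'. spec_subgraph T Y' X'} - {X'})"
  proof (rule bij_betw_subset[OF b(1)])
    show "\<beta> ` ({Y. spec_subgraph T Y X} - {X}) = {Y'. spec_subgraph T Y' X'} - {X'}"
      using inj_on_image_set_diff[OF bij_betw_imp_inj_on[OF b(1)], of "{Y. spec_subgraph T Y X}" "{X}"]
        spec_subgraph_refl[OF T X] bij_betw_imp_surj_on[OF b(1)] b(3) by simp
  qed blast
  have "ev (fst X) p (cterm F H X Y) = ev (fst X') ?p (cterm F H X' (\<beta> Y))"
    if Y: "Y \<in> {Y. spec_subgraph T Y X} - {X}" for Y
  proof -
    have YX: "spec_subgraph T Y X" "fst Y \<noteq> fst X" using Y unfolding proper_subs_eq[OF T X, symmetric] by simp_all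
    have bY: "spec_subgraph T (\<beta> Y) X'" using bij_betwE[OF b(1)] YX(1) by blast
    have IY: "sgraph_iso f h Y (\<beta> Y)" by (rule b(2)[OF YX(1)])
    note s = spec_subgraph_subgr[OF T YX(1)] and s' = spec_subgraph_subgr[OF T bY]
    have gY: "graph_iso f h (fst Y) (fst (\<beta> Y))"
      using IY sgraph_iso_iff[OF subgrD(1)[OF s] subgrD(1)[OF s'], of f h "snd Y" "snd (\<beta> Y)"] by simp
    have hY: "push h (fst Y) (fst (\<beta> Y)) p = ?p" using subgrD(4)[OF s] subgrD(4)[OF s'] by (simp add: push_def cong: if_cong)
    have 1: "ev (fst Y) p (F Y) = ev (fst (\<beta> Y)) ?p (F (\<beta> Y))"
      using F[OF YX] IY spec_subgraph_specified[OF T bY] momentum_space_sub[OF T YX(1) p] hY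
      unfolding iso_at_def by metis
    have ex: "external (fst (\<beta> Y)) = h ` external (fst Y)" by (rule external_graph_iso_image[OF gY])
    have "push h (fst (scontract X Y)) (fst (scontract X' (\<beta> Y))) (mom_restrict (external (fst Y)) p)
        = mom_restrict (external (fst (\<beta> Y))) ?p"
      unfolding ex
      by (rule push_mom_restrict[OF IG])
        (use subgrD(4)[OF s] hedges_scontract[OF T YX(1)] hedges_scontract[OF T bY] ex in \<open>auto simp: external_def\<close>)
    then have 2: "ev (fst (scontract X Y)) (mom_restrict (external (fst Y)) p) (H (scontract X Y))
      = ev (fst (scontract X' (\<beta> Y))) (mom_restrict (external (fst (\<beta> Y))) ?p) (H (scontract X' (\<beta> Y)))"
      using char_valuedD(5)[OF H scontract_specified[OF T YX(1)]] scontract_specified[OF T bY]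
        scontract_graph_iso[OF T I IY YX(1) bY] momentum_space_scontract[OF T YX(1) p]
      unfolding iso_at_def by metis
    show ?thesis using 1 2 ev_cterm[OF T YX(1) p, of F H] ev_cterm[OF T bY p', of F H] by simp
  qed
  then show "ev (fst X) p (bsum T F H X) = ev (fst X') ?p (bsum T F H X')"
    unfolding bsum_def proper_subs_eq[OF T X] proper_subs_eq[OF T X'] ev_sum
    by (subst sum.reindex_bij_betw[OF bs, symmetric]) (rule sum.cong[OF refl])
qed

subsection \<open>Multiplicativity\<close>

text \<open>The sum over all pairs of subgraphs of the two parts is a product of two full
  convolution sums. The pair of the two full parts corresponds to \<open>Y = X\<close>, which
  \<open>bsum\<close> omits and where \<open>F\<close> is not assumed to be multiplicative; its
  contribution is the product added on the left. With \<open>F\<close> the counterterm, each factor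
  on the right is the renormalised value of a part.\<close>

lemma bsum_mult:
  fixes F H :: "'t sgraph \<Rightarrow> ('t, 'd::finite) bfam fls"
  assumes T: "is_theory T" and H: "char_valued T H" and X: "X \<in> specified T"
    and F: "\<And>Y. spec_subgraph T Y X \<Longrightarrow> fst Y \<noteq> fst X \<Longrightarrow> mult_at F Y"
    and U: "saturated (fst X) U" and p: "p \<in> momentum_space (fst X)"
  shows "ev (fst X) p (bsum T F H X) + part_ev F X p U * part_ev F X p (verts (fst X) - U)
    = (part_ev F X p U + part_ev (bsum T F H) X p U)
      * (part_ev F X p (verts (fst X) - U) + part_ev (bsum T F H) X p (verts (fst X) - U))"
proof -
  obtain G i where XG: "X = (G, i)" by (cases X)
  have G: "is_graph G" using specified_is_graph[OF T X] XG by simp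
  have sU: "saturated G U" using U XG by simp
  let ?U' = "verts G - U"
  have sU': "saturated G ?U'" by (rule saturated_Diff[OF G saturated_verts[OF G] sU])
  define q where "q V = mom_restrict (hedges (component G V)) p" for V
  have pG: "p \<in> momentum_space G" using p XG by simp
  have q: "q V \<in> momentum_space (component G V)" if "saturated G V" for V
    unfolding q_def by (rule momentum_space_component[OF G that pG])
  define a where "a V Z = ev (component G V) (q V) (cterm F H (srestr X V) Z)" for V Z
  have sf: "fst (srestr X V) = component G V" for V by (simp add: srestr_def XG)
  have suma: "(\<Sum>Z | spec_subgraph T Z (srestr X V). a V Z) = part_ev F X p V + part_ev (bsum T F H) X p V"
    if V: "saturated G V" for V
    using ev_csum_eq[OF T srestr_specified[OF T X] char_valuedD(1,2)[OF H], of V "q V" F] V q[OF V]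
    by (simp add: XG sf[unfolded XG] a_def part_ev_def q_def)
  have self: "a V (srestr X V) = part_ev F X p V" if V: "saturated G V" for V
  proof -
    have S: "srestr X V \<in> specified T" using srestr_specified[OF T X] V XG by simp
    note r = spec_subgraph_refl[OF T S]
    have "internal (fst (scontract (srestr X V) (srestr X V))) = {}"
      using scontract_self_no_internal[OF specified_is_graph[OF T S], of "snd (srestr X V)"] by (simp add: fst_scontract)
    then have h: "H (scontract (srestr X V) (srestr X V)) = one_V (fst (scontract (srestr X V) (srestr X V)))"
      by (rule unitalD[OF char_valuedD(2)[OF H] scontract_specified[OF T r]])
    have qq: "q V \<in> momentum_space (fst (srestr X V))" using q[OF V] by (simp add: sf)
    show ?thesis
      using ev_cterm[OF T r qq, of F H] h ev_one_V[OF momentum_space_scontract[OF T r qq]]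
      by (simp add: a_def part_ev_def sf[unfolded XG] q_def XG)
  qed
  \<comment> \<open>\<open>F\<close> is multiplicative at the proper subgraph \<open>Y\<close> and
    \<open>H\<close> at the contraction; the factors are regrouped because contraction commutes with
    the splitting.\<close>
  have tm: "ev G p (cterm F H X Y) = a U (srestr Y U) * a ?U' (srestr Y ?U')"
    if Y: "Y \<in> {Y. spec_subgraph T Y X} - {X}" for Y
  proof -
    have YX: "spec_subgraph T Y X" "fst Y \<noteq> fst X" using Y unfolding proper_subs_eq[OF T X, symmetric] by simp_all
    obtain g j where gj: "Y = (g, j)" by (cases Y)
    note D = spec_subgraphD[OF T YX(1)[unfolded gj XG]]
    note s = D(3) and g = subgrD(1)[OF D(3)]
    let ?Q = "scontract_graph G (g, j)"
    let ?R = "\<lambda>V. V \<inter> rep g ` verts g"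
    have pg: "p \<in> momentum_space g" using momentum_space_sub[OF T YX(1) p] gj by simp
    have sg: "saturated g V" if "saturated G V" for V by (rule saturated_subgr[OF s that])
    have hg: "hedges (component g V) = hedges (component G V)" for V using subgrD(4,5)[OF s] by simp
    have 1: "ev g p (F Y) = part_ev F Y p U * part_ev F Y p ?U'"
      using F[OF YX] sg[OF sU] pg subgrD(3)[OF s] by (simp add: mult_at_def gj)
    have S: "scontract X Y \<in> specified T" by (rule scontract_specified[OF T YX(1)])
    have fS: "fst (scontract X Y) = ?Q" by (simp add: XG gj fst_scontract)
    let ?r = "mom_restrict (external g) p"
    have rQ: "?r \<in> momentum_space ?Q" by (rule momentum_space_scontract_graph[OF s pG])
    have RU: "verts ?Q - ?R U = ?R ?U'"
      using scontract_graph_sel(1)[OF g, of G j] rep_in(2)[OF g] subgrD(3)[OF s] by auto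
    have 2: "ev ?Q ?r (H (scontract X Y)) = part_ev H (scontract X Y) ?r (?R U) * part_ev H (scontract X Y) ?r (?R ?U')"
      using char_valuedD(4)[OF H S] saturated_scontract_graph_Int[OF s sU, of j] rQ RU
      unfolding mult_at_def fS by (metis (no_types, lifting))
    have 3: "a V (srestr Y V) = part_ev F Y p V * part_ev H (scontract X Y) ?r (?R V)" if V: "saturated G V" for V
    proof -
      have sub: "spec_subgraph T (srestr Y V) (srestr X V)" by (rule spec_subgraph_srestr[OF T YX(1)]) (simp add: XG V)
      have qq: "q V \<in> momentum_space (fst (srestr X V))" using q[OF V] by (simp add: sf)
      have fy: "fst (srestr Y V) = component g V" by (simp add: srestr_def gj)
      have sc: "scontract (srestr X V) (srestr Y V) = srestr (scontract X Y) (?R V)"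
        unfolding XG gj by (rule scontract_srestr(1)[OF s V])
      have hq: "hedges (component ?Q (?R V)) = external (component g V)" by (rule scontract_srestr(2)[OF s V])
      have "mom_restrict (external (component g V)) (q V) = mom_restrict (hedges (component ?Q (?R V))) ?r"
        unfolding hq q_def mom_restrict_mom_restrict external_component hg[symmetric]
        by (rule arg_cong[where f = "\<lambda>E. mom_restrict E p"]) (auto simp: external_def)
      moreover have "fst (srestr (scontract X Y) (?R V)) = component ?Q (?R V)" by (simp add: srestr_def fS)
      ultimately show ?thesis
        using ev_cterm[OF T sub qq, of F H] unfolding sf fy sc
        by (simp only: a_def part_ev_def fS) (simp add: gj q_def subgrD(4,5)[OF s])
    qed
    show ?thesis
      using ev_cterm[OF T YX(1) p, of F H] 1 2 3[OF sU] 3[OF sU'] fS by (simp add: XG gj)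
  qed
  let ?S = "{Y. spec_subgraph T Y X}"
  have "ev G p (bsum T F H X) = (\<Sum>Y\<in>?S - {X}. a U (srestr Y U) * a ?U' (srestr Y ?U'))"
    unfolding bsum_def proper_subs_eq[OF T X] ev_sum by (rule sum.cong[OF refl tm])
  then have "ev G p (bsum T F H X) + part_ev F X p U * part_ev F X p ?U'
      = (\<Sum>Y\<in>?S. a U (srestr Y U) * a ?U' (srestr Y ?U'))"
    using sum.remove[OF finite_spec_subgraph[OF T, of X], of X "\<lambda>Y. a U (srestr Y U) * a ?U' (srestr Y ?U')"]
      spec_subgraph_refl[OF T X] self[OF sU] self[OF sU'] by (simp add: add.commute)
  also have "\<dots> = (\<Sum>(Z, Z')\<in>{Z. spec_subgraph T Z (srestr X U)} \<times> {Z. spec_subgraph T Z (srestr X ?U')}. a U Z * a ?U' Z')"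
    using sum.reindex_bij_betw[OF bij_betw_srestr[OF T X U], of "\<lambda>(Z, Z'). a U Z * a ?U' Z'"] by (simp add: XG)
  also have "\<dots> = (\<Sum>Z | spec_subgraph T Z (srestr X U). a U Z) * (\<Sum>Z | spec_subgraph T Z (srestr X ?U'). a ?U' Z)"
    by (simp add: sum_product sum.cartesian_product)
  finally show ?thesis using suma[OF sU] suma[OF sU'] by (simp add: XG)
qed

subsection \<open>Associativity and characters as values\<close>

lemma csum_assoc:
  fixes F H K :: "'t sgraph \<Rightarrow> ('t, 'd::finite) bfam fls"
  assumes T: "is_theory T" and X: "X \<in> specified T"
    and F: "laurent_valued T F" and H: "laurent_valued T H" and K: "laurent_valued T K"
  shows "csum T (csum T F H) K X = csum T F (csum T H K) X"
proof (rule V_laurent_eqI)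
  note FH = csum_laurent[OF T F H] and HK = csum_laurent[OF T H K]
  show "csum T (csum T F H) K X \<in> V_laurent (fst X)" by (rule laurent_valuedD[OF csum_laurent[OF T FH K] X])
  show "csum T F (csum T H K) X \<in> V_laurent (fst X)" by (rule laurent_valuedD[OF csum_laurent[OF T F HK] X])
  fix p :: "'d mom" assume p: "p \<in> momentum_space (fst X)"
  define r where "r Y = mom_restrict (external (fst Y)) p" for Y :: "'t sgraph"
  \<comment> \<open>The common summand of both sides for a chain
    \<open>Z \<subseteq> Y \<subseteq> X\<close>.\<close>
  define t where "t Z Y = ev (fst Z) p (F Z) * (ev (fst (scontract Y Z)) (r Z) (H (scontract Y Z))
    * ev (fst (scontract X Y)) (r Y) (K (scontract X Y)))" for Z Y
  let ?S = "{Y. spec_subgraph T Y X}"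
  have fin: "finite ?S" by (rule finite_spec_subgraph[OF T])
  have tr: "{Z. spec_subgraph T Z Y} = {Z \<in> ?S. spec_subgraph T Z Y}" if "spec_subgraph T Y X" for Y
    using spec_subgraph_trans[OF T _ that] by blast
  have l: "ev (fst X) p (cterm (csum T F H) K X Y) = (\<Sum>Z | spec_subgraph T Z Y. t Z Y)" if Y: "spec_subgraph T Y X" for Y
  proof -
    have "ev (fst Y) p (csum T F H Y) = (\<Sum>Z | spec_subgraph T Z Y.
        ev (fst Z) p (F Z) * ev (fst (scontract Y Z)) (r Z) (H (scontract Y Z)))"
      unfolding csum_def ev_sum r_def using ev_cterm[OF T _ momentum_space_sub[OF T Y p]] by (intro sum.cong) auto
    then show ?thesis
      using ev_cterm[OF T Y p, of "csum T F H" K] by (simp add: t_def r_def sum_distrib_right mult.assoc)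
  qed
  have R: "ev (fst X) p (cterm F (csum T H K) X Z) = (\<Sum>Y | spec_subgraph T Z Y \<and> spec_subgraph T Y X. t Z Y)"
    if Z: "spec_subgraph T Z X" for Z
  proof -
    let ?Q = "scontract X Z"
    have q: "r Z \<in> momentum_space (fst ?Q)" unfolding r_def by (rule momentum_space_scontract[OF T Z p])
    let ?B = "{Y. spec_subgraph T Z Y \<and> spec_subgraph T Y X}"
    have bij: "bij_betw (\<lambda>Y. scontract Y Z) ?B {W. spec_subgraph T W ?Q}"
      unfolding bij_betw_def
    proof
      show "inj_on (\<lambda>Y. scontract Y Z) ?B"
        using scontract_inj[OF T] by (intro inj_onI) blast
      show "(\<lambda>Y. scontract Y Z) ` ?B = {W. spec_subgraph T W ?Q}"
      proof (intro subset_antisym subsetI)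
        fix W assume "W \<in> (\<lambda>Y. scontract Y Z) ` ?B"
        then show "W \<in> {W. spec_subgraph T W ?Q}" using scontract_spec_subgraph[OF T] by blast
      next
        fix W assume "W \<in> {W. spec_subgraph T W ?Q}"
        then have W: "spec_subgraph T W ?Q" by simp
        obtain Y where "spec_subgraph T Z Y" "spec_subgraph T Y X" "scontract Y Z = W"
          by (rule scontract_surj[OF T Z W])
        then show "W \<in> (\<lambda>Y. scontract Y Z) ` ?B" by blast
      qed
    qed
    \<comment> \<open>Momenta are restricted first to the external half-edges of \<open>Z\<close>
      and then to those of \<open>Y\<close>; the latter are contained in the former, so this is one
      restriction.\<close>
    have tm: "ev (fst ?Q) (r Z) (cterm H K ?Q (scontract Y Z)) = ev (fst (scontract Y Z)) (r Z) (H (scontract Y Z))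
        * ev (fst (scontract X Y)) (r Y) (K (scontract X Y))" if Y: "spec_subgraph T Z Y" "spec_subgraph T Y X" for Y
    proof -
      note s = spec_subgraph_subgr[OF T Y(1)] spec_subgraph_subgr[OF T Y(2)]
      have sc: "scontract ?Q (scontract Y Z) = scontract X Y"
        using scontract_scontract[OF s, of "snd X" "snd Z" "snd Y"] by simp
      have "external (fst (scontract Y Z)) = external (fst Y)"
        using external_scontract_graph[OF s(1), of "snd Z"] by (simp add: fst_scontract)
      then have "mom_restrict (external (fst (scontract Y Z))) (r Z) = r Y"
        using external_mono[OF s(1)] by (simp add: r_def mom_restrict_mom_restrict Int_absorb2)
      then show ?thesis
        using ev_cterm[OF T scontract_spec_subgraph[OF T Y] q, of H K] sc by simp
    qed
    have "ev (fst ?Q) (r Z) (csum T H K ?Q) = (\<Sum>Y\<in>?B. ev (fst ?Q) (r Z) (cterm H K ?Q (scontract Y Z)))"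
      unfolding csum_def ev_sum by (rule sum.reindex_bij_betw[OF bij, symmetric])
    also have "\<dots> = (\<Sum>Y\<in>?B. ev (fst (scontract Y Z)) (r Z) (H (scontract Y Z))
        * ev (fst (scontract X Y)) (r Y) (K (scontract X Y)))"
      using tm by (intro sum.cong) auto
    finally show ?thesis
      using ev_cterm[OF T Z p, of F "csum T H K"] by (simp add: t_def r_def[symmetric] sum_distrib_left)
  qed
  have "ev (fst X) p (csum T (csum T F H) K X) = (\<Sum>Y\<in>?S. \<Sum>Z | Z \<in> ?S \<and> spec_subgraph T Z Y. t Z Y)"
    unfolding csum_def[of T "csum T F H"] ev_sum using l tr by (intro sum.cong) auto
  also have "\<dots> = (\<Sum>Z\<in>?S. \<Sum>Y | Y \<in> ?S \<and> spec_subgraph T Z Y. t Z Y)"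
    by (rule sum.swap_restrict[OF fin fin])
  also have "\<dots> = ev (fst X) p (csum T F (csum T H K) X)"
    unfolding csum_def[of T F] ev_sum using R by (intro sum.cong) (auto simp: conj_commute)
  finally show "ev (fst X) p (csum T (csum T F H) K X) = ev (fst X) p (csum T F (csum T H K) X)" .
qed

lemma part_ev_no_internal:
  assumes T: "is_theory T" and F: "unital T F" and X: "X \<in> specified T" and U: "saturated (fst X) U"
    and p: "p \<in> momentum_space (fst X)" and i: "internal (component (fst X) U) = {}"
  shows "part_ev F X p U = 1"
  using unitalD[OF F srestr_specified[OF T X U]] i
    ev_one_V[OF momentum_space_component[OF specified_is_graph[OF T X] U p]]
  by (simp add: part_ev_def srestr_def)

lemma internal_component_empty:
  assumes G: "is_graph G" and U: "saturated G U"
  shows "internal G = {} \<longleftrightarrow> internal (component G U) = {} \<and> internal (component G (verts G - U)) = {}"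
  using is_graphD(5)[OF G] by (auto simp: internal_empty_iff)

lemma internal_graph_iso:
  assumes I: "graph_iso f h G G'"
  shows "internal G = {} \<longleftrightarrow> internal G' = {}"
proof -
  have "internal G = {} \<longleftrightarrow> (\<forall>e\<in>hedges G. e \<in> external G)" for G :: "'a fgraph"
    by (simp add: internal_empty_iff external_def)
  moreover have "(\<forall>e\<in>hedges G'. e \<in> external G') \<longleftrightarrow> (\<forall>e\<in>hedges G. e \<in> external G)"
    unfolding graph_isoD(6)[OF I, symmetric] using external_graph_iso[OF I] by simp
  ultimately show ?thesis by simp
qed

lemma indep_atD: "indep_at T F G \<Longrightarrow> (G, i) \<in> specified T \<Longrightarrow> (G, i') \<in> specified T \<Longrightarrow> F (G, i) = F (G, i')"
  unfolding indep_at_def by blast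

lemma indep_atI:
  "(\<And>i i'. (G, i) \<in> specified T \<Longrightarrow> (G, i') \<in> specified T \<Longrightarrow> F (G, i) = F (G, i')) \<Longrightarrow> indep_at T F G"
  unfolding indep_at_def by blast

lemma char_valued_cong:
  assumes T: "is_theory T" and F: "char_valued T F" and eq: "\<And>X. X \<in> specified T \<Longrightarrow> F' X = F X"
  shows "char_valued T F'"
proof -
  have p: "part_ev F' X p U = part_ev F X p U" if "X \<in> specified T" "saturated (fst X) U" for X p U
    using eq[OF srestr_specified[OF T that]] by (simp add: part_ev_def)
  have "mult_at F' X" if X: "X \<in> specified T" for X
    using char_valuedD(4)[OF F X] p[OF X] eq[OF X]
      saturated_Diff[OF specified_is_graph[OF T X] saturated_verts[OF specified_is_graph[OF T X]]]
    unfolding mult_at_def by simp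
  moreover have "iso_at T F' X" if X: "X \<in> specified T" for X
    using char_valuedD(5)[OF F X] eq X unfolding iso_at_def by simp
  moreover have "indep_at T F' (fst X)" if X: "X \<in> specified T" for X
  proof (rule indep_atI)
    fix i i' assume "(fst X, i) \<in> specified T" "(fst X, i') \<in> specified T"
    then show "F' (fst X, i) = F' (fst X, i')" using indep_atD[OF char_valuedD(3)[OF F X], of i i'] eq by simp
  qed
  ultimately show ?thesis
    using char_valuedD(1,2)[OF F] eq unfolding char_valued_def laurent_valued_def unital_def by simp
qed

text \<open>\<open>csum_eq\<close> reduces the claim to the lemmas on \<open>bsum\<close>; for
  multiplicativity the product added in \<open>bsum_mult\<close> is now the value of
  \<open>F\<close> at \<open>X\<close>.\<close>

lemma csum_char_valued:
  fixes F H :: "'t sgraph \<Rightarrow> ('t, 'd::finite) bfam fls"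
  assumes T: "is_theory T" and F: "char_valued T F" and H: "char_valued T H"
  shows "char_valued T (csum T F H)"
proof -
  note F' = char_valuedD[OF F] and H' = char_valuedD[OF H]
  have c: "csum T F H X = F X + bsum T F H X" if X: "X \<in> specified T" for X
    by (rule csum_eq[where F = F, OF T X laurent_valuedD[OF F'(1) X] H'(1,2)])
  have sub: "Y \<in> specified T" if "spec_subgraph T Y X" for Y X using spec_subgraph_specified[OF T that] by blast
  have "unital T (csum T F H)"
    unfolding unital_def using c unitalD[OF F'(2)] by (simp add: bsum_no_internal[OF T])
  moreover have "indep_at T (csum T F H) (fst X)" if X: "X \<in> specified T" for X
  proof (rule indep_atI)
    fix i i' assume a: "(fst X, i) \<in> specified T" "(fst X, i') \<in> specified T"
    have "indep_at T (bsum T F H) (fst X)"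
      by (rule bsum_indep[OF T H]) (use laurent_valuedD[OF F'(1)] F'(3) in blast)
    from indep_atD[OF this a] indep_atD[OF F'(3)[OF X] a]
    show "csum T F H (fst X, i) = csum T F H (fst X, i')" by (simp add: c a)
  qed
  moreover have "iso_at T (csum T F H) X" if X: "X \<in> specified T" for X
    unfolding iso_at_def
  proof (intro ballI allI impI)
    fix X' f h and p :: "'d mom"
    assume a: "X' \<in> specified T" "sgraph_iso f h X X'" "p \<in> momentum_space (fst X)"
    have "iso_at T (bsum T F H) X" by (rule bsum_iso[OF T H X]) (use F'(5) sub in blast)
    then have "ev (fst X) p (bsum T F H X) = ev (fst X') (push h (fst X) (fst X') p) (bsum T F H X')"
      using a unfolding iso_at_def by blast
    moreover have "ev (fst X) p (F X) = ev (fst X') (push h (fst X) (fst X') p) (F X')"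
      using F'(5)[OF X] a unfolding iso_at_def by blast
    ultimately show "ev (fst X) p (csum T F H X) = ev (fst X') (push h (fst X) (fst X') p) (csum T F H X')"
      using X a(1) by (simp add: c)
  qed
  moreover have "mult_at (csum T F H) X" if X: "X \<in> specified T" for X
    unfolding mult_at_def
  proof (intro allI impI ballI)
    fix U and p :: "'d mom" assume U: "saturated (fst X) U" and p: "p \<in> momentum_space (fst X)"
    note G = specified_is_graph[OF T X]
    have U': "saturated (fst X) (verts (fst X) - U)" by (rule saturated_Diff[OF G saturated_verts[OF G] U])
    have pe: "part_ev (csum T F H) X p V = part_ev F X p V + part_ev (bsum T F H) X p V" if "saturated (fst X) V" for V
      using c[OF srestr_specified[OF T X that]] by (simp add: part_ev_def)
    have "ev (fst X) p (F X) = part_ev F X p U * part_ev F X p (verts (fst X) - U)"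
      using F'(4)[OF X] U p unfolding mult_at_def by blast
    then show "ev (fst X) p (csum T F H X) = part_ev (csum T F H) X p U * part_ev (csum T F H) X p (verts (fst X) - U)"
      using bsum_mult[OF T H X _ U p, of F] F'(4) sub by (simp add: c[OF X] pe[OF U] pe[OF U'] add.commute)
  qed
  ultimately show ?thesis
    using csum_laurent[OF T F'(1) H'(1)] unfolding char_valued_def by blast
qed

subsection \<open>The recursion\<close>

text \<open>Drawn directly from the definitions, as termination of \<open>birk\<close> has to be
  shown for arbitrary \<open>T\<close>.\<close>

lemma spec_subgraph_imp_subgr: "spec_subgraph T Y X \<Longrightarrow> subgr (fst Y) (fst X)"
  using covering_subgraph_iff[of "fst X"] by (auto simp: spec_subgraph_def specified_def graph_of_def)

text \<open>The body of \<open>bsum\<close> is written out so that the recursive calls appear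
  together with the condition on \<open>Y\<close>.\<close>

function birk :: "'t feynman_theory \<Rightarrow> int set \<Rightarrow> ('t sgraph \<Rightarrow> ('t, 'd::finite) bfam fls) \<Rightarrow>
    't sgraph \<Rightarrow> ('t, 'd) bfam fls" where
  "birk T S H X = (if internal (fst X) = {} then one_V (fst X) else
     - fls_filter S (\<Sum>Y | spec_subgraph T Y X \<and> fst Y \<noteq> fst X.
         pi_map (fst Y) (fst X) (birk T S H Y) * i_map (fst X) (fst (scontract X Y)) (H (scontract X Y))))"
  by pat_completeness auto
termination
  by (relation "Wellfounded.measure (\<lambda>(T, S, H, X). card (internal (fst X)))")
    (auto intro: internal_subgr_less dest: spec_subgraph_imp_subgr)

declare birk.simps [simp del]

lemma birk_no_internal: "internal (fst X) = {} \<Longrightarrow> birk T S H X = one_V (fst X)"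
  by (simp add: birk.simps)

lemma birk_eq: "internal (fst X) \<noteq> {} \<Longrightarrow> birk T S H X = - fls_filter S (bsum T (birk T S H) H X)"
  by (simp add: birk.simps[of T S H X] bsum_def cterm_def)

lemma add_fls_filter_Compl:
  fixes F :: "'a::ab_group_add fls"
  shows "- fls_filter S F + F = fls_filter (- S) F"
  by (rule fls_eqI) simp

lemma birk_laurent:
  fixes H :: "'t sgraph \<Rightarrow> ('t, 'd::finite) bfam fls"
  assumes T: "is_theory T" and H: "laurent_valued T H"
  shows "laurent_valued T (birk T S H)"
proof -
  have "X \<in> specified T \<longrightarrow> birk T S H X \<in> V_laurent (fst X)" for X
  proof (induction X rule: measure_induct_rule[where f = "\<lambda>X. card (internal (fst X))"])
    case (less X)
    show ?case
    proof (cases "internal (fst X) = {}")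
      case False
      have "bsum T (birk T S H) H X \<in> V_laurent (fst X)"
        by (rule bsum_laurent[OF T H]) (use less card_internal_less[OF T] spec_subgraph_specified[OF T] in blast)
      then show ?thesis using False by (simp add: birk_eq V_laurent_uminus V_laurent_fls_filter)
    qed (simp add: birk_no_internal V_laurent_one)
  qed
  then show ?thesis by (simp add: laurent_valued_def)
qed

text \<open>Independence, invariance and multiplicativity each follow by induction on the number of
  internal edges from the matching lemma on \<open>bsum\<close>; the closure properties of
  \<open>S\<close> and its complement enter in the multiplicativity.\<close>

lemma birk_char_valued:
  fixes H :: "'t sgraph \<Rightarrow> ('t, 'd::finite) bfam fls"
  assumes T: "is_theory T" and H: "char_valued T H"
    and S: "\<And>m n. m \<in> S \<Longrightarrow> n \<in> S \<Longrightarrow> m + n \<in> S" "\<And>m n. m \<notin> S \<Longrightarrow> n \<notin> S \<Longrightarrow> m + n \<notin> S"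
  shows "char_valued T (birk T S H)"
proof -
  let ?F = "birk T S H"
  let ?b = "bsum T ?F H"
  note H' = char_valuedD[OF H]
  have F: "laurent_valued T ?F" by (rule birk_laurent[OF T H'(1)])
  have u: "unital T ?F" by (simp add: unital_def birk_no_internal)
  have sub: "Y \<in> specified T" if "spec_subgraph T Y X" for Y X using spec_subgraph_specified[OF T that] by blast
  have indep: "is_graph G \<longrightarrow> indep_at T ?F G" for G
  proof (induction G rule: measure_induct_rule[where f = "\<lambda>G. card (internal G)"])
    case (less G)
    show ?case
    proof
      assume "is_graph G"
      have "indep_at T ?b G"
        by (rule bsum_indep[OF T H])
          (use less internal_subgr_less laurent_valuedD[OF F] specified_is_graph[OF T] in blast)
      then show "indep_at T ?F G"
      proof (intro indep_atI)
        fix i i' assume b: "indep_at T ?b G" and a: "(G, i) \<in> specified T" "(G, i') \<in> specified T"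
        show "?F (G, i) = ?F (G, i')"
          using indep_atD[OF b a] by (cases "internal G = {}") (simp_all add: birk_no_internal birk_eq)
      qed
    qed
  qed
  have iso: "X \<in> specified T \<longrightarrow> iso_at T ?F X" for X
  proof (induction X rule: measure_induct_rule[where f = "\<lambda>X. card (internal (fst X))"])
    case (less X)
    show ?case
    proof
      assume X: "X \<in> specified T"
      have b: "iso_at T ?b X"
        by (rule bsum_iso[OF T H X]) (use less card_internal_less[OF T] sub in blast)
      show "iso_at T ?F X"
        unfolding iso_at_def
      proof (intro ballI allI impI)
        fix X' f h and p :: "'d mom"
        assume X': "X' \<in> specified T" and I: "sgraph_iso f h X X'" and p: "p \<in> momentum_space (fst X)"
        note G = specified_is_graph[OF T X] specified_is_graph[OF T X']
        have IG: "graph_iso f h (fst X) (fst X')"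
          using I sgraph_iso_iff[OF G, of f h "snd X" "snd X'"] by simp
        show "ev (fst X) p (?F X) = ev (fst X') (push h (fst X) (fst X') p) (?F X')"
        proof (cases "internal (fst X) = {}")
          case True
          then show ?thesis
            using internal_graph_iso[OF IG] ev_one_V[OF p] ev_one_V[OF push_momentum_space[OF IG p]]
            by (simp add: birk_no_internal)
        next
          case False
          have "ev (fst X) p (?b X) = ev (fst X') (push h (fst X) (fst X') p) (?b X')"
            using b X' I p unfolding iso_at_def by blast
          then show ?thesis using False internal_graph_iso[OF IG] by (simp add: birk_eq)
        qed
      qed
    qed
  qed
  have mult: "X \<in> specified T \<longrightarrow> mult_at ?F X" for X
  proof (induction X rule: measure_induct_rule[where f = "\<lambda>X. card (internal (fst X))"])
    case (less X)
    show ?case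
      unfolding mult_at_def
    proof (intro impI allI ballI)
      fix U and p :: "'d mom" assume X: "X \<in> specified T" and U: "saturated (fst X) U" and p: "p \<in> momentum_space (fst X)"
      note G = specified_is_graph[OF T X]
      let ?U' = "verts (fst X) - U"
      have U': "saturated (fst X) ?U'" by (rule saturated_Diff[OF G saturated_verts[OF G] U])
      note ie = internal_component_empty[OF G U]
      \<comment> \<open>\<open>f\<close> and \<open>g\<close> are the counterterm and the
        renormalised value of a part; once the part has an internal edge they are supported in
        \<open>S\<close> and in its complement, respectively.\<close>
      define f where "f V = part_ev ?F X p V" for V
      define g where "g V = part_ev ?F X p V + part_ev ?b X p V" for V
      have fg: "f V = 1 \<and> g V = 1" if V: "saturated (fst X) V" "internal (component (fst X) V) = {}" for V
        using part_ev_no_internal[OF T u X V(1) p V(2)] bsum_no_internal[OF T, of "srestr X V" ?F H] V(2)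
        by (simp add: f_def g_def part_ev_def[of ?b] srestr_def)
      have supp: "fls_supp_in S (f V) \<and> fls_supp_in (- S) (g V)" if V: "internal (component (fst X) V) \<noteq> {}" for V
      proof -
        let ?e = "ev (component (fst X) V) (mom_restrict (hedges (component (fst X) V)) p) (?b (srestr X V))"
        have "f V = - fls_filter S ?e" using V by (simp add: f_def part_ev_def birk_eq srestr_def)
        moreover have "g V = fls_filter (- S) ?e"
          using V add_fls_filter_Compl[of S ?e] by (simp add: g_def part_ev_def birk_eq srestr_def)
        ultimately show ?thesis by simp
      qed
      show "ev (fst X) p (?F X) = part_ev ?F X p U * part_ev ?F X p ?U'"
      proof (cases "internal (fst X) = {}")
        case True
        then show ?thesis
          using fg[OF U] fg[OF U'] ie ev_one_V[OF p] by (simp add: f_def birk_no_internal)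
      next
        case False
        have m: "ev (fst X) p (?b X) + f U * f ?U' = g U * g ?U'"
          unfolding f_def g_def
          by (rule bsum_mult[OF T H X _ U p]) (use less card_internal_less[OF T] sub in blast)
        \<comment> \<open>A part without internal edges has \<open>f\<close> and \<open>g\<close>
          equal to 1, and the exponent 0 cannot lie in \<open>S\<close> and in its complement at
          once. Such a part, of which there is at most one, is therefore treated as a trivial
          factor.\<close>
        have s: "fls_supp_in S (f U * f ?U') \<and> fls_supp_in (- S) (g U * g ?U')"
        proof (cases "internal (component (fst X) U) = {}")
          case True
          then show ?thesis using fg[OF U] supp[of ?U'] ie False by simp
        next
          case nU: False
          show ?thesis
          proof (cases "internal (component (fst X) ?U') = {}")
            case True
            then show ?thesis using fg[OF U'] supp[OF nU] by simp
          next
            case nU': False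
            show ?thesis
              using supp[OF nU] supp[OF nU'] S by (auto intro: fls_supp_in_mult)
          qed
        qed
        let ?e = "ev (fst X) p (?b X)"
        have "ev (fst X) p (?F X) = - fls_filter S ?e" using False by (simp add: birk_eq)
        moreover have "- fls_filter S ?e = f U * f ?U'"
        proof (rule fls_supp_in_decomposition_unique[of S])
          show "fls_filter (- S) ?e - (- fls_filter S ?e) = g U * g ?U' - f U * f ?U'"
            using m add_fls_filter_Compl[of S ?e] by (simp add: algebra_simps)
        qed (use s in simp_all)
        ultimately show ?thesis by (simp add: f_def)
      qed
    qed
  qed
  show ?thesis
    using F u indep iso mult specified_is_graph[OF T] unfolding char_valued_def by blast
qed

section \<open>The group of characters\<close>

lemma poly_mapping_eq_sum: "x = (\<Sum>X\<in>Poly_Mapping.keys x. Poly_Mapping.single X (Poly_Mapping.lookup x X))"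
  by (rule poly_mapping_eqI)
    (auto simp: Poly_Mapping.lookup_sum lookup_single when_def in_keys_iff sum.delta)

lemma lookup_map_scale: "Poly_Mapping.lookup (Poly_Mapping.map ((*) c) x) X = c * Poly_Mapping.lookup (x :: _ \<Rightarrow>\<^sub>0 complex) X"
  by (simp add: Poly_Mapping.map.rep_eq when_def)

lemma keys_map_scale: "Poly_Mapping.keys (Poly_Mapping.map ((*) c) (x :: _ \<Rightarrow>\<^sub>0 complex)) \<subseteq> Poly_Mapping.keys x"
  by (auto simp: in_keys_iff lookup_map_scale)

lemma H_space_add: "x \<in> H_space T \<Longrightarrow> y \<in> H_space T \<Longrightarrow> x + y \<in> H_space T"
  using Poly_Mapping.keys_add[of x y] by (auto simp: H_space_def)

lemma H_space_scale: "x \<in> H_space T \<Longrightarrow> Poly_Mapping.map ((*) c) x \<in> H_space T"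
  using keys_map_scale[of c x] by (auto simp: H_space_def)

lemma H_space_single: "X \<in> specified T \<Longrightarrow> Poly_Mapping.single X c \<in> H_space T"
  by (simp add: H_space_def)

lemma H_space_0: "0 \<in> H_space T"
  by (simp add: H_space_def)

lemma H_space_sum: "(\<And>a. a \<in> A \<Longrightarrow> f a \<in> H_space T) \<Longrightarrow> sum f A \<in> H_space T"
  by (induction A rule: infinite_finite_induct) (auto simp: H_space_add H_space_0)

lemma A_space_0: "0 \<in> A_space"
  by (simp add: A_space_def B_space_def V_space_0)

lemma A_space_add: "F \<in> A_space \<Longrightarrow> F' \<in> A_space \<Longrightarrow> F + F' \<in> A_space"
  by (simp add: A_space_def B_space_def V_space_add)

lemma A_space_scale: "F \<in> A_space \<Longrightarrow> A_scale c F \<in> A_space"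
  by (auto simp: A_space_def B_space_def A_scale_nth V_space_scale fun_eq_iff)

lemma A_space_sum: "(\<And>a. a \<in> A \<Longrightarrow> f a \<in> A_space) \<Longrightarrow> sum f A \<in> A_space"
  by (induction A rule: infinite_finite_induct) (auto simp: A_space_0 A_space_add)

lemma A_scale_add: "A_scale c (F + F') = A_scale c F + A_scale c F'"
  by (intro fls_eqI ext) (simp add: A_scale_nth algebra_simps)

lemma A_scale_add_left: "A_scale (c + d) F = A_scale c F + A_scale d F"
  by (intro fls_eqI ext) (simp add: A_scale_nth algebra_simps)

lemma A_scale_mult: "A_scale (c * d) F = A_scale c (A_scale d F)"
  by (intro fls_eqI ext) (simp add: A_scale_nth)

lemma A_scale_simps [simp]: "A_scale 0 F = 0" "A_scale c 0 = 0" "A_scale 1 F = F"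
  by (intro fls_eqI ext; simp add: A_scale_nth)+

lemma A_scale_sum: "A_scale c (sum f A) = (\<Sum>a\<in>A. A_scale c (f a))"
  by (induction A rule: infinite_finite_induct) (auto simp: A_scale_add)

text \<open>Summing over a larger finite set lets \<open>x\<close>, \<open>y\<close> and
  \<open>x + y\<close> be treated over one index set.\<close>

lemma linear_ext_superset:
  assumes "x \<in> H_space T" "finite K" "Poly_Mapping.keys x \<subseteq> K"
  shows "linear_ext T F x = (\<Sum>X\<in>K. A_scale (Poly_Mapping.lookup x X) (F X))"
  using assms unfolding linear_ext_def
  by (auto intro!: sum.mono_neutral_left simp: in_keys_iff)

lemma linear_ext_linear:
  assumes F: "\<And>X. X \<in> specified T \<Longrightarrow> F X \<in> A_space"
  shows "linear_ext T F \<in> linear_maps T"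
  unfolding linear_maps_def
proof (intro CollectI conjI ballI allI)
  show "linear_ext T F \<in> H_space T \<rightarrow>\<^sub>E A_space"
    unfolding linear_ext_def by (rule PiE_I) (auto intro!: A_space_sum A_space_scale F simp: H_space_def)
  fix x y assume x: "x \<in> H_space T" and y: "y \<in> H_space T"
  let ?K = "Poly_Mapping.keys x \<union> Poly_Mapping.keys y"
  have "linear_ext T F z = (\<Sum>X\<in>?K. A_scale (Poly_Mapping.lookup z X) (F X))" if "z \<in> {x, y, x + y}" for z
    using that x y Poly_Mapping.keys_add[of x y] by (intro linear_ext_superset) (auto simp: H_space_add)
  then show "linear_ext T F (x + y) = linear_ext T F x + linear_ext T F y"
    by (simp add: lookup_add A_scale_add_left sum.distrib)
next
  fix c x assume x: "x \<in> H_space T"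
  show "linear_ext T F (Poly_Mapping.map ((*) c) x) = A_scale c (linear_ext T F x)"
    unfolding linear_ext_superset[OF H_space_scale[OF x] finite_keys keys_map_scale]
      linear_ext_superset[OF x finite_keys order_refl]
    by (simp add: lookup_map_scale A_scale_mult A_scale_sum)
qed

lemma val_linear_ext: "X \<in> specified T \<Longrightarrow> val (linear_ext T F) X = F X"
  using H_space_single[of X T 1] by (simp add: val_def linear_ext_def)

lemma linear_mapsD:
  assumes "\<phi> \<in> linear_maps T"
  shows "\<phi> \<in> H_space T \<rightarrow>\<^sub>E A_space" "x \<in> H_space T \<Longrightarrow> y \<in> H_space T \<Longrightarrow> \<phi> (x + y) = \<phi> x + \<phi> y"
    "x \<in> H_space T \<Longrightarrow> \<phi> (Poly_Mapping.map ((*) c) x) = A_scale c (\<phi> x)"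
  using assms by (auto simp: linear_maps_def)

lemma linear_maps_expand:
  assumes L: "\<phi> \<in> linear_maps T" and x: "x \<in> H_space T"
  shows "\<phi> x = (\<Sum>X\<in>Poly_Mapping.keys x. A_scale (Poly_Mapping.lookup x X) (val \<phi> X))"
proof -
  note D = linear_mapsD[OF L]
  have z: "0 \<in> H_space T" by (simp add: H_space_def)
  have z0: "\<phi> 0 = 0" using D(2)[OF z z] by simp
  have s: "\<phi> (sum f A) = (\<Sum>a\<in>A. \<phi> (f a))" if "finite A" "\<And>a. a \<in> A \<Longrightarrow> f a \<in> H_space T" for f and A :: "'a sgraph set"
    using that
  proof (induction A rule: finite_induct)
    case (insert a A)
    then have "f a \<in> H_space T" "sum f A \<in> H_space T" by (auto intro: H_space_sum)
    then show ?case using insert D(2) by simp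
  qed (simp add: z0)
  have sp: "X \<in> specified T" if "X \<in> Poly_Mapping.keys x" for X using that x by (auto simp: H_space_def)
  have e: "\<phi> (Poly_Mapping.single X c) = A_scale c (val \<phi> X)" if "X \<in> specified T" for X c
    using D(3)[OF H_space_single[OF that, of 1], of c] by (simp add: val_def)
  have "\<phi> x = \<phi> (\<Sum>X\<in>Poly_Mapping.keys x. Poly_Mapping.single X (Poly_Mapping.lookup x X))"
    using poly_mapping_eq_sum[of x] by simp
  also have "\<dots> = (\<Sum>X\<in>Poly_Mapping.keys x. A_scale (Poly_Mapping.lookup x X) (val \<phi> X))"
    by (subst s) (auto simp: sp e H_space_single intro!: sum.cong)
  finally show ?thesis .
qed

lemma linear_maps_eqI:
  assumes L: "\<phi> \<in> linear_maps T" "\<psi> \<in> linear_maps T" and v: "\<And>X. X \<in> specified T \<Longrightarrow> val \<phi> X = val \<psi> X"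
  shows "\<phi> = \<psi>"
proof
  fix x
  show "\<phi> x = \<psi> x"
  proof (cases "x \<in> H_space T")
    case True
    have "X \<in> specified T" if "X \<in> Poly_Mapping.keys x" for X using that True by (auto simp: H_space_def)
    then show ?thesis using linear_maps_expand[OF L(1) True] linear_maps_expand[OF L(2) True] v by simp
  next
    case False
    then show ?thesis using linear_mapsD(1)[OF L(1)] linear_mapsD(1)[OF L(2)] by (auto simp: PiE_def extensional_def)
  qed
qed

lemma V_laurent_conc:
  assumes G: "is_graph G" and G': "is_graph G'" and d: "disjoint_graphs G G'"
    and F: "F \<in> V_laurent G" and F': "F' \<in> V_laurent G'"
  shows "conc G G' F F' \<in> V_laurent (graph_union G G')"
proof -
  let ?U = "graph_union G G'"
  note P = graph_union_parts[OF G G' d]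
  have *: "z_ext (\<lambda>b. in_B ?U (\<lambda>p. if p \<in> momentum_space ?U then b K (mom_restrict (hedges K) p) else 0)) E \<in> V_laurent ?U"
    if E: "E \<in> V_laurent K" and K: "saturated ?U V" "component ?U V = K" for E K V
  proof -
    have n: "z_ext (\<lambda>b. in_B ?U (\<lambda>p. if p \<in> momentum_space ?U then b K (mom_restrict (hedges K) p) else 0)) E $$ n
      = in_B ?U (\<lambda>p. if p \<in> momentum_space ?U then (E $$ n) K (mom_restrict (hedges K) p) else 0)" for n
      unfolding z_ext_eq_fls_map by (subst fls_map_nth) (auto simp: in_B_def fun_eq_iff)
    have "(\<lambda>p. if p \<in> momentum_space ?U then (E $$ n) K (mom_restrict (hedges K) p) else 0) \<in> V_space ?U" for n
      using V_space_component[OF P(1) K(1), of "(E $$ n) K"] E unfolding K(2) by (simp add: V_laurent_iff)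
    then show ?thesis unfolding V_laurent_iff n in_B_apply by simp
  qed
  have s: "saturated ?U (verts G')" using saturated_Diff[OF P(1) saturated_verts[OF P(1)] P(2)] P(5) by simp
  show ?thesis
    unfolding conc_def Let_def by (rule V_laurent_mult[OF *[OF F P(2,3)] *[OF F' s P(4)]])
qed

lemma empty_sgraph_specified:
  assumes T: "is_theory T"
  shows "empty_sgraph \<in> specified T"
proof -
  have "is_graph (empty_graph :: 'a fgraph)" by (auto simp: is_graph_def empty_graph_def extensional_def)
  moreover have "pi0 (empty_graph :: 'a fgraph) = {}" by (simp add: pi0_def empty_graph_def)
  ultimately show ?thesis
    unfolding empty_sgraph_def specified_iff[OF T]
    by (auto simp: graph_of_def bridgeless_def isolated_def empty_graph_def extensional_def)
qed

text \<open>A graph is the disjoint union of its two parts along a saturated set, and the two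
  members of a disjoint union are its parts along one. This turns the rule for disjoint unions into
  \<open>mult_at\<close> and back; the identities between series are compared by evaluation.\<close>

lemma characters_iff:
  fixes \<phi> :: "('t, 'd::finite) hmap"
  assumes T: "is_theory T"
  shows "\<phi> \<in> characters T \<longleftrightarrow> \<phi> \<in> linear_maps T \<and> char_valued T (val \<phi>)"
proof
  assume c: "\<phi> \<in> characters T"
  have lin: "\<phi> \<in> linear_maps T" and comp: "compatible T \<phi>"
    and L: "laurent_valued T (val \<phi>)" and u: "unital T (val \<phi>)" and i: "indep_at T (val \<phi>) G"
    and un: "\<And>X X'. X \<in> specified T \<Longrightarrow> X' \<in> specified T \<Longrightarrow> disjoint_graphs (fst X) (fst X') \<Longrightarrow>
          val \<phi> (sgraph_union X X') = conc (fst X) (fst X') (val \<phi> X) (val \<phi> X')" for G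
    using c unfolding characters_def laurent_valued_def unital_def indep_at_def by blast+
  have m: "mult_at (val \<phi>) X" if X: "X \<in> specified T" for X
    unfolding mult_at_def
  proof (intro allI impI ballI)
    fix U and p :: "'d mom" assume U: "saturated (fst X) U" and p: "p \<in> momentum_space (fst X)"
    note G = specified_is_graph[OF T X]
    have U': "saturated (fst X) (verts (fst X) - U)" by (rule saturated_Diff[OF G saturated_verts[OF G] U])
    have "val \<phi> (sgraph_union (srestr X U) (srestr X (verts (fst X) - U)))
      = conc (component (fst X) U) (component (fst X) (verts (fst X) - U)) (val \<phi> (srestr X U)) (val \<phi> (srestr X (verts (fst X) - U)))"
      using un[OF srestr_specified[OF T X U] srestr_specified[OF T X U']] disjoint_parts[of "fst X" U]
      by (simp add: srestr_def)
    then show "ev (fst X) p (val \<phi> X) = part_ev (val \<phi>) X p U * part_ev (val \<phi>) X p (verts (fst X) - U)"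
      using ev_conc[of p "component (fst X) U" "component (fst X) (verts (fst X) - U)"] p
      unfolding sgraph_union_srestr[OF T X U] graph_union_component[OF G U] part_ev_def by simp
  qed
  have "iso_at T (val \<phi>) X" if X: "X \<in> specified T" for X
    unfolding iso_at_def
  proof (intro ballI allI impI)
    fix X' f h and p :: "'d mom"
    assume X': "X' \<in> specified T" and I: "sgraph_iso f h X X'" and p: "p \<in> momentum_space (fst X)"
    have "val \<phi> X = iso_map h (fst X) (fst X') (val \<phi> X')" using comp X X' I unfolding compatible_def by blast
    then show "ev (fst X) p (val \<phi> X) = ev (fst X') (push h (fst X) (fst X') p) (val \<phi> X')"
      using ev_iso_map[OF p, of h "fst X'" "val \<phi> X'"] by (simp add: push_def)
  qed
  then show "\<phi> \<in> linear_maps T \<and> char_valued T (val \<phi>)"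
    using lin L u i m unfolding char_valued_def by blast
next
  assume c: "\<phi> \<in> linear_maps T \<and> char_valued T (val \<phi>)"
  note D = char_valuedD[OF conjunct2[OF c]]
  have "val \<phi> X = iso_map h (fst X) (fst X') (val \<phi> X')"
    if X: "X \<in> specified T" and X': "X' \<in> specified T" and I: "sgraph_iso f h X X'" for X X' f h
  proof (rule V_laurent_eqI[OF laurent_valuedD[OF D(1) X]])
    have IG: "graph_iso f h (fst X) (fst X')"
      using I sgraph_iso_iff[OF specified_is_graph[OF T X] specified_is_graph[OF T X'], of f h "snd X" "snd X'"] by simp
    show "iso_map h (fst X) (fst X') (val \<phi> X') \<in> V_laurent (fst X)"
      by (rule V_laurent_iso_map[OF IG laurent_valuedD[OF D(1) X']])
    fix p :: "'d mom" assume p: "p \<in> momentum_space (fst X)"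
    show "ev (fst X) p (val \<phi> X) = ev (fst X) p (iso_map h (fst X) (fst X') (val \<phi> X'))"
      using D(5)[OF X] X' I p ev_iso_map[OF p, of h "fst X'" "val \<phi> X'"] unfolding iso_at_def push_def by simp
  qed
  moreover have "val \<phi> (sgraph_union X X') = conc (fst X) (fst X') (val \<phi> X) (val \<phi> X')"
    if X: "X \<in> specified T" and X': "X' \<in> specified T" and d: "disjoint_graphs (fst X) (fst X')" for X X'
  proof -
    note P = sgraph_union_parts[OF T X X' d]
    note G = specified_is_graph[OF T X] specified_is_graph[OF T X']
    have f: "fst (sgraph_union X X') = graph_union (fst X) (fst X')" by (cases X; cases X') (simp add: sgraph_union_def)
    note C = graph_union_parts[OF G d]
    show ?thesis
    proof (rule V_laurent_eqI)
      show "val \<phi> (sgraph_union X X') \<in> V_laurent (graph_union (fst X) (fst X'))"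
        using laurent_valuedD[OF D(1) P(1)] f by simp
      show "conc (fst X) (fst X') (val \<phi> X) (val \<phi> X') \<in> V_laurent (graph_union (fst X) (fst X'))"
        by (rule V_laurent_conc[OF G d laurent_valuedD[OF D(1) X] laurent_valuedD[OF D(1) X']])
      fix p :: "'d mom" assume p: "p \<in> momentum_space (graph_union (fst X) (fst X'))"
      have "ev (graph_union (fst X) (fst X')) p (val \<phi> (sgraph_union X X'))
        = part_ev (val \<phi>) (sgraph_union X X') p (verts (fst X))
          * part_ev (val \<phi>) (sgraph_union X X') p (verts (fst (sgraph_union X X')) - verts (fst X))"
        using D(4)[OF P(1)] P(2) p f unfolding mult_at_def by simp
      then show "ev (graph_union (fst X) (fst X')) p (val \<phi> (sgraph_union X X'))
        = ev (graph_union (fst X) (fst X')) p (conc (fst X) (fst X') (val \<phi> X) (val \<phi> X'))"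
        unfolding ev_conc[OF p] part_ev_def P(3,4) unfolding f C(3,4,5) .
    qed
  qed
  moreover have "val \<phi> (G, i) = val \<phi> (G, i')" if "(G, i) \<in> specified T" "(G, i') \<in> specified T" for G i i'
    by (rule indep_atD[OF _ that]) (use D(3)[OF that(1)] in simp)
  moreover have "val \<phi> empty_sgraph = one_V empty_graph"
    using unitalD[OF D(2) empty_sgraph_specified[OF T]]
    by (simp add: empty_sgraph_def internal_def empty_graph_def)
  ultimately show "\<phi> \<in> characters T"
    using c D(1,2) unfolding characters_def compatible_def laurent_valued_def unital_def by blast
qed

section \<open>Convolution of characters and the group laws\<close>

lemma val_conv:
  assumes T: "is_theory T" and X: "X \<in> specified T"
  shows "val (conv T \<psi> \<eta>) X = csum T (val \<psi>) (val \<eta>) X"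
proof -
  have "graph_of T (fst (scontract X Y))" if "spec_subgraph T Y X" for Y
    using specifiedD(1)[OF T, of "fst (scontract X Y)" "snd (scontract X Y)"] scontract_specified[OF T that] by simp
  then have "{Y. spec_subgraph T Y X \<and> graph_of T (fst (scontract X Y))} = {Y. spec_subgraph T Y X}" by blast
  then show ?thesis
    unfolding conv_def val_linear_ext[OF X] csum_def by (simp add: conv_term_def cterm_def)
qed

lemma linear_ext_laurent:
  assumes T: "is_theory T" and F: "laurent_valued T F"
  shows "linear_ext T F \<in> linear_maps T"
  using V_laurent_subset_A_space[OF specified_is_graph[OF T] laurent_valuedD[OF F]] by (rule linear_ext_linear)

lemma linear_ext_character:
  assumes T: "is_theory T" and F: "char_valued T F"
  shows "linear_ext T F \<in> characters T"
  using linear_ext_laurent[OF T char_valuedD(1)[OF F]]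
    char_valued_cong[where F = F and F' = "val (linear_ext T F)", OF T F val_linear_ext]
  unfolding characters_iff[OF T] by blast

lemma conv_linear:
  assumes T: "is_theory T" and c: "\<psi> \<in> characters T" "\<eta> \<in> characters T"
  shows "conv T \<psi> \<eta> \<in> linear_maps T"
proof -
  have "laurent_valued T (csum T (val \<psi>) (val \<eta>))"
    using csum_laurent[OF T] char_valuedD(1) c unfolding characters_iff[OF T] by blast
  then show ?thesis
    unfolding conv_def using val_conv[OF T, of _ \<psi> \<eta>]
    by (intro linear_ext_linear)
      (simp add: conv_def val_linear_ext laurent_valued_def V_laurent_subset_A_space[OF specified_is_graph[OF T]])
qed

lemma conv_character:
  assumes T: "is_theory T" and c: "\<psi> \<in> characters T" "\<eta> \<in> characters T"
  shows "conv T \<psi> \<eta> \<in> characters T"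
proof -
  have "char_valued T (csum T (val \<psi>) (val \<eta>))"
    using csum_char_valued[OF T] c unfolding characters_iff[OF T] by blast
  from char_valued_cong[where F' = "val (conv T \<psi> \<eta>)", OF T this val_conv[OF T]]
  show ?thesis using conv_linear[OF assms] unfolding characters_iff[OF T] by blast
qed

text \<open>Trees with internal edges also have loop number 0; bridgelessness excludes them, so that
  degree 0 means having no internal edge.\<close>

lemma sdegree_specified:
  assumes T: "is_theory T" and X: "X \<in> specified T"
  shows "sdegree X = 0 \<longleftrightarrow> internal (fst X) = {}" "sdegree X \<ge> 1 \<longleftrightarrow> internal (fst X) \<noteq> {}"
proof -
  note G = specified_is_graph[OF T X]
  have B: "bridgeless (fst X)" using specifiedD(3)[OF T, of "fst X" "snd X"] X by simp
  show "sdegree X = 0 \<longleftrightarrow> internal (fst X) = {}" "sdegree X \<ge> 1 \<longleftrightarrow> internal (fst X) \<noteq> {}"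
    using loop_number_no_internal[OF G] loop_number_pos[OF G B] by (fastforce simp: sdegree_def)+
qed

lemma val_counit:
  assumes T: "is_theory T" and X: "X \<in> specified T"
  shows "val (counit T) X = (if internal (fst X) = {} then one_V (fst X) else 0)"
  by (simp add: counit_def val_linear_ext[OF X] sdegree_specified(1)[OF T X])

lemma counit_linear:
  assumes T: "is_theory T"
  shows "counit T \<in> linear_maps T"
  unfolding counit_def
  by (rule linear_ext_linear)
    (simp add: V_laurent_subset_A_space[OF specified_is_graph[OF T] V_laurent_one] A_space_0)

text \<open>The counit vanishes at every subgraph with an internal edge, so only the skeleton term
  is left. That the counit is a character is a hypothesis here and is supplied in
  \<open>group_char_group\<close>.\<close>

lemma conv_counit:
  fixes \<phi> :: "('t, 'd::finite) hmap"
  assumes T: "is_theory T" and c: "\<phi> \<in> characters T" and e: "counit T \<in> (characters T :: ('t, 'd) hmap set)"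
  shows "conv T (counit T) \<phi> = \<phi>"
proof (rule linear_maps_eqI[OF conv_linear[OF T e c]])
  have D: "char_valued T (val \<phi>)" "char_valued T (val (counit T :: ('t, 'd) hmap))"
    using c e unfolding characters_iff[OF T] by auto
  show "\<phi> \<in> linear_maps T" using c unfolding characters_iff[OF T] by blast
  fix X assume X: "X \<in> specified T"
  let ?e = "val (counit T) :: 't sgraph \<Rightarrow> ('t, 'd) bfam fls"
  have "cterm ?e (val \<phi>) X Y = 0" if Y: "Y \<in> {Y. spec_subgraph T Y X} - {skel X}" for Y
  proof -
    have YX: "spec_subgraph T Y X" and "Y \<noteq> skel X" using Y by auto
    then have "fst Y \<noteq> skeleton (fst X)" using spec_subgraph_skel_unique[OF T YX] by blast
    moreover have "fst Y = skeleton (fst X)" if i: "internal (fst Y) = {}"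
    proof (rule subgr_eqI[OF spec_subgraph_subgr[OF T YX] subgr_skeleton(1)[OF specified_is_graph[OF T X]]])
      fix x assume "x \<in> hedges (fst X)"
      then show "sig (fst Y) x = sig (skeleton (fst X)) x"
        using i subgr_skeleton(2)[OF specified_is_graph[OF T X]] subgrD(4)[OF spec_subgraph_subgr[OF T YX]]
        by (simp add: internal_empty_iff)
    qed
    ultimately have "internal (fst Y) \<noteq> {}" by blast
    then have "?e Y = 0" using spec_subgraph_specified[OF T YX] by (simp add: val_counit[OF T])
    moreover have "pi_map (fst Y) (fst X) (0 :: ('t, 'd) bfam fls) = 0"
      by (intro fls_eqI ext) (simp add: pi_map_nth in_B_apply)
    ultimately show ?thesis by (simp add: cterm_def)
  qed
  then have "csum T ?e (val \<phi>) X = cterm ?e (val \<phi>) X (skel X)"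
    unfolding csum_def
    using sum.remove[OF finite_spec_subgraph[OF T, of X], of "skel X" "cterm ?e (val \<phi>) X"] skel_spec_subgraph[OF T X]
    by simp
  also have "\<dots> = val \<phi> X" by (rule cterm_skel[OF T X char_valuedD(1,2)[OF D(2)] char_valuedD(1)[OF D(1)]])
  finally show "val (conv T (counit T) \<phi>) X = val \<phi> X" by (simp add: val_conv[OF T X])
qed

lemma conv_assoc:
  assumes T: "is_theory T" and c: "\<phi> \<in> characters T" "\<psi> \<in> characters T" "\<eta> \<in> characters T"
  shows "conv T (conv T \<phi> \<psi>) \<eta> = conv T \<phi> (conv T \<psi> \<eta>)"
proof (rule linear_maps_eqI)
  show "conv T (conv T \<phi> \<psi>) \<eta> \<in> linear_maps T" "conv T \<phi> (conv T \<psi> \<eta>) \<in> linear_maps T"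
    using conv_linear[OF T] conv_character[OF T] c by auto
  have L: "laurent_valued T (val \<phi>)" "laurent_valued T (val \<psi>)" "laurent_valued T (val \<eta>)"
    using c char_valuedD(1) unfolding characters_iff[OF T] by auto
  fix X assume X: "X \<in> specified T"
  have "val (conv T (conv T \<phi> \<psi>) \<eta>) X = csum T (csum T (val \<phi>) (val \<psi>)) (val \<eta>) X"
    unfolding val_conv[OF T X] by (rule csum_cong[OF T val_conv[OF T] refl])
  also have "\<dots> = csum T (val \<phi>) (csum T (val \<psi>) (val \<eta>)) X" by (rule csum_assoc[OF T X L])
  also have "\<dots> = val (conv T \<phi> (conv T \<psi> \<eta>)) X"
    unfolding val_conv[OF T X] by (rule csum_cong[OF T refl val_conv[OF T, symmetric]])
  finally show "val (conv T (conv T \<phi> \<psi>) \<eta>) X = val (conv T \<phi> (conv T \<psi> \<eta>)) X" .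
qed

text \<open>With \<open>b\<close> the \<open>bsum\<close> at a graph with internal edges, the value
  is \<open>- fls_filter S b + b\<close>, the part of \<open>b\<close> outside
  \<open>S\<close>.\<close>

lemma conv_birk:
  assumes T: "is_theory T" and c: "\<phi> \<in> characters T" and X: "X \<in> specified T"
  shows "val (conv T (linear_ext T (birk T S (val \<phi>))) \<phi>) X
    = (if internal (fst X) = {} then one_V (fst X) else fls_filter (- S) (bsum T (birk T S (val \<phi>)) (val \<phi>) X))"
proof -
  have D: "char_valued T (val \<phi>)" using c unfolding characters_iff[OF T] by blast
  note D' = char_valuedD[OF D]
  let ?F = "birk T S (val \<phi>)"
  have "val (conv T (linear_ext T ?F) \<phi>) X = csum T ?F (val \<phi>) X"
    unfolding val_conv[OF T X] by (rule csum_cong[OF T val_linear_ext refl])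
  also have "\<dots> = ?F X + bsum T ?F (val \<phi>) X"
    by (rule csum_eq[where F = ?F, OF T X laurent_valuedD[OF birk_laurent[OF T D'(1)] X] D'(1,2)])
  finally show ?thesis
    using bsum_no_internal[OF T, of X ?F "val \<phi>"] add_fls_filter_Compl[of S "bsum T ?F (val \<phi>) X"]
    by (simp add: birk_no_internal birk_eq)
qed

text \<open>For \<open>S = UNIV\<close> nothing is left outside \<open>S\<close>, so
  \<open>conv_birk\<close> yields the counit; this is the usual recursion for convolution
  inverses.\<close>

lemma left_inverse:
  assumes T: "is_theory T" and c: "\<phi> \<in> characters T"
  shows "linear_ext T (birk T UNIV (val \<phi>)) \<in> characters T" "conv T (linear_ext T (birk T UNIV (val \<phi>))) \<phi> = counit T"
proof -
  have D: "char_valued T (val \<phi>)" using c unfolding characters_iff[OF T] by blast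
  show 1: "linear_ext T (birk T UNIV (val \<phi>)) \<in> characters T"
    by (rule linear_ext_character[OF T birk_char_valued[OF T D]]) auto
  have z: "fls_filter {} F = 0" for F :: "('a, 'b) bfam fls" by (rule fls_eqI) simp
  show "conv T (linear_ext T (birk T UNIV (val \<phi>))) \<phi> = counit T"
    by (rule linear_maps_eqI[OF conv_linear[OF T 1 c] counit_linear[OF T]])
      (simp add: conv_birk[OF T c] val_counit[OF T] z)
qed

lemma group_char_group:
  fixes \<phi> :: "('t, 'd::finite) hmap"
  assumes T: "is_theory T" and c: "\<phi> \<in> characters T"
  shows "group (char_group T :: ('t, 'd) hmap monoid)"
proof (rule groupI)
  \<comment> \<open>The counit is the product of the left inverse of \<open>\<phi>\<close> with
    \<open>\<phi>\<close>, hence a character.\<close>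
  have e: "counit T \<in> (characters T :: ('t, 'd) hmap set)"
    using conv_character[OF T left_inverse(1)[OF T c] c] left_inverse(2)[OF T c] by simp
  show "\<one>\<^bsub>char_group T\<^esub> \<in> carrier (char_group T :: ('t, 'd) hmap monoid)" using e by (simp add: char_group_def)
  fix x :: "('t, 'd) hmap" assume x: "x \<in> carrier (char_group T)"
  show "\<one>\<^bsub>char_group T\<^esub> \<otimes>\<^bsub>char_group T\<^esub> x = x" using conv_counit[OF T _ e] x by (simp add: char_group_def)
  show "\<exists>y\<in>carrier (char_group T). y \<otimes>\<^bsub>char_group T\<^esub> x = \<one>\<^bsub>char_group T\<^esub>"
    using left_inverse[OF T] x by (auto simp: char_group_def)
qed (use conv_character[OF T] conv_assoc[OF T] in \<open>simp_all add: char_group_def\<close>)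

section \<open>The Birkhoff decomposition\<close>

lemma prepared_eq_bsum:
  assumes T: "is_theory T" and c: "\<phi> \<in> characters T" and m: "laurent_valued T (val \<phi>m)" "unital T (val \<phi>m)"
    and X: "X \<in> specified T" and i: "internal (fst X) \<noteq> {}"
  shows "prepared T \<phi> \<phi>m X = bsum T (val \<phi>m) (val \<phi>) X"
proof -
  have D: "char_valued T (val \<phi>)" using c unfolding characters_iff[OF T] by blast
  have "graph_of T (fst (scontract X Y))" if "spec_subgraph T Y X" for Y
    using specifiedD(1)[OF T, of "fst (scontract X Y)" "snd (scontract X Y)"] scontract_specified[OF T that] by simp
  then have "{Y. proper_spec_subgraph T Y X \<and> graph_of T (fst (scontract X Y))} = {Y. proper_spec_subgraph T Y X}"
    by (auto simp: proper_spec_subgraph_def)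
  then show ?thesis
    unfolding prepared_def bsum_eq_proper[OF T X m char_valuedD(1)[OF D] i]
    by (simp add: conv_term_def cterm_def)
qed

lemma fls_supp_in_neg: "fls_supp_in {..<0} F \<longleftrightarrow> (\<forall>n\<ge>0. F $$ n = 0)"
  and fls_supp_in_nonneg: "fls_supp_in (- {..<0}) F \<longleftrightarrow> (\<forall>n<0. F $$ n = 0)" for F :: "'a::zero fls"
  by (auto simp: fls_supp_in_def)

text \<open>Multiplication by \<open>\<phi>m\<close> from the left clears the group inverse.\<close>

lemma birkhoff_iff:
  fixes \<phi> :: "('t, 'd::finite) hmap"
  assumes T: "is_theory T" and c: "\<phi> \<in> characters T"
  shows "birkhoff T \<phi> \<phi>m \<phi>p \<longleftrightarrow> \<phi>m \<in> characters T \<and> \<phi>p \<in> characters T \<and> conv T \<phi>m \<phi> = \<phi>p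
    \<and> (\<forall>x\<in>H_space T. \<phi>p x \<in> A_plus) \<and> (\<forall>X\<in>specified T. sdegree X \<ge> 1 \<longrightarrow> val \<phi>m X \<in> A_minus)"
proof -
  interpret g: group "char_group T :: ('t, 'd) hmap monoid" by (rule group_char_group[OF T c])
  have C: "carrier (char_group T :: ('t, 'd) hmap monoid) = characters T"
    "mult (char_group T :: ('t, 'd) hmap monoid) = conv T" by (simp_all add: char_group_def)
  have "\<phi> = inv\<^bsub>char_group T\<^esub> \<phi>m \<otimes>\<^bsub>char_group T\<^esub> \<phi>p \<longleftrightarrow> conv T \<phi>m \<phi> = \<phi>p"
    if "\<phi>m \<in> characters T" "\<phi>p \<in> characters T"
    using g.inv_solve_left[of \<phi> \<phi>m \<phi>p] that c unfolding C by auto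
  then show ?thesis unfolding birkhoff_def C by blast
qed

text \<open>In positive degree \<open>conv T \<phi>m \<phi> = \<phi>p\<close> reads
  \<open>\<phi>p = \<phi>m + b\<close> with \<open>b\<close> the prepared value. Hence
  \<open>- \<phi>m\<close> and \<open>\<phi>p\<close> are the polar and the regular part of
  \<open>b\<close>.\<close>

lemma birkhoff_imp_recursion:
  assumes T: "is_theory T" and c: "\<phi> \<in> characters T" and B: "birkhoff T \<phi> \<phi>m \<phi>p"
  shows "birkhoff_recursion T \<phi> \<phi>m \<phi>p"
  unfolding birkhoff_recursion_def
proof (intro ballI conjI impI)
  note B = B[unfolded birkhoff_iff[OF T c]]
  have D: "char_valued T (val \<phi>)" "char_valued T (val \<phi>m)" "char_valued T (val \<phi>p)"
    using c B unfolding characters_iff[OF T] by auto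
  fix X assume X: "X \<in> specified T"
  note deg = sdegree_specified[OF T X]
  show "val \<phi>m X = one_V (fst X)" "val \<phi>p X = one_V (fst X)" "val \<phi> X = one_V (fst X)" if "sdegree X = 0"
    using that deg(1) D char_valuedD(2) unitalD X by blast+
  assume d: "sdegree X \<ge> 1"
  then have i: "internal (fst X) \<noteq> {}" using deg(2) by simp
  let ?b = "prepared T \<phi> \<phi>m X"
  have b: "?b = bsum T (val \<phi>m) (val \<phi>) X"
    by (rule prepared_eq_bsum[OF T c char_valuedD(1,2)[OF D(2)] X i])
  have p: "val \<phi>p X = val \<phi>m X + ?b"
    using val_conv[OF T X, of \<phi>m \<phi>] csum_eq[where F = "val \<phi>m", OF T X laurent_valuedD[OF char_valuedD(1)[OF D(2)] X] char_valuedD(1,2)[OF D(1)]] B b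
    by simp
  have "val \<phi>p X \<in> A_plus" using B H_space_single[OF X, of 1] unfolding val_def by blast
  then have sp: "fls_supp_in (- {..<0}) (val \<phi>p X)" unfolding fls_supp_in_nonneg by (simp add: A_plus_def)
  have "val \<phi>m X \<in> A_minus" using B X d by blast
  then have sm: "fls_supp_in {..<0} (val \<phi>m X)" unfolding fls_supp_in_neg by (simp add: A_minus_def)
  have "val \<phi>m X = - fls_filter {..<0} ?b"
  proof (rule fls_supp_in_decomposition_unique[OF sm _ sp])
    show "fls_supp_in (- {..<0}) (fls_filter (- {..<0}) ?b)" by simp
    show "val \<phi>p X - val \<phi>m X = fls_filter (- {..<0}) ?b - - fls_filter {..<0} ?b"
      using p add_fls_filter_Compl[of "{..<0}" ?b] by (simp add: algebra_simps)
  qed simp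
  then show m: "val \<phi>m X = - P_minus ?b" by (simp add: P_minus_eq_fls_filter)
  show "val \<phi>p X = ?b - P_minus ?b" using p m by simp
qed

text \<open>\<open>\<phi>m\<close> and \<open>\<phi>p\<close> are arbitrary linear maps here. The
  right-hand side of the recursion involves \<open>\<phi>m\<close> at proper subgraphs only, so
  induction on the number of internal edges identifies its values with those of
  \<open>birk\<close>.\<close>

lemma recursion_unique:
  assumes T: "is_theory T" and c: "\<phi> \<in> characters T" and L: "\<phi>m \<in> linear_maps T" "\<phi>p \<in> linear_maps T"
    and R: "birkhoff_recursion T \<phi> \<phi>m \<phi>p"
  shows "\<phi>m = linear_ext T (birk T {..<0} (val \<phi>))" "\<phi>p = conv T \<phi>m \<phi>"
proof -
  have D: "char_valued T (val \<phi>)" using c unfolding characters_iff[OF T] by blast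
  note D' = char_valuedD[OF D]
  let ?M = "linear_ext T (birk T {..<0} (val \<phi>))"
  have B: "char_valued T (birk T {..<0} (val \<phi>))" by (rule birk_char_valued[OF T D]) auto
  have M: "?M \<in> characters T" by (rule linear_ext_character[OF T B])
  have pr: "(val \<phi>m X = - P_minus (prepared T \<phi> \<phi>m X) \<and> val \<phi>p X = prepared T \<phi> \<phi>m X - P_minus (prepared T \<phi> \<phi>m X))"
    if "X \<in> specified T" "internal (fst X) \<noteq> {}" for X
    using R that sdegree_specified(2)[OF T that(1)] unfolding birkhoff_recursion_def by blast
  have un: "val \<phi>m X = one_V (fst X) \<and> val \<phi>p X = one_V (fst X)" if "X \<in> specified T" "internal (fst X) = {}" for X
    using R that sdegree_specified(1)[OF T that(1)] unfolding birkhoff_recursion_def by blast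
  \<comment> \<open>\<open>prepared_eq_bsum\<close> asks for a Laurent-valued unital map, which is
    known of \<open>?M\<close> but not yet of \<open>\<phi>m\<close>; so the prepared value is first
    rewritten in terms of \<open>?M\<close>.\<close>
  have cut: "prepared T \<phi> \<phi>m X = prepared T \<phi> ?M X"
    if "\<And>Y. spec_subgraph T Y X \<Longrightarrow> fst Y \<noteq> fst X \<Longrightarrow> val \<phi>m Y = birk T {..<0} (val \<phi>) Y" for X
  proof -
    have "val \<phi>m Y = val ?M Y" if "proper_spec_subgraph T Y X" for Y
      using that \<open>\<And>Y. spec_subgraph T Y X \<Longrightarrow> fst Y \<noteq> fst X \<Longrightarrow> val \<phi>m Y = birk T {..<0} (val \<phi>) Y\<close>[of Y]
        spec_subgraph_specified[OF T, of Y X] by (simp add: proper_spec_subgraph_def val_linear_ext)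
    then show ?thesis unfolding prepared_def conv_term_def by (intro arg_cong2[where f = "(+)"] refl sum.cong) auto
  qed
  have pb: "prepared T \<phi> ?M X = bsum T (birk T {..<0} (val \<phi>)) (val \<phi>) X"
    if X: "X \<in> specified T" "internal (fst X) \<noteq> {}" for X
  proof -
    have "char_valued T (val ?M)" using M unfolding characters_iff[OF T] by blast
    then have "prepared T \<phi> ?M X = bsum T (val ?M) (val \<phi>) X"
      using prepared_eq_bsum[OF T c _ _ X] char_valuedD(1,2) by blast
    also have "\<dots> = bsum T (birk T {..<0} (val \<phi>)) (val \<phi>) X"
      by (rule bsum_cong) (use spec_subgraph_specified[OF T] val_linear_ext in blast)
    finally show ?thesis .
  qed
  have m: "X \<in> specified T \<longrightarrow> val \<phi>m X = birk T {..<0} (val \<phi>) X" for X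
  proof (induction X rule: measure_induct_rule[where f = "\<lambda>X. card (internal (fst X))"])
    case (less X)
    show ?case
    proof (cases "internal (fst X) = {}")
      case True
      then show ?thesis using un by (simp add: birk_no_internal)
    next
      case False
      have "prepared T \<phi> \<phi>m X = prepared T \<phi> ?M X"
        by (rule cut) (use less card_internal_less[OF T] spec_subgraph_specified[OF T] in blast)
      then show ?thesis using pr pb False by (simp add: birk_eq P_minus_eq_fls_filter)
    qed
  qed
  show mM: "\<phi>m = ?M"
    by (rule linear_maps_eqI[OF L(1)]) (use M m in \<open>simp_all add: characters_iff[OF T] val_linear_ext\<close>)
  show "\<phi>p = conv T \<phi>m \<phi>"
    unfolding mM
  proof (rule linear_maps_eqI[OF L(2) conv_linear[OF T M c]])
    fix X assume X: "X \<in> specified T"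
    show "val \<phi>p X = val (conv T ?M \<phi>) X"
    proof (cases "internal (fst X) = {}")
      case True
      then show ?thesis using un[OF X] by (simp add: conv_birk[OF T c X])
    next
      case False
      then show ?thesis
        using pr[OF X False] pb[OF X False] mM add_fls_filter_Compl[of "{..<0}" "bsum T (birk T {..<0} (val \<phi>)) (val \<phi>) X"]
        by (simp add: conv_birk[OF T c X] P_minus_eq_fls_filter)
    qed
  qed
qed

lemma birkhoff_exists:
  assumes T: "is_theory T" and c: "\<phi> \<in> characters T"
  defines "M \<equiv> linear_ext T (birk T {..<0} (val \<phi>))"
  shows "birkhoff T \<phi> M (conv T M \<phi>)"
  unfolding birkhoff_iff[OF T c]
proof (intro conjI ballI impI refl)
  have D: "char_valued T (val \<phi>)" using c unfolding characters_iff[OF T] by blast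
  have B: "char_valued T (birk T {..<0} (val \<phi>))" by (rule birk_char_valued[OF T D]) auto
  show M: "M \<in> characters T" unfolding M_def by (rule linear_ext_character[OF T B])
  show P: "conv T M \<phi> \<in> characters T" by (rule conv_character[OF T M c])
  have A: "val \<psi> X \<in> A_space" if "\<psi> \<in> characters T" "X \<in> specified T" for \<psi> :: "('a, 'b) hmap" and X
    using that V_laurent_subset_A_space[OF specified_is_graph[OF T that(2)]] char_valuedD(1) laurent_valuedD
    unfolding characters_iff[OF T] by blast
  show "val M X \<in> A_minus" if X: "X \<in> specified T" "sdegree X \<ge> 1" for X
    using A[OF M X(1)] X sdegree_specified(2)[OF T X(1)] by (simp add: A_minus_def M_def val_linear_ext birk_eq)
  \<comment> \<open>Without internal edges the value is \<open>one_V\<close>, whose only coefficient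
    is at exponent 0, on the side of \<open>A_plus\<close>.\<close>
  have p: "val (conv T M \<phi>) X \<in> A_plus" if X: "X \<in> specified T" for X
    using A[OF P X] by (simp add: A_plus_def M_def conv_birk[OF T c X] one_V_nth)
  show "conv T M \<phi> x \<in> A_plus" if x: "x \<in> H_space T" for x
  proof -
    have L: "conv T M \<phi> \<in> linear_maps T" using P unfolding characters_iff[OF T] by blast
    have s: "X \<in> specified T" if "X \<in> Poly_Mapping.keys x" for X using that x by (auto simp: H_space_def)
    have a: "A_scale k F \<in> A_plus" if "F \<in> A_plus" for k and F :: "('a, 'b) bfam fls"
      using that A_space_scale by (auto simp: A_plus_def A_scale_nth fun_eq_iff)
    have "sum f K \<in> A_plus" if "\<And>k. k \<in> K \<Longrightarrow> f k \<in> A_plus" for f :: "_ \<Rightarrow> ('a, 'b) bfam fls" and K :: "'a sgraph set"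
      using that by (induction K rule: infinite_finite_induct) (auto simp: A_plus_def A_space_0 A_space_add)
    then show ?thesis unfolding linear_maps_expand[OF L x] using a p s by simp
  qed
qed

theorem theorem5:
  fixes T :: "'t feynman_theory"
    and \<phi> :: "('t, 'd::finite) hmap"
  assumes "is_theory T"
    and "\<phi> \<in> carrier (char_group T)"
  shows "(\<exists>!(\<phi>m, \<phi>p). birkhoff T \<phi> \<phi>m \<phi>p)
    \<and> (\<forall>\<phi>m\<in>linear_maps T. \<forall>\<phi>p\<in>linear_maps T.
           birkhoff T \<phi> \<phi>m \<phi>p \<longleftrightarrow> birkhoff_recursion T \<phi> \<phi>m \<phi>p)
    \<and> (\<forall>\<phi>m\<in>linear_maps T. \<forall>\<phi>p\<in>linear_maps T.
           birkhoff_recursion T \<phi> \<phi>m \<phi>p \<longrightarrow>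
             \<phi>m \<in> carrier (char_group T) \<and> \<phi>p \<in> carrier (char_group T))"
proof -
  note T = assms(1)
  have c: "\<phi> \<in> characters T" using assms(2) by (simp add: char_group_def)
  define M where "M = linear_ext T (birk T {..<0} (val \<phi>))"
  have B: "birkhoff T \<phi> M (conv T M \<phi>)" unfolding M_def by (rule birkhoff_exists[OF T c])
  have lin: "\<phi>m \<in> linear_maps T" "\<phi>p \<in> linear_maps T" if "birkhoff T \<phi> \<phi>m \<phi>p" for \<phi>m \<phi>p
    using that unfolding birkhoff_iff[OF T c] characters_iff[OF T] by auto
  have U: "\<phi>m = M \<and> \<phi>p = conv T M \<phi>"
    if "\<phi>m \<in> linear_maps T" "\<phi>p \<in> linear_maps T" "birkhoff_recursion T \<phi> \<phi>m \<phi>p" for \<phi>m \<phi>p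
    using recursion_unique[OF T c that] unfolding M_def by simp
  have "\<exists>!(\<phi>m, \<phi>p). birkhoff T \<phi> \<phi>m \<phi>p"
  proof (rule ex1I[of _ "(M, conv T M \<phi>)"])
    fix z assume z: "case z of (\<phi>m, \<phi>p) \<Rightarrow> birkhoff T \<phi> \<phi>m \<phi>p"
    obtain \<phi>m \<phi>p where zz: "z = (\<phi>m, \<phi>p)" by (cases z)
    then have b: "birkhoff T \<phi> \<phi>m \<phi>p" using z by simp
    show "z = (M, conv T M \<phi>)"
      using U[OF lin[OF b] birkhoff_imp_recursion[OF T c b]] zz by simp
  qed (simp add: B)
  moreover have "birkhoff T \<phi> \<phi>m \<phi>p \<longleftrightarrow> birkhoff_recursion T \<phi> \<phi>m \<phi>p"
    if "\<phi>m \<in> linear_maps T" "\<phi>p \<in> linear_maps T" for \<phi>m \<phi>p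
    using birkhoff_imp_recursion[OF T c] U[OF that] B by blast
  \<comment> \<open>The last claim follows from the equivalence, since \<open>birkhoff\<close>
    includes membership of both components in the group.\<close>
  ultimately show ?thesis
    unfolding birkhoff_def by blast
qed

end
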